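(* Let $G\in\mathcal{L}$ be a finite simple group of Lie type belonging to the class $\mathcal{L}$. Then the Cartan scheme $\mathcal{X}$ of $G$ is $2$-separable.
   Context: **Coherent configurations.** Let $\Omega$ be a finite set. For $r\subseteq\Omega\times\Omega$ and $\alpha\in\Omega$ put $r^*=\{(\beta,\alpha):(\alpha,\beta)\in r\}$ and $\alpha r=\{\beta:(\alpha,\beta)\in r\}$; $1_\Omega$ is the diagonal of $\Omega\times\Omega$. A coherent configuration on $\Omega$ is a pair $\mathcal{X}=(\Omega,S)$, where $S$ is a partition of $\Omega\times\Omega$ such that $1_\Omega$ is a union of elements of $S$, $s^*\in S$ for all $s\in S$, and for all $r,s,t\in S$ the intersection number $c_{rs}^t=|\alpha r\cap\beta s^*|$ does not depend on $(\alpha,\beta)\in t$. The elements of $S$ are the basis relations, unions of them are the relations; a fiber is a set $\Gamma\subseteq\Omega$ with $1_\Gamma=\{(\gamma,\gamma):\gamma\in\Gamma\}\in S$. For coherent configurations on the same set, $\mathcal{X}\le\mathcal{X}'$ means that every relation of $\mathcal{X}$ is a relation of $\mathcal{X}'$; "smallest" refers to this order. For a group $G$ acting on $\Omega$, $\mathrm{Inv}(G,\Omega)=(\Omega,S)$ with $S$ the set of orbits of $G$ on $\Omega\times\Omega$. **Separability.** An algebraic isomorphism from $\mathcal{X}=(\Omega,S)$ to $\mathcal{X}'=(\Omega',S')$ is a bijection $\varphi:S\to S'$, $r\mapsto r'$, with $c_{rs}^t=c_{r's'}^{t'}$ for all $r,s,t\in S$; it extends naturally to relations (unions of basis relations). It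 is induced by an isomorphism if there is a bijection $f:\Omega\to\Omega'$ with $\{(\alpha^f,\beta^f):(\alpha,\beta)\in s\}=\varphi(s)$ for all $s\in S$. The $m$-extension of $\mathcal{X}$ is the smallest coherent configuration on $\Omega^m$ that contains the Cartesian $m$-power $\mathcal{X}^m$ of $\mathcal{X}$ and for which $\mathrm{Diag}(\Omega^m)=\{(\alpha,\ldots,\alpha):\alpha\in\Omega\}$ is a union of fibers. An algebraic isomorphism $\varphi:\mathcal{X}\to\mathcal{X}'$ is $m$-dimensional if there is an algebraic isomorphism from the $m$-extension of $\mathcal{X}$ to the $m$-extension of $\mathcal{X}'$ that takes $1_{\mathrm{Diag}(\Omega^m)}$ to $1_{\mathrm{Diag}(\Omega'^m)}$ and takes each relation $s_1\times\cdots\times s_m$ of $\mathcal{X}^m$ ($s_i\in S$) to $\varphi(s_1)\times\cdots\times\varphi(s_m)$. $\mathcal{X}$ is $m$-separable if every $m$-dimensional algebraic isomorphism from $\mathcal{X}$ to another coherent configuration is induced by an isomorphism. **Groups.** Notation ${}^t\Phi_l(q)$ is used for all simple groups of Lie type ($t$ is empty for untwisted groups), with ${}^t\Phi_l(q)$ for twisted groups denoting what Carter's book denotes ${}^t\Phi_l(q^t)$; thus the classical groups are $A_l(q)=\mathrm{PSL}(l+1,q)$, ${}^2A_l(q)=\mathrm{PSU}(l+1,q)$ (matrices over $\mathbb{F}_{q^2}$), $B_l(q)=\Omega_{2l+1}(q)$ with $q$ odd (for $q$ even $B_l(q)\cong C_l(q)$), $C_l(q)=\mathrm{PSp}(2l,q)$,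 $D_l(q)=\mathrm{P}\Omega^+_{2l}(q)$, ${}^2D_l(q)=\mathrm{P}\Omega^-_{2l}(q)$. $B$, $N$, $H=B\cap N$ denote the standard Borel, monomial and Cartan subgroups of $G$ (forming the standard $(B,N)$-pair). The Cartan scheme of $G$ is $\mathcal{X}=\mathrm{Inv}(G,\Omega)$, where $\Omega=G/H$ is the set of right cosets of $H$ in $G$ and $G$ acts by right multiplication. **The class $\mathcal{L}$** consists of all simple exceptional groups of Lie type (types $E_6,E_7,E_8,F_4,G_2,{}^2E_6,{}^3D_4,{}^2F_4,{}^2G_2,{}^2B_2$) and all simple classical groups ${}^t\Phi_l(q)$ with $l\ge l_0$ and $q\ge al$, where $(l_0,a)$ equals $(7,4)$ for $A_l$, $(6,4)$ for ${}^2A_l$, $(4,4)$ for $B_l$, $(3,4)$ for $C_l$, $(4,2)$ for $D_l$, and $(4,2)$ for ${}^2D_l$. *)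

theory Defs
  imports
    "HOL-Algebra.SimpleGroups"
    "HOL-Algebra.Group_Action"
    "HOL-Algebra.Generated_Groups"
    "HOL-Library.Disjoint_Sets"
    "HOL-Library.Function_Algebras"
begin

section \<open>Coherent configurations\<close>

type_synonym 'a config = "'a set \<times> ('a \<times> 'a) set set"

definition coherent_config :: "'a config \<Rightarrow> bool" where
  "coherent_config X \<longleftrightarrow> (case X of (\<Omega>, S) \<Rightarrow>
     finite \<Omega> \<and>
     partition_on (\<Omega> \<times> \<Omega>) S \<and>
     (\<exists>T \<subseteq> S. Id_on \<Omega> = \<Union>T) \<and>
     (\<forall>s \<in> S. s\<inverse> \<in> S) \<and>
     (\<forall>r \<in> S. \<forall>s \<in> S. \<forall>t \<in> S. \<exists>c. \<forall>(\<alpha>, \<beta>) \<in> t. card (r `` {\<alpha>} \<inter> s\<inverse> `` {\<beta>}) = c))"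

definition intersection_number ::
  "('a \<times> 'a) set \<Rightarrow> ('a \<times> 'a) set \<Rightarrow> ('a \<times> 'a) set \<Rightarrow> nat" where
  "intersection_number r s t =
     (THE c. \<forall>(\<alpha>, \<beta>) \<in> t. card (r `` {\<alpha>} \<inter> s\<inverse> `` {\<beta>}) = c)"

definition relations :: "'a config \<Rightarrow> ('a \<times> 'a) set set" where
  "relations X = {\<Union>T | T. T \<subseteq> snd X}"

definition fibers :: "'a config \<Rightarrow> 'a set set" where
  "fibers X = {\<Gamma>. \<Gamma> \<subseteq> fst X \<and> Id_on \<Gamma> \<in> snd X}"

definition config_le :: "'a config \<Rightarrow> 'a config \<Rightarrow> bool" where
  "config_le X Y \<longleftrightarrow> fst X = fst Y \<and> relations X \<subseteq> relations Y"

definition algebraic_iso ::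
  "'a config \<Rightarrow> 'b config \<Rightarrow> (('a \<times> 'a) set \<Rightarrow> ('b \<times> 'b) set) \<Rightarrow> bool" where
  "algebraic_iso X Y \<phi> \<longleftrightarrow>
     bij_betw \<phi> (snd X) (snd Y) \<and>
     (\<forall>r \<in> snd X. \<forall>s \<in> snd X. \<forall>t \<in> snd X.
        intersection_number r s t = intersection_number (\<phi> r) (\<phi> s) (\<phi> t))"

definition extend_to_relations ::
  "'a config \<Rightarrow> (('a \<times> 'a) set \<Rightarrow> ('b \<times> 'b) set) \<Rightarrow> ('a \<times> 'a) set \<Rightarrow> ('b \<times> 'b) set" where
  "extend_to_relations X \<phi> R = \<Union>(\<phi> ` {s \<in> snd X. s \<subseteq> R})"

definition induced_by_iso ::
  "'a config \<Rightarrow> 'b config \<Rightarrow> (('a \<times> 'a) set \<Rightarrow> ('b \<times> 'b) set) \<Rightarrow> bool" where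
  "induced_by_iso X Y \<phi> \<longleftrightarrow>
     (\<exists>f. bij_betw f (fst X) (fst Y) \<and> (\<forall>s \<in> snd X. map_prod f f ` s = \<phi> s))"

text \<open>Points of \<open>\<Omega>\<^sup>m\<close> are represented by lists of length \<open>m\<close>.\<close>

definition power_set :: "nat \<Rightarrow> 'a set \<Rightarrow> 'a list set" where
  "power_set m \<Omega> = {xs. length xs = m \<and> set xs \<subseteq> \<Omega>}"

definition relation_product :: "('a \<times> 'a) set list \<Rightarrow> ('a list \<times> 'a list) set" where
  "relation_product ss =
     {(xs, ys). length xs = length ss \<and> length ys = length ss \<and>
        (\<forall>i < length ss. (xs ! i, ys ! i) \<in> ss ! i)}"

definition config_power :: "nat \<Rightarrow> 'a config \<Rightarrow> 'a list config" where
  "config_power m X = (power_set m (fst X), relation_product ` power_set m (snd X))"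

definition diagonal :: "nat \<Rightarrow> 'a set \<Rightarrow> 'a list set" where
  "diagonal m \<Omega> = {replicate m \<alpha> | \<alpha>. \<alpha> \<in> \<Omega>}"

definition extension_candidate :: "nat \<Rightarrow> 'a config \<Rightarrow> 'a list config \<Rightarrow> bool" where
  "extension_candidate m X E \<longleftrightarrow>
     coherent_config E \<and>
     config_le (config_power m X) E \<and>
     (\<exists>F \<subseteq> fibers E. diagonal m (fst X) = \<Union>F)"

definition is_extension :: "nat \<Rightarrow> 'a config \<Rightarrow> 'a list config \<Rightarrow> bool" where
  "is_extension m X E \<longleftrightarrow>
     extension_candidate m X E \<and> (\<forall>E'. extension_candidate m X E' \<longrightarrow> config_le E E')"

definition dimensional_iso ::
  "nat \<Rightarrow> 'a config \<Rightarrow> 'b config \<Rightarrow> (('a \<times> 'a) set \<Rightarrow> ('b \<times> 'b) set) \<Rightarrow> bool" where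
  "dimensional_iso m X Y \<phi> \<longleftrightarrow>
     algebraic_iso X Y \<phi> \<and>
     (\<exists>E E' \<psi>.
        is_extension m X E \<and> is_extension m Y E' \<and> algebraic_iso E E' \<psi> \<and>
        extend_to_relations E \<psi> (Id_on (diagonal m (fst X))) = Id_on (diagonal m (fst Y)) \<and>
        (\<forall>ss \<in> power_set m (snd X).
           extend_to_relations E \<psi> (relation_product ss) = relation_product (map \<phi> ss)))"

text \<open>The type argument is the type of the points of the second configuration; a theorem in which
  it is a type variable speaks about all second configurations.\<close>

definition separable :: "'b itself \<Rightarrow> nat \<Rightarrow> 'a config \<Rightarrow> bool" where
  "separable (_ :: 'b itself) m X \<longleftrightarrow>
     (\<forall>(Y :: 'b config) \<phi>.
        coherent_config Y \<longrightarrow> dimensional_iso m X Y \<phi> \<longrightarrow> induced_by_iso X Y \<phi>)"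

definition Inv :: "('g, 'z) monoid_scheme \<Rightarrow> ('g \<Rightarrow> 'a \<Rightarrow> 'a) \<Rightarrow> 'a set \<Rightarrow> 'a config" where
  "Inv G act \<Omega> = (\<Omega>, orbits G (\<Omega> \<times> \<Omega>) (\<lambda>g. map_prod (act g) (act g)))"

definition coset_scheme :: "('g, 'z) monoid_scheme \<Rightarrow> 'g set \<Rightarrow> 'g set config" where
  "coset_scheme G H = Inv G (\<lambda>g C. C #>\<^bsub>G\<^esub> g) (rcosets\<^bsub>G\<^esub> H)"


section \<open>Root systems\<close>

datatype dynkin = An nat | Bn nat | Cn nat | Dn nat | En nat | F4 | G2

fun rank :: "dynkin \<Rightarrow> nat" where
  "rank (An l) = l"
| "rank (Bn l) = l"
| "rank (Cn l) = l"
| "rank (Dn l) = l"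
| "rank (En l) = l"
| "rank F4 = 4"
| "rank G2 = 2"

text \<open>Squared lengths of the simple roots, numbered from 0.\<close>

fun sqlen :: "dynkin \<Rightarrow> nat \<Rightarrow> int" where
  "sqlen (Bn l) i = (if Suc i = l then 2 else 4)"
| "sqlen (Cn l) i = (if Suc i = l then 4 else 2)"
| "sqlen F4 i = (if i < 2 then 4 else 2)"
| "sqlen G2 i = (if i = 0 then 2 else 6)"
| "sqlen _ i = 2"

text \<open>The edges of the diagram, given for \<open>i < j\<close>. In type \<open>D\<^sub>l\<close> the node \<open>l - 1\<close> hangs on the
  node \<open>l - 3\<close> of the path \<open>0, \<dots>, l - 2\<close>; in type \<open>E\<^sub>l\<close> it hangs on the node 2.\<close>

fun edge :: "dynkin \<Rightarrow> nat \<Rightarrow> nat \<Rightarrow> bool" where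
  "edge (Dn l) i j \<longleftrightarrow> (j = Suc i \<and> Suc j < l) \<or> (i + 3 = l \<and> Suc j = l)"
| "edge (En l) i j \<longleftrightarrow> (j = Suc i \<and> Suc j < l) \<or> (i = 2 \<and> Suc j = l)"
| "edge _ i j \<longleftrightarrow> j = Suc i"

definition gram :: "dynkin \<Rightarrow> nat \<Rightarrow> nat \<Rightarrow> int" where
  "gram X i j =
     (if i = j then sqlen X i
      else if edge X (min i j) (max i j) then - (max (sqlen X i) (sqlen X j) div 2)
      else 0)"

text \<open>A root is the function giving its coefficients in the basis of simple roots.\<close>

type_synonym root = "nat \<Rightarrow> int"

definition inner :: "dynkin \<Rightarrow> root \<Rightarrow> root \<Rightarrow> int" where
  "inner X r s = (\<Sum>i < rank X. \<Sum>j < rank X. r i * s j * gram X i j)"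

text \<open>\<open>A\<^bsub>rs\<^esub> = 2(r,s)/(r,r)\<close>; this and the division in \<open>coroot\<close> are exact on roots.\<close>

definition cartan_int :: "dynkin \<Rightarrow> root \<Rightarrow> root \<Rightarrow> int" where
  "cartan_int X r s = 2 * inner X r s div inner X r r"

definition simple_root :: "nat \<Rightarrow> root" where
  "simple_root i = (\<lambda>j. if j = i then 1 else 0)"

inductive_set roots :: "dynkin \<Rightarrow> root set" for X where
  simple: "i < rank X \<Longrightarrow> simple_root i \<in> roots X"
| reflect: "r \<in> roots X \<Longrightarrow> i < rank X \<Longrightarrow>
    (\<lambda>j. r j - cartan_int X (simple_root i) r * simple_root i j) \<in> roots X"

definition positive_roots :: "dynkin \<Rightarrow> root set" where
  "positive_roots X = {r \<in> roots X. \<forall>i. 0 \<le> r i}"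

definition negative_roots :: "dynkin \<Rightarrow> root set" where
  "negative_roots X = {r \<in> roots X. \<forall>i. r i \<le> 0}"

text \<open>The coefficients of the coroot \<open>2r/(r,r)\<close> in the basis of simple coroots.\<close>

definition coroot :: "dynkin \<Rightarrow> root \<Rightarrow> nat \<Rightarrow> int" where
  "coroot X r i = r i * sqlen X i div inner X r r"


section \<open>Chevalley bases\<close>

datatype lie_index = Cartan nat | Root root

definition basis :: "dynkin \<Rightarrow> lie_index set" where
  "basis X = Cartan ` {..<rank X} \<union> Root ` roots X"

definition unit_vector :: "lie_index \<Rightarrow> lie_index \<Rightarrow> int" where
  "unit_vector a = (\<lambda>b. if b = a then 1 else 0)"

text \<open>The Lie product of two basis vectors in the \<open>\<int>\<close>-form spanned by a Chevalley basis
  \<open>h\<^sub>i\<close>, \<open>e\<^sub>r\<close> with structure constants \<open>N\<close>.\<close>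

fun basis_bracket ::
  "dynkin \<Rightarrow> (root \<Rightarrow> root \<Rightarrow> int) \<Rightarrow> lie_index \<Rightarrow> lie_index \<Rightarrow> (lie_index \<Rightarrow> int)" where
  "basis_bracket X N (Cartan i) (Cartan j) = (\<lambda>c. 0)"
| "basis_bracket X N (Cartan i) (Root s) =
     (\<lambda>c. cartan_int X (simple_root i) s * unit_vector (Root s) c)"
| "basis_bracket X N (Root r) (Cartan i) =
     (\<lambda>c. - cartan_int X (simple_root i) r * unit_vector (Root r) c)"
| "basis_bracket X N (Root r) (Root s) =
     (if s = - r then (\<lambda>c. case c of Cartan i \<Rightarrow> coroot X r i | Root _ \<Rightarrow> 0)
      else if r + s \<in> roots X then (\<lambda>c. N r s * unit_vector (Root (r + s)) c)
      else (\<lambda>c. 0))"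

definition bracket ::
  "dynkin \<Rightarrow> (root \<Rightarrow> root \<Rightarrow> int) \<Rightarrow> (lie_index \<Rightarrow> int) \<Rightarrow> (lie_index \<Rightarrow> int) \<Rightarrow> (lie_index \<Rightarrow> int)" where
  "bracket X N u v =
     (\<lambda>c. \<Sum>a \<in> basis X. \<Sum>b \<in> basis X. u a * v b * basis_bracket X N a b c)"

text \<open>\<open>N\<close> is the family of structure constants of a Chevalley basis of the simple Lie algebra of
  type \<open>X\<close>: \<open>N\<^bsub>rs\<^esub> = \<plusminus>(p + 1)\<close>, where \<open>s - pr, \<dots>, s\<close> is the lower part of the \<open>r\<close>-string
  through \<open>s\<close>, and the Lie product is antisymmetric and satisfies the Jacobi identity.\<close>

definition chevalley_constants :: "dynkin \<Rightarrow> (root \<Rightarrow> root \<Rightarrow> int) \<Rightarrow> bool" where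
  "chevalley_constants X N \<longleftrightarrow>
     (\<forall>r \<in> roots X. \<forall>s \<in> roots X. r + s \<in> roots X \<longrightarrow>
        N s r = - N r s \<and>
        \<bar>N r s\<bar> = int (Max {p. (\<lambda>i. s i - int p * r i) \<in> roots X}) + 1) \<and>
     (\<forall>a \<in> basis X. \<forall>b \<in> basis X. \<forall>c \<in> basis X.
        let br = bracket X N; u = unit_vector a; v = unit_vector b; w = unit_vector c in
        br u (br v w) + br v (br w u) + br w (br u v) = 0)"


section \<open>Chevalley groups\<close>

definition lie_space :: "dynkin \<Rightarrow> (lie_index \<Rightarrow> 'k::{field,finite}) set" where
  "lie_space X = {v. \<forall>a. a \<notin> basis X \<longrightarrow> v a = 0}"

type_synonym 'k lie_map = "(lie_index \<Rightarrow> 'k) \<Rightarrow> (lie_index \<Rightarrow> 'k)"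

text \<open>\<open>x\<^sub>r(\<zeta>) = exp (\<zeta> ad e\<^sub>r)\<close>. The matrices of \<open>(ad e\<^sub>r)\<^sup>n / n!\<close> in the Chevalley basis are
  integral, so that the division is exact, and they vanish for \<open>n \<ge> 4\<close>.\<close>

definition root_element ::
  "dynkin \<Rightarrow> (root \<Rightarrow> root \<Rightarrow> int) \<Rightarrow> root \<Rightarrow> 'k::{field,finite} \<Rightarrow> 'k lie_map" where
  "root_element X N r \<zeta> =
     (\<lambda>v \<in> lie_space X. \<lambda>c. \<Sum>a \<in> basis X. \<Sum>n < 4.
        v a * \<zeta> ^ n *
        of_int (((bracket X N (unit_vector (Root r)) ^^ n) (unit_vector a)) c div fact n))"

definition chevalley_group ::
  "dynkin \<Rightarrow> (root \<Rightarrow> root \<Rightarrow> int) \<Rightarrow> 'k::{field,finite} lie_map monoid" where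
  "chevalley_group X N =
     (BijGroup (lie_space X))\<lparr>carrier :=
        generate (BijGroup (lie_space X)) {root_element X N r \<zeta> | r \<zeta>. r \<in> roots X}\<rparr>"

definition unipotent_pos ::
  "dynkin \<Rightarrow> (root \<Rightarrow> root \<Rightarrow> int) \<Rightarrow> 'k::{field,finite} lie_map set" where
  "unipotent_pos X N =
     generate (chevalley_group X N) {root_element X N r \<zeta> | r \<zeta>. r \<in> positive_roots X}"

definition unipotent_neg ::
  "dynkin \<Rightarrow> (root \<Rightarrow> root \<Rightarrow> int) \<Rightarrow> 'k::{field,finite} lie_map set" where
  "unipotent_neg X N =
     generate (chevalley_group X N) {root_element X N r \<zeta> | r \<zeta>. r \<in> negative_roots X}"

definition weyl_element ::
  "dynkin \<Rightarrow> (root \<Rightarrow> root \<Rightarrow> int) \<Rightarrow> root \<Rightarrow> 'k::{field,finite} \<Rightarrow> 'k lie_map" where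
  "weyl_element X N r \<zeta> =
     root_element X N r \<zeta> \<otimes>\<^bsub>chevalley_group X N\<^esub>
     root_element X N (- r) (- inverse \<zeta>) \<otimes>\<^bsub>chevalley_group X N\<^esub>
     root_element X N r \<zeta>"

definition torus_element ::
  "dynkin \<Rightarrow> (root \<Rightarrow> root \<Rightarrow> int) \<Rightarrow> root \<Rightarrow> 'k::{field,finite} \<Rightarrow> 'k lie_map" where
  "torus_element X N r \<zeta> =
     weyl_element X N r \<zeta> \<otimes>\<^bsub>chevalley_group X N\<^esub> weyl_element X N r (- 1)"

definition torus ::
  "dynkin \<Rightarrow> (root \<Rightarrow> root \<Rightarrow> int) \<Rightarrow> 'k::{field,finite} lie_map set" where
  "torus X N =
     generate (chevalley_group X N) {torus_element X N r \<zeta> | r \<zeta>. r \<in> roots X \<and> \<zeta> \<noteq> 0}"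

definition torus_normalizer ::
  "dynkin \<Rightarrow> (root \<Rightarrow> root \<Rightarrow> int) \<Rightarrow> 'k::{field,finite} lie_map set" where
  "torus_normalizer X N =
     generate (chevalley_group X N) (torus X N \<union> {weyl_element X N r 1 | r. r \<in> roots X})"


section \<open>Groups of Lie type\<close>

definition diagram_symmetry :: "dynkin \<Rightarrow> (nat \<Rightarrow> nat) \<Rightarrow> bool" where
  "diagram_symmetry X \<rho> \<longleftrightarrow>
     bij_betw \<rho> {..<rank X} {..<rank X} \<and>
     (\<forall>i < rank X. \<forall>j < rank X. i \<noteq> j \<longrightarrow>
        edge X (min i j) (max i j) = edge X (min (\<rho> i) (\<rho> j)) (max (\<rho> i) (\<rho> j)))"

text \<open>The map \<open>r \<mapsto> r\<close>-bar on roots attached to a diagram symmetry \<open>\<rho>\<close>: it is the linear extension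
  of \<open>\<rho>\<close> if all roots have the same length. In types \<open>B\<^sub>2\<close>, \<open>F\<^sub>4\<close>, \<open>G\<^sub>2\<close> (with \<open>\<rho>\<close> exchanging long
  and short roots) r-bar is the root which is a positive multiple of the image of \<open>r\<close> under the
  isometry taking each \<open>r\<^sub>i\<close> to a positive multiple of \<open>r\<^bsub>\<rho>(i)\<^esub>\<close>. As
  \<open>\<bar>r\<bar> \<bar>r-bar\<bar>\<close> is independent of \<open>r\<close>, its coefficient at \<open>r\<^bsub>\<rho>(i)\<^esub>\<close> is the coroot
  coefficient of \<open>r\<close> at \<open>i\<close>.\<close>

definition root_bar :: "dynkin \<Rightarrow> (nat \<Rightarrow> nat) \<Rightarrow> root \<Rightarrow> root" where
  "root_bar X \<rho> r = (\<lambda>j. \<Sum>i < rank X. coroot X r i * simple_root (\<rho> i) j)"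

text \<open>The multiplicity (1, 2 or 3) of the multiple bond of the diagram; 1 if there is none.\<close>

definition bond :: "dynkin \<Rightarrow> nat" where
  "bond X = nat (Max (sqlen X ` {..<rank X}) div Min (sqlen X ` {..<rank X}))"

text \<open>\<open>\<lambda>(r)\<close> is 1 for short roots and \<open>bond X\<close> for long roots; all roots count as short if they have
  the same length.\<close>

definition root_exponent :: "dynkin \<Rightarrow> root \<Rightarrow> nat" where
  "root_exponent X r = nat (inner X r r div Min (sqlen X ` {..<rank X}))"

definition field_automorphism :: "('k::field \<Rightarrow> 'k) \<Rightarrow> bool" where
  "field_automorphism f \<longleftrightarrow>
     bij f \<and> (\<forall>x y. f (x + y) = f x + f y) \<and> (\<forall>x y. f (x * y) = f x * f y)"

text \<open>\<open>\<sigma>\<close> is the automorphism \<open>gf\<close> of the Chevalley group whose fixed points define the twisted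
  group \<open>\<^sup>tX\<close>. Here \<open>g : x\<^sub>r(\<zeta>) \<mapsto> x\<^bsub>r-bar\<^esub>(\<gamma>\<^sub>r \<zeta>\<^bsup>\<lambda>(r-bar)\<^esup>)\<close> is a graph
  automorphism coming from a diagram symmetry of order \<open>t\<close> (a prime), and \<open>f\<close> comes from a field
  automorphism with \<open>\<sigma>\<^sup>t = 1\<close>. With all roots of the same length this means that \<open>f\<close> has
  order \<open>t\<close>; otherwise \<open>t = 2\<close>, the characteristic is \<open>p = bond X\<close>, \<open>g\<^sup>2\<close> is the field
  automorphism \<open>\<zeta> \<mapsto> \<zeta>\<^sup>p\<close>, and the condition is \<open>p f\<^sup>2 = 1\<close>.\<close>

definition twisting_automorphism ::
  "nat \<Rightarrow> dynkin \<Rightarrow> (root \<Rightarrow> root \<Rightarrow> int) \<Rightarrow> ('k::{field,finite} lie_map \<Rightarrow> 'k lie_map) \<Rightarrow> bool" where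
  "twisting_automorphism t X N \<sigma> \<longleftrightarrow>
     \<sigma> \<in> iso (chevalley_group X N) (chevalley_group X N) \<and>
     (\<exists>\<rho> (f :: 'k \<Rightarrow> 'k) (\<gamma> :: root \<Rightarrow> 'k).
        diagram_symmetry X \<rho> \<and>
        (\<exists>i < rank X. \<rho> i \<noteq> i) \<and> (\<forall>i < rank X. (\<rho> ^^ t) i = i) \<and>
        field_automorphism f \<and>
        (\<forall>x. ((f ^^ t) x) ^ bond X = x) \<and>
        (if bond X = 1 then f \<noteq> id else of_nat (bond X) = (0 :: 'k)) \<and>
        (\<forall>r. \<gamma> r = 1 \<or> \<gamma> r = - 1) \<and>
        (\<forall>i < rank X. \<gamma> (simple_root i) = 1 \<and> \<gamma> (- simple_root i) = 1) \<and>
        (\<forall>r \<in> roots X. \<forall>\<zeta>. \<sigma> (root_element X N r \<zeta>) =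
           root_element X N (root_bar X \<rho> r)
             (\<gamma> r * f \<zeta> ^ root_exponent X (root_bar X \<rho> r))))"

text \<open>The untwisted groups are the case \<open>t = 1\<close>, with \<open>\<sigma>\<close> the identity: the constructions below then
  return the Chevalley group (which is generated by its two unipotent subgroups) and its
  standard subgroups.\<close>

definition lie_type_automorphism ::
  "nat \<Rightarrow> dynkin \<Rightarrow> (root \<Rightarrow> root \<Rightarrow> int) \<Rightarrow> ('k::{field,finite} lie_map \<Rightarrow> 'k lie_map) \<Rightarrow> bool" where
  "lie_type_automorphism t X N \<sigma> \<longleftrightarrow>
     (if t = 1 then \<sigma> = id else twisting_automorphism t X N \<sigma>)"

definition lie_type_group ::
  "dynkin \<Rightarrow> (root \<Rightarrow> root \<Rightarrow> int) \<Rightarrow> ('k::{field,finite} lie_map \<Rightarrow> 'k lie_map) \<Rightarrow> 'k lie_map monoid" where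
  "lie_type_group X N \<sigma> =
     (chevalley_group X N)\<lparr>carrier := generate (chevalley_group X N)
        ({u \<in> unipotent_pos X N. \<sigma> u = u} \<union> {v \<in> unipotent_neg X N. \<sigma> v = v})\<rparr>"

definition borel ::
  "dynkin \<Rightarrow> (root \<Rightarrow> root \<Rightarrow> int) \<Rightarrow> ('k::{field,finite} lie_map \<Rightarrow> 'k lie_map) \<Rightarrow> 'k lie_map set" where
  "borel X N \<sigma> =
     {u \<in> unipotent_pos X N. \<sigma> u = u} <#>\<^bsub>chevalley_group X N\<^esub>
     (torus X N \<inter> carrier (lie_type_group X N \<sigma>))"

definition monomial ::
  "dynkin \<Rightarrow> (root \<Rightarrow> root \<Rightarrow> int) \<Rightarrow> ('k::{field,finite} lie_map \<Rightarrow> 'k lie_map) \<Rightarrow> 'k lie_map set" where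
  "monomial X N \<sigma> = torus_normalizer X N \<inter> carrier (lie_type_group X N \<sigma>)"

definition cartan ::
  "dynkin \<Rightarrow> (root \<Rightarrow> root \<Rightarrow> int) \<Rightarrow> ('k::{field,finite} lie_map \<Rightarrow> 'k lie_map) \<Rightarrow> 'k lie_map set" where
  "cartan X N \<sigma> = borel X N \<sigma> \<inter> monomial X N \<sigma>"

definition cartan_scheme ::
  "dynkin \<Rightarrow> (root \<Rightarrow> root \<Rightarrow> int) \<Rightarrow> ('k::{field,finite} lie_map \<Rightarrow> 'k lie_map) \<Rightarrow>
    'k lie_map set config" where
  "cartan_scheme X N \<sigma> = coset_scheme (lie_type_group X N \<sigma>) (cartan X N \<sigma>)"


section \<open>The class of groups\<close>

definition exceptional_type :: "nat \<Rightarrow> dynkin \<Rightarrow> bool" where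
  "exceptional_type t X \<longleftrightarrow>
     (t, X) \<in> {(1, En 6), (1, En 7), (1, En 8), (1, F4), (1, G2),
               (2, En 6), (3, Dn 4), (2, F4), (2, G2), (2, Bn 2)}"

definition large_classical_type :: "nat \<Rightarrow> dynkin \<Rightarrow> nat \<Rightarrow> bool" where
  "large_classical_type t X q \<longleftrightarrow> (\<exists>l.
     (t, X) = (1, An l) \<and> l \<ge> 7 \<and> q \<ge> 4 * l \<or>
     (t, X) = (2, An l) \<and> l \<ge> 6 \<and> q \<ge> 4 * l \<or>
     (t, X) = (1, Bn l) \<and> l \<ge> 4 \<and> q \<ge> 4 * l \<and> odd q \<or>
     (t, X) = (1, Cn l) \<and> l \<ge> 3 \<and> q \<ge> 4 * l \<or>
     (t, X) = (1, Dn l) \<and> l \<ge> 4 \<and> q \<ge> 2 * l \<or>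
     (t, X) = (2, Dn l) \<and> l \<ge> 4 \<and> q \<ge> 2 * l)"

text \<open>The group \<open>\<^sup>tX(q)\<close> is defined over the field of order \<open>q\<^sup>t\<close>. The exceptional types carry no
  condition on \<open>q\<close> (which is the square root of an odd power of a prime for
  \<open>\<^sup>2B\<^sub>2\<close>, \<open>\<^sup>2G\<^sub>2\<close>, \<open>\<^sup>2F\<^sub>4\<close>).\<close>

definition class_L ::
  "nat \<Rightarrow> dynkin \<Rightarrow> (root \<Rightarrow> root \<Rightarrow> int) \<Rightarrow> ('k::{field,finite} lie_map \<Rightarrow> 'k lie_map) \<Rightarrow> bool" where
  "class_L t X N \<sigma> \<longleftrightarrow>
     chevalley_constants X N \<and>
     lie_type_automorphism t X N \<sigma> \<and>
     simple_group (lie_type_group X N \<sigma>) \<and>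
     (exceptional_type t X \<or> (\<exists>q. card (UNIV :: 'k set) = q ^ t \<and> large_classical_type t X q))"

end

theory Submission
  imports Defs Complex_Main
begin

text \<open>If two points of a coherent configuration determine all others through successive triangles
  with uniquely determined third vertex, then in the 2-extension every diagonal point is
  distinguished by its relation to a single pair of points. A 2-dimensional algebraic isomorphism
  therefore yields a bijection of the points, and it induces the given isomorphism.

  In the coset scheme of a group \<open>G\<close> with point stabilizer \<open>H\<close>, such a pair is \<open>H, H u\<close>, provided
  that \<open>G\<close> is generated by two subgroups \<open>U\<close>, \<open>V\<close> which \<open>H\<close> normalizes, \<open>U \<inter> V H = V \<inter> U H = 1\<close>,
  and each of \<open>U\<close>, \<open>V\<close> contains \<open>u, w\<close> such that \<open>u\<close>, \<open>w\<close> and \<open>u w\<^sup>-\<^sup>1\<close> have trivial centralizer in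
  \<open>H\<close>: two points \<open>H u g\<close>, \<open>H w g\<close> determine all \<open>H v g\<close> with \<open>v\<close> a regular element of \<open>V\<close>, and the
  roles of \<open>U\<close> and \<open>V\<close> may be exchanged.

  For a group of Lie type, \<open>U\<close> and \<open>V\<close> are the two standard maximal unipotent subgroups and \<open>H\<close> is
  the Cartan subgroup. A unipotent element is regular if its coordinates at all simple roots are
  nonzero, as the torus acts faithfully on these. The only exceptions to the existence of three such
  elements come from small fields, where the torus acts trivially on the coordinate; in the groups
  \<open>\<^sup>2B\<^sub>2\<close>, \<open>\<^sup>2G\<^sub>2\<close>, \<open>\<^sup>2F\<^sub>4\<close> higher root elements serve instead.\<close>

section \<open>A criterion for 2-separability\<close>

text \<open>All calculations with root elements are made over the integers and reduced to the field
  only afterwards. The structure constants are known up to sign only, and in characteristic 2 or 3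
  one can neither divide by factorials nor tell weights apart; over the integers factorials cancel,
  and a nonzero entry of a Weyl element reveals how it moves weights. The coordinate of a unipotent
  element at a simple root is one fixed matrix entry, additive under products. Two elements with
  distinct nonzero values at every node therefore give three regular ones, and they can be built up
  orbit by orbit of the diagram symmetry. The obstacle is a twisted orbit of two adjacent nodes: the
  two simple root elements do not commute, so a product that \<sigma> permutes is not fixed. With
  one root length a factor at the sum of the two roots repairs this, its parameter being the
  solution of a trace equation. With two root lengths the two highest roots of the rank 2 system
  replace the simple ones: their root subgroups commute, and the exponents of their characters form
  a unimodular matrix.\<close>

lemma partition_unique:
  "partition_on A P \<Longrightarrow> r \<in> P \<Longrightarrow> s \<in> P \<Longrightarrow> x \<in> r \<Longrightarrow> x \<in> s \<Longrightarrow> r = s"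
  by (metis partition_onD2 disjointD IntI empty_iff)

locale coherent =
  fixes \<Omega> :: "'a set" and S
  assumes cc: "coherent_config (\<Omega>, S)"
begin

lemma fin: "finite \<Omega>"
  using cc by (simp add: coherent_config_def)

lemma part: "partition_on (\<Omega> \<times> \<Omega>) S"
  using cc by (simp add: coherent_config_def)

lemma rel_subset: "s \<in> S \<Longrightarrow> s \<subseteq> \<Omega> \<times> \<Omega>"
  using part by (auto simp: partition_on_def)

lemma rel_nonempty: "s \<in> S \<Longrightarrow> s \<noteq> {}"
  using part by (auto simp: partition_on_def)

lemma ex_rel: "x \<in> \<Omega> \<Longrightarrow> y \<in> \<Omega> \<Longrightarrow> \<exists>s\<in>S. (x, y) \<in> s"
  using part by (auto simp: partition_on_def)

lemma rel_unique: "r \<in> S \<Longrightarrow> s \<in> S \<Longrightarrow> x \<in> r \<Longrightarrow> x \<in> s \<Longrightarrow> r = s"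
  using partition_unique[OF part] .

lemma converse_closed: "s \<in> S \<Longrightarrow> s\<inverse> \<in> S"
  using cc by (simp add: coherent_config_def)

lemma intersection_number_eq:
  assumes "r \<in> S" "s \<in> S" "t \<in> S" "(x, y) \<in> t"
  shows "intersection_number r s t = card (r `` {x} \<inter> s\<inverse> `` {y})"
proof -
  obtain c where c: "\<forall>(\<alpha>, \<beta>) \<in> t. card (r `` {\<alpha>} \<inter> s\<inverse> `` {\<beta>}) = c"
    using cc assms(1-3) unfolding coherent_config_def prod.case by blast
  have "intersection_number r s t = c"
    unfolding intersection_number_def
    by (rule the_equality) (use c assms(4) in auto)
  then show ?thesis using c assms(4) by auto
qed

lemma finite_image:
  assumes "r \<in> S" shows "finite (r `` {x})"
proof -
  have "r `` {x} \<subseteq> \<Omega>" using rel_subset[OF assms] by blast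
  then show ?thesis using fin finite_subset by blast
qed

text \<open>Intersection numbers enter the argument through their positivity, which asserts that a
  triangle exists over an edge, and through valencies, see \<open>degree_eq\<close>.\<close>

lemma intersection_number_pos_iff:
  assumes "r \<in> S" "s \<in> S" "t \<in> S" "(x, y) \<in> t"
  shows "0 < intersection_number r s t \<longleftrightarrow> (\<exists>z. (x, z) \<in> r \<and> (z, y) \<in> s)"
  using intersection_number_eq[OF assms] finite_image[OF assms(1)]
  by (auto simp: card_gt_0_iff)

text \<open>Going along \<open>w\<close> and back along its converse over a loop counts the
  neighbours of a point, so valencies are intersection numbers and survive algebraic
  isomorphisms.\<close>

lemma degree_eq:
  assumes "w \<in> S" "e \<in> S" "(x, x) \<in> e"
  shows "card (w `` {x}) = intersection_number w (w\<inverse>) e"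
  using intersection_number_eq[OF assms(1) converse_closed[OF assms(1)] assms(2,3)] by simp

text \<open>The diagonals of the fibers; they stand for the fibers themselves.\<close>

definition reflexive :: "('a \<times> 'a) set \<Rightarrow> bool" where
  "reflexive e \<longleftrightarrow> e \<in> S \<and> e \<subseteq> Id"

lemma ex_reflexive:
  assumes "x \<in> \<Omega>" obtains e where "reflexive e" "(x, x) \<in> e"
proof -
  obtain T where "T \<subseteq> S" "Id_on \<Omega> = \<Union>T"
    using cc by (auto simp: coherent_config_def)
  moreover have "(x, x) \<in> Id_on \<Omega>" using assms by auto
  ultimately obtain e where "e \<in> T" "(x, x) \<in> e" by auto
  moreover have "Id_on \<Omega> \<subseteq> Id" by auto
  then have "e \<subseteq> Id" using \<open>Id_on \<Omega> = \<Union>T\<close> \<open>e \<in> T\<close> by blast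
  ultimately show thesis using that \<open>T \<subseteq> S\<close> by (auto simp: reflexive_def)
qed

lemma triangle:
  assumes "r \<in> S" "s \<in> S" "t \<in> S" "(x, y) \<in> t" "(x, z) \<in> r" "(z, y) \<in> s" "(x', y') \<in> t"
  shows "\<exists>z'. (x', z') \<in> r \<and> (z', y') \<in> s"
  using assms intersection_number_pos_iff by metis

end

section \<open>Algebraic isomorphisms transport triangles, fibers, converses and valencies\<close>

locale coherent_pair = E: coherent \<Omega> S + E': coherent \<Omega>' S'
  for \<Omega> :: "'a set" and S and \<Omega>' :: "'b set" and S' +
  fixes \<psi>
  assumes alg: "algebraic_iso (\<Omega>, S) (\<Omega>', S') \<psi>"
begin

lemma bij: "bij_betw \<psi> S S'"
  using alg by (simp add: algebraic_iso_def)

lemma psi_mem: "s \<in> S \<Longrightarrow> \<psi> s \<in> S'"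
  using bij by (auto simp: bij_betw_def)

lemma psi_surj: "s' \<in> S' \<Longrightarrow> \<exists>s\<in>S. s' = \<psi> s"
  using bij by (auto simp: bij_betw_def)

lemma psi_inj: "s \<in> S \<Longrightarrow> t \<in> S \<Longrightarrow> \<psi> s = \<psi> t \<Longrightarrow> s = t"
  using bij by (auto simp: bij_betw_def inj_on_def)

lemma intersection_psi:
  "r \<in> S \<Longrightarrow> s \<in> S \<Longrightarrow> t \<in> S \<Longrightarrow>
    intersection_number (\<psi> r) (\<psi> s) (\<psi> t) = intersection_number r s t"
  using alg by (simp add: algebraic_iso_def)

lemma triangle_iff:
  assumes "r \<in> S" "s \<in> S" "t \<in> S" "(x, y) \<in> t" "(x', y') \<in> \<psi> t"
  shows "(\<exists>z. (x, z) \<in> r \<and> (z, y) \<in> s) \<longleftrightarrow> (\<exists>z'. (x', z') \<in> \<psi> r \<and> (z', y') \<in> \<psi> s)"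
  using E.intersection_number_pos_iff[OF assms(1-4)] intersection_psi[OF assms(1-3)]
    E'.intersection_number_pos_iff[OF psi_mem[OF assms(1)] psi_mem[OF assms(2)] psi_mem[OF assms(3)] assms(5)]
  by simp

text \<open>Let \<open>\<psi> e1\<close> be the reflexive relation at the start of an edge of
  \<open>\<psi> e\<close>. The degenerate triangle with colours \<open>\<psi> e1\<close> and
  \<open>\<psi> e\<close> over that edge pulls back to an edge of \<open>e\<close>, which is a loop,
  and there it shows that \<open>e1\<close> shares this loop with \<open>e\<close>.\<close>

lemma psi_reflexive:
  assumes "E.reflexive e" shows "E'.reflexive (\<psi> e)"
proof -
  have e: "e \<in> S" "e \<subseteq> Id" using assms by (auto simp: E.reflexive_def)
  obtain x y where xy: "(x, y) \<in> \<psi> e"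
    using E'.rel_nonempty[OF psi_mem[OF e(1)]] by (metis ex_in_conv surj_pair)
  then have "x \<in> \<Omega>'" using E'.rel_subset[OF psi_mem[OF e(1)]] by auto
  then obtain e1' where e1': "E'.reflexive e1'" "(x, x) \<in> e1'" using E'.ex_reflexive by blast
  then obtain e1 where e1: "e1 \<in> S" "e1' = \<psi> e1" using psi_surj by (auto simp: E'.reflexive_def)
  obtain p q where pq: "(p, q) \<in> e" using E.rel_nonempty[OF e(1)] by (metis ex_in_conv surj_pair)
  have "\<exists>z. (p, z) \<in> e1 \<and> (z, q) \<in> e"
    using triangle_iff[OF e1(1) e(1) e(1) pq xy] e1' e1(2) xy by blast
  then have "(p, p) \<in> e1" "(p, p) \<in> e" using pq e(2) by auto
  then have "e1 = e" using E.rel_unique e(1) e1(1) by blast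
  then show ?thesis using e1'(1) e1(2) by simp
qed

text \<open>Going along \<open>w\<close> and returning along its converse is a triangle over a loop.
  It corresponds to a triangle over a loop in the image, where the second side can only be the
  converse of the first.\<close>

lemma psi_converse:
  assumes "w \<in> S" shows "\<psi> (w\<inverse>) = (\<psi> w)\<inverse>"
proof -
  have w': "\<psi> w \<in> S'" "(\<psi> w)\<inverse> \<in> S'" using assms psi_mem E'.converse_closed by auto
  obtain v where v: "v \<in> S" "(\<psi> w)\<inverse> = \<psi> v" using psi_surj w'(2) by blast
  obtain p z where pz: "(p, z) \<in> w" using E.rel_nonempty[OF assms] by (metis ex_in_conv surj_pair)
  then have "p \<in> \<Omega>" using E.rel_subset[OF assms] by auto
  then obtain e where e: "E.reflexive e" "(p, p) \<in> e" using E.ex_reflexive by blast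
  then have eS: "e \<in> S" by (simp add: E.reflexive_def)
  obtain p' q' where "(p', q') \<in> \<psi> e"
    using E'.rel_nonempty[OF psi_mem[OF eS]] by (metis ex_in_conv surj_pair)
  then have p': "(p', p') \<in> \<psi> e" using psi_reflexive[OF e(1)] by (auto simp: E'.reflexive_def)
  have "\<exists>z'. (p', z') \<in> \<psi> w \<and> (z', p') \<in> \<psi> (w\<inverse>)"
    using triangle_iff[OF assms E.converse_closed[OF assms] eS e(2) p'] pz by blast
  then show ?thesis
    by (metis E'.rel_unique E.converse_closed assms converse_iff psi_mem w'(2))
qed

lemma degree_psi:
  assumes "w \<in> S" "e \<in> S" "(x, x) \<in> e" "(x', x') \<in> \<psi> e"
  shows "card (\<psi> w `` {x'}) = card (w `` {x})"
  using E.degree_eq[OF assms(1-3)] E'.degree_eq[OF psi_mem[OF assms(1)] psi_mem[OF assms(2)] assms(4)]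
    intersection_psi[OF assms(1) E.converse_closed[OF assms(1)] assms(2)] psi_converse[OF assms(1)]
  by simp

end

text \<open>Equality of colours is expressed by membership in all relations that contain the given
  pair, so that no colouring function has to be chosen.\<close>

inductive_set point_closure :: "'a config \<Rightarrow> 'a \<Rightarrow> 'a \<Rightarrow> 'a set" for X \<alpha> \<beta> where
  fst: "\<alpha> \<in> point_closure X \<alpha> \<beta>"
| snd: "\<beta> \<in> point_closure X \<alpha> \<beta>"
| determined: "\<gamma> \<in> point_closure X \<alpha> \<beta> \<Longrightarrow> \<gamma>' \<in> point_closure X \<alpha> \<beta> \<Longrightarrow> \<delta> \<in> fst X \<Longrightarrow>
    (\<And>\<delta>'. \<delta>' \<in> fst X \<Longrightarrow> (\<And>s. s \<in> snd X \<Longrightarrow> (\<gamma>, \<delta>) \<in> s \<Longrightarrow> (\<gamma>, \<delta>') \<in> s) \<Longrightarrow>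
      (\<And>s. s \<in> snd X \<Longrightarrow> (\<gamma>', \<delta>) \<in> s \<Longrightarrow> (\<gamma>', \<delta>') \<in> s) \<Longrightarrow> \<delta>' = \<delta>) \<Longrightarrow>
    \<delta> \<in> point_closure X \<alpha> \<beta>"

section \<open>The 2-extension seen from a pair of points\<close>

lemma relation_product_pair:
  "([x, y], [z, w]) \<in> relation_product [s, t] \<longleftrightarrow> (x, z) \<in> s \<and> (y, w) \<in> t"
  by (auto simp: relation_product_def less_Suc_eq nth_Cons split: nat.splits)

lemma power_set_2: "xs \<in> power_set 2 A \<longleftrightarrow> (\<exists>x y. xs = [x, y] \<and> x \<in> A \<and> y \<in> A)"
  by (auto simp: power_set_def length_Suc_conv numeral_2_eq_2)

lemma diagonal_2: "xs \<in> diagonal 2 A \<longleftrightarrow> (\<exists>x\<in>A. xs = [x, x])"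
  by (auto simp: diagonal_def numeral_2_eq_2)

text \<open>The base enters as a partition of pairs of points; in this form the locale applies to
  the given scheme and to its target alike.\<close>

locale extension_2 = coherent \<Omega>\<^sub>2 S\<^sub>2 for \<Omega>\<^sub>2 :: "'a list set" and S\<^sub>2 +
  fixes \<Omega> S
  assumes part1: "partition_on (\<Omega> \<times> \<Omega>) S"
    and cand: "extension_candidate 2 (\<Omega>, S) (\<Omega>\<^sub>2, S\<^sub>2)"
begin

lemma points: "\<Omega>\<^sub>2 = power_set 2 \<Omega>"
  using cand by (simp add: extension_candidate_def config_le_def config_power_def)

lemma product_union:
  assumes "s \<in> S" "t \<in> S" "p \<in> relation_product [s, t]"
  shows "\<exists>w\<in>S\<^sub>2. p \<in> w \<and> w \<subseteq> relation_product [s, t]"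
proof -
  let ?R = "relation_product [s, t]"
  have "[s, t] \<in> power_set 2 S" using assms by (simp add: power_set_2)
  then have "?R \<in> relations (config_power 2 (\<Omega>, S))"
    unfolding relations_def config_power_def by (auto intro!: exI[of _ "{?R}"])
  then have "?R \<in> relations (\<Omega>\<^sub>2, S\<^sub>2)"
    using cand by (auto simp: extension_candidate_def config_le_def)
  then obtain T where T: "T \<subseteq> S\<^sub>2" "?R = \<Union>T" by (auto simp: relations_def)
  then obtain w where w: "w \<in> T" "p \<in> w" using assms(3) by (metis UnionE)
  moreover have "w \<subseteq> ?R" unfolding T(2) using w(1) by (rule Union_upper)
  ultimately show ?thesis using T(1) by (intro bexI[of _ w]) auto
qed

lemma product_subset:
  assumes "w \<in> S\<^sub>2" "s \<in> S" "t \<in> S" "p \<in> w" "p \<in> relation_product [s, t]"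
  shows "w \<subseteq> relation_product [s, t]"
  using product_union[OF assms(2,3,5)] rel_unique[OF assms(1) _ assms(4)] by blast

lemma diag_reflexive:
  assumes "x \<in> \<Omega>"
  shows "\<exists>e\<in>S\<^sub>2. ([x, x], [x, x]) \<in> e \<and> e \<subseteq> Id_on (diagonal 2 \<Omega>)"
proof -
  obtain F where F: "F \<subseteq> fibers (\<Omega>\<^sub>2, S\<^sub>2)" "diagonal 2 \<Omega> = \<Union>F"
    using cand by (auto simp: extension_candidate_def)
  have "[x, x] \<in> \<Union>F" using assms F(2) by (metis diagonal_2)
  then obtain \<Gamma> where "\<Gamma> \<in> F" "[x, x] \<in> \<Gamma>" by auto
  then show ?thesis using F by (intro bexI[of _ "Id_on \<Gamma>"]) (auto simp: fibers_def)
qed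

text \<open>All edges of one basis relation end in the same fiber: the triangle whose third vertex
  is the end point itself carries the loop at \<open>[x, x]\<close> over to
  \<open>c\<close>.\<close>

lemma target_diag:
  assumes "w \<in> S\<^sub>2" "(a, [x, x]) \<in> w" "(b, c) \<in> w" "x \<in> \<Omega>"
  shows "c \<in> diagonal 2 \<Omega>"
proof -
  obtain e where e: "e \<in> S\<^sub>2" "([x, x], [x, x]) \<in> e" "e \<subseteq> Id_on (diagonal 2 \<Omega>)"
    using diag_reflexive[OF assms(4)] by blast
  show ?thesis using triangle[OF assms(1) e(1) assms(1,2) assms(2) e(2) assms(3)] e(3) by blast
qed

lemma mem_points: "x \<in> \<Omega> \<Longrightarrow> y \<in> \<Omega> \<Longrightarrow> [x, y] \<in> \<Omega>\<^sub>2"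
  by (simp add: points power_set_2)

lemma ex_rel1: "x \<in> \<Omega> \<Longrightarrow> y \<in> \<Omega> \<Longrightarrow> \<exists>s\<in>S. (x, y) \<in> s"
  using part1 by (auto simp: partition_on_def)

text \<open>The relation between the pair \<open>[\<alpha>, \<beta>]\<close> and the diagonal point of \<open>\<gamma>\<close> has valency 1
  at \<open>[\<alpha>, \<beta>]\<close>.\<close>

definition resolved :: "'a \<Rightarrow> 'a \<Rightarrow> 'a \<Rightarrow> bool" where
  "resolved \<alpha> \<beta> \<gamma> \<longleftrightarrow>
     \<gamma> \<in> \<Omega> \<and> (\<forall>w\<in>S\<^sub>2. ([\<alpha>, \<beta>], [\<gamma>, \<gamma>]) \<in> w \<longrightarrow> (\<forall>c. ([\<alpha>, \<beta>], c) \<in> w \<longrightarrow> c = [\<gamma>, \<gamma>]))"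

text \<open>The pair \<open>[\<alpha>, \<beta>]\<close> sees the diagonal point of \<alpha> through
  a product whose first factor is the whole diagonal of \<Omega>, here a single basis relation. This
  fixes the first coordinate of the end point, and lying on the diagonal fixes the second.\<close>

lemma resolved_endpoint:
  assumes "Id_on \<Omega> \<in> S" "\<alpha> \<in> \<Omega>" "\<beta> \<in> \<Omega>"
  shows "resolved \<alpha> \<beta> \<alpha>" "resolved \<alpha> \<beta> \<beta>"
proof -
  obtain t where t: "t \<in> S" "(\<beta>, \<alpha>) \<in> t" using ex_rel1 assms by blast
  obtain t' where t': "t' \<in> S" "(\<alpha>, \<beta>) \<in> t'" using ex_rel1 assms by blast
  show "resolved \<alpha> \<beta> \<alpha>"
    unfolding resolved_def
  proof (intro conjI ballI impI allI)
    fix w c assume w: "w \<in> S\<^sub>2" "([\<alpha>, \<beta>], [\<alpha>, \<alpha>]) \<in> w" "([\<alpha>, \<beta>], c) \<in> w"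
    have "w \<subseteq> relation_product [Id_on \<Omega>, t]"
      by (rule product_subset[OF w(1) assms(1) t(1) w(2)]) (use assms t in \<open>simp add: relation_product_pair Id_on_iff\<close>)
    moreover obtain y where "c = [y, y]" using target_diag[OF w assms(2)] by (auto simp: diagonal_2)
    ultimately have "([\<alpha>, \<beta>], [y, y]) \<in> relation_product [Id_on \<Omega>, t]" using w(3) by blast
    then show "c = [\<alpha>, \<alpha>]" using \<open>c = [y, y]\<close> by (simp add: relation_product_pair Id_on_iff)
  qed (use assms in auto)
  show "resolved \<alpha> \<beta> \<beta>"
    unfolding resolved_def
  proof (intro conjI ballI impI allI)
    fix w c assume w: "w \<in> S\<^sub>2" "([\<alpha>, \<beta>], [\<beta>, \<beta>]) \<in> w" "([\<alpha>, \<beta>], c) \<in> w"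
    have "w \<subseteq> relation_product [t', Id_on \<Omega>]"
      by (rule product_subset[OF w(1) t'(1) assms(1) w(2)]) (use assms t' in \<open>simp add: relation_product_pair Id_on_iff\<close>)
    moreover obtain y where "c = [y, y]" using target_diag[OF w assms(3)] by (auto simp: diagonal_2)
    ultimately have "([\<alpha>, \<beta>], [y, y]) \<in> relation_product [t', Id_on \<Omega>]" using w(3) by blast
    then show "c = [\<beta>, \<beta>]" using \<open>c = [y, y]\<close> by (simp add: relation_product_pair Id_on_iff)
  qed (use assms in auto)
qed

text \<open>A triangle through the diagonal point of \<gamma> is transported along \<open>w\<close>.
  As \<gamma> is resolved, the middle vertex does not move, and so the colour from \<gamma> to the
  end point is kept.\<close>

lemma resolved_step:
  assumes "\<alpha> \<in> \<Omega>" "\<beta> \<in> \<Omega>" "resolved \<alpha> \<beta> \<gamma>" "\<delta> \<in> \<Omega>" "w \<in> S\<^sub>2" "([\<alpha>, \<beta>], [\<delta>, \<delta>]) \<in> w"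
    "([\<alpha>, \<beta>], [\<delta>', \<delta>']) \<in> w" "s \<in> S" "(\<gamma>, \<delta>) \<in> s"
  shows "(\<gamma>, \<delta>') \<in> s"
proof -
  have g: "\<gamma> \<in> \<Omega>" using assms by (simp add: resolved_def)
  obtain v where v: "v \<in> S\<^sub>2" "([\<alpha>, \<beta>], [\<gamma>, \<gamma>]) \<in> v"
    using ex_rel[OF mem_points[OF assms(1,2)] mem_points[OF g g]] by blast
  have "([\<gamma>, \<gamma>], [\<delta>, \<delta>]) \<in> relation_product [s, s]" using assms(9) by (simp add: relation_product_pair)
  then obtain e where e: "e \<in> S\<^sub>2" "([\<gamma>, \<gamma>], [\<delta>, \<delta>]) \<in> e" "e \<subseteq> relation_product [s, s]"
    using product_union assms(8) by blast
  obtain z where "([\<alpha>, \<beta>], z) \<in> v" "(z, [\<delta>', \<delta>']) \<in> e"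
    using triangle[OF v(1) e(1) assms(5,6) v(2) e(2) assms(7)] by blast
  then have "([\<gamma>, \<gamma>], [\<delta>', \<delta>']) \<in> e" using assms(3) v by (auto simp: resolved_def)
  then have "([\<gamma>, \<gamma>], [\<delta>', \<delta>']) \<in> relation_product [s, s]" using e(3) by blast
  then show ?thesis by (simp add: relation_product_pair)
qed

lemma closure_resolved:
  assumes "Id_on \<Omega> \<in> S" "\<alpha> \<in> \<Omega>" "\<beta> \<in> \<Omega>" "\<delta> \<in> point_closure (\<Omega>, S) \<alpha> \<beta>"
  shows "resolved \<alpha> \<beta> \<delta>"
  using assms(4)
proof induction
  case (determined \<gamma> \<gamma>' \<delta>)
  have d: "\<delta> \<in> \<Omega>" using determined by simp
  show ?case
    unfolding resolved_def
  proof (intro conjI ballI impI allI)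
    fix w c assume w: "w \<in> S\<^sub>2" "([\<alpha>, \<beta>], [\<delta>, \<delta>]) \<in> w" "([\<alpha>, \<beta>], c) \<in> w"
    obtain y where y: "c = [y, y]" "y \<in> \<Omega>" using target_diag[OF w d] by (auto simp: diagonal_2)
    have w': "([\<alpha>, \<beta>], [y, y]) \<in> w" using w(3) y(1) by simp
    have "y = \<delta>"
    proof (rule determined.hyps(4))
      show "y \<in> fst (\<Omega>, S)" using y(2) by simp
      show "(\<gamma>, y) \<in> s" if "s \<in> snd (\<Omega>, S)" "(\<gamma>, \<delta>) \<in> s" for s
        using resolved_step[OF assms(2,3) determined.IH(1) d w(1,2) w'] that by simp
      show "(\<gamma>', y) \<in> s" if "s \<in> snd (\<Omega>, S)" "(\<gamma>', \<delta>) \<in> s" for s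
        using resolved_step[OF assms(2,3) determined.IH(2) d w(1,2) w'] that by simp
    qed
    then show "c = [\<delta>, \<delta>]" using y by simp
  qed (rule d)
qed (use resolved_endpoint[OF assms(1-3)] in auto)

end

theorem separable_2_if_closure:
  fixes X :: "'a config"
  assumes X: "partition_on (fst X \<times> fst X) (snd X)" "Id_on (fst X) \<in> snd X"
    and ab: "\<alpha> \<in> fst X" "\<beta> \<in> fst X" "fst X \<subseteq> point_closure X \<alpha> \<beta>"
  shows "separable TYPE('b) 2 X"
  unfolding separable_def
proof (intro allI impI)
  fix Y :: "'b config" and \<phi>
  assume Y: "coherent_config Y" and dim: "dimensional_iso 2 X Y \<phi>"
  obtain \<Omega> S where XX: "X = (\<Omega>, S)" by fastforce
  obtain \<Omega>' S' where YY: "Y = (\<Omega>', S')" by fastforce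
  obtain E E' \<psi> where EE: "extension_candidate 2 X E" "extension_candidate 2 Y E'" "algebraic_iso E E' \<psi>"
    and \<psi>diag: "extend_to_relations E \<psi> (Id_on (diagonal 2 \<Omega>)) = Id_on (diagonal 2 \<Omega>')"
    and \<psi>prod: "\<forall>ss \<in> power_set 2 S. extend_to_relations E \<psi> (relation_product ss) = relation_product (map \<phi> ss)"
    using dim by (auto simp: dimensional_iso_def is_extension_def XX YY)
  have \<phi>: "bij_betw \<phi> S S'" using dim by (simp add: dimensional_iso_def algebraic_iso_def XX YY)
  obtain \<Omega>2 S2 where E: "E = (\<Omega>2, S2)" by fastforce
  obtain \<Omega>2' S2' where E': "E' = (\<Omega>2', S2')" by fastforce
  interpret Y: coherent \<Omega>' S' using Y by unfold_locales (simp add: YY)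
  interpret coherent_pair \<Omega>2 S2 \<Omega>2' S2' \<psi>
    using EE by unfold_locales (auto simp: extension_candidate_def E E')
  interpret E: extension_2 \<Omega>2 S2 \<Omega> S
    using X EE by unfold_locales (auto simp: E XX)
  interpret E': extension_2 \<Omega>2' S2' \<Omega>' S'
    using Y.part EE by unfold_locales (auto simp: E' YY)
  have ab': "\<alpha> \<in> \<Omega>" "\<beta> \<in> \<Omega>" using ab by (auto simp: XX)
  have res: "E.resolved \<alpha> \<beta> \<gamma>" if "\<gamma> \<in> \<Omega>" for \<gamma>
    using E.closure_resolved ab' X(2) ab(3) that by (auto simp: XX)
  have prod: "\<psi> w \<subseteq> relation_product [\<phi> s, \<phi> t]"
    if "w \<in> S2" "s \<in> S" "t \<in> S" "w \<subseteq> relation_product [s, t]" for w s t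
  proof -
    have "extend_to_relations E \<psi> (relation_product [s, t]) = relation_product [\<phi> s, \<phi> t]"
      using \<psi>prod that by (simp add: power_set_2)
    then show ?thesis using that by (auto simp: extend_to_relations_def E)
  qed
  have diag: "\<psi> w \<subseteq> Id_on (diagonal 2 \<Omega>')" if "w \<in> S2" "w \<subseteq> Id_on (diagonal 2 \<Omega>)" for w
    using \<psi>diag that by (auto simp: extend_to_relations_def E)
  define a where "a = [\<alpha>, \<beta>]"
  have a: "a \<in> \<Omega>2" using ab' by (simp add: a_def E.mem_points)
  obtain ea where ea: "E.reflexive ea" "(a, a) \<in> ea" using E.ex_reflexive[OF a] by blast
  have eaS: "ea \<in> S2" using ea by (simp add: E.reflexive_def)
  \<comment> \<open>\<open>a'\<close> takes over the part of the pair \<open>a\<close> in the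
    target. Any point whose loop has the matching colour serves; all values of \<open>f\<close> are
    then forced.\<close>
  obtain a' where a': "(a', a') \<in> \<psi> ea"
    using E'.rel_nonempty[OF psi_mem[OF eaS]] psi_reflexive[OF ea(1)]
    by (metis E'.reflexive_def IdE ex_in_conv subsetD)
  have a'\<Omega>: "a' \<in> \<Omega>2'" using a' E'.rel_subset[OF psi_mem[OF eaS]] by auto
  have "\<exists>w. w \<in> S2 \<and> (a, [\<gamma>, \<gamma>]) \<in> w" if "\<gamma> \<in> \<Omega>" for \<gamma>
    using E.ex_rel[OF a] E.mem_points that by blast
  then obtain w where w: "\<And>\<gamma>. \<gamma> \<in> \<Omega> \<Longrightarrow> w \<gamma> \<in> S2" "\<And>\<gamma>. \<gamma> \<in> \<Omega> \<Longrightarrow> (a, [\<gamma>, \<gamma>]) \<in> w \<gamma>"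
    by metis
  have w_image: "w \<gamma> `` {a} = {[\<gamma>, \<gamma>]}" if "\<gamma> \<in> \<Omega>" for \<gamma>
    using w[OF that] res[OF that] by (auto simp: E.resolved_def a_def)
  have "\<exists>\<gamma>'\<in>\<Omega>'. \<psi> (w \<gamma>) `` {a'} = {[\<gamma>', \<gamma>']}" if g: "\<gamma> \<in> \<Omega>" for \<gamma>
  proof -
    \<comment> \<open>Being resolved means valency 1 at \<open>a\<close>, and valencies are
      preserved.\<close>
    have "card (\<psi> (w \<gamma>) `` {a'}) = 1"
      using degree_psi[OF w(1)[OF g] eaS ea(2) a'] w_image[OF g] by simp
    then obtain d where d: "\<psi> (w \<gamma>) `` {a'} = {d}" by (auto simp: card_1_singleton_iff)
    obtain e where e: "e \<in> S2" "([\<gamma>, \<gamma>], [\<gamma>, \<gamma>]) \<in> e" "e \<subseteq> Id_on (diagonal 2 \<Omega>)"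
      using E.diag_reflexive[OF g] by blast
    have "(a', d) \<in> \<psi> (w \<gamma>)" using d by auto
    then have "\<exists>z'. (a', z') \<in> \<psi> (w \<gamma>) \<and> (z', d) \<in> \<psi> e"
      using triangle_iff[OF w(1)[OF g] e(1) w(1)[OF g] w(2)[OF g]] w(2)[OF g] e(2) by blast
    then have "d \<in> diagonal 2 \<Omega>'" using diag[OF e(1,3)] by blast
    then show ?thesis using d by (auto simp: diagonal_2)
  qed
  then obtain f where f: "\<And>\<gamma>. \<gamma> \<in> \<Omega> \<Longrightarrow> f \<gamma> \<in> \<Omega>'"
    "\<And>\<gamma>. \<gamma> \<in> \<Omega> \<Longrightarrow> \<psi> (w \<gamma>) `` {a'} = {[f \<gamma>, f \<gamma>]}" by metis
  have f_mem: "(a', [f \<gamma>, f \<gamma>]) \<in> \<psi> (w \<gamma>)" if "\<gamma> \<in> \<Omega>" for \<gamma> using f(2)[OF that] by auto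
  have f_rel: "(f \<gamma>, f \<delta>) \<in> \<phi> s" if s: "s \<in> S" "(\<gamma>, \<delta>) \<in> s" and g: "\<gamma> \<in> \<Omega>" "\<delta> \<in> \<Omega>" for s \<gamma> \<delta>
  proof -
    have "([\<gamma>, \<gamma>], [\<delta>, \<delta>]) \<in> relation_product [s, s]" using s by (simp add: relation_product_pair)
    then obtain e where e: "e \<in> S2" "([\<gamma>, \<gamma>], [\<delta>, \<delta>]) \<in> e" "e \<subseteq> relation_product [s, s]"
      using E.product_union s(1) by blast
    have "\<exists>z'. (a', z') \<in> \<psi> (w \<gamma>) \<and> (z', [f \<delta>, f \<delta>]) \<in> \<psi> e"
      using triangle_iff[OF w(1)[OF g(1)] e(1) w(1)[OF g(2)] w(2)[OF g(2)] f_mem[OF g(2)]]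
        w(2)[OF g(1)] e(2) by blast
    then obtain z' where z': "z' \<in> \<psi> (w \<gamma>) `` {a'}" "(z', [f \<delta>, f \<delta>]) \<in> \<psi> e" by blast
    then have "([f \<gamma>, f \<gamma>], [f \<delta>, f \<delta>]) \<in> \<psi> e" unfolding f(2)[OF g(1)] by simp
    then have "([f \<gamma>, f \<gamma>], [f \<delta>, f \<delta>]) \<in> relation_product [\<phi> s, \<phi> s]" using prod[OF e(1) s(1) s(1) e(3)] by blast
    then show ?thesis by (simp add: relation_product_pair)
  qed
  have inj: "inj_on f \<Omega>"
  proof (rule inj_onI)
    fix \<gamma> \<delta> assume g: "\<gamma> \<in> \<Omega>" "\<delta> \<in> \<Omega>" and eq: "f \<gamma> = f \<delta>"
    have "\<psi> (w \<gamma>) = \<psi> (w \<delta>)"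
      using E'.rel_unique[OF psi_mem[OF w(1)[OF g(1)]] psi_mem[OF w(1)[OF g(2)]] f_mem[OF g(1)]] f_mem[OF g(2)] eq
      by simp
    then have "w \<gamma> = w \<delta>" using psi_inj w(1) g by blast
    then have "{[\<gamma>, \<gamma>]} = {[\<delta>, \<delta>]}" using w_image[OF g(1)] w_image[OF g(2)] by metis
    then show "\<gamma> = \<delta>" by simp
  qed
  have surj: "\<exists>\<gamma>\<in>\<Omega>. f \<gamma> = \<gamma>'" if g': "\<gamma>' \<in> \<Omega>'" for \<gamma>'
  proof -
    let ?d' = "[\<gamma>', \<gamma>']"
    obtain v where v: "v \<in> S2" "(a', ?d') \<in> \<psi> v"
      using E'.ex_rel[OF a'\<Omega> E'.mem_points[OF g' g']] psi_surj by blast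
    have "(?d', ?d') \<in> Id_on (diagonal 2 \<Omega>')" using g' by (auto simp: diagonal_2)
    then obtain e where e: "e \<in> S2" "e \<subseteq> Id_on (diagonal 2 \<Omega>)" "(?d', ?d') \<in> \<psi> e"
      using \<psi>diag by (auto simp: extend_to_relations_def E)
    \<comment> \<open>The relation \<open>v\<close> starts in the fiber of \<open>a\<close> and ends
      on the diagonal because its image does so; hence it occurs at \<open>a\<close> itself and
      leads to some diagonal point.\<close>
    have tri: "\<exists>z. (p, z) \<in> ea \<and> (z, q) \<in> v" "\<exists>z. (p, z) \<in> v \<and> (z, q) \<in> e" if "(p, q) \<in> v" for p q
      using triangle_iff[OF eaS v(1) v(1) that v(2)] triangle_iff[OF v(1) e(1) v(1) that v(2)] a' v(2) e(3) by blast+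
    obtain p q where pq: "(p, q) \<in> v" using E.rel_nonempty[OF v(1)] by (metis ex_in_conv surj_pair)
    have "(p, p) \<in> ea" using tri(1)[OF pq] ea(1) by (auto simp: E.reflexive_def)
    then obtain q' where aq: "(a, q') \<in> v"
      using E.triangle[OF v(1) E.converse_closed[OF v(1)] eaS _ pq _ ea(2)] pq by blast
    then have "(q', q') \<in> Id_on (diagonal 2 \<Omega>)" using tri(2)[OF aq] e(2) by blast
    then obtain \<gamma> where \<gamma>: "\<gamma> \<in> \<Omega>" "q' = [\<gamma>, \<gamma>]" by (auto simp: diagonal_2)
    then have "w \<gamma> = v" using E.rel_unique[OF w(1) v(1) w(2)] aq by blast
    then have "?d' \<in> \<psi> (w \<gamma>) `` {a'}" using v(2) by simp
    then have "[\<gamma>', \<gamma>'] = [f \<gamma>, f \<gamma>]" unfolding f(2)[OF \<gamma>(1)] by simp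
    then show ?thesis using \<gamma>(1) by auto
  qed
  have bijf: "bij_betw f \<Omega> \<Omega>'"
    using inj f(1) surj by (auto simp: bij_betw_def)
  have S_sub: "s \<subseteq> \<Omega> \<times> \<Omega>" if "s \<in> S" for s using E.part1 that by (auto simp: partition_on_def)
  have "map_prod f f ` s = \<phi> s" if s: "s \<in> S" for s
  proof
    show "map_prod f f ` s \<subseteq> \<phi> s" using f_rel[OF s] S_sub[OF s] by auto
    have \<phi>s: "\<phi> s \<in> S'" using \<phi> s by (auto simp: bij_betw_def)
    show "\<phi> s \<subseteq> map_prod f f ` s"
    proof
      fix p assume p: "p \<in> \<phi> s"
      then obtain x' y' where p': "p = (x', y')" "x' \<in> \<Omega>'" "y' \<in> \<Omega>'" using Y.rel_subset[OF \<phi>s] by auto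
      obtain x y where xy: "x \<in> \<Omega>" "y \<in> \<Omega>" "x' = f x" "y' = f y" using surj p'(2,3) by metis
      obtain s1 where s1: "s1 \<in> S" "(x, y) \<in> s1" using E.ex_rel1 xy by blast
      have "p \<in> \<phi> s1" using f_rel[OF s1 xy(1,2)] p'(1) xy by simp
      moreover have "\<phi> s1 \<in> S'" using \<phi> s1 by (auto simp: bij_betw_def)
      ultimately have "\<phi> s1 = \<phi> s" using Y.rel_unique \<phi>s p by blast
      then have "s1 = s" using \<phi> s1(1) s by (auto simp: bij_betw_def inj_on_def)
      then show "p \<in> map_prod f f ` s" using s1 p'(1) xy by force
    qed
  qed
  then show "induced_by_iso X Y \<phi>"
    using bijf by (auto simp: induced_by_iso_def XX YY)
qed

section \<open>Groups with two opposite subgroups\<close>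

context group
begin

lemma cancel_left:
  "x \<in> carrier G \<Longrightarrow> y \<in> carrier G \<Longrightarrow> inv x \<otimes> (x \<otimes> y) = y"
  "x \<in> carrier G \<Longrightarrow> y \<in> carrier G \<Longrightarrow> x \<otimes> (inv x \<otimes> y) = y"
  by (simp_all flip: m_assoc)

lemma rcoset_eq_iff:
  assumes "subgroup H G" "x \<in> carrier G" "y \<in> carrier G"
  shows "H #> x = H #> y \<longleftrightarrow> (\<exists>h\<in>H. x = h \<otimes> y)"
proof
  assume "H #> x = H #> y"
  then have "x \<in> H #> y" using rcos_self[OF assms(2,1)] by simp
  then show "\<exists>h\<in>H. x = h \<otimes> y" by (auto simp: r_coset_def)
next
  assume "\<exists>h\<in>H. x = h \<otimes> y"
  then have "x \<in> H #> y" by (auto simp: r_coset_def)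
  then show "H #> x = H #> y" using repr_independence[OF _ assms(3,1)] by simp
qed

end

definition regular :: "('g, 'z) monoid_scheme \<Rightarrow> 'g set \<Rightarrow> 'g \<Rightarrow> bool" where
  "regular G H x \<longleftrightarrow> (\<forall>h\<in>H. h \<otimes>\<^bsub>G\<^esub> x = x \<otimes>\<^bsub>G\<^esub> h \<longrightarrow> h = \<one>\<^bsub>G\<^esub>)"

locale opposite_subgroups = group G for G (structure) +
  fixes H U V
  assumes H: "subgroup H G" and U: "subgroup U G" and V: "subgroup V G"
    and conj_U: "h \<in> H \<Longrightarrow> u \<in> U \<Longrightarrow> h \<otimes> u \<otimes> inv h \<in> U"
    and conj_V: "h \<in> H \<Longrightarrow> v \<in> V \<Longrightarrow> h \<otimes> v \<otimes> inv h \<in> V"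
    and U_VH: "u \<in> U \<Longrightarrow> v \<in> V \<Longrightarrow> h \<in> H \<Longrightarrow> u = v \<otimes> h \<Longrightarrow> u = \<one>"
    and V_UH: "u \<in> U \<Longrightarrow> v \<in> V \<Longrightarrow> h \<in> H \<Longrightarrow> v = u \<otimes> h \<Longrightarrow> v = \<one>"
    and gen: "carrier G = generate G (U \<union> V)"
    and reg_U: "\<exists>u\<in>U. \<exists>w\<in>U. regular G H u \<and> regular G H w \<and> regular G H (u \<otimes> inv w)"
    and reg_V: "\<exists>u\<in>V. \<exists>w\<in>V. regular G H u \<and> regular G H w \<and> regular G H (u \<otimes> inv w)"
begin

lemma swap: "opposite_subgroups G H V U"
proof (rule opposite_subgroups.intro[OF is_group], rule opposite_subgroups_axioms.intro)
  show "carrier G = generate G (V \<union> U)" using gen by (simp add: Un_commute)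
  show "u = \<one>" if "u \<in> V" "v \<in> U" "h \<in> H" "u = v \<otimes> h" for u v h using V_UH that by blast
  show "v = \<one>" if "u \<in> V" "v \<in> U" "h \<in> H" "v = u \<otimes> h" for u v h using U_VH that by blast
  show "h \<otimes> v \<otimes> inv h \<in> V" if "h \<in> H" "v \<in> V" for h v using conj_V that by blast
  show "h \<otimes> u \<otimes> inv h \<in> U" if "h \<in> H" "u \<in> U" for h u using conj_U that by blast
qed (rule H U V reg_U reg_V)+

lemma H_carrier: "h \<in> H \<Longrightarrow> h \<in> carrier G"
  and U_carrier: "u \<in> U \<Longrightarrow> u \<in> carrier G"
  and V_carrier: "v \<in> V \<Longrightarrow> v \<in> carrier G"
  using H U V by (auto dest: subgroup.mem_carrier)

lemma U_H: "u \<in> U \<Longrightarrow> u \<in> H \<Longrightarrow> u = \<one>"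
  using U_VH[OF _ subgroup.one_closed[OF V]] H_carrier by simp

abbreviation scheme where "scheme \<equiv> coset_scheme G H"

lemma scheme_points: "\<gamma> \<in> fst scheme \<longleftrightarrow> (\<exists>x\<in>carrier G. \<gamma> = H #> x)"
  by (auto simp: coset_scheme_def Inv_def RCOSETS_def)

text \<open>Relations are orbits, so some \<open>a\<close> fixes \<open>H #> x\<close> and moves
  \<open>H #> y\<close> to \<open>H #> y'\<close>; that it fixes the coset of \<open>x\<close> is
  recorded as an equation with a factor \<open>h\<close> from \<open>H\<close>.\<close>

lemma same_relation:
  assumes "x \<in> carrier G" "y \<in> carrier G" "y' \<in> carrier G"
    and same: "\<And>s. s \<in> snd scheme \<Longrightarrow> (H #> x, H #> y) \<in> s \<Longrightarrow> (H #> x, H #> y') \<in> s"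
  shows "\<exists>a\<in>carrier G. \<exists>h\<in>H. x \<otimes> a = h \<otimes> x \<and> H #> (y \<otimes> a) = H #> y'"
proof -
  let ?p = "(H #> x, H #> y)"
  let ?act = "\<lambda>g. map_prod (\<lambda>C. C #> g) (\<lambda>C. C #> g)"
  have sub: "H \<subseteq> carrier G" using H subgroup.subset by blast
  have "orbit G ?act ?p \<in> snd scheme"
    using assms(1,2) by (auto simp: coset_scheme_def Inv_def orbits_def RCOSETS_def)
  moreover have "?p = ?act \<one> ?p" using assms(1,2) sub by (simp add: coset_mult_assoc)
  then have "?p \<in> orbit G ?act ?p" unfolding orbit_def using one_closed by blast
  ultimately have "(H #> x, H #> y') \<in> orbit G ?act ?p" using same by blast
  then obtain a where a: "a \<in> carrier G" "H #> x = H #> x #> a" "H #> y' = H #> y #> a"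
    by (auto simp: orbit_def)
  have "H #> (x \<otimes> a) = H #> x" using a(1,2) assms(1) sub by (simp add: coset_mult_assoc)
  then have "\<exists>h\<in>H. x \<otimes> a = h \<otimes> x" using rcoset_eq_iff[OF H] a(1) assms(1) by simp
  then show ?thesis using a assms(2) sub by (auto simp: coset_mult_assoc)
qed

context
  fixes \<alpha> \<beta> :: "'a set"
begin

abbreviation closure where "closure \<equiv> point_closure scheme \<alpha> \<beta>"

text \<open>A state of knowledge about the translate by \<open>g\<close> of the points
  \<open>H #> u\<close> with \<open>u\<close> in \<open>W\<close>: two known points are enough to
  reach the opposite side. It depends on \<open>g\<close> only modulo left multiplication by
  \<open>W\<close>, see \<open>good_mult\<close>.\<close>

definition good :: "'a set \<Rightarrow> 'a \<Rightarrow> bool" where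
  "good W g \<longleftrightarrow> (\<exists>u\<in>W. \<exists>w\<in>W. H #> (u \<otimes> g) \<in> closure \<and> H #> (w \<otimes> g) \<in> closure \<and>
     regular G H (u \<otimes> inv w))"

text \<open>Another candidate for the third vertex is \<open>H #> (v \<otimes> g \<otimes> a) = H #> (v \<otimes> g \<otimes> b)\<close>, where \<open>a\<close> and
  \<open>b\<close> fix \<open>H #> (u \<otimes> g)\<close> and \<open>H #> (w \<otimes> g)\<close>. Conjugation by \<open>g\<close> gives an equation between an
  element of \<open>V H\<close> and one of \<open>U H\<close>, and regularity of \<open>v\<close> and \<open>u \<otimes> inv w\<close> forces \<open>a = b = \<one>\<close>.\<close>

lemma good_regular:
  assumes g: "g \<in> carrier G" and good: "good U g" and v: "v \<in> V" "regular G H v"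
  shows "H #> (v \<otimes> g) \<in> closure"
proof -
  obtain u w where uw: "u \<in> U" "w \<in> U" "H #> (u \<otimes> g) \<in> closure" "H #> (w \<otimes> g) \<in> closure"
    and reg: "regular G H (u \<otimes> inv w)"
    using good by (auto simp: good_def)
  note car = g H_carrier U_carrier[OF uw(1)] U_carrier[OF uw(2)] V_carrier[OF v(1)]
  note norm = m_assoc inv_mult_group cancel_left
  show ?thesis
  proof (rule point_closure.determined[OF uw(3,4)])
    show "H #> (v \<otimes> g) \<in> fst scheme" using car by (auto simp: scheme_points)
    fix \<delta>' assume "\<delta>' \<in> fst scheme"
      and 1: "\<And>s. s \<in> snd scheme \<Longrightarrow> (H #> (u \<otimes> g), H #> (v \<otimes> g)) \<in> s \<Longrightarrow> (H #> (u \<otimes> g), \<delta>') \<in> s"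
      and 2: "\<And>s. s \<in> snd scheme \<Longrightarrow> (H #> (w \<otimes> g), H #> (v \<otimes> g)) \<in> s \<Longrightarrow> (H #> (w \<otimes> g), \<delta>') \<in> s"
    then obtain y where y: "y \<in> carrier G" "\<delta>' = H #> y" by (auto simp: scheme_points)
    obtain a h where a: "a \<in> carrier G" "h \<in> H" "u \<otimes> g \<otimes> a = h \<otimes> (u \<otimes> g)" "H #> (v \<otimes> g \<otimes> a) = \<delta>'"
      using same_relation[of "u \<otimes> g" "v \<otimes> g" y] car y 1 by auto
    obtain b k where b: "b \<in> carrier G" "k \<in> H" "w \<otimes> g \<otimes> b = k \<otimes> (w \<otimes> g)" "H #> (v \<otimes> g \<otimes> b) = \<delta>'"
      using same_relation[of "w \<otimes> g" "v \<otimes> g" y] car y 2 by auto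
    have "\<exists>l\<in>H. v \<otimes> g \<otimes> a = l \<otimes> (v \<otimes> g \<otimes> b)"
      using iffD1[OF rcoset_eq_iff[OF H]] a(1,4) b(1,4) car by (metis m_closed)
    then obtain l where l: "l \<in> H" "v \<otimes> g \<otimes> a = l \<otimes> (v \<otimes> g \<otimes> b)" by blast
    note car = car a(1) b(1) H_carrier[OF a(2)] H_carrier[OF b(2)] H_carrier[OF l(1)]
    define c where "c = g \<otimes> a \<otimes> inv g"
    define d where "d = g \<otimes> b \<otimes> inv g"
    have cd: "c \<in> carrier G" "d \<in> carrier G" using car by (auto simp: c_def d_def)
    have "u \<otimes> c = (u \<otimes> g \<otimes> a) \<otimes> inv g" using car by (simp add: c_def norm)
    also have "\<dots> = h \<otimes> u" unfolding a(3) using car by (simp add: norm)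
    finally have c: "u \<otimes> c = h \<otimes> u" .
    have "w \<otimes> d = (w \<otimes> g \<otimes> b) \<otimes> inv g" using car by (simp add: d_def norm)
    also have "\<dots> = k \<otimes> w" unfolding b(3) using car by (simp add: norm)
    finally have d: "w \<otimes> d = k \<otimes> w" .
    have "v \<otimes> c = (v \<otimes> g \<otimes> a) \<otimes> inv g" using car by (simp add: c_def norm)
    also have "\<dots> = l \<otimes> (v \<otimes> d)" unfolding l(2) using car by (simp add: d_def norm)
    finally have vc: "v \<otimes> c = l \<otimes> (v \<otimes> d)" .
    define x where "x = u \<otimes> inv w"
    define m where "m = h \<otimes> inv k"
    have x: "x \<in> U" using uw U by (simp add: x_def subgroup.m_closed subgroup.m_inv_closed)
    have m: "m \<in> H" using a(2) b(2) H by (simp add: m_def subgroup.m_closed subgroup.m_inv_closed)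
    note car = car cd H_carrier[OF m] U_carrier[OF x]
    have c': "c = inv u \<otimes> (h \<otimes> u)" using car by (simp flip: c add: cancel_left)
    have d': "d = inv w \<otimes> (k \<otimes> w)" using car by (simp flip: d add: cancel_left)
    have l_conj: "inv v \<otimes> (l \<otimes> v) = c \<otimes> inv d"
    proof -
      have "inv v \<otimes> (l \<otimes> v) = inv v \<otimes> (l \<otimes> (v \<otimes> d)) \<otimes> inv d" using car by (simp add: norm)
      also have "\<dots> = c \<otimes> inv d" using car by (simp flip: vc add: norm)
      finally show ?thesis .
    qed
    \<comment> \<open>In c d^-1 = u^-1 h x k^-1 w all elements of \<open>H\<close> are moved to the
      right; conjugation keeps \<open>U\<close> stable, and \<open>m\<close> is what remains at the
      end. The same treatment of v^-1 l v gives \<open>v0\<close>.\<close>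
    define u0 where "u0 = inv u \<otimes> ((h \<otimes> x \<otimes> inv h) \<otimes> (m \<otimes> w \<otimes> inv m))"
    define v0 where "v0 = inv v \<otimes> (l \<otimes> v \<otimes> inv l)"
    have u0: "u0 \<in> U" unfolding u0_def
      using uw x m a(2) by (intro subgroup.m_closed[OF U] subgroup.m_inv_closed[OF U] conj_U) auto
    have v0: "v0 \<in> V" unfolding v0_def
      using v l by (intro subgroup.m_closed[OF V] subgroup.m_inv_closed[OF V] conj_V) auto
    have "v0 = u0 \<otimes> (m \<otimes> inv l)"
    proof -
      have "v0 = inv v \<otimes> (l \<otimes> v) \<otimes> inv l" using car by (simp add: v0_def norm)
      also have "\<dots> = u0 \<otimes> (m \<otimes> inv l)"
        unfolding l_conj c' d' using car by (simp add: u0_def x_def m_def norm)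
      finally show ?thesis .
    qed
    moreover have "m \<otimes> inv l \<in> H" using m l H by (simp add: subgroup.m_closed subgroup.m_inv_closed)
    ultimately have "v0 = \<one>" using V_UH[OF u0 v0] by blast
    then have "v \<otimes> v0 \<otimes> l = v \<otimes> l" using car by simp
    then have "l \<otimes> v = v \<otimes> l" using car by (simp add: v0_def norm)
    then have "l = \<one>" using v(2) l(1) by (simp add: regular_def)
    then have "c = d" using vc car by simp
    then have "u \<otimes> c \<otimes> inv w = u \<otimes> inv w \<otimes> (w \<otimes> d) \<otimes> inv w" using car by (simp add: norm)
    then have hx: "h \<otimes> x = x \<otimes> k" unfolding c d using car by (simp add: x_def norm)
    \<comment> \<open>The two sides lie in \<open>U\<close> and in \<open>H\<close>, hence are
      trivial.\<close>
    have "inv x \<otimes> (h \<otimes> x \<otimes> inv h) = k \<otimes> inv h"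
      unfolding hx using car by (simp add: norm)
    moreover have "inv x \<otimes> (h \<otimes> x \<otimes> inv h) \<in> U"
      using x a(2) by (intro subgroup.m_closed[OF U] subgroup.m_inv_closed[OF U] conj_U) auto
    moreover have "k \<otimes> inv h \<in> H" using a(2) b(2) H by (simp add: subgroup.m_closed subgroup.m_inv_closed)
    ultimately have "k \<otimes> inv h = \<one>" using U_H by simp
    then have "k \<otimes> inv h \<otimes> h = h" using car by simp
    then have "k = h" using car by (simp add: norm)
    then have "h = \<one>" using hx reg a(2) by (simp add: regular_def x_def)
    then have "c = \<one>" using c' car by simp
    then have "inv g \<otimes> c \<otimes> g = \<one>" using car by simp
    then have "a = \<one>" using car by (simp add: c_def norm)
    then show "\<delta>' = H #> (v \<otimes> g)" using a(4) car by simp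
  qed
qed

text \<open>\<open>good_regular\<close> reaches every regular \<open>v\<close>, and
  \<open>reg_V\<close> provides two of them with a regular quotient; this is the place where three
  regular elements are required.\<close>

lemma good_swap:
  assumes "g \<in> carrier G" "good U g" shows "good V g"
  using reg_V good_regular[OF assms] unfolding good_def by blast

text \<open>Multiplying both witnesses on the right by the inverse of \<open>u\<close> leaves their
  quotient unchanged.\<close>

lemma good_mult:
  assumes "g \<in> carrier G" "good U g" "u \<in> U" shows "good U (u \<otimes> g)"
proof -
  obtain x y where xy: "x \<in> U" "y \<in> U" "H #> (x \<otimes> g) \<in> closure" "H #> (y \<otimes> g) \<in> closure"
    and reg: "regular G H (x \<otimes> inv y)"
    using assms(2) by (auto simp: good_def)
  have car: "x \<in> carrier G" "y \<in> carrier G" "u \<in> carrier G" using xy assms(3) U_carrier by auto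
  show ?thesis
    unfolding good_def
  proof (rule bexI[of _ "x \<otimes> inv u"], rule bexI[of _ "y \<otimes> inv u"], intro conjI)
    show "x \<otimes> inv u \<in> U" "y \<otimes> inv u \<in> U"
      using xy assms(3) U by (auto simp: subgroup.m_closed subgroup.m_inv_closed)
    show "H #> (x \<otimes> inv u \<otimes> (u \<otimes> g)) \<in> closure" "H #> (y \<otimes> inv u \<otimes> (u \<otimes> g)) \<in> closure"
      using xy car assms(1) by (simp_all add: m_assoc cancel_left)
    show "regular G H (x \<otimes> inv u \<otimes> inv (y \<otimes> inv u))"
      using reg car by (simp add: m_assoc cancel_left inv_mult_group)
  qed
qed

end

text \<open>The good elements contain the identity, with witnesses \<open>u\<close> and
  \<open>\<one>\<close>. They are closed under left multiplication by \<open>U\<close>, and by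
  \<open>V\<close> after swapping sides before and after; and \<open>U\<close> and \<open>V\<close>
  generate the group.\<close>

lemma good_all:
  assumes "\<alpha> = H" "\<beta> = H #> u" "u \<in> U" "regular G H u" "g \<in> carrier G"
  shows "good \<alpha> \<beta> U g"
proof -
  interpret swap: opposite_subgroups G H V U by (rule swap)
  have good_step: "good \<alpha> \<beta> U (x \<otimes> g)" if x: "x \<in> U \<union> V" and g: "g \<in> carrier G" "good \<alpha> \<beta> U g" for x g
  proof (cases "x \<in> U")
    case True
    then show ?thesis using good_mult g by blast
  next
    case False
    then have xV: "x \<in> V" using x by blast
    then have "good \<alpha> \<beta> V (x \<otimes> g)" using swap.good_mult[OF g(1) good_swap[OF g]] by blast
    then show ?thesis using swap.good_swap xV g V_carrier by simp
  qed
  have *: "good \<alpha> \<beta> U (x \<otimes> g)" if "x \<in> generate G (U \<union> V)" "g \<in> carrier G" "good \<alpha> \<beta> U g" for x g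
    using that
  proof (induction arbitrary: g)
    case one then show ?case by simp
  next
    case (incl h) then show ?case using good_step by blast
  next
    case (inv h)
    then have "inv h \<in> U \<union> V" using U V by (auto intro: subgroup.m_inv_closed)
    then show ?case using good_step inv by blast
  next
    case (eng h1 h2)
    then have "h1 \<in> carrier G" "h2 \<in> carrier G" using gen by auto
    then show ?case using eng by (simp add: m_assoc)
  qed
  have u: "u \<in> carrier G" using assms(3) U_carrier by blast
  have "good \<alpha> \<beta> U \<one>"
    unfolding good_def
  proof (rule bexI[of _ u], rule bexI[of _ \<one>], intro conjI)
    show "H #> (u \<otimes> \<one>) \<in> point_closure scheme \<alpha> \<beta>"
      using point_closure.snd[of \<beta> scheme \<alpha>] assms(2) u by simp
    have "H #> (\<one> \<otimes> \<one>) = \<alpha>" using assms(1) H by (simp add: subgroup.subset)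
    then show "H #> (\<one> \<otimes> \<one>) \<in> point_closure scheme \<alpha> \<beta>" using point_closure.fst by metis
    show "regular G H (u \<otimes> inv \<one>)" using assms(4) u by simp
  qed (use assms(3) U subgroup.one_closed in auto)
  then show ?thesis using *[of g \<one>] assms(5) gen by auto
qed

section \<open>Orbits on pairs of cosets\<close>

lemma partition_scheme: "partition_on (fst scheme \<times> fst scheme) (snd scheme)"
proof -
  let ?act = "\<lambda>g. map_prod (\<lambda>C. C #> g) (\<lambda>C. C #> g)"
  let ?\<Omega> = "rcosets H"
  have sub: "H \<subseteq> carrier G" using H subgroup.subset by blast
  have act_closed: "C #> g \<in> ?\<Omega>" if "C \<in> ?\<Omega>" "g \<in> carrier G" for C g
    using that sub by (auto simp: RCOSETS_def coset_mult_assoc)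
  have act_mult: "C #> g #> g' = C #> (g \<otimes> g')" if "C \<in> ?\<Omega>" "g \<in> carrier G" "g' \<in> carrier G" for C g g'
    using that rcosets_subset_PowG[OF H] by (intro coset_mult_assoc) auto
  have act_one: "C #> \<one> = C" if "C \<in> ?\<Omega>" for C
    using that rcosets_subset_PowG[OF H] by (intro coset_mult_one) auto
  have refl: "p \<in> orbit G ?act p" if "p \<in> ?\<Omega> \<times> ?\<Omega>" for p
  proof -
    have "p = ?act \<one> p" using that act_one by auto
    then show ?thesis unfolding orbit_def using one_closed by blast
  qed
  have sub_orbit: "orbit G ?act q \<subseteq> orbit G ?act p" if "p \<in> ?\<Omega> \<times> ?\<Omega>" "q \<in> orbit G ?act p" for p q
    using that act_mult by (fastforce simp: orbit_def)
  have sym: "p \<in> orbit G ?act q" if p: "p \<in> ?\<Omega> \<times> ?\<Omega>" and q: "q \<in> orbit G ?act p" for p q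
  proof -
    obtain g where g: "g \<in> carrier G" "q = ?act g p" using q by (auto simp: orbit_def)
    then have "p = ?act (inv g) q" using p act_mult act_one by auto
    then show ?thesis using g(1) inv_closed unfolding orbit_def by blast
  qed
  have snd: "snd scheme = {orbit G ?act p | p. p \<in> ?\<Omega> \<times> ?\<Omega>}"
    by (simp add: coset_scheme_def Inv_def orbits_def)
  have fst: "fst scheme = ?\<Omega>" by (simp add: coset_scheme_def Inv_def)
  show ?thesis
    unfolding fst
  proof (rule partition_onI)
    show "\<Union>(snd scheme) = ?\<Omega> \<times> ?\<Omega>"
      unfolding snd
    proof (intro equalityI subsetI)
      fix p assume "p \<in> \<Union>{orbit G ?act p | p. p \<in> ?\<Omega> \<times> ?\<Omega>}"
      then show "p \<in> ?\<Omega> \<times> ?\<Omega>" using act_closed by (auto simp: orbit_def)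
    qed (use refl in blast)
    show "{} \<notin> snd scheme"
      unfolding snd using refl by blast
    fix r s assume rs: "r \<in> snd scheme" "s \<in> snd scheme" "r \<noteq> s"
    then obtain p q where pq: "r = orbit G ?act p" "s = orbit G ?act q" "p \<in> ?\<Omega> \<times> ?\<Omega>" "q \<in> ?\<Omega> \<times> ?\<Omega>"
      unfolding snd by blast
    show "disjnt r s"
    proof (rule ccontr)
      assume "\<not> disjnt r s"
      then obtain z where z: "z \<in> r" "z \<in> s" by (auto simp: disjnt_def)
      then have zO: "z \<in> ?\<Omega> \<times> ?\<Omega>" using pq act_closed by (auto simp: orbit_def)
      have "r = orbit G ?act z" "s = orbit G ?act z"
        using sub_orbit sym pq z zO by blast+
      then show False using rs(3) by simp
    qed
  qed
qed

text \<open>The group is transitive on the cosets, so that the diagonal is a single orbit.\<close>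

lemma Id_scheme: "Id_on (fst scheme) \<in> snd scheme"
proof -
  let ?act = "\<lambda>g. map_prod (\<lambda>C. C #> g) (\<lambda>C. C #> g)"
  have H1: "H \<in> rcosets H" using H subgroup.subgroup_in_rcosets is_group by blast
  have "Id_on (rcosets H) = orbit G ?act (H, H)"
    by (auto simp: orbit_def RCOSETS_def Id_on_def)
  then show ?thesis using H1 by (auto simp: coset_scheme_def Inv_def orbits_def)
qed

theorem separable_2_scheme: "separable TYPE('c) 2 scheme"
proof -
  obtain u where u: "u \<in> U" "regular G H u" using reg_U by blast
  obtain v where v: "v \<in> V" "regular G H v" using reg_V by blast
  have uv: "u \<in> carrier G" "v \<in> carrier G" using u v U_carrier V_carrier by auto
  show ?thesis
  proof (rule separable_2_if_closure[OF partition_scheme Id_scheme])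
    have "H = H #> \<one>" using H by (simp add: subgroup.subset)
    then show "H \<in> fst scheme" using one_closed by (auto simp: scheme_points)
    show "H #> u \<in> fst scheme" using uv by (auto simp: scheme_points)
    show "fst scheme \<subseteq> point_closure scheme H (H #> u)"
    proof
      fix \<gamma> assume "\<gamma> \<in> fst scheme"
      then obtain x where x: "x \<in> carrier G" "\<gamma> = H #> x" by (auto simp: scheme_points)
      \<comment> \<open>An arbitrary element \<open>x\<close> is written as the regular
        \<open>v\<close> times v^-1 x, and the latter is good like every element.\<close>
      have "H #> (v \<otimes> (inv v \<otimes> x)) \<in> point_closure scheme H (H #> u)"
        using good_regular[OF _ good_all[OF refl refl u] v] uv x by simp
      then show "\<gamma> \<in> point_closure scheme H (H #> u)" using x uv by (simp add: cancel_left)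
    qed
  qed
qed

end

section \<open>Row-finite matrices\<close>

lemma finite_row_unary:
  "(\<And>a. finite {c. M a c \<noteq> 0}) \<Longrightarrow> (\<And>a c. M a c = 0 \<Longrightarrow> L a c = 0) \<Longrightarrow> finite {c. L a c \<noteq> 0}"
  by (metis (mono_tags, lifting) finite_subset mem_Collect_eq subsetI)

lemma finite_row_binary:
  assumes "\<And>a. finite {c. M a c \<noteq> 0}" "\<And>a. finite {c. L a c \<noteq> 0}"
    "\<And>a c. M a c = 0 \<Longrightarrow> L a c = 0 \<Longrightarrow> K a c = 0"
  shows "finite {c. K a c \<noteq> 0}"
  by (rule finite_subset[of _ "{c. M a c \<noteq> 0} \<union> {c. L a c \<noteq> 0}"]) (use assms in auto)

lemma finite_row_times:
  fixes M L :: "'a \<Rightarrow> 'a \<Rightarrow> 'b::ring_1"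
  assumes "\<And>a. finite {c. M a c \<noteq> 0}" "\<And>a. finite {c. L a c \<noteq> 0}"
  shows "finite {c. (\<Sum>b | M a b \<noteq> 0. M a b * L b c) \<noteq> 0}"
proof -
  have "{c. (\<Sum>b | M a b \<noteq> 0. M a b * L b c) \<noteq> 0} \<subseteq> (\<Union>b\<in>{b. M a b \<noteq> 0}. {c. L b c \<noteq> 0})"
  proof
    fix c assume "c \<in> {c. (\<Sum>b | M a b \<noteq> 0. M a b * L b c) \<noteq> 0}"
    then have "(\<Sum>b | M a b \<noteq> 0. M a b * L b c) \<noteq> 0" by simp
    then obtain b where "b \<in> {b. M a b \<noteq> 0}" "M a b * L b c \<noteq> 0" by (rule sum.not_neutral_contains_not_neutral)
    then show "c \<in> (\<Union>b\<in>{b. M a b \<noteq> 0}. {c. L b c \<noteq> 0})" by auto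
  qed
  then show "finite {c. (\<Sum>b | M a b \<noteq> 0. M a b * L b c) \<noteq> 0}"
    by (rule finite_subset) (use assms in auto)
qed

text \<open>\<open>lie_index\<close> is an infinite type, so matrices over it need a finiteness
  condition to be multiplied. Finite rows suffice and give a type of class \<open>ring_1\<close>,
  with powers and the usual ring identities at hand.\<close>

typedef (overloaded) ('i, 'a) rmat = "{M :: 'i \<Rightarrow> 'i \<Rightarrow> 'a::zero. \<forall>a. finite {c. M a c \<noteq> 0}}"
  morphisms entry Rmat
  by (rule exI[of _ "\<lambda>_ _. 0"]) simp

setup_lifting type_definition_rmat

lemma rmat_eqI: "(\<And>a c. entry A a c = entry B a c) \<Longrightarrow> A = B"
  by (metis entry_inject ext)

lemma finite_row: "finite {c. entry A a c \<noteq> 0}"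
  using entry[of A] by simp

instantiation rmat :: (type, ring_1) ring_1
begin

lift_definition zero_rmat :: "('a, 'b) rmat" is "\<lambda>_ _. 0" by simp

lift_definition one_rmat :: "('a, 'b) rmat" is "\<lambda>a c. if a = c then 1 else 0" by simp

lift_definition plus_rmat :: "('a, 'b) rmat \<Rightarrow> ('a, 'b) rmat \<Rightarrow> ('a, 'b) rmat"
  is "\<lambda>M L a c. M a c + L a c"
  subgoal for M L by (rule finite_row_binary[of M L]) auto
  done

lift_definition minus_rmat :: "('a, 'b) rmat \<Rightarrow> ('a, 'b) rmat \<Rightarrow> ('a, 'b) rmat"
  is "\<lambda>M L a c. M a c - L a c"
  subgoal for M L by (rule finite_row_binary[of M L]) auto
  done

lift_definition uminus_rmat :: "('a, 'b) rmat \<Rightarrow> ('a, 'b) rmat"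
  is "\<lambda>M a c. - M a c" by simp

lift_definition times_rmat :: "('a, 'b) rmat \<Rightarrow> ('a, 'b) rmat \<Rightarrow> ('a, 'b) rmat"
  is "\<lambda>M L a c. \<Sum>b | M a b \<noteq> 0. M a b * L b c"
  subgoal for M L by (rule finite_row_times) auto
  done

lemma entry_times_aux:
  fixes A B :: "('a, 'b) rmat"
  assumes "finite F" "\<And>b. entry A a b \<noteq> 0 \<Longrightarrow> b \<in> F"
  shows "entry (A * B) a c = (\<Sum>b\<in>F. entry A a b * entry B b c)"
  unfolding times_rmat.rep_eq
  by (rule sum.mono_neutral_left) (use assms in auto)

instance
proof
  fix A B C :: "('a, 'b) rmat"
  show "A * B * C = A * (B * C)"
  proof (rule rmat_eqI)
    fix a d
    let ?F = "{b. entry A a b \<noteq> 0}"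
    let ?K = "\<Union>b\<in>?F. {c. entry B b c \<noteq> 0}"
    have finF: "finite ?F" "finite ?K" by (auto simp: finite_row)
    have "entry (A * B * C) a d = (\<Sum>c\<in>?K. entry (A * B) a c * entry C c d)"
    proof (rule entry_times_aux[OF finF(2)])
      fix c assume "entry (A * B) a c \<noteq> 0"
      then obtain b where "b \<in> ?F" "entry A a b * entry B b c \<noteq> 0"
        unfolding times_rmat.rep_eq by (rule sum.not_neutral_contains_not_neutral)
      then show "c \<in> ?K" by auto
    qed
    also have "\<dots> = (\<Sum>c\<in>?K. \<Sum>b\<in>?F. entry A a b * entry B b c * entry C c d)"
      by (simp add: entry_times_aux[OF finF(1)] sum_distrib_right)
    also have "\<dots> = (\<Sum>b\<in>?F. \<Sum>c\<in>?K. entry A a b * (entry B b c * entry C c d))"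
      by (subst sum.swap) (simp add: mult.assoc)
    also have "\<dots> = (\<Sum>b\<in>?F. entry A a b * entry (B * C) b d)"
    proof (rule sum.cong[OF refl])
      fix b assume "b \<in> ?F"
      then have "entry (B * C) b d = (\<Sum>c\<in>?K. entry B b c * entry C c d)"
        by (intro entry_times_aux finF(2)) auto
      then show "(\<Sum>c\<in>?K. entry A a b * (entry B b c * entry C c d)) = entry A a b * entry (B * C) b d"
        by (simp add: sum_distrib_left)
    qed
    also have "\<dots> = entry (A * (B * C)) a d" by (simp add: entry_times_aux[OF finF(1)])
    finally show "entry (A * B * C) a d = entry (A * (B * C)) a d" .
  qed
  show "(A + B) * C = A * C + B * C"
  proof (rule rmat_eqI)
    fix a d
    let ?F = "{b. entry A a b \<noteq> 0} \<union> {b. entry B a b \<noteq> 0}"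
    have F: "finite ?F" using finite_row by auto
    have "entry ((A + B) * C) a d = (\<Sum>b\<in>?F. entry (A + B) a b * entry C b d)"
      by (rule entry_times_aux[OF F]) (auto simp: plus_rmat.rep_eq)
    moreover have "entry (A * C) a d = (\<Sum>b\<in>?F. entry A a b * entry C b d)"
      by (rule entry_times_aux[OF F]) auto
    moreover have "entry (B * C) a d = (\<Sum>b\<in>?F. entry B a b * entry C b d)"
      by (rule entry_times_aux[OF F]) auto
    ultimately show "entry ((A + B) * C) a d = entry (A * C + B * C) a d"
      by (simp add: plus_rmat.rep_eq sum.distrib distrib_right)
  qed
  show "A * (B + C) = A * B + A * C"
    by (rule rmat_eqI) (simp add: times_rmat.rep_eq plus_rmat.rep_eq distrib_left sum.distrib)
  show "1 * A = A"
  proof (rule rmat_eqI)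
    fix a c
    show "entry (1 * A) a c = entry A a c"
      by (subst entry_times_aux[of "{a}"]) (auto simp: one_rmat.rep_eq split: if_splits)
  qed
  show "A * 1 = A"
    by (rule rmat_eqI)
      (simp add: times_rmat.rep_eq one_rmat.rep_eq if_distrib[of "times _"] finite_row cong: if_cong)
  show "(0 :: ('a, 'b) rmat) \<noteq> 1"
    by transfer (auto simp: fun_eq_iff)
  show "- A + A = 0" "A - B = A + - B"
    by (rule rmat_eqI, simp add: plus_rmat.rep_eq minus_rmat.rep_eq uminus_rmat.rep_eq zero_rmat.rep_eq)+
qed (rule rmat_eqI, simp add: plus_rmat.rep_eq zero_rmat.rep_eq add_ac)+

end

lemmas entry_simps [simp] =
  zero_rmat.rep_eq plus_rmat.rep_eq minus_rmat.rep_eq uminus_rmat.rep_eq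

lemma entry_one: "entry 1 a c = (if a = c then 1 else 0)"
  by (simp add: one_rmat.rep_eq)

lemma entry_times:
  "finite F \<Longrightarrow> (\<And>b. entry A a b \<noteq> 0 \<Longrightarrow> b \<in> F) \<Longrightarrow>
    entry (A * B) a c = (\<Sum>b\<in>F. entry A a b * entry B b c)"
  by (rule entry_times_aux)

lemma entry_times_nonzero:
  assumes "entry (A * B) a c \<noteq> 0"
  obtains b where "entry A a b \<noteq> 0" "entry B b c \<noteq> 0"
proof -
  obtain b where "entry A a b * entry B b c \<noteq> 0"
    using assms unfolding times_rmat.rep_eq by (rule sum.not_neutral_contains_not_neutral)
  then show thesis using that[of b] by (metis mult_zero_left mult_zero_right)
qed

lemma entry_sum: "entry (\<Sum>i\<in>I. A i) a c = (\<Sum>i\<in>I. entry (A i) a c)"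
  by (induction I rule: infinite_finite_induct) auto

lift_definition smul :: "'b \<Rightarrow> ('a, 'b::comm_ring_1) rmat \<Rightarrow> ('a, 'b) rmat"
  is "\<lambda>k M a c. k * M a c"
  by (erule finite_row_unary) auto

lemma entry_smul [simp]: "entry (smul k A) a c = k * entry A a c"
  by (simp add: smul.rep_eq)

lemma smul_times_left: "smul k A * B = smul k (A * B)"
proof (rule rmat_eqI)
  fix a c
  have "entry (smul k A * B) a c = (\<Sum>b | entry A a b \<noteq> 0. entry (smul k A) a b * entry B b c)"
    by (rule entry_times[OF finite_row]) auto
  then show "entry (smul k A * B) a c = entry (smul k (A * B)) a c"
    by (simp add: times_rmat.rep_eq sum_distrib_left mult.assoc)
qed

lemma smul_times_right: "A * smul k B = smul k (A * B)"
  by (rule rmat_eqI) (simp add: times_rmat.rep_eq sum_distrib_left mult.left_commute)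

lemma smul_smul [simp]: "smul k (smul l A) = smul (k * l) A"
  by (rule rmat_eqI) (simp add: mult.assoc)

lemma smul_add: "smul k (A + B) = smul k A + smul k B"
  and smul_add_scalar: "smul (k + l) A = smul k A + smul l A"
  and smul_minus: "smul k (A - B) = smul k A - smul k B"
  and smul_uminus: "smul k (- A) = - smul k A"
  and smul_uminus_scalar: "smul (- k) A = - smul k A"
  and smul_zero [simp]: "smul k 0 = 0"
  and smul_zero_scalar [simp]: "smul 0 A = 0"
  and smul_one [simp]: "smul 1 A = A"
  by (rule rmat_eqI, simp add: algebra_simps)+

text \<open>Carries identities proved over the integers to any commutative ring, in particular to
  fields of small characteristic.\<close>

lift_definition rmap :: "('a, int) rmat \<Rightarrow> ('a, 'b::comm_ring_1) rmat"
  is "\<lambda>M a c. of_int (M a c)"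
  by (erule finite_row_unary) auto

lemma entry_rmap [simp]: "entry (rmap A) a c = of_int (entry A a c)"
  by (simp add: rmap.rep_eq)

lemma rmap_times: "rmap (A * B) = (rmap A * rmap B :: (_, 'c::comm_ring_1) rmat)"
proof (rule rmat_eqI)
  fix a c
  have "entry (rmap A * rmap B :: (_, 'c) rmat) a c =
      (\<Sum>b | entry A a b \<noteq> 0. entry (rmap A) a b * entry (rmap B) b c)"
    by (rule entry_times[OF finite_row]) auto
  then show "entry (rmap (A * B)) a c = entry (rmap A * rmap B :: (_, 'c) rmat) a c"
    by (simp add: times_rmat.rep_eq)
qed

lemma rmap_add: "rmap (A + B) = rmap A + rmap B"
  and rmap_minus: "rmap (A - B) = rmap A - rmap B"
  and rmap_uminus: "rmap (- A) = - rmap A"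
  and rmap_zero [simp]: "rmap 0 = 0"
  and rmap_one [simp]: "rmap 1 = 1"
  and rmap_smul: "rmap (smul k A) = smul (of_int k) (rmap A)"
  by (rule rmat_eqI, simp add: entry_one)+

lemma rmap_sum: "rmap (\<Sum>i\<in>I. A i) = (\<Sum>i\<in>I. rmap (A i))"
  by (induction I rule: infinite_finite_induct) (auto simp: rmap_add)

lift_definition diag :: "('a \<Rightarrow> 'b) \<Rightarrow> ('a, 'b::zero) rmat"
  is "\<lambda>d a c. if a = c then d a else 0" by simp

lemma entry_diag: "entry (diag d) a c = (if a = c then d a else 0)"
  by (simp add: diag.rep_eq)

lemma entry_diag_times: "entry (diag d * A) a c = d a * entry A a c"
  by (subst entry_times[of "{a}"]) (auto simp: entry_diag split: if_splits)

lemma entry_times_diag: "entry (A * diag d) a c = entry A a c * d c"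
proof -
  have "entry (A * diag d) a c = (\<Sum>b | entry A a b \<noteq> 0. if b = c then entry A a b * d b else 0)"
    by (simp add: times_rmat.rep_eq entry_diag if_distrib[of "times _"] cong: if_cong)
  then show ?thesis by (simp add: finite_row)
qed

lemma diag_times: "diag d * diag e = diag (\<lambda>a. d a * e a)"
  by (rule rmat_eqI) (simp add: entry_diag_times entry_diag)

lemma diag_one: "diag (\<lambda>_. 1) = 1"
  by (rule rmat_eqI) (simp add: entry_diag entry_one)

section \<open>Root systems\<close>

text \<open>\<open>cartan_int\<close> and \<open>coroot\<close> are integer divisions by a norm.
  Identities between them are proved after multiplication by this norm, which is at least 2, and
  then cancelled.\<close>

lemma cancel_norm: "2 \<le> (k::int) \<Longrightarrow> k * a = k * b \<Longrightarrow> a = b"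
  by simp

lemma sqlen_bounds: "2 \<le> sqlen X i" "sqlen X i \<le> 6"
  by (cases X; simp)+

lemma gram_sym: "gram X i j = gram X j i"
  by (auto simp: gram_def min.commute max.commute)

lemma gram_diag [simp]: "gram X i i = sqlen X i"
  by (simp add: gram_def)

lemma gram_nonpos: "i \<noteq> j \<Longrightarrow> gram X i j \<le> 0"
  using sqlen_bounds(1)[of X i] by (auto simp: gram_def max_def)

lemma sqlen_dvd: "sqlen X i dvd 2 * gram X i j"
  by (cases X; cases "i = j"; simp add: gram_def max_def)

lemma inner_sym: "inner X r s = inner X s r"
  unfolding inner_def by (subst sum.swap) (simp add: gram_sym mult.commute mult.left_commute)

lemma inner_lin: "inner X (\<lambda>i. r i + c * s i) t = inner X r t + c * inner X s t"
  by (simp add: inner_def algebra_simps sum.distrib sum_distrib_left)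

lemma inner_lin_right: "inner X t (\<lambda>i. r i + c * s i) = inner X t r + c * inner X t s"
  by (metis inner_lin inner_sym)

lemma inner_add: "inner X (r + s) t = inner X r t + inner X s t"
  using inner_lin[of X r 1 s t] by (simp add: plus_fun_def)

lemma inner_add_right: "inner X t (r + s) = inner X t r + inner X t s"
  by (metis inner_add inner_sym)

lemma inner_uminus: "inner X (- r) t = - inner X r t"
  using inner_lin[of X "\<lambda>_. 0" "-1" r t] by (simp add: inner_def fun_Compl_def)

lemma inner_uminus_right: "inner X t (- r) = - inner X t r"
  by (metis inner_uminus inner_sym)

lemma inner_zero [simp]: "inner X 0 t = 0" "inner X t 0 = 0"
  by (simp_all add: inner_def)

lemma inner_simple: "i < rank X \<Longrightarrow> inner X (simple_root i) s = (\<Sum>j<rank X. s j * gram X i j)"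
proof -
  assume i: "i < rank X"
  have "inner X (simple_root i) s = (\<Sum>k<rank X. if k = i then \<Sum>j<rank X. s j * gram X i j else 0)"
    unfolding inner_def by (rule sum.cong) (auto simp: simple_root_def)
  then show ?thesis using i by simp
qed

lemma inner_simple_self: "i < rank X \<Longrightarrow> inner X (simple_root i) (simple_root i) = sqlen X i"
proof -
  assume i: "i < rank X"
  have "(\<Sum>j<rank X. simple_root i j * gram X i j) = (\<Sum>j<rank X. if j = i then sqlen X i else 0)"
    by (rule sum.cong) (auto simp: simple_root_def)
  then show ?thesis using i by (simp add: inner_simple)
qed

lemma cartan_simple: "i < rank X \<Longrightarrow> sqlen X i * cartan_int X (simple_root i) s = 2 * inner X (simple_root i) s"
proof -
  assume i: "i < rank X"
  have "2 * inner X (simple_root i) s = (\<Sum>j<rank X. s j * (2 * gram X i j))"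
    by (simp add: inner_simple[OF i] sum_distrib_left algebra_simps)
  also have "sqlen X i dvd \<dots>" by (intro dvd_sum dvd_mult sqlen_dvd)
  finally show ?thesis by (simp add: cartan_int_def inner_simple_self[OF i])
qed

definition simple_reflection :: "dynkin \<Rightarrow> nat \<Rightarrow> root \<Rightarrow> root" where
  "simple_reflection X i x = (\<lambda>j. x j - cartan_int X (simple_root i) x * simple_root i j)"

lemma inner_reflection_left:
  "i < rank X \<Longrightarrow> inner X (simple_reflection X i x) y =
     inner X x y - cartan_int X (simple_root i) x * inner X (simple_root i) y"
  using inner_lin[of X x "- cartan_int X (simple_root i) x" "simple_root i" y]
  by (simp add: simple_reflection_def)

text \<open>The reflection coefficient times the squared length is twice the inner product with the
  simple root, so the correction terms on the two sides agree.\<close>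

lemma inner_reflection_swap:
  assumes i: "i < rank X"
  shows "inner X (simple_reflection X i x) y = inner X x (simple_reflection X i y)"
proof -
  let ?a = "simple_root i"
  let ?c = "cartan_int X ?a"
  have "?c x * (2 * inner X ?a y) = ?c y * (2 * inner X ?a x)"
    unfolding cartan_simple[OF i, symmetric] by (simp add: mult_ac)
  then have "?c x * inner X ?a y = ?c y * inner X ?a x" by simp
  then show ?thesis
    using inner_reflection_left[OF i, of x y] inner_reflection_left[OF i, of y x]
    by (metis inner_sym)
qed

lemma inner_reflection:
  assumes i: "i < rank X"
  shows "inner X (simple_reflection X i x) (simple_reflection X i y) = inner X x y"
proof -
  let ?a = "simple_root i"
  let ?c = "cartan_int X ?a"
  have "inner X (simple_reflection X i x) (simple_reflection X i y) =
      inner X x (simple_reflection X i y) - ?c x * inner X ?a (simple_reflection X i y)"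
    by (rule inner_reflection_left[OF i])
  also have "inner X ?a (simple_reflection X i y) = - inner X ?a y"
    using inner_reflection_left[OF i, of y ?a] cartan_simple[OF i, of y] inner_simple_self[OF i]
      inner_sym[of X ?a y] inner_sym[of X ?a "simple_reflection X i y"]
    by (simp add: mult.commute)
  also have "inner X x (simple_reflection X i y) = inner X x y - ?c x * inner X ?a y"
    using inner_reflection_left[OF i, of x y] inner_reflection_swap[OF i, of x y] by simp
  finally show ?thesis by simp
qed

lemma roots_reflection: "r \<in> roots X \<Longrightarrow> i < rank X \<Longrightarrow> simple_reflection X i r \<in> roots X"
  unfolding simple_reflection_def by (rule roots.reflect)

lemma roots_induct [consumes 1, case_names simple reflect]:
  assumes "r \<in> roots X"
    and "\<And>i. i < rank X \<Longrightarrow> P (simple_root i)"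
    and "\<And>r i. r \<in> roots X \<Longrightarrow> P r \<Longrightarrow> i < rank X \<Longrightarrow> P (simple_reflection X i r)"
  shows "P r"
  using assms unfolding simple_reflection_def by (rule roots.induct)

lemma root_norm:
  assumes "r \<in> roots X" obtains i where "i < rank X" "inner X r r = sqlen X i"
proof -
  have "\<exists>i<rank X. inner X r r = sqlen X i"
    using assms by (induction rule: roots_induct) (auto simp: inner_simple_self inner_reflection)
  then show thesis using that by blast
qed

lemma root_norm_bounds:
  assumes "r \<in> roots X" shows "2 \<le> inner X r r" "inner X r r \<le> 6"
proof -
  obtain i where "inner X r r = sqlen X i" using root_norm[OF assms] .
  then show "2 \<le> inner X r r" "inner X r r \<le> 6" using sqlen_bounds by simp_all
qed

lemma zero_not_root [simp]: "0 \<notin> roots X"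
  using root_norm_bounds(1)[of 0 X] by auto

lemma simple_reflection_uminus:
  assumes i: "i < rank X" shows "simple_reflection X i (- r) = - simple_reflection X i r"
proof -
  have "sqlen X i * cartan_int X (simple_root i) (- r) = sqlen X i * (- cartan_int X (simple_root i) r)"
    using cartan_simple[OF i, of "- r"] cartan_simple[OF i, of r] by (simp add: inner_uminus_right)
  then have "cartan_int X (simple_root i) (- r) = - cartan_int X (simple_root i) r"
    by (rule cancel_norm[OF sqlen_bounds(1)])
  then show ?thesis by (auto simp: simple_reflection_def)
qed

lemma uminus_root: "r \<in> roots X \<Longrightarrow> - r \<in> roots X"
proof (induction rule: roots_induct)
  case (simple i)
  have "cartan_int X (simple_root i) (simple_root i) = 2"
    using simple sqlen_bounds(1)[of X i] by (simp add: cartan_int_def inner_simple_self)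
  then have "- simple_root i = simple_reflection X i (simple_root i)"
    by (auto simp: simple_reflection_def)
  then show ?case using roots_reflection[OF roots.simple[OF simple] simple] by simp
next
  case (reflect r i)
  then have "simple_reflection X i (- r) \<in> roots X" by (intro roots_reflection)
  then show ?case unfolding simple_reflection_uminus[OF reflect(2)] .
qed

lemma root_support: "r \<in> roots X \<Longrightarrow> rank X \<le> j \<Longrightarrow> r j = 0"
  by (induction rule: roots_induct) (auto simp: simple_reflection_def simple_root_def)

text \<open>For simple roots this is a property of the Gram matrix; a reflection preserves the norm
  and can be moved to the other argument.\<close>

lemma norm_dvd: "r \<in> roots X \<Longrightarrow> inner X r r dvd 2 * inner X r s"
proof (induction arbitrary: s rule: roots_induct)
  case (simple i)
  then show ?case using cartan_simple[OF simple, of s] by (metis dvd_triv_left inner_simple_self)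
next
  case (reflect r i)
  then show ?case using inner_reflection_swap[of i X r s] by (simp add: inner_reflection)
qed

lemma cartan_int_eq: "r \<in> roots X \<Longrightarrow> inner X r r * cartan_int X r s = 2 * inner X r s"
  using norm_dvd[of r X s] by (simp add: cartan_int_def)

lemma cartan_int_add: "r \<in> roots X \<Longrightarrow> cartan_int X r (s + t) = cartan_int X r s + cartan_int X r t"
proof -
  assume r: "r \<in> roots X"
  have "inner X r r * cartan_int X r (s + t) = inner X r r * (cartan_int X r s + cartan_int X r t)"
    by (simp add: cartan_int_eq[OF r] distrib_left inner_add_right)
  then show ?thesis by (rule cancel_norm[OF root_norm_bounds(1)[OF r]])
qed

lemma cartan_int_scale: "r \<in> roots X \<Longrightarrow> cartan_int X r (\<lambda>i. c * s i) = c * cartan_int X r s"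
proof -
  assume r: "r \<in> roots X"
  have "inner X r r * cartan_int X r (\<lambda>i. c * s i) = inner X r r * (c * cartan_int X r s)"
    using cartan_int_eq[OF r] inner_lin_right[of X r 0 c s] by (simp add: mult.left_commute)
  then show ?thesis by (rule cancel_norm[OF root_norm_bounds(1)[OF r]])
qed

lemma cartan_int_self: "r \<in> roots X \<Longrightarrow> cartan_int X r r = 2"
  using root_norm_bounds(1)[of r X] by (simp add: cartan_int_def)

lemma cartan_int_zero [simp]: "cartan_int X r 0 = 0"
  by (simp add: cartan_int_def)

text \<open>Exactness of the division in \<open>coroot\<close>. A reflection alters a single
  coefficient, and \<open>norm_dvd\<close> shows that the change is divisible.\<close>

lemma coroot_eq: "r \<in> roots X \<Longrightarrow> i < rank X \<Longrightarrow> inner X r r * coroot X r i = r i * sqlen X i"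
proof -
  assume r: "r \<in> roots X" and i: "i < rank X"
  have "inner X r r dvd r i * sqlen X i"
    using r i
  proof (induction rule: roots_induct)
    case (simple j)
    then show ?case by (auto simp: inner_simple_self) (simp add: simple_root_def)
  next
    case (reflect r j)
    show ?case
    proof (cases "i = j")
      case True
      have "simple_reflection X j r i * sqlen X i = r i * sqlen X i - 2 * inner X (simple_root j) r"
        using cartan_simple[OF reflect(2), of r] True fun_cong[OF simple_root_def[of j], of j]
        by (simp add: simple_reflection_def algebra_simps)
      moreover have "inner X r r dvd 2 * inner X (simple_root j) r"
        using norm_dvd[OF reflect(1), of "simple_root j"] by (simp only: inner_sym)
      ultimately show ?thesis using reflect by (simp add: inner_reflection)
    next
      case False
      then show ?thesis using reflect by (simp add: inner_reflection) (simp add: simple_reflection_def simple_root_def)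
    qed
  qed
  then show ?thesis by (simp add: coroot_def)
qed

lemma coroot_simple: "i < rank X \<Longrightarrow> coroot X (simple_root i) j = simple_root i j"
  using sqlen_bounds(1)[of X i] by (auto simp: coroot_def inner_simple_self) (auto simp: simple_root_def)

lemma coroot_uminus: "r \<in> roots X \<Longrightarrow> i < rank X \<Longrightarrow> coroot X (- r) i = - coroot X r i"
proof -
  assume r: "r \<in> roots X" and i: "i < rank X"
  have "inner X r r * coroot X (- r) i = inner X r r * (- coroot X r i)"
    using coroot_eq[OF r i] coroot_eq[OF uminus_root[OF r] i] by (simp add: inner_uminus inner_uminus_right)
  then show ?thesis by (rule cancel_norm[OF root_norm_bounds(1)[OF r]])
qed

text \<open>The coroot of \<open>r\<close>, expanded in simple coroots and evaluated at
  \<open>s\<close>. Through this the bracket of e_r and e_-r acts by Cartan integers.\<close>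

lemma sum_coroot: "r \<in> roots X \<Longrightarrow> (\<Sum>i<rank X. coroot X r i * cartan_int X (simple_root i) s) = cartan_int X r s"
proof -
  assume r: "r \<in> roots X"
  have "inner X r r * (\<Sum>i<rank X. coroot X r i * cartan_int X (simple_root i) s) =
      (\<Sum>i<rank X. r i * (sqlen X i * cartan_int X (simple_root i) s))"
    using coroot_eq[OF r] by (simp add: sum_distrib_left flip: mult.assoc)
  also have "\<dots> = 2 * (\<Sum>i<rank X. r i * inner X (simple_root i) s)"
    by (simp add: cartan_simple sum_distrib_left algebra_simps)
  also have "(\<Sum>i<rank X. r i * inner X (simple_root i) s) = inner X r s"
    unfolding inner_def[of X r s] by (simp add: inner_simple sum_distrib_left mult.assoc)
  also have "2 * inner X r s = inner X r r * cartan_int X r s"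
    using cartan_int_eq[OF r] by simp
  finally show ?thesis by (rule cancel_norm[OF root_norm_bounds(1)[OF r]])
qed

text \<open>Norms of roots lie between 2 and 6, so the square of \<open>k\<close> is less than 4 and
  not 0.\<close>

lemma root_multiple:
  assumes "r \<in> roots X" "(\<lambda>i. k * r i) \<in> roots X" shows "\<bar>k\<bar> = 1"
proof -
  have "inner X (\<lambda>i. k * r i) (\<lambda>i. k * r i) = k * k * inner X r r"
    by (simp add: inner_def sum_distrib_left algebra_simps)
  then have *: "2 \<le> k * k * inner X r r" "k * k * inner X r r \<le> 6" using root_norm_bounds[OF assms(2)] by auto
  have "k * k < 4"
  proof (rule ccontr)
    assume "\<not> k * k < 4"
    then have "4 * 2 \<le> k * k * inner X r r" using root_norm_bounds(1)[OF assms(1)] by (intro mult_mono) auto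
    then show False using * by simp
  qed
  then have "\<bar>k\<bar> * \<bar>k\<bar> < 2 * 2" by (simp add: abs_mult_self_eq)
  then have "\<bar>k\<bar> < 2" by (metis abs_ge_zero linorder_not_less mult_mono zero_le_numeral)
  moreover have "k \<noteq> 0" using * by auto
  ultimately show ?thesis by auto
qed

subsection \<open>Finiteness\<close>

text \<open>A symmetric matrix with nonpositive entries off the diagonal which maps some positive vector
  to a positive vector is positive definite.\<close>

lemma finite_roots_if:
  assumes m: "\<And>i. i < rank X \<Longrightarrow> 0 < m i"
    and gm: "\<And>i. i < rank X \<Longrightarrow> 1 \<le> (\<Sum>j<rank X. gram X i j * m j)"
  shows "finite (roots X)"
proof -
  let ?n = "rank X"
  have bound: "real_of_int (x i) ^ 2 / m i \<le> inner X x x" if i: "i < ?n" for x i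
  proof -
    let ?g = "\<lambda>i j. real_of_int (gram X i j)"
    define M where "M i = real_of_int (m i)" for i
    define x' where "x' i = real_of_int (x i)" for i
    have M: "M i > 0" if "i < ?n" for i using m[OF that] by (simp add: M_def)
    \<comment> \<open>The inequality of arithmetic and geometric means with weights
      \<open>M\<close>, turned around by the nonpositive entry off the diagonal. Summed over all
      pairs, each of the two terms contributes \<open>S\<close>, in which all row sums are at least
      1.\<close>
    have ge: "x' i * x' j * ?g i j \<ge> (?g i j * M j * (x' i ^ 2 / M i) + ?g i j * M i * (x' j ^ 2 / M j)) / 2"
      if ij: "i < ?n" "j < ?n" for i j
    proof (cases "i = j")
      case True
      then show ?thesis using M[OF ij(1)] by (simp add: power2_eq_square)
    next
      case False
      have "M j * (x' i ^ 2 / M i) + M i * (x' j ^ 2 / M j) - 2 * (x' i * x' j) = (M j * x' i - M i * x' j) ^ 2 / (M i * M j)"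
        using M[OF ij(1)] M[OF ij(2)] by (simp add: field_simps power2_eq_square)
      also have "\<dots> \<ge> 0" using M[OF ij(1)] M[OF ij(2)] by simp
      finally have "2 * (x' i * x' j) \<le> M j * (x' i ^ 2 / M i) + M i * (x' j ^ 2 / M j)" by simp
      moreover have "?g i j \<le> 0" using gram_nonpos[OF False, of X] by simp
      ultimately have "?g i j * (2 * (x' i * x' j)) \<ge> ?g i j * (M j * (x' i ^ 2 / M i) + M i * (x' j ^ 2 / M j))"
        by (rule mult_left_mono_neg)
      then show ?thesis by (simp add: algebra_simps)
    qed
    have row: "(\<Sum>j<?n. ?g i j * M j) \<ge> 1" if "i < ?n" for i
    proof -
      have "real_of_int 1 \<le> real_of_int (\<Sum>j<?n. gram X i j * m j)" using gm[OF that] by linarith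
      then show ?thesis by (simp add: M_def)
    qed
    define S where "S = (\<Sum>i<?n. \<Sum>j<?n. ?g i j * M j * (x' i ^ 2 / M i))"
    have S': "S = (\<Sum>i<?n. \<Sum>j<?n. ?g i j * M i * (x' j ^ 2 / M j))"
      unfolding S_def by (subst sum.swap) (simp add: gram_sym)
    have "x' i ^ 2 / M i \<le> (\<Sum>i<?n. x' i ^ 2 / M i)"
      using i M by (intro member_le_sum) (auto simp: less_imp_le)
    also have "\<dots> \<le> (\<Sum>i<?n. (\<Sum>j<?n. ?g i j * M j) * (x' i ^ 2 / M i))"
    proof (rule sum_mono)
      fix i assume "i \<in> {..<?n}"
      then have "1 * (x' i ^ 2 / M i) \<le> (\<Sum>j<?n. ?g i j * M j) * (x' i ^ 2 / M i)"
        using row M by (intro mult_right_mono) (auto simp: less_imp_le)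
      then show "x' i ^ 2 / M i \<le> (\<Sum>j<?n. ?g i j * M j) * (x' i ^ 2 / M i)" by simp
    qed
    also have "\<dots> = S" by (simp only: S_def sum_distrib_right)
    also have "S = (S + S) / 2" by simp
    also have "\<dots> = (\<Sum>i<?n. \<Sum>j<?n. (?g i j * M j * (x' i ^ 2 / M i) + ?g i j * M i * (x' j ^ 2 / M j)) / 2)"
      by (subst (2) S') (simp add: S_def sum.distrib add_divide_distrib sum_divide_distrib)
    also have "\<dots> \<le> (\<Sum>i<?n. \<Sum>j<?n. x' i * x' j * ?g i j)"
      using ge by (intro sum_mono) auto
    also have "\<dots> = inner X x x" by (simp add: inner_def x'_def)
    finally show ?thesis by (simp add: x'_def M_def)
  qed
  define B where "B = 6 * (\<Sum>i<?n. m i)"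
  have "roots X \<subseteq> {f. \<forall>i. (i \<in> {..<?n} \<longrightarrow> f i \<in> {-B..B}) \<and> (i \<notin> {..<?n} \<longrightarrow> f i = 0)}"
  proof (intro subsetI CollectI allI conjI impI)
    fix r i assume r: "r \<in> roots X"
    show "r i = 0" if "i \<notin> {..<?n}" using root_support[OF r] that by simp
    assume i: "i \<in> {..<?n}"
    have "real_of_int (r i) ^ 2 / m i \<le> 6"
      using bound[of i r] root_norm_bounds(2)[OF r] i by simp
    then have "real_of_int (r i) ^ 2 \<le> 6 * m i" using m[of i] i by (simp add: field_simps)
    then have "r i ^ 2 \<le> 6 * m i" by (metis of_int_le_iff of_int_mult of_int_numeral of_int_power)
    also have "6 * m i \<le> B"
      unfolding B_def using i m by (intro mult_left_mono member_le_sum) (auto simp: less_imp_le)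
    finally have B: "r i ^ 2 \<le> B" .
    have "\<bar>r i\<bar> \<le> \<bar>r i\<bar> ^ 2" using self_le_power[of "\<bar>r i\<bar>" 2] by (cases "r i = 0") auto
    then have "\<bar>r i\<bar> \<le> B" using B by simp
    then show "r i \<in> {-B..B}" by auto
  qed
  moreover have "finite {f :: nat \<Rightarrow> int. \<forall>i. (i \<in> {..<?n} \<longrightarrow> f i \<in> {-B..B}) \<and> (i \<notin> {..<?n} \<longrightarrow> f i = 0)}"
    by (rule finite_set_of_finite_funs) auto
  ultimately show ?thesis by (rule finite_subset)
qed

lemma sum_single: "finite A \<Longrightarrow> (\<Sum>j\<in>A. if j = i then f j else 0) = (if i \<in> A then f i else (0::int))"
  by (simp add: sum.delta)

lemma sum_path:
  fixes f g h :: "nat \<Rightarrow> int"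
  assumes "i < l"
  shows "(\<Sum>j<l. (if j = i then f j else 0) + (if Suc j = i then g j else 0) + (if j = Suc i then h j else 0)) =
    f i + (if i = 0 then 0 else g (i - 1)) + (if Suc i < l then h (Suc i) else 0)"
proof -
  have "(\<Sum>j<l. if Suc j = i then g j else 0) = (if i = 0 then 0 else g (i - 1))"
  proof (cases i)
    case (Suc k)
    then have "(\<Sum>j<l. if Suc j = i then g j else 0) = (\<Sum>j<l. if j = k then g j else 0)" by simp
    then show ?thesis using assms Suc by simp
  qed simp
  then show ?thesis using assms by (simp add: sum.distrib)
qed

lemma finite_roots_A: "finite (roots (An l))"
proof (rule finite_roots_if)
  \<comment> \<open>A concave parabola vanishing at -1 and at \<open>l\<close>; its second
    difference is -2, so every row sum is 2.\<close>
  let ?m = "\<lambda>j. (int j + 1) * (int l - int j)"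
  show "0 < ?m i" if "i < rank (An l)" for i using that by simp
  fix i assume "i < rank (An l)"
  then have i: "i < l" by simp
  have "(\<Sum>j<rank (An l). gram (An l) i j * ?m j) = (\<Sum>j<l. (if j = i then 2 * ?m j else 0) +
      (if Suc j = i then - ?m j else 0) + (if j = Suc i then - ?m j else 0))"
    using i by (intro sum.cong) (auto simp: gram_def min_def max_def)
  also have "\<dots> \<ge> 1" unfolding sum_path[OF i]
    by (insert i, cases "l = Suc i"; cases i) (auto simp: algebra_simps)
  finally show "1 \<le> (\<Sum>j<rank (An l). gram (An l) i j * ?m j)" .
qed

lemma finite_roots_B: "finite (roots (Bn l))"
proof (rule finite_roots_if)
  \<comment> \<open>This parabola vanishes at -1 and still increases at the last node, whose row
    reduces to a first difference because its diagonal entry is only 2.\<close>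
  let ?m = "\<lambda>j. (int j + 1) * (2 * int l - int j)"
  show "0 < ?m i" if "i < rank (Bn l)" for i using that by simp
  fix i assume "i < rank (Bn l)"
  then have i: "i < l" by simp
  have "(\<Sum>j<rank (Bn l). gram (Bn l) i j * ?m j) = (\<Sum>j<l. (if j = i then sqlen (Bn l) i * ?m j else 0) +
      (if Suc j = i then - 2 * ?m j else 0) + (if j = Suc i then - 2 * ?m j else 0))"
    using i by (intro sum.cong) (auto simp: gram_def min_def max_def)
  also have "\<dots> \<ge> 1" unfolding sum_path[OF i]
    by (insert i, cases "l = Suc i"; cases i) (auto simp: algebra_simps)
  finally show "1 \<le> (\<Sum>j<rank (Bn l). gram (Bn l) i j * ?m j)" .
qed

lemma finite_roots_C: "2 \<le> l \<Longrightarrow> finite (roots (Cn l))"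
proof (rule finite_roots_if)
  assume l: "2 \<le> l"
  \<comment> \<open>The parabola of type \<open>Bn\<close>; the factor 1 at the long last node
    against 2 elsewhere makes the last row a multiple of a first difference again.\<close>
  let ?m = "\<lambda>j. (if Suc j = l then 1 else 2) * ((int j + 1) * (2 * int l - int j))"
  show "0 < ?m i" if "i < rank (Cn l)" for i using that by simp
  fix i assume "i < rank (Cn l)"
  then have i: "i < l" by simp
  have "(\<Sum>j<rank (Cn l). gram (Cn l) i j * ?m j) = (\<Sum>j<l. (if j = i then sqlen (Cn l) i * ?m j else 0) +
      (if Suc j = i then - (if Suc i = l then 2 else 1) * ?m j else 0) +
      (if j = Suc i then - (if Suc j = l then 2 else 1) * ?m j else 0))"
    using i by (intro sum.cong) (auto simp: gram_def min_def max_def)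
  also have "\<dots> \<ge> 1" unfolding sum_path[OF i]
  proof -
    obtain k where k: "l = k + 2" using l by (metis le_iff_add add.commute)
    consider "i = k + 1" | "i = k" | "i < k" using i k by linarith
    then show "1 \<le> sqlen (Cn l) i * ?m i + (if i = 0 then 0 else - (if Suc i = l then 2 else 1) * ?m (i - 1)) +
        (if Suc i < l then - (if Suc (Suc i) = l then 2 else 1) * ?m (Suc i) else 0)"
      by cases (cases i; simp add: k algebra_simps)+
  qed
  finally show "1 \<le> (\<Sum>j<rank (Cn l). gram (Cn l) i j * ?m j)" .
qed

lemma gram_D:
  "gram (Dn l) i j = (if j = i then 2 else if Suc j = i \<and> Suc i < l \<or> j = Suc i \<and> Suc j < l \<or>
    i + 3 = l \<and> Suc j = l \<or> j + 3 = l \<and> Suc i = l then - 1 else 0)"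
  by (cases i j rule: linorder_cases) (auto simp: gram_def min_def max_def)

lemma sum_gram_D:
  fixes m :: "nat \<Rightarrow> int"
  assumes l: "4 \<le> l" and i: "i < l"
  shows "(\<Sum>j<l. gram (Dn l) i j * m j) =
    2 * m i + (if i = 0 then 0 else if Suc i < l then - m (i - 1) else 0) +
    (if Suc (Suc i) < l then - m (Suc i) else 0) +
    ((if i + 3 = l then - m (l - 1) else 0) + (if Suc i = l then - m (l - 3) else 0))"
proof -
  have "gram (Dn l) i j * m j =
      (if j = i then 2 * m j else 0) + (if Suc j = i then (if Suc i < l then - m j else 0) else 0) +
        (if j = Suc i then (if Suc j < l then - m j else 0) else 0) +
        ((if j = l - 1 then (if i + 3 = l then - m j else 0) else 0) +
        (if j = l - 3 then (if Suc i = l then - m j else 0) else 0))" if j: "j < l" for j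
  proof -
    have e: "j = l - 1 \<longleftrightarrow> Suc j = l" "j = l - 3 \<longleftrightarrow> j + 3 = l" using l j by auto
    show ?thesis unfolding e gram_D using l i j by auto
  qed
  then have "(\<Sum>j<l. gram (Dn l) i j * m j) =
      (\<Sum>j<l. ((if j = i then 2 * m j else 0) + (if Suc j = i then (if Suc i < l then - m j else 0) else 0) +
        (if j = Suc i then (if Suc j < l then - m j else 0) else 0)) +
        ((if j = l - 1 then (if i + 3 = l then - m j else 0) else 0) +
        (if j = l - 3 then (if Suc i = l then - m j else 0) else 0)))"
    by (intro sum.cong) auto
  also have "\<dots> = 2 * m i + (if i = 0 then 0 else if Suc i < l then - m (i - 1) else 0) +
      (if Suc i < l then if Suc (Suc i) < l then - m (Suc i) else 0 else 0) +
      ((if i + 3 = l then - m (l - 1) else 0) + (if Suc i = l then - m (l - 3) else 0))"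
    using l by (subst sum.distrib, subst sum_path[OF i], subst sum.distrib, subst (1 2) sum_single) simp_all
  finally show ?thesis by simp
qed

lemma finite_roots_D:
  assumes l: "4 \<le> l" shows "finite (roots (Dn l))"
proof (rule finite_roots_if)
  let ?f = "\<lambda>j. (int j + 1) * (2 * int l - int j)"
  \<comment> \<open>Each of the two end nodes needs a little more than half the value at the branch
    node \<open>l - 3\<close>. The excess 1 gives row sum 2 there, and at the branch node the slope
    of \<open>?f\<close> outweighs it.\<close>
  let ?m = "\<lambda>j. if j + 2 < l then 2 * ?f j else ?f (l - 3) + 1"
  have f: "0 < ?f j" if "j < l" for j using that by simp
  then show "0 < ?m i" if "i < rank (Dn l)" for i using that l f[of "l - 3"] by (simp add: add_pos_pos)
  fix i assume "i < rank (Dn l)"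
  then have i: "i < l" by simp
  obtain k where k: "l = k + 4" using l by (metis le_iff_add add.commute)
  consider "i = k + 3" | "i = k + 2" | "i = k + 1" | "i \<le> k" using i k by linarith
  then show "1 \<le> (\<Sum>j<rank (Dn l). gram (Dn l) i j * ?m j)"
    unfolding rank.simps sum_gram_D[OF l i]
  proof cases
    case 4
    then show "1 \<le> 2 * ?m i + (if i = 0 then 0 else if Suc i < l then - ?m (i - 1) else 0) +
        (if Suc (Suc i) < l then - ?m (Suc i) else 0) +
        ((if i + 3 = l then - ?m (l - 1) else 0) + (if Suc i = l then - ?m (l - 3) else 0))"
      by (cases i) (auto simp: k algebra_simps)
  qed (simp_all add: k algebra_simps)
qed

text \<open>The vectors make all row sums equal, to 1, 2 and 1 respectively; they are the half sum
  of the positive roots, doubled in type E7.\<close>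

lemma finite_roots_E:
  "finite (roots (En 6))" "finite (roots (En 7))" "finite (roots (En 8))"
proof -
  have 6: "{..<6} = {0, 1, 2, 3, 4, 5 :: nat}" and 7: "{..<7} = {0, 1, 2, 3, 4, 5, 6 :: nat}"
    and 8: "{..<8} = {0, 1, 2, 3, 4, 5, 6, 7 :: nat}" by auto
  show "finite (roots (En 6))"
  proof (rule finite_roots_if)
    fix i assume "i < rank (En 6)"
    then have "i \<in> {..<6}" by simp
    then have i: "i \<in> {0, 1, 2, 3, 4, 5}" unfolding 6 .
    show "0 < [8, 15, 21, 15, 8, 11 :: int] ! i" using i by auto
    show "1 \<le> (\<Sum>j<rank (En 6). gram (En 6) i j * [8, 15, 21, 15, 8, 11] ! j)"
      using i by (auto simp: 6 gram_def)
  qed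
  show "finite (roots (En 7))"
  proof (rule finite_roots_if)
    fix i assume "i < rank (En 7)"
    then have "i \<in> {..<7}" by simp
    then have i: "i \<in> {0, 1, 2, 3, 4, 5, 6}" unfolding 7 .
    show "0 < [34, 66, 96, 75, 52, 27, 49 :: int] ! i" using i by auto
    show "1 \<le> (\<Sum>j<rank (En 7). gram (En 7) i j * [34, 66, 96, 75, 52, 27, 49] ! j)"
      using i by (auto simp: 7 gram_def)
  qed
  show "finite (roots (En 8))"
  proof (rule finite_roots_if)
    fix i assume "i < rank (En 8)"
    then have "i \<in> {..<8}" by simp
    then have i: "i \<in> {0, 1, 2, 3, 4, 5, 6, 7}" unfolding 8 .
    show "0 < [46, 91, 135, 110, 84, 57, 29, 68 :: int] ! i" using i by auto
    show "1 \<le> (\<Sum>j<rank (En 8). gram (En 8) i j * [46, 91, 135, 110, 84, 57, 29, 68] ! j)"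
      using i by (auto simp: 8 gram_def)
  qed
qed

text \<open>As in type E the vector makes all row sums equal, here to 2.\<close>

lemma finite_roots_F: "finite (roots F4)"
proof (rule finite_roots_if)
  have 4: "{..<4} = {0, 1, 2, 3 :: nat}" by auto
  fix i assume "i < rank F4"
  then have "i \<in> {..<4}" by simp
  then have i: "i \<in> {0, 1, 2, 3}" unfolding 4 .
  show "0 < [11, 21, 30, 16 :: int] ! i" using i by auto
  show "1 \<le> (\<Sum>j<rank F4. gram F4 i j * [11, 21, 30, 16] ! j)"
    using i by (auto simp: 4 gram_def)
qed

text \<open>Both row sums are 3.\<close>

lemma finite_roots_G: "finite (roots G2)"
proof (rule finite_roots_if)
  have 2: "{..<2} = {0, 1 :: nat}" by auto
  fix i assume "i < rank G2"
  then have "i \<in> {..<2}" by simp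
  then have i: "i \<in> {0, 1}" unfolding 2 .
  show "0 < [9, 5 :: int] ! i" using i by auto
  show "1 \<le> (\<Sum>j<rank G2. gram G2 i j * [9, 5] ! j)"
    using i by (auto simp: 2 gram_def)
qed

section \<open>The adjoint representation over the integers\<close>

fun grade :: "lie_index \<Rightarrow> root" where
  "grade (Cartan i) = 0"
| "grade (Root s) = s"

text \<open>Row \<open>a\<close> holds the coordinates of the bracket of \<open>b\<close> with
  \<open>a\<close>. Cutting rows and columns down to the basis makes the rows finite.\<close>

definition ad_matrix :: "dynkin \<Rightarrow> (root \<Rightarrow> root \<Rightarrow> int) \<Rightarrow> lie_index \<Rightarrow> (lie_index, int) rmat" where
  "ad_matrix X N b = Rmat (\<lambda>a c. if a \<in> basis X \<and> c \<in> basis X then basis_bracket X N b a c else 0)"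

text \<open>The entrywise division is exact by \<open>fact_dvd_power\<close>; this is what gives
  divided powers a meaning in positive characteristic.\<close>

definition divided_power :: "dynkin \<Rightarrow> (root \<Rightarrow> root \<Rightarrow> int) \<Rightarrow> root \<Rightarrow> nat \<Rightarrow> (lie_index, int) rmat" where
  "divided_power X N r n = Rmat (\<lambda>a c. entry (ad_matrix X N (Root r) ^ n) a c div fact n)"

lemma entry_Rmat: "(\<And>a. finite {c. M a c \<noteq> 0}) \<Longrightarrow> entry (Rmat M) = M"
  by (rule Rmat_inverse) simp

lemma entry_divided_power: "entry (divided_power X N r n) a c = entry (ad_matrix X N (Root r) ^ n) a c div fact n"
  unfolding divided_power_def
proof (subst entry_Rmat)
  show "finite {c. entry (ad_matrix X N (Root r) ^ n) a c div fact n \<noteq> 0}" for a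
    by (rule finite_subset[OF _ finite_row[of "ad_matrix X N (Root r) ^ n" a]]) auto
qed simp

lemma entry_times_single:
  assumes "\<And>b. b \<noteq> b0 \<Longrightarrow> entry A a b = 0"
  shows "entry (A * B) a c = entry A a b0 * entry B b0 c"
proof -
  have "entry (A * B) a c = (\<Sum>b\<in>{b0}. entry A a b * entry B b c)"
    by (rule entry_times) (use assms in auto)
  then show ?thesis by simp
qed

lemma fact_dvd_rising: "fact n dvd (\<Prod>j<n. int m + 1 + int j)"
proof -
  have *: "fact m * (\<Prod>j<n. int m + 1 + int j) = fact (m + n)"
  proof (induction n)
    case (Suc n)
    have "fact m * (\<Prod>j<Suc n. int m + 1 + int j) = fact m * (\<Prod>j<n. int m + 1 + int j) * (int m + 1 + int n)"
      by simp
    also have "\<dots> = fact (m + Suc n)" unfolding Suc.IH by (simp add: algebra_simps)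
    finally show ?case .
  qed simp
  have "(fact m * fact n :: int) dvd fact (m + n)" by (rule fact_fact_dvd_fact)
  then show ?thesis unfolding *[symmetric] by simp
qed

locale chevalley =
  fixes X N
  assumes constants: "chevalley_constants X N" and finite_roots: "finite (roots X)"
begin

lemma finite_basis: "finite (basis X)"
  using finite_roots by (simp add: basis_def)

lemma Root_basis [simp]: "Root r \<in> basis X \<longleftrightarrow> r \<in> roots X"
  and Cartan_basis [simp]: "Cartan i \<in> basis X \<longleftrightarrow> i < rank X"
  by (auto simp: basis_def)

lemma N_swap: "r \<in> roots X \<Longrightarrow> s \<in> roots X \<Longrightarrow> r + s \<in> roots X \<Longrightarrow> N s r = - N r s"
  using constants by (simp add: chevalley_constants_def)

lemma N_abs: "r \<in> roots X \<Longrightarrow> s \<in> roots X \<Longrightarrow> r + s \<in> roots X \<Longrightarrow>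
    \<bar>N r s\<bar> = int (Max {p. (\<lambda>i. s i - int p * r i) \<in> roots X}) + 1"
  using constants by (simp add: chevalley_constants_def)

lemma bracket_support:
  assumes "b \<in> basis X" "a \<in> basis X" "basis_bracket X N b a c \<noteq> 0"
  shows "c \<in> basis X \<and> grade c = grade a + grade b"
proof (cases b; cases a)
  fix r s assume [simp]: "b = Root r" "a = Root s"
  have r: "r \<in> roots X" using assms(1) by simp
  show ?thesis
  proof (cases "s = - r")
    case True
    have "i < rank X" if "coroot X r i \<noteq> 0" for i
      using that root_support[OF r, of i] by (cases "i < rank X") (auto simp: coroot_def)
    then show ?thesis using True assms(3) by (cases c) auto
  next
    case False
    then show ?thesis using assms(3) by (auto simp: unit_vector_def add.commute split: if_splits)
  qed
qed (use assms in \<open>auto simp: unit_vector_def split: if_splits\<close>)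

lemma bracket_swap:
  assumes "a \<in> basis X" "b \<in> basis X"
  shows "basis_bracket X N a b c = - basis_bracket X N b a c"
proof (cases a; cases b)
  fix r s assume [simp]: "a = Root r" "b = Root s"
  have rs: "r \<in> roots X" "s \<in> roots X" using assms by auto
  show ?thesis
  proof (cases "s = - r")
    case True
    have "coroot X (- r) i = - coroot X r i" for i
      using coroot_uminus[OF rs(1), of i] root_support[OF rs(1), of i]
      by (cases "i < rank X") (auto simp: coroot_def)
    then show ?thesis using True by (auto split: lie_index.split)
  next
    case False
    then have "r \<noteq> - s" by auto
    then show ?thesis using False N_swap[OF rs] by (auto simp: add.commute)
  qed
qed auto

lemma entry_ad:
  assumes "b \<in> basis X"
  shows "entry (ad_matrix X N b) a c = (if a \<in> basis X then basis_bracket X N b a c else 0)"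
proof -
  have "finite {c. (if a \<in> basis X \<and> c \<in> basis X then basis_bracket X N b a c else 0) \<noteq> 0}" for a
    by (rule finite_subset[OF _ finite_basis]) auto
  then show ?thesis
    unfolding ad_matrix_def using bracket_support[OF assms, of a c] by (subst entry_Rmat) auto
qed

lemma ad_nonzero:
  assumes "b \<in> basis X" "entry (ad_matrix X N b) a c \<noteq> 0"
  shows "a \<in> basis X" "c \<in> basis X" "grade c = grade a + grade b"
  using assms bracket_support[of b a c] by (auto simp: entry_ad split: if_splits)

lemma bracket_unit_left:
  assumes "a \<in> basis X"
  shows "bracket X N (unit_vector a) v c = (\<Sum>b\<in>basis X. v b * basis_bracket X N a b c)"
proof -
  have "bracket X N (unit_vector a) v c =
      (\<Sum>a'\<in>basis X. if a' = a then \<Sum>b\<in>basis X. v b * basis_bracket X N a b c else 0)"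
    unfolding bracket_def by (rule sum.cong) (auto simp: unit_vector_def)
  then show ?thesis using assms finite_basis by simp
qed

lemma bracket_unit:
  assumes "a \<in> basis X" "b \<in> basis X"
  shows "bracket X N (unit_vector a) (unit_vector b) = basis_bracket X N a b"
proof
  fix c
  have "(\<Sum>b'\<in>basis X. unit_vector b b' * basis_bracket X N a b' c) =
      (\<Sum>b'\<in>basis X. if b' = b then basis_bracket X N a b c else 0)"
    by (rule sum.cong) (auto simp: unit_vector_def)
  then show "bracket X N (unit_vector a) (unit_vector b) c = basis_bracket X N a b c"
    using assms finite_basis by (simp add: bracket_unit_left)
qed

lemma entry_ad_times:
  assumes "b \<in> basis X" "a \<in> basis X"
  shows "entry (ad_matrix X N b * M) a c = (\<Sum>d\<in>basis X. basis_bracket X N b a d * entry M d c)"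
proof -
  have "entry (ad_matrix X N b * M) a c = (\<Sum>d\<in>basis X. entry (ad_matrix X N b) a d * entry M d c)"
    by (rule entry_times[OF finite_basis]) (rule ad_nonzero(2)[OF assms(1)])
  then show ?thesis using assms by (simp add: entry_ad)
qed

text \<open>Matrices act on row vectors, so that products are reversed.\<close>

lemma ad_commute:
  assumes u: "u \<in> basis X" and v: "v \<in> basis X"
  shows "ad_matrix X N v * ad_matrix X N u = ad_matrix X N u * ad_matrix X N v +
    (\<Sum>b\<in>basis X. smul (basis_bracket X N u v b) (ad_matrix X N b))"
proof (rule rmat_eqI)
  fix a c
  let ?br = "basis_bracket X N"
  show "entry (ad_matrix X N v * ad_matrix X N u) a c = entry (ad_matrix X N u * ad_matrix X N v +
    (\<Sum>b\<in>basis X. smul (?br u v b) (ad_matrix X N b))) a c"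
  proof (cases "a \<in> basis X")
    case a: True
    let ?J = "\<lambda>u v w. bracket X N (unit_vector u) (bracket X N (unit_vector v) (unit_vector w))"
    have "?J u v a + ?J v a u + ?J a u v = 0"
      using constants u v a unfolding chevalley_constants_def Let_def by blast
    then have "?J u v a c + ?J v a u c + ?J a u v c = 0" by (metis plus_fun_apply zero_fun_apply)
    moreover have "?J u v a c = entry (ad_matrix X N v * ad_matrix X N u) a c"
      by (simp add: bracket_unit v a bracket_unit_left u entry_ad_times entry_ad)
    moreover have "?J v a u c = - entry (ad_matrix X N u * ad_matrix X N v) a c"
      by (simp add: bracket_unit u a bracket_unit_left v entry_ad_times entry_ad bracket_swap[of a u] sum_negf)
    moreover have "?J a u v c = (\<Sum>b\<in>basis X. ?br u v b * ?br a b c)"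
      by (simp add: bracket_unit u v bracket_unit_left a)
    moreover have "\<dots> = (\<Sum>b\<in>basis X. - (?br u v b * ?br b a c))"
      by (rule sum.cong) (auto simp: bracket_swap[OF a])
    moreover have "(\<Sum>b\<in>basis X. ?br u v b * ?br b a c) =
        entry (\<Sum>b\<in>basis X. smul (?br u v b) (ad_matrix X N b)) a c"
      by (simp add: entry_sum entry_ad a cong: sum.cong)
    ultimately show ?thesis by (simp add: sum_negf)
  next
    case False
    have "entry (ad_matrix X N b * M) a c = 0" if "b \<in> basis X" for b M
      by (subst entry_times[of "{}"]) (use that False in \<open>auto simp: entry_ad\<close>)
    then show ?thesis using u v False by (simp add: entry_sum entry_ad)
  qed
qed

text \<open>The eigenvalue of h_r at the basis vector \<open>a\<close>. The value 0 outside the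
  basis matches the adjoint matrices, which vanish there, so that identities hold between whole
  matrices.\<close>

definition weight :: "root \<Rightarrow> lie_index \<Rightarrow> int" where
  "weight r a = (if a \<in> basis X then cartan_int X r (grade a) else 0)"

definition H :: "root \<Rightarrow> (lie_index, int) rmat" where
  "H r = diag (weight r)"

abbreviation E where "E r \<equiv> ad_matrix X N (Root r)"

abbreviation D where "D \<equiv> divided_power X N"

text \<open>With products reversed this is the relation [e_r, e_-r] = h_r of the sl2-triple of
  \<open>r\<close>.\<close>

lemma E_commute_opposite:
  assumes r: "r \<in> roots X"
  shows "E (- r) * E r - E r * E (- r) = H r"
proof (rule rmat_eqI)
  fix a c
  let ?c = "\<lambda>b. case b of Cartan i \<Rightarrow> coroot X r i | Root _ \<Rightarrow> 0"
  have mr: "- r \<in> roots X" by (rule uminus_root[OF r])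
  have "E (- r) * E r - E r * E (- r) = (\<Sum>b\<in>basis X. smul (?c b) (ad_matrix X N b))"
    using ad_commute[of "Root r" "Root (- r)"] r mr by simp
  also have "\<dots> = (\<Sum>i<rank X. smul (coroot X r i) (ad_matrix X N (Cartan i)))"
  proof -
    have "(\<Sum>b\<in>basis X. smul (?c b) (ad_matrix X N b)) =
        (\<Sum>b\<in>Cartan ` {..<rank X}. smul (?c b) (ad_matrix X N b))"
      by (rule sum.mono_neutral_right) (auto simp: finite_basis basis_def finite_roots)
    also have "\<dots> = (\<Sum>i<rank X. smul (coroot X r i) (ad_matrix X N (Cartan i)))"
      by (subst sum.reindex) (auto simp: inj_on_def)
    finally show ?thesis .
  qed
  also have "entry \<dots> a c = entry (H r) a c"
  proof (cases "a \<in> basis X")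
    case True
    have "entry (\<Sum>i<rank X. smul (coroot X r i) (ad_matrix X N (Cartan i))) a c =
        (\<Sum>i<rank X. coroot X r i * basis_bracket X N (Cartan i) a c)"
      unfolding entry_sum using True by (intro sum.cong) (auto simp: entry_ad)
    also have "\<dots> = entry (H r) a c"
    proof (cases a)
      case (Cartan i)
      then show ?thesis by (auto simp: H_def entry_diag weight_def)
    next
      case (Root s)
      then have "(\<Sum>i<rank X. coroot X r i * basis_bracket X N (Cartan i) a c) =
          (\<Sum>i<rank X. coroot X r i * cartan_int X (simple_root i) s) * unit_vector (Root s) c"
        by (simp add: sum_distrib_right mult.assoc)
      then show ?thesis using Root True by (auto simp: H_def entry_diag sum_coroot[OF r] unit_vector_def weight_def)
    qed
    finally show ?thesis .
  next
    case False
    then show ?thesis unfolding entry_sum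
      by (auto intro!: sum.neutral simp: entry_ad H_def entry_diag weight_def)
  qed
  finally show "entry (E (- r) * E r - E r * E (- r)) a c = entry (H r) a c" .
qed

section \<open>Nilpotency of root vectors and integrality of divided powers\<close>

lemma power_nonzero:
  assumes "r \<in> roots X" "entry (E r ^ n) a c \<noteq> 0"
  shows "grade c = (\<lambda>i. grade a i + int n * r i)" "a \<in> basis X \<Longrightarrow> c \<in> basis X"
    "0 < n \<Longrightarrow> a \<in> basis X"
proof -
  have "grade c = (\<lambda>i. grade a i + int n * r i) \<and> (a \<in> basis X \<longrightarrow> c \<in> basis X) \<and> (0 < n \<longrightarrow> a \<in> basis X)"
    using assms(2)
  proof (induction n arbitrary: a)
    case 0
    then show ?case by (auto simp: entry_one split: if_splits)
  next
    case (Suc n)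
    have "entry (E r * E r ^ n) a c \<noteq> 0" using Suc.prems by simp
    then obtain b where b: "entry (E r) a b \<noteq> 0" "entry (E r ^ n) b c \<noteq> 0" by (rule entry_times_nonzero)
    then show ?case
      using Suc.IH[OF b(2)] ad_nonzero[OF _ b(1)] assms(1) by (auto simp: algebra_simps)
  qed
  then show "grade c = (\<lambda>i. grade a i + int n * r i)" "a \<in> basis X \<Longrightarrow> c \<in> basis X" "0 < n \<Longrightarrow> a \<in> basis X"
    by auto
qed

lemma basis_grade: "a \<in> basis X \<Longrightarrow> grade a = 0 \<or> grade a \<in> roots X"
  by (auto simp: basis_def)

lemma basis_norm: "a \<in> basis X \<Longrightarrow> 0 \<le> inner X (grade a) (grade a) \<and> inner X (grade a) (grade a) \<le> 6"
  using basis_grade[of a] root_norm_bounds[of "grade a" X] by auto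

text \<open>The norms of the grades after 0, 2 and 4 steps satisfy q0 + q4 - 2 q2 = 8 (r, r), which
  is at least 16, whereas grades of basis vectors have norms between 0 and 6.\<close>

lemma power_4:
  assumes r: "r \<in> roots X" shows "E r ^ 4 = 0"
proof (rule rmat_eqI, rule ccontr)
  fix a c assume "entry (E r ^ 4) a c \<noteq> entry 0 a c"
  then have ac: "entry (E r ^ 4) a c \<noteq> 0" by simp
  then have "entry (E r ^ 2 * E r ^ 2) a c \<noteq> 0" by (simp flip: power_add)
  then obtain b where b: "entry (E r ^ 2) a b \<noteq> 0" by (rule entry_times_nonzero)
  have a: "a \<in> basis X" using power_nonzero(3)[OF r ac] by simp
  have "b \<in> basis X" "c \<in> basis X" using power_nonzero(2)[OF r] a b ac by blast+
  note norms = basis_norm[OF a] basis_norm[OF \<open>b \<in> basis X\<close>] basis_norm[OF \<open>c \<in> basis X\<close>]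
  let ?g = "grade a"
  have gb: "grade b = (\<lambda>i. ?g i + 2 * r i)" and gc: "grade c = (\<lambda>i. ?g i + 4 * r i)"
    using power_nonzero(1)[OF r b] power_nonzero(1)[OF r ac] by auto
  have "inner X (grade b) (grade b) = inner X ?g ?g + 4 * inner X ?g r + 4 * inner X r r"
    unfolding gb by (simp add: inner_lin inner_lin_right inner_sym[of X r ?g])
  moreover have "inner X (grade c) (grade c) = inner X ?g ?g + 8 * inner X ?g r + 16 * inner X r r"
    unfolding gc by (simp add: inner_lin inner_lin_right inner_sym[of X r ?g])
  ultimately show False using norms root_norm_bounds(1)[OF r] by linarith
qed

lemma power_ge_4: "r \<in> roots X \<Longrightarrow> 4 \<le> n \<Longrightarrow> E r ^ n = 0"
  using power_4[of r] by (metis le_add_diff_inverse mult_zero_left power_add)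

lemma E_row_root:
  assumes "r \<in> roots X" "s \<in> roots X" "s \<noteq> - r"
  shows "entry (E r) (Root s) c = (if r + s \<in> roots X \<and> c = Root (r + s) then N r s else 0)"
  using assms by (auto simp: entry_ad unit_vector_def)

lemma E_row_Cartan:
  assumes "r \<in> roots X" "i < rank X"
  shows "entry (E r) (Cartan i) c = (if c = Root r then - cartan_int X (simple_root i) r else 0)"
  using assms by (auto simp: entry_ad unit_vector_def)

lemma E_row_opposite:
  assumes "r \<in> roots X"
  shows "entry (E r) (Root (- r)) c = (case c of Cartan i \<Rightarrow> coroot X r i | Root _ \<Rightarrow> 0)"
  using assms uminus_root[OF assms] by (simp add: entry_ad)

lemma not_root_double: "r \<in> roots X \<Longrightarrow> r + r \<notin> roots X"
  using root_multiple[of r X 2] by (auto simp: plus_fun_def)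

lemma root_neq_uminus:
  assumes "r \<in> roots X" shows "r \<noteq> - r"
proof
  assume "r = - r"
  then have "inner X r r = - inner X r r" by (metis inner_uminus)
  then show False using root_norm_bounds(1)[OF assms] by simp
qed

lemma E_row_self:
  assumes r: "r \<in> roots X" shows "entry (E r) (Root r) c = 0"
  using E_row_root[OF r r] root_neq_uminus[OF r] not_root_double[OF r] by simp

text \<open>The lower part of the string through \<open>r + s\<close> is that through
  \<open>s\<close> with one step added in front.\<close>

lemma string_Max:
  assumes r: "r \<in> roots X" and s: "s \<in> roots X" and rs: "r + s \<in> roots X"
  shows "Max {p. (\<lambda>i. (r + s) i - int p * r i) \<in> roots X} = Suc (Max {p. (\<lambda>i. s i - int p * r i) \<in> roots X})"
proof -
  let ?A = "{p. (\<lambda>i. s i - int p * r i) \<in> roots X}"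
  let ?B = "{p. (\<lambda>i. (r + s) i - int p * r i) \<in> roots X}"
  have "r \<noteq> 0" using r by auto
  then obtain j where j: "r j \<noteq> 0" by (auto simp: fun_eq_iff)
  have fin: "finite ?A"
  proof (rule finite_imageD)
    show "finite ((\<lambda>p i. s i - int p * r i) ` ?A)" by (rule finite_subset[OF _ finite_roots]) auto
    show "inj_on (\<lambda>p i. s i - int p * r i) ?A"
      using j by (auto simp: inj_on_def dest!: fun_cong[of _ _ j])
  qed
  have A0: "0 \<in> ?A" using s by simp
  have B: "?B = insert 0 (Suc ` ?A)"
  proof (intro equalityI subsetI)
    fix p assume p: "p \<in> ?B"
    then show "p \<in> insert 0 (Suc ` ?A)" by (cases p) (auto simp: algebra_simps)
  next
    fix p assume "p \<in> insert 0 (Suc ` ?A)"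
    moreover have "(\<lambda>i. r i + s i) \<in> roots X" using rs by (simp add: plus_fun_def)
    ultimately show "p \<in> ?B" by (auto simp: algebra_simps)
  qed
  have "Max ?B = Max (Suc ` ?A)"
    unfolding B by (subst Max_insert) (use fin A0 in \<open>blast | simp\<close>)+
  also have "\<dots> = Suc (Max ?A)"
    by (rule mono_Max_commute[symmetric]) (use fin A0 in \<open>blast | simp add: mono_def\<close>)+
  finally show ?thesis .
qed

text \<open>Every step along the string multiplies by a structure constant of absolute value p + 1,
  and p grows by one with each step; up to sign the product is a rising factorial.\<close>

lemma string_dvd:
  assumes r: "r \<in> roots X" and s: "s \<in> roots X" "s \<noteq> - r"
  shows "(\<Prod>j<n. int (Max {p. (\<lambda>i. s i - int p * r i) \<in> roots X}) + 1 + int j) dvd entry (E r ^ n) (Root s) c"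
  using s
proof (induction n arbitrary: s)
  case 0
  then show ?case by simp
next
  case (Suc n)
  let ?M = "\<lambda>s. Max {p. (\<lambda>i. s i - int p * r i) \<in> roots X}"
  show ?case
  proof (cases "r + s \<in> roots X")
    case False
    then have "entry (E r) (Root s) b = 0" for b using E_row_root[OF r Suc.prems] by simp
    then have "entry (E r * E r ^ n) (Root s) c = 0" by (subst entry_times[of "{}"]) auto
    then show ?thesis by simp
  next
    case True
    have "r + s \<noteq> - r"
    proof
      assume eq: "r + s = - r"
      have "s i = - 2 * r i" for i using fun_cong[OF eq, of i] by simp
      then have "s = (\<lambda>i. - 2 * r i)" by auto
      then show False using root_multiple[OF r, of "- 2"] Suc.prems(1) by simp
    qed
    then have IH: "(\<Prod>j<n. int (?M (r + s)) + 1 + int j) dvd entry (E r ^ n) (Root (r + s)) c"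
      by (rule Suc.IH[OF True])
    have row: "entry (E r ^ Suc n) (Root s) c = N r s * entry (E r ^ n) (Root (r + s)) c"
      using entry_times_single[of "Root (r + s)" "E r" "Root s" "E r ^ n" c] E_row_root[OF r Suc.prems] True
      by auto
    have *: "(int (?M s) + 1) dvd N r s" using N_abs[OF r Suc.prems(1) True] by (metis dvd_abs_iff dvd_refl)
    have "(\<Prod>j<Suc n. int (?M s) + 1 + int j) = (int (?M s) + 1) * (\<Prod>j<n. int (?M (r + s)) + 1 + int j)"
      unfolding string_Max[OF r Suc.prems(1) True] prod.lessThan_Suc_shift by (simp add: add_ac)
    then show ?thesis unfolding row using mult_dvd_mono[OF * IH] by (simp only:)
  qed
qed

lemma power_row_zero:
  assumes "\<And>b. entry A a b = 0" shows "entry (A * B) a c = 0"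
  by (subst entry_times[of "{}"]) (use assms in auto)

lemma power_Cartan:
  assumes r: "r \<in> roots X" and i: "i < rank X" and n: "2 \<le> n"
  shows "entry (E r ^ n) (Cartan i) c = 0"
proof -
  have "entry (E r * E r) (Cartan i) d = 0" for d
    using entry_times_single[of "Root r" "E r" "Cartan i" "E r" d] E_row_Cartan[OF r i] E_row_self[OF r] by auto
  moreover have "E r ^ n = E r * E r * E r ^ (n - 2)"
    using n by (metis le_add_diff_inverse power2_eq_square power_add)
  ultimately show ?thesis by (simp add: power_row_zero)
qed

text \<open>The string through \<open>- r\<close> crosses the Cartan part, where the structure
  constants do not apply: it leads from e_-r over the coroot to a multiple of e_r.\<close>

lemma power_opposite:
  assumes r: "r \<in> roots X"
  shows "entry (E r ^ 2) (Root (- r)) c = (if c = Root r then - 2 else 0)"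
    and "3 \<le> n \<Longrightarrow> entry (E r ^ n) (Root (- r)) c = 0"
proof -
  have sq: "entry (E r ^ 2) (Root (- r)) c = (if c = Root r then - 2 else 0)" for c
  proof -
    have "entry (E r * E r) (Root (- r)) c = (\<Sum>b\<in>Cartan ` {..<rank X}. entry (E r) (Root (- r)) b * entry (E r) b c)"
    proof (rule entry_times)
      fix b assume b: "entry (E r) (Root (- r)) b \<noteq> 0"
      have "b \<in> basis X" using ad_nonzero(2)[OF _ b] r by simp
      then show "b \<in> Cartan ` {..<rank X}" using b E_row_opposite[OF r, of b] by (auto split: lie_index.splits)
    qed simp
    also have "\<dots> = (\<Sum>i<rank X. coroot X r i * entry (E r) (Cartan i) c)"
      by (subst sum.reindex) (auto simp: inj_on_def E_row_opposite[OF r])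
    also have "\<dots> = (if c = Root r then - (\<Sum>i<rank X. coroot X r i * cartan_int X (simple_root i) r) else 0)"
    proof -
      have "(\<Sum>i<rank X. coroot X r i * entry (E r) (Cartan i) c) =
          (\<Sum>i<rank X. if c = Root r then - (coroot X r i * cartan_int X (simple_root i) r) else 0)"
        by (rule sum.cong) (use E_row_Cartan[OF r] in auto)
      then show ?thesis by (simp add: sum_negf)
    qed
    finally show ?thesis by (simp add: sum_coroot[OF r] cartan_int_self[OF r] power2_eq_square)
  qed
  then show "entry (E r ^ 2) (Root (- r)) c = (if c = Root r then - 2 else 0)" .
  assume n: "3 \<le> n"
  have "entry (E r ^ 2 * E r) (Root (- r)) d = 0" for d
    using entry_times_single[of "Root r" "E r ^ 2" "Root (- r)" "E r" d] sq E_row_self[OF r] by auto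
  moreover have "E r ^ n = E r ^ 2 * E r * E r ^ (n - 3)"
  proof -
    have "E r ^ 2 * E r * E r ^ (n - 3) = E r ^ (Suc 2 + (n - 3))" unfolding power_add power_Suc2 ..
    then show ?thesis using n by simp
  qed
  ultimately show "entry (E r ^ n) (Root (- r)) c = 0" by (simp add: power_row_zero)
qed

text \<open>Rows at Cartan indices and at \<open>- r\<close> are known explicitly; along every other
  string a rising factorial of length \<open>n\<close> divides the entry.\<close>

lemma fact_dvd_power:
  assumes r: "r \<in> roots X" shows "fact n dvd entry (E r ^ n) a c"
proof (cases "n \<le> 1")
  case True
  then show ?thesis by (cases n) auto
next
  case n: False
  show ?thesis
  proof (cases "a \<in> basis X")
    case False
    then have "entry (E r ^ n) a c = 0" using power_nonzero(3)[OF r, of n a c] n by auto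
    then show ?thesis by simp
  next
    case True
    show ?thesis
    proof (cases a)
      case (Cartan i)
      then show ?thesis using power_Cartan[OF r] True n by simp
    next
      case (Root s)
      then have s: "s \<in> roots X" using True by simp
      show ?thesis
      proof (cases "s = - r")
        case True
        then show ?thesis using Root power_opposite[OF r] n by (cases "n = 2") (auto simp: fact_2)
      next
        case False
        then show ?thesis using string_dvd[OF r s False] fact_dvd_rising dvd_trans Root by blast
      qed
    qed
  qed
qed

lemma fact_divided_power:
  assumes r: "r \<in> roots X" shows "smul (fact n) (D r n) = E r ^ n"
  by (rule rmat_eqI) (use fact_dvd_power[OF r] in \<open>simp add: entry_divided_power\<close>)

lemma divided_power_ge_4: "r \<in> roots X \<Longrightarrow> 4 \<le> n \<Longrightarrow> D r n = 0"
  by (rule rmat_eqI) (simp add: entry_divided_power power_ge_4)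

lemma divided_power_0 [simp]: "D r 0 = 1" and divided_power_1 [simp]: "D r (Suc 0) = E r"
  by (rule rmat_eqI, simp add: entry_divided_power)+

text \<open>Integral matrices have no torsion. Identities between divided powers follow from those
  between powers by cancelling factorials.\<close>

lemma smul_cancel: "(k::int) \<noteq> 0 \<Longrightarrow> smul k A = smul k B \<Longrightarrow> A = B"
proof (rule rmat_eqI)
  fix a c assume "k \<noteq> 0" "smul k A = smul k B"
  then have "k * entry A a c = k * entry B a c" by (metis entry_smul)
  then show "entry A a c = entry B a c" using \<open>k \<noteq> 0\<close> by simp
qed

lemma divided_power_times:
  assumes r: "r \<in> roots X"
  shows "D r m * D r n = smul (of_nat (m + n choose m)) (D r (m + n))"
proof (rule smul_cancel)
  let ?k = "fact m * fact n :: int"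
  show "?k \<noteq> 0" by simp
  have "smul ?k (D r m * D r n) = smul (fact m) (D r m) * smul (fact n) (D r n)"
    by (simp add: smul_times_left smul_times_right mult.commute)
  also have "\<dots> = E r ^ (m + n)" by (simp add: fact_divided_power[OF r] power_add)
  also have "\<dots> = smul (fact (m + n)) (D r (m + n))" by (simp add: fact_divided_power[OF r])
  also have "(fact (m + n) :: int) = ?k * of_nat (m + n choose m)"
    using binomial_fact_lemma[of m "m + n"]
    by (metis add_diff_cancel_left' le_add1 of_nat_fact of_nat_mult)
  finally show "smul ?k (D r m * D r n) = smul ?k (smul (of_nat (m + n choose m)) (D r (m + n)))" by simp
qed

lemma divided_power_nonzero:
  assumes "r \<in> roots X" "entry (D r n) a c \<noteq> 0"
  shows "grade c = (\<lambda>i. grade a i + int n * r i)" "a \<in> basis X \<Longrightarrow> c \<in> basis X"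
    "0 < n \<Longrightarrow> a \<in> basis X"
proof -
  have "entry (E r ^ n) a c \<noteq> 0" using assms(2) by (auto simp: entry_divided_power)
  then show "grade c = (\<lambda>i. grade a i + int n * r i)" "a \<in> basis X \<Longrightarrow> c \<in> basis X" "0 < n \<Longrightarrow> a \<in> basis X"
    using power_nonzero[OF assms(1)] by blast+
qed

end

text \<open>The hypotheses are the relations [e, f] = h and [h, e] = 2 e of sl2 for the reversed
  product.\<close>

lemma sl2_power:
  fixes e f h :: "'a::ring_1"
  assumes fe: "f * e = e * f + h" and he: "h * e = e * h - 2 * e"
  shows "f * e ^ Suc n = e ^ Suc n * f + of_nat (Suc n) * (e ^ n * h) - of_nat (Suc n * n) * e ^ n"
proof (induction n)
  case 0
  then show ?case using fe by simp
next
  case (Suc n)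
  have "f * e ^ Suc (Suc n) = (f * e ^ Suc n) * e" by (simp only: power_Suc2[of e "Suc n"] mult.assoc)
  also have "\<dots> = e ^ Suc n * (f * e) + of_nat (Suc n) * (e ^ n * (h * e)) - of_nat (Suc n * n) * e ^ Suc n"
    unfolding Suc.IH by (simp only: distrib_right left_diff_distrib mult.assoc power_Suc2)
  also have "\<dots> = e ^ Suc (Suc n) * f + of_nat (Suc (Suc n)) * (e ^ Suc n * h) -
      of_nat (Suc (Suc n) * Suc n) * e ^ Suc n"
  proof -
    have 1: "e ^ n * (h * e) = e ^ Suc n * h - 2 * e ^ Suc n"
      unfolding he power_Suc2 by (simp add: right_diff_distrib mult.assoc mult_2 distrib_left)
    have 2: "e ^ Suc n * (f * e) = e ^ Suc (Suc n) * f + e ^ Suc n * h"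
      unfolding fe by (simp only: power_Suc2[of e "Suc n"] distrib_left mult.assoc)
    show ?thesis unfolding 1 2 by (simp add: algebra_simps mult_2)
  qed
  finally show ?case .
qed

context chevalley
begin

lemma weight_shift:
  assumes r: "r \<in> roots X" and nz: "entry (D r n) a c \<noteq> 0"
  shows "weight r c = weight r a + 2 * int n"
proof (cases "n = 0")
  case True
  then show ?thesis using nz by (auto simp: entry_one split: if_splits)
next
  case False
  then have ac: "a \<in> basis X" "c \<in> basis X" using divided_power_nonzero(2,3)[OF r nz] by auto
  have "grade c = grade a + (\<lambda>i. int n * r i)"
    using divided_power_nonzero(1)[OF r nz] by auto
  then show ?thesis
    using ac cartan_int_scale[OF r, of "int n" r]
    by (simp add: weight_def cartan_int_add[OF r] cartan_int_self[OF r])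
qed

lemma weight_uminus: "r \<in> roots X \<Longrightarrow> weight (- r) a = - weight r a"
proof -
  assume r: "r \<in> roots X"
  have "inner X r r * cartan_int X (- r) s = inner X r r * (- cartan_int X r s)" for s
    using cartan_int_eq[OF uminus_root[OF r], of s] cartan_int_eq[OF r, of s]
    by (simp add: inner_uminus inner_uminus_right)
  then have "cartan_int X (- r) s = - cartan_int X r s" for s
    by (rule cancel_norm[OF root_norm_bounds(1)[OF r]])
  then show ?thesis by (simp add: weight_def)
qed

lemma H_uminus: "r \<in> roots X \<Longrightarrow> H (- r) = - H r"
  by (rule rmat_eqI) (simp add: H_def entry_diag weight_uminus)

lemma divided_power_H:
  assumes r: "r \<in> roots X"
  shows "D r n * H r = H r * D r n + smul (2 * int n) (D r n)"
proof (rule rmat_eqI)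
  fix a c
  show "entry (D r n * H r) a c = entry (H r * D r n + smul (2 * int n) (D r n)) a c"
    using weight_shift[OF r, of n a c]
    by (cases "entry (D r n) a c = 0") (simp_all add: H_def entry_times_diag entry_diag_times algebra_simps)
qed

text \<open>This is \<open>sl2_power\<close> divided by the factorial of n + 1.\<close>

lemma opposite_divided_power:
  assumes r: "r \<in> roots X"
  shows "E (- r) * D r (Suc n) = D r (Suc n) * E (- r) + D r n * H r - smul (int n) (D r n)"
proof (rule smul_cancel)
  let ?e = "E r" and ?f = "E (- r)" and ?h = "H r"
  have fe: "?f * ?e = ?e * ?f + ?h" using E_commute_opposite[OF r] by (simp add: algebra_simps)
  have eh: "?h * ?e = ?e * ?h - 2 * ?e"
    using divided_power_H[OF r, of 1] smul_add_scalar[of 1 1 ?e] by (simp add: algebra_simps mult_2)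
  note pow = sl2_power[OF fe eh]
  have sm: "of_nat k * A = smul (int k) A" for k and A :: "(lie_index, int) rmat"
    by (induction k) (simp_all add: distrib_right smul_add_scalar)
  let ?k = "fact (Suc n) :: int"
  show "?k \<noteq> 0" by simp
  have k: "?k = int (Suc n) * fact n" by simp
  have "smul ?k (?f * D r (Suc n)) = ?f * ?e ^ Suc n"
    by (metis smul_times_right fact_divided_power[OF r])
  also have "\<dots> = smul ?k (D r (Suc n)) * ?f + smul (int (Suc n)) (smul (fact n) (D r n) * ?h) -
      smul (int (Suc n * n)) (smul (fact n) (D r n))"
    unfolding pow sm fact_divided_power[OF r] ..
  also have "\<dots> = smul ?k (D r (Suc n) * ?f + D r n * ?h - smul (int n) (D r n))"
    unfolding k by (simp add: smul_add smul_minus smul_times_left algebra_simps)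
  finally show "smul ?k (?f * D r (Suc n)) = smul ?k (D r (Suc n) * ?f + D r n * ?h - smul (int n) (D r n))" .
qed

lemma E_times_divided_power:
  assumes r: "r \<in> roots X"
  shows "E r * D r n = smul (int (Suc n)) (D r (Suc n))" "D r n * E r = smul (int (Suc n)) (D r (Suc n))"
  using divided_power_times[OF r, of 1 n] divided_power_times[OF r, of n 1] by simp_all

section \<open>Matrices of root elements, Weyl elements and torus elements\<close>

definition root_matrix :: "root \<Rightarrow> 'k::comm_ring_1 \<Rightarrow> (lie_index, 'k) rmat" where
  "root_matrix r \<zeta> = (\<Sum>n<4. smul (\<zeta> ^ n) (rmap (D r n)))"

lemma root_matrix_expand:
  "root_matrix r \<zeta> = 1 + smul \<zeta> (rmap (E r)) + smul (\<zeta> ^ 2) (rmap (D r 2)) + smul (\<zeta> ^ 3) (rmap (D r 3))"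
  by (simp add: root_matrix_def eval_nat_numeral add.assoc)

lemma rmap_id: "rmap A = (A :: ('a, int) rmat)"
  by (rule rmat_eqI) simp

lemma rmap_root_matrix: "rmap (root_matrix r z) = root_matrix r (of_int z)"
  by (simp add: root_matrix_def rmap_sum rmap_smul rmap_id)

lemma entry_root_matrix_nonzero:
  assumes "entry (root_matrix r \<zeta>) a c \<noteq> 0"
  obtains n where "n < 4" "entry (D r n) a c \<noteq> 0"
proof -
  have "(\<Sum>n<4. \<zeta> ^ n * of_int (entry (D r n) a c)) \<noteq> 0"
    using assms by (simp add: root_matrix_def entry_sum)
  then obtain n where "n \<in> {..<4}" "\<zeta> ^ n * of_int (entry (D r n) a c) \<noteq> 0"
    by (rule sum.not_neutral_contains_not_neutral)
  then show thesis using that[of n] by (metis lessThan_iff mult_zero_right of_int_0)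
qed

lemma root_matrix_0 [simp]: "root_matrix r 0 = 1"
  by (simp add: root_matrix_expand)

text \<open>The exponential law. All products of total degree 4 or more vanish, so truncating the
  series loses nothing.\<close>

lemma root_matrix_add:
  assumes r: "r \<in> roots X"
  shows "root_matrix r \<zeta> * root_matrix r \<eta> = root_matrix r (\<zeta> + \<eta>)"
proof -
  let ?d = "\<lambda>n. rmap (D r n)"
  have dd: "?d m * ?d n = smul (of_nat (m + n choose m)) (?d (m + n))" for m n
    using divided_power_times[OF r, of m n] by (metis of_int_of_nat_eq rmap_smul rmap_times)
  have d4: "?d n = 0" if "4 \<le> n" for n using divided_power_ge_4[OF r that] by simp
  have dd4: "?d m * ?d n = 0" if "4 \<le> m + n" for m n by (simp add: dd d4[OF that])
  have p: "rmap (E r) * rmap (E r) = smul 2 (?d 2)" "rmap (E r) * ?d 2 = smul 3 (?d 3)"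
    "?d 2 * rmap (E r) = smul 3 (?d 3)" "rmap (E r) * ?d 3 = 0" "?d 3 * rmap (E r) = 0"
    using dd[of 1 1] dd[of 1 2] dd[of 2 1] dd4[of 1 3] dd4[of 3 1] by (simp_all add: eval_nat_numeral)
  show ?thesis
    unfolding root_matrix_expand
    by (rule rmat_eqI)
      (simp add: distrib_left distrib_right smul_times_left smul_times_right p dd4,
       simp add: algebra_simps power2_eq_square power3_eq_cube)
qed

lemma E_root_matrix:
  assumes r: "r \<in> roots X"
  shows "E r * root_matrix r z = root_matrix r z * E r"
  unfolding root_matrix_expand rmap_id
  using E_times_divided_power[OF r, of 2] E_times_divided_power[OF r, of 3]
  by (simp add: distrib_left distrib_right smul_times_left smul_times_right)

text \<open>Here and in \<open>opposite_root_matrix\<close> the exponential of z e_r acts on the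
  other members of the sl2-triple. With the matrix standing on both sides these are polynomial
  identities in \<open>z\<close> over the integers.\<close>

lemma H_root_matrix:
  fixes z :: int assumes r: "r \<in> roots X"
  shows "H r * root_matrix r z = root_matrix r z * (H r - smul (2 * z) (E r))"
proof -
  have D: "H r * D r n = D r n * H r - smul (2 * int n) (D r n)" for n
    using divided_power_H[OF r, of n] by simp
  have e: "E r * E r = smul 2 (D r 2)" "D r 2 * E r = smul 3 (D r 3)" "D r 3 * E r = 0"
    using E_times_divided_power(2)[OF r, of 1] E_times_divided_power(2)[OF r, of 2]
      E_times_divided_power(2)[OF r, of 3] divided_power_ge_4[OF r, of 4] by (simp_all add: eval_nat_numeral)
  show ?thesis
    unfolding root_matrix_expand rmap_id
    by (rule rmat_eqI)
      (simp add: distrib_left distrib_right right_diff_distrib smul_times_left smul_times_right D D[of 1, simplified] e,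
       simp add: algebra_simps power2_eq_square power3_eq_cube)
qed

lemma opposite_root_matrix:
  fixes z :: int assumes r: "r \<in> roots X"
  shows "E (- r) * root_matrix r z = root_matrix r z * (E (- r) + smul z (H r) - smul (z ^ 2) (E r))"
proof -
  have f: "E (- r) * E r = E r * E (- r) + H r"
    "E (- r) * D r 2 = D r 2 * E (- r) + E r * H r - E r"
    "E (- r) * D r 3 = D r 3 * E (- r) + D r 2 * H r - smul 2 (D r 2)"
    "D r 3 * H r = smul 3 (D r 3)"
    using opposite_divided_power[OF r, of 0] opposite_divided_power[OF r, of 1]
      opposite_divided_power[OF r, of 2] opposite_divided_power[OF r, of 3] divided_power_ge_4[OF r, of 4]
    by (simp_all add: eval_nat_numeral)
  have e: "E r * E r = smul 2 (D r 2)" "D r 2 * E r = smul 3 (D r 3)" "D r 3 * E r = 0"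
    using E_times_divided_power(2)[OF r, of 1] E_times_divided_power(2)[OF r, of 2]
      E_times_divided_power(2)[OF r, of 3] divided_power_ge_4[OF r, of 4] by (simp_all add: eval_nat_numeral)
  show ?thesis
    unfolding root_matrix_expand rmap_id
    by (rule rmat_eqI)
      (simp add: distrib_left distrib_right right_diff_distrib smul_times_left smul_times_right f e,
       simp add: algebra_simps power2_eq_square power3_eq_cube)
qed

definition weyl_matrix :: "root \<Rightarrow> 'k::field \<Rightarrow> (lie_index, 'k) rmat" where
  "weyl_matrix r \<zeta> = root_matrix r \<zeta> * root_matrix (- r) (- inverse \<zeta>) * root_matrix r \<zeta>"

text \<open>The parameter 1 is its own inverse, so this case exists over the integers;
  \<open>scaling_weyl_matrix\<close> recovers the other parameters.\<close>

definition weyl_int :: "root \<Rightarrow> (lie_index, int) rmat" where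
  "weyl_int r = root_matrix r 1 * root_matrix (- r) (- 1) * root_matrix r 1"

lemma weyl_matrix_1: "weyl_matrix r 1 = rmap (weyl_int r)"
  by (simp add: weyl_matrix_def weyl_int_def rmap_times rmap_root_matrix)

text \<open>The Weyl element negates h_r. Over the integers a nonzero entry must therefore connect
  opposite weights, a conclusion that would be lost modulo a small prime.\<close>

lemma H_weyl:
  assumes r: "r \<in> roots X"
  shows "H r * weyl_int r = - (weyl_int r * H r)"
proof -
  have mr: "- r \<in> roots X" by (rule uminus_root[OF r])
  define x where "x = root_matrix r (1::int)"
  define y where "y = root_matrix (- r) (- 1::int)"
  let ?e = "E r" and ?f = "E (- r)" and ?h = "H r"
  have two: "smul 2 A = A + A" for A :: "(lie_index, int) rmat"
    using smul_add_scalar[of 1 1 A] by simp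
  have hx: "?h * x = x * ?h - x * ?e - x * ?e"
    using H_root_matrix[OF r, of 1] by (simp add: x_def two algebra_simps)
  have ex: "?e * x = x * ?e" using E_root_matrix[OF r] by (simp add: x_def)
  have hy: "?h * y = y * ?h - y * ?f - y * ?f"
    using H_root_matrix[OF mr, of "- 1"] by (simp add: y_def H_uminus[OF r] two smul_uminus_scalar algebra_simps)
  have ey: "?e * y = y * ?e + y * ?h - y * ?f"
    using opposite_root_matrix[OF mr, of "- 1"] by (simp add: y_def H_uminus[OF r] smul_uminus_scalar algebra_simps)
  have "?h * (x * y * x) = (?h * x) * y * x" by (simp only: mult.assoc)
  also have "\<dots> = x * (?h * y) * x - x * (?e * y) * x - x * (?e * y) * x"
    unfolding hx by (simp only: left_diff_distrib mult.assoc)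
  also have "\<dots> = - (x * y * (?h * x)) - x * y * (?e * x) - x * y * (?e * x)"
    unfolding hy ey by (simp add: algebra_simps)
  also have "\<dots> = - (x * y * x * ?h)"
    unfolding hx ex by (simp add: algebra_simps)
  finally show ?thesis by (simp add: weyl_int_def x_def y_def)
qed

lemma weyl_int_nonzero:
  assumes r: "r \<in> roots X" and nz: "entry (weyl_int r) a c \<noteq> 0"
  shows "weight r a = - weight r c" "\<exists>k. grade c = (\<lambda>i. grade a i + k * r i)" "a \<in> basis X \<Longrightarrow> c \<in> basis X"
proof -
  have "entry (H r * weyl_int r) a c = entry (- (weyl_int r * H r)) a c" by (simp only: H_weyl[OF r])
  then have "weight r a * entry (weyl_int r) a c = - (entry (weyl_int r) a c * weight r c)"
    by (simp add: H_def entry_diag_times entry_times_diag)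
  then have "(weight r a + weight r c) * entry (weyl_int r) a c = 0" by (simp add: algebra_simps)
  then show "weight r a = - weight r c" using nz by simp
  have step: "(\<exists>k. grade d = (\<lambda>i. grade b i + k * r i)) \<and> (b \<in> basis X \<longrightarrow> d \<in> basis X)"
    if nz': "entry (root_matrix s z) b d \<noteq> 0" "s = r \<or> s = - r" for s b d and z :: int
  proof -
    have s: "s \<in> roots X" using nz'(2) r uminus_root by auto
    obtain n where n: "entry (D s n) b d \<noteq> 0" by (rule entry_root_matrix_nonzero[OF nz'(1)])
    note nz = divided_power_nonzero(1,2)[OF s n]
    show ?thesis
    proof (intro conjI impI)
      show "\<exists>k. grade d = (\<lambda>i. grade b i + k * r i)"
        using nz(1) nz'(2) by (auto intro: exI[of _ "int n"] exI[of _ "- int n"])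
    qed (rule nz(2))
  qed
  obtain b where b: "entry (root_matrix r (1::int) * root_matrix (- r) (- 1)) a b \<noteq> 0"
      "entry (root_matrix r (1::int)) b c \<noteq> 0"
    using nz unfolding weyl_int_def by (rule entry_times_nonzero)
  obtain d where d: "entry (root_matrix r (1::int)) a d \<noteq> 0" "entry (root_matrix (- r) (- 1::int)) d b \<noteq> 0"
    using b(1) by (rule entry_times_nonzero)
  obtain k1 k2 k3 where "grade d = (\<lambda>i. grade a i + k1 * r i)" "grade b = (\<lambda>i. grade d i + k2 * r i)"
      "grade c = (\<lambda>i. grade b i + k3 * r i)"
    using step[OF d(1)] step[OF d(2)] step[OF b(2)] by blast
  then show "\<exists>k. grade c = (\<lambda>i. grade a i + k * r i)"
    by (intro exI[of _ "k1 + k2 + k3"]) (simp add: algebra_simps)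
  show "a \<in> basis X \<Longrightarrow> c \<in> basis X" using step[OF d(1)] step[OF d(2)] step[OF b(2)] by blast
qed

text \<open>A nonzero entry shifts the grade by a multiple of \<open>r\<close> and negates its
  Cartan integer with \<open>r\<close>, which determines the shift as the reflection in
  \<open>r\<close>. Reflections preserve norms, so a root does not end in the Cartan part.\<close>

lemma weyl_int_monomial:
  assumes r: "r \<in> roots X"
  shows "s \<in> roots X \<Longrightarrow> entry (weyl_int r) (Root s) c \<noteq> 0 \<Longrightarrow> c = Root (\<lambda>i. s i - cartan_int X r s * r i)"
    and "i < rank X \<Longrightarrow> entry (weyl_int r) (Cartan i) c \<noteq> 0 \<Longrightarrow> \<exists>j. c = Cartan j"
proof -
  have *: "grade c = (\<lambda>i. grade a i - cartan_int X r (grade a) * r i)"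
    if a: "a \<in> basis X" and nz: "entry (weyl_int r) a c \<noteq> 0" for a c
  proof -
    have c: "c \<in> basis X" using weyl_int_nonzero(3)[OF r nz a] .
    obtain k where k: "grade c = (\<lambda>i. grade a i + k * r i)" using weyl_int_nonzero(2)[OF r nz] by blast
    then have "grade c = grade a + (\<lambda>i. k * r i)" by auto
    then have "cartan_int X r (grade c) = cartan_int X r (grade a) + 2 * k"
      by (simp add: cartan_int_add[OF r] cartan_int_scale[OF r] cartan_int_self[OF r])
    moreover have "cartan_int X r (grade a) = - cartan_int X r (grade c)"
      using weyl_int_nonzero(1)[OF r nz] a c by (simp add: weight_def)
    ultimately have "k = - cartan_int X r (grade a)" by linarith
    then show ?thesis using k by simp
  qed
  show "c = Root (\<lambda>i. s i - cartan_int X r s * r i)" if s: "s \<in> roots X" and nz: "entry (weyl_int r) (Root s) c \<noteq> 0"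
  proof -
    let ?t = "\<lambda>i. s i - cartan_int X r s * r i"
    have g: "grade c = ?t" using *[of "Root s" c] s nz by simp
    let ?c = "cartan_int X r s"
    have t1: "inner X ?t v = inner X s v - ?c * inner X r v" for v
      using inner_lin[of X s "- ?c" r v] by simp
    have "inner X ?t ?t = inner X s ?t - ?c * inner X r ?t" by (rule t1)
    also have "inner X s ?t = inner X s s - ?c * inner X r s" using t1[of s] inner_sym[of X s ?t] by simp
    also have "inner X r ?t = inner X r s - ?c * inner X r r"
      using t1[of r] inner_sym[of X r ?t] inner_sym[of X r s] by simp
    finally have "inner X ?t ?t = inner X s s - 2 * ?c * inner X r s + ?c * (inner X r r * ?c)"
      by (simp add: algebra_simps)
    also have "\<dots> = inner X s s" unfolding cartan_int_eq[OF r] by simp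
    finally have "inner X ?t ?t \<noteq> 0" using root_norm_bounds(1)[OF s] by simp
    then have "?t \<noteq> 0" by auto
    then show ?thesis using g by (cases c) auto
  qed
  show "\<exists>j. c = Cartan j" if i: "i < rank X" and nz: "entry (weyl_int r) (Cartan i) c \<noteq> 0"
  proof -
    have c: "c \<in> basis X" using weyl_int_nonzero(3)[OF r nz] i by simp
    have "grade c = 0" using *[of "Cartan i" c] i nz by auto
    then show ?thesis using c by (cases c) auto
  qed
qed

text \<open>A diagonal matrix conjugating \<open>x\<^sub>r(1)\<close> to \<open>x\<^sub>r(\<zeta>)\<close> and \<open>x\<^bsub>-r\<^esub>(-1)\<close> to
  \<open>x\<^bsub>-r\<^esub>(-\<zeta>\<^sup>-\<^sup>1)\<close>.\<close>

definition scaling :: "root \<Rightarrow> 'k::field \<Rightarrow> (lie_index, 'k) rmat" where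
  "scaling r \<zeta> = diag (\<lambda>a. \<zeta> powi (weight r a div 2))"

lemma scaling_inverse:
  "\<zeta> \<noteq> 0 \<Longrightarrow> scaling r \<zeta> * scaling r (inverse \<zeta>) = 1" "\<zeta> \<noteq> 0 \<Longrightarrow> scaling r (inverse \<zeta>) * scaling r \<zeta> = 1"
  by (simp_all add: scaling_def diag_times power_int_inverse diag_one power_int_not_zero)

lemma scaling_root_matrix:
  fixes \<zeta> :: "'k::field"
  assumes r: "r \<in> roots X" and z: "\<zeta> \<noteq> 0"
  shows "root_matrix r (\<zeta> * \<eta>) = scaling r (inverse \<zeta>) * root_matrix r \<eta> * scaling r \<zeta>"
    and "root_matrix (- r) (inverse \<zeta> * \<eta>) = scaling r (inverse \<zeta>) * root_matrix (- r) \<eta> * scaling r \<zeta>"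
proof -
  have mr: "- r \<in> roots X" by (rule uminus_root[OF r])
  \<comment> \<open>Halving rounds odd weights down, but a nonzero entry connects weights of equal
    parity, so the differences of \<open>?k\<close> are exact.\<close>
  let ?k = "\<lambda>a. weight r a div 2"
  have *: "inverse \<zeta> powi ?k a * x * \<zeta> powi ?k c = \<zeta> powi (?k c - ?k a) * x" for a c x
    using z by (simp add: power_int_diff power_int_inverse field_simps)
  show "root_matrix r (\<zeta> * \<eta>) = scaling r (inverse \<zeta>) * root_matrix r \<eta> * scaling r \<zeta>"
  proof (rule rmat_eqI)
    fix a c
    have "\<zeta> ^ n * \<eta> ^ n * of_int (entry (D r n) a c) = \<zeta> powi (?k c - ?k a) * (\<eta> ^ n * of_int (entry (D r n) a c))" for n
    proof (cases "entry (D r n) a c = 0")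
      case False
      then have "weight r c = weight r a + 2 * int n" by (rule weight_shift[OF r])
      then have "?k c - ?k a = int n" by simp
      then show ?thesis by simp
    qed simp
    then show "entry (root_matrix r (\<zeta> * \<eta>)) a c = entry (scaling r (inverse \<zeta>) * root_matrix r \<eta> * scaling r \<zeta>) a c"
      unfolding scaling_def entry_times_diag entry_diag_times *
      by (simp only: root_matrix_def entry_sum entry_smul entry_rmap power_mult_distrib sum_distrib_left)
  qed
  show "root_matrix (- r) (inverse \<zeta> * \<eta>) = scaling r (inverse \<zeta>) * root_matrix (- r) \<eta> * scaling r \<zeta>"
  proof (rule rmat_eqI)
    fix a c
    have "inverse \<zeta> ^ n * \<eta> ^ n * of_int (entry (D (- r) n) a c) =
        \<zeta> powi (?k c - ?k a) * (\<eta> ^ n * of_int (entry (D (- r) n) a c))" for n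
    proof (cases "entry (D (- r) n) a c = 0")
      case False
      then have "weight r c = weight r a - 2 * int n"
        using weight_shift[OF mr, of n a c] weight_uminus[OF r, of a] weight_uminus[OF r, of c] by simp
      then have "?k a = ?k c + int n" by simp
      then have "?k c - ?k a = - int n" by simp
      then show ?thesis by (simp add: power_int_minus power_inverse)
    qed simp
    then show "entry (root_matrix (- r) (inverse \<zeta> * \<eta>)) a c =
        entry (scaling r (inverse \<zeta>) * root_matrix (- r) \<eta> * scaling r \<zeta>) a c"
      unfolding scaling_def entry_times_diag entry_diag_times *
      by (simp only: root_matrix_def entry_sum entry_smul entry_rmap power_mult_distrib sum_distrib_left)
  qed
qed

lemma scaling_weyl_matrix:
  fixes \<zeta> :: "'k::field"
  assumes r: "r \<in> roots X" and z: "\<zeta> \<noteq> 0"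
  shows "weyl_matrix r \<zeta> = scaling r (inverse \<zeta>) * weyl_matrix r 1 * scaling r \<zeta>"
proof -
  note inv = scaling_inverse[OF z, of r]
  have c: "scaling r \<zeta> * (scaling r (inverse \<zeta>) * A) = A" for A
    by (simp flip: mult.assoc add: inv)
  show ?thesis
    using scaling_root_matrix(1)[OF r z, of 1] scaling_root_matrix(2)[OF r z, of "- 1"]
    by (simp add: weyl_matrix_def mult.assoc c)
qed

lemma weyl_matrix_minus:
  assumes r: "r \<in> roots X"
  shows "weyl_matrix r (- \<zeta>) * weyl_matrix r (\<zeta> :: 'k::field) = 1"
proof -
  have mr: "- r \<in> roots X" by (rule uminus_root[OF r])
  have c: "root_matrix s (- z) * (root_matrix s z * A) = A" if "s \<in> roots X" for s and z :: 'k and A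
    using root_matrix_add[OF that, of "- z" z] by (simp flip: mult.assoc)
  show ?thesis using c[OF r, of \<zeta>] c[OF mr, of "- inverse \<zeta>"] root_matrix_add[OF r, of "- \<zeta>" \<zeta>]
    by (simp add: weyl_matrix_def mult.assoc)
qed

theorem torus_matrix:
  fixes \<zeta> :: "'k::field"
  assumes r: "r \<in> roots X" and z: "\<zeta> \<noteq> 0"
  shows "weyl_matrix r (- 1) * weyl_matrix r \<zeta> = diag (\<lambda>a. \<zeta> powi weight r a)"
proof -
  \<comment> \<open>What the left scaling becomes when it is moved past the Weyl matrix, which
    negates weights. The rounding does no harm: the floors of w/2 and -w/2 always differ by
    w.\<close>
  let ?K = "diag (\<lambda>a. inverse \<zeta> powi ((- weight r a) div 2))"
  let ?n = "weyl_matrix r (1 :: 'k)"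
  have "scaling r (inverse \<zeta>) * ?n = ?n * ?K"
  proof (rule rmat_eqI)
    fix a c
    show "entry (scaling r (inverse \<zeta>) * ?n) a c = entry (?n * ?K) a c"
      using weyl_int_nonzero(1)[OF r, of a c]
      by (cases "entry (weyl_int r) a c = 0")
        (simp_all add: weyl_matrix_1 scaling_def entry_diag_times entry_times_diag)
  qed
  then have "weyl_matrix r (- 1) * weyl_matrix r \<zeta> = (weyl_matrix r (- 1) * ?n) * (?K * scaling r \<zeta>)"
    using scaling_weyl_matrix[OF r z] by (simp add: mult.assoc)
  also have "\<dots> = diag (\<lambda>a. \<zeta> powi weight r a)"
  proof -
    have "inverse \<zeta> powi ((- w) div 2) * \<zeta> powi (w div 2) = \<zeta> powi w" for w :: int
    proof -
      have "inverse \<zeta> powi ((- w) div 2) * \<zeta> powi (w div 2) = \<zeta> powi (w div 2 - (- w) div 2)"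
        using z by (simp add: power_int_diff power_int_inverse field_simps)
      also have "w div 2 - (- w) div 2 = w" by presburger
      finally show ?thesis .
    qed
    then show ?thesis by (simp add: weyl_matrix_minus[OF r] scaling_def diag_times)
  qed
  finally show ?thesis .
qed

end

section \<open>Matrices and linear maps\<close>

definition matrix_map :: "dynkin \<Rightarrow> (lie_index, 'k::{field,finite}) rmat \<Rightarrow> 'k lie_map" where
  "matrix_map X M = (\<lambda>v \<in> lie_space X. \<lambda>c. \<Sum>a \<in> basis X. v a * entry M a c)"

definition basis_closed :: "dynkin \<Rightarrow> (lie_index, 'k::{field,finite}) rmat \<Rightarrow> bool" where
  "basis_closed X M \<longleftrightarrow> (\<forall>a\<in>basis X. \<forall>c. entry M a c \<noteq> 0 \<longrightarrow> c \<in> basis X)"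

text \<open>Rows outside the basis are arbitrary, so a map has many representing matrices;
  \<open>represents_eq_iff\<close> compares the rows that count.\<close>

definition represents :: "dynkin \<Rightarrow> 'k::{field,finite} lie_map \<Rightarrow> (lie_index, 'k) rmat \<Rightarrow> bool" where
  "represents X g M \<longleftrightarrow> g \<in> Bij (lie_space X) \<and> g = matrix_map X M \<and> basis_closed X M"

context chevalley
begin

lemma matrix_map_closed:
  "basis_closed X M \<Longrightarrow> v \<in> lie_space X \<Longrightarrow> matrix_map X M v \<in> lie_space X"
  unfolding lie_space_def matrix_map_def basis_closed_def
  by (auto intro!: sum.neutral simp: lie_space_def)

lemma entry_times_basis:
  assumes "basis_closed X A" "a \<in> basis X"
  shows "entry (A * B) a c = (\<Sum>b\<in>basis X. entry A a b * entry B b c)"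
  using assms by (intro entry_times finite_basis) (auto simp: basis_closed_def)

lemma basis_closed_times: "basis_closed X A \<Longrightarrow> basis_closed X B \<Longrightarrow> basis_closed X (A * B)"
  unfolding basis_closed_def by (metis entry_times_nonzero)

lemma basis_closed_diag [simp]: "basis_closed X (diag d)"
  by (auto simp: basis_closed_def entry_diag)

lemma basis_closed_1 [simp]: "basis_closed X 1"
  by (auto simp: basis_closed_def entry_one)

lemma matrix_map_compose:
  assumes A: "basis_closed X A"
  shows "compose (lie_space X) (matrix_map X B) (matrix_map X A) = matrix_map X (A * B)"
proof
  fix v
  show "compose (lie_space X) (matrix_map X B) (matrix_map X A) v = matrix_map X (A * B) v"
  proof (cases "v \<in> lie_space X")
    case v: True
    have "matrix_map X B (matrix_map X A v) c = matrix_map X (A * B) v c" for c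
    proof -
      have "matrix_map X B (matrix_map X A v) c = (\<Sum>b\<in>basis X. (\<Sum>a\<in>basis X. v a * entry A a b) * entry B b c)"
        using v matrix_map_closed[OF A v] by (simp add: matrix_map_def)
      also have "\<dots> = (\<Sum>a\<in>basis X. \<Sum>b\<in>basis X. v a * (entry A a b * entry B b c))"
        by (subst sum.swap) (simp add: sum_distrib_right mult.assoc)
      also have "\<dots> = (\<Sum>a\<in>basis X. v a * entry (A * B) a c)"
        by (rule sum.cong) (auto simp: entry_times_basis[OF A] sum_distrib_left)
      finally show ?thesis using v by (simp add: matrix_map_def)
    qed
    then show ?thesis using v by (auto simp: compose_def)
  next
    case False
    then show ?thesis by (simp add: compose_def matrix_map_def)
  qed
qed

lemma matrix_map_1: "matrix_map X 1 = (\<lambda>v\<in>lie_space X. v)"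
proof
  fix v
  have "(\<Sum>a\<in>basis X. v a * entry 1 a c) = v c" if "v \<in> lie_space X" for c
  proof -
    have "(\<Sum>a\<in>basis X. v a * entry 1 a c) = (\<Sum>a\<in>basis X. if a = c then v a else 0)"
      by (rule sum.cong) (auto simp: entry_one)
    then show ?thesis using that finite_basis by (auto simp: lie_space_def)
  qed
  then show "matrix_map X 1 v = (\<lambda>v\<in>lie_space X. v) v" by (auto simp: matrix_map_def)
qed

lemma matrix_map_eq_iff:
  fixes A B :: "(lie_index, 'k::{field,finite}) rmat"
  shows "matrix_map X A = matrix_map X B \<longleftrightarrow> (\<forall>a\<in>basis X. \<forall>c. entry A a c = entry B a c)"
proof
  assume eq: "matrix_map X A = matrix_map X B"
  have *: "matrix_map X M (\<lambda>b. if b = a then 1 else 0) c = entry M a c" if "a \<in> basis X"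
    for a c and M :: "(lie_index, 'k) rmat"
  proof -
    have "(\<lambda>b. if b = a then 1 else 0 :: 'k) \<in> lie_space X" using that by (auto simp: lie_space_def)
    moreover have "(\<Sum>b\<in>basis X. (if b = a then 1 else 0) * entry M b c) = (\<Sum>b\<in>basis X. if b = a then entry M b c else 0)"
      by (rule sum.cong) auto
    ultimately show ?thesis using that finite_basis by (simp add: matrix_map_def)
  qed
  then show "\<forall>a\<in>basis X. \<forall>c. entry A a c = entry B a c" by (metis eq)
next
  assume "\<forall>a\<in>basis X. \<forall>c. entry A a c = entry B a c"
  then show "matrix_map X A = matrix_map X B"
    by (auto simp: matrix_map_def intro!: restrict_ext sum.cong)
qed

lemma represents_inverse:
  assumes "basis_closed X A" "basis_closed X B" "A * B = 1" "B * A = 1"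
  shows "represents X (matrix_map X A) A"
proof -
  let ?S = "lie_space X :: (lie_index \<Rightarrow> 'a) set"
  have "matrix_map X B (matrix_map X A v) = v" "matrix_map X A (matrix_map X B v) = v" if "v \<in> ?S" for v
    using fun_cong[OF matrix_map_compose[OF assms(1), of B], of v] fun_cong[OF matrix_map_compose[OF assms(2), of A], of v]
      that assms(3,4) by (simp_all add: compose_def matrix_map_1)
  then have "bij_betw (matrix_map X A) ?S ?S"
    using matrix_map_closed[OF assms(1)] matrix_map_closed[OF assms(2)]
    by (intro bij_betw_byWitness[where f' = "matrix_map X B"]) auto
  moreover have "matrix_map X A \<in> extensional ?S" by (simp add: matrix_map_def)
  ultimately show ?thesis using assms(1) by (simp add: represents_def Bij_def)
qed

text \<open>Row vectors are multiplied by matrices from the right, hence the reversed order.\<close>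

lemma represents_mult:
  assumes "represents X g B" "represents X f A"
  shows "represents X (g \<otimes>\<^bsub>BijGroup (lie_space X)\<^esub> f) (A * B)"
proof -
  have g: "g \<in> Bij (lie_space X)" "g = matrix_map X B" "basis_closed X B"
    and f: "f \<in> Bij (lie_space X)" "f = matrix_map X A" "basis_closed X A"
    using assms unfolding represents_def by blast+
  have "g \<otimes>\<^bsub>BijGroup (lie_space X)\<^esub> f = compose (lie_space X) g f"
    using g(1) f(1) by (simp add: BijGroup_def)
  moreover have "compose (lie_space X) g f = matrix_map X (A * B)"
    unfolding g(2) f(2) by (rule matrix_map_compose[OF f(3)])
  ultimately show ?thesis
    using compose_Bij[OF g(1) f(1)] basis_closed_times[OF f(3) g(3)] by (simp add: represents_def)
qed

lemma represents_one: "represents X \<one>\<^bsub>BijGroup (lie_space X)\<^esub> (1 :: (lie_index, 'k::{field,finite}) rmat)"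
  using represents_inverse[of 1 1] by (simp add: BijGroup_def matrix_map_1)

lemma represents_eq_iff:
  assumes "represents X f A" "represents X g B"
  shows "f = g \<longleftrightarrow> (\<forall>a\<in>basis X. \<forall>c. entry A a c = entry B a c)"
  using assms by (simp add: represents_def matrix_map_eq_iff)

lemma represents_cong:
  assumes "represents X f A" "\<And>a c. a \<in> basis X \<Longrightarrow> entry A a c = entry B a c"
  shows "represents X f B"
  using assms matrix_map_eq_iff[of A B] by (auto simp: represents_def basis_closed_def)

section \<open>The Chevalley group\<close>

lemma entry_power_bracket:
  assumes r: "r \<in> roots X" and a: "a \<in> basis X"
  shows "(bracket X N (unit_vector (Root r)) ^^ n) (unit_vector a) c = entry (E r ^ n) a c"
proof (induction n arbitrary: c)
  case 0
  then show ?case by (simp add: unit_vector_def entry_one eq_commute)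
next
  case (Suc n)
  have "entry (E r ^ n * E r) a c = (\<Sum>b\<in>basis X. entry (E r ^ n) a b * entry (E r) b c)"
    by (rule entry_times[OF finite_basis]) (use power_nonzero(2)[OF r] a in blast)
  also have "\<dots> = (\<Sum>b\<in>basis X. entry (E r ^ n) a b * basis_bracket X N (Root r) b c)"
    using r by (intro sum.cong) (auto simp: entry_ad)
  also have "\<dots> = (bracket X N (unit_vector (Root r)) ^^ Suc n) (unit_vector a) c"
    unfolding funpow.simps(2) comp_def by (subst bracket_unit_left) (use r in \<open>simp_all only: Root_basis Suc.IH\<close>)
  finally show ?case by (simp only: power_Suc2)
qed

lemma root_element_matrix:
  assumes r: "r \<in> roots X"
  shows "root_element X N r \<zeta> = matrix_map X (root_matrix r \<zeta>)"
proof -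
  have "(\<Sum>a\<in>basis X. \<Sum>n<4. v a * \<zeta> ^ n * of_int ((bracket X N (unit_vector (Root r)) ^^ n) (unit_vector a) c div fact n)) =
      (\<Sum>a\<in>basis X. v a * entry (root_matrix r \<zeta>) a c)" for v c
  proof (rule sum.cong[OF refl])
    fix a assume a: "a \<in> basis X"
    show "(\<Sum>n<4. v a * \<zeta> ^ n * of_int ((bracket X N (unit_vector (Root r)) ^^ n) (unit_vector a) c div fact n)) =
        v a * entry (root_matrix r \<zeta>) a c"
      by (simp add: entry_power_bracket[OF r a] root_matrix_def entry_sum entry_divided_power sum_distrib_left mult.assoc)
  qed
  then show ?thesis by (simp add: root_element_def matrix_map_def)
qed

lemma basis_closed_root_matrix:
  assumes r: "r \<in> roots X" shows "basis_closed X (root_matrix r \<zeta>)"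
  unfolding basis_closed_def
proof (intro ballI allI impI)
  fix a c assume a: "a \<in> basis X" and nz: "entry (root_matrix r \<zeta>) a c \<noteq> 0"
  obtain n where "entry (D r n) a c \<noteq> 0" by (rule entry_root_matrix_nonzero[OF nz])
  then show "c \<in> basis X" using divided_power_nonzero(2)[OF r _ a] by blast
qed

lemma represents_root:
  assumes r: "r \<in> roots X"
  shows "represents X (root_element X N r \<zeta>) (root_matrix r \<zeta>)"
  unfolding root_element_matrix[OF r]
  by (rule represents_inverse[OF basis_closed_root_matrix[OF r] basis_closed_root_matrix[OF r, of "- \<zeta>"]])
    (simp_all add: root_matrix_add[OF r])

end

locale chevalley_field = chevalley X N for X N +
  fixes k :: "'k::{field,finite} itself"
begin

abbreviation B where "B \<equiv> BijGroup (lie_space X :: (lie_index \<Rightarrow> 'k) set)"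

abbreviation C :: "'k lie_map monoid" where "C \<equiv> chevalley_group X N"

abbreviation x :: "root \<Rightarrow> 'k \<Rightarrow> 'k lie_map" where "x \<equiv> root_element X N"

sublocale B: group B by (rule group_BijGroup)

lemma carrier_C: "carrier C = generate B {x r \<zeta> | r \<zeta>. r \<in> roots X}"
  by (simp add: chevalley_group_def)

lemma mult_C: "f \<otimes>\<^bsub>C\<^esub> g = f \<otimes>\<^bsub>B\<^esub> g" and one_C: "\<one>\<^bsub>C\<^esub> = \<one>\<^bsub>B\<^esub>"
  by (simp_all add: chevalley_group_def)

lemma represents_carrier: "represents X g M \<Longrightarrow> g \<in> carrier B"
  unfolding represents_def BijGroup_def partial_object.select_convs by blast

lemma x_B: "r \<in> roots X \<Longrightarrow> x r \<zeta> \<in> carrier B"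
  by (rule represents_carrier[OF represents_root])

lemma subgroup_C: "subgroup (carrier C) B"
  unfolding carrier_C by (rule B.generate_is_subgroup) (auto intro: x_B)

lemma group_C: "group C"
proof -
  have "C = B\<lparr>carrier := carrier C\<rparr>" by (simp add: chevalley_group_def)
  then show ?thesis using B.subgroup_imp_group[OF subgroup_C] by simp
qed

sublocale C: group C by (rule group_C)

lemma x_C: "r \<in> roots X \<Longrightarrow> x r \<zeta> \<in> carrier C"
  unfolding carrier_C by (rule generate.incl) blast

lemma represents_C_mult: "represents X f A \<Longrightarrow> represents X g M \<Longrightarrow> represents X (f \<otimes>\<^bsub>C\<^esub> g) (M * A)"
  unfolding mult_C by (rule represents_mult)

lemma represents_C_one: "represents X \<one>\<^bsub>C\<^esub> 1"
  unfolding one_C by (rule represents_one)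

lemma x_add: "r \<in> roots X \<Longrightarrow> x r \<zeta> \<otimes>\<^bsub>C\<^esub> x r \<eta> = x r (\<zeta> + \<eta>)"
  using represents_C_mult[OF represents_root[of r \<zeta>] represents_root[of r \<eta>]]
    represents_eq_iff[OF _ represents_root[of r "\<zeta> + \<eta>"]]
  by (simp add: root_matrix_add add.commute)

lemma x_0: "r \<in> roots X \<Longrightarrow> x r 0 = \<one>\<^bsub>C\<^esub>"
  using represents_eq_iff[OF represents_root represents_C_one, of r 0] by simp

lemma x_inv: "r \<in> roots X \<Longrightarrow> inv\<^bsub>C\<^esub> (x r \<zeta>) = x r (- \<zeta>)"
  by (rule C.inv_equality) (simp_all add: x_add x_0 x_C)

section \<open>Unipotent elements are unitriangular for the height\<close>

definition height :: "int \<Rightarrow> lie_index \<Rightarrow> int" where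
  "height e a = e * (\<Sum>i<rank X. grade a i)"

definition unitriangular :: "int \<Rightarrow> (lie_index, 'k) rmat \<Rightarrow> bool" where
  "unitriangular e M \<longleftrightarrow> (\<forall>a\<in>basis X. entry M a a = 1 \<and>
     (\<forall>c. entry M a c \<noteq> 0 \<longrightarrow> c = a \<or> height e a < height e c))"

text \<open>The parameter \<open>e = \<plusminus>1\<close> distinguishes positive and negative roots.\<close>

definition signed_roots :: "int \<Rightarrow> root set" where
  "signed_roots e = {r \<in> roots X. \<forall>i. r i \<noteq> 0 \<longrightarrow> 0 < e * r i}"

definition unipotent :: "int \<Rightarrow> 'k lie_map set" where
  "unipotent e = generate C {x r \<zeta> | r \<zeta>. r \<in> signed_roots e}"

lemma unipotent_pos_eq: "unipotent_pos X N = unipotent 1"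
proof -
  have "0 \<le> z \<longleftrightarrow> (z \<noteq> 0 \<longrightarrow> 0 < 1 * z)" for z :: int by auto
  then have "positive_roots X = signed_roots 1"
    by (simp only: positive_roots_def signed_roots_def)
  then show ?thesis by (simp add: unipotent_pos_def unipotent_def)
qed

lemma unipotent_neg_eq: "unipotent_neg X N = unipotent (- 1)"
proof -
  have "z \<le> 0 \<longleftrightarrow> (z \<noteq> 0 \<longrightarrow> 0 < - 1 * z)" for z :: int by auto
  then have "negative_roots X = signed_roots (- 1)"
    by (simp only: negative_roots_def signed_roots_def)
  then show ?thesis by (simp add: unipotent_neg_def unipotent_def)
qed

lemma height_root:
  assumes "r \<in> signed_roots e" shows "0 < height e (Root r)"
proof -
  have r: "r \<in> roots X" and pos: "\<And>i. r i \<noteq> 0 \<Longrightarrow> 0 < e * r i" using assms by (auto simp: signed_roots_def)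
  then have nonneg: "0 \<le> e * r i" for i by (cases "r i = 0") (auto simp: less_imp_le)
  have "r \<noteq> 0" using r by auto
  then obtain i where i: "r i \<noteq> 0" by (auto simp: fun_eq_iff)
  then have "i < rank X" using root_support[OF r, of i] by (meson not_le)
  then have "0 < (\<Sum>i<rank X. e * r i)" using pos[OF i] by (intro sum_pos2[of _ i]) (auto simp: nonneg)
  then show ?thesis by (simp add: height_def sum_distrib_left)
qed

lemma unitriangular_1: "unitriangular e 1"
  by (simp add: unitriangular_def entry_one)

lemma unitriangular_times:
  assumes cl: "basis_closed X A" "basis_closed X M" and tri: "unitriangular e A" "unitriangular e M"
  shows "unitriangular e (A * M)"
  unfolding unitriangular_def
proof (intro ballI conjI allI impI)
  fix a assume a: "a \<in> basis X"
  have "entry A a b * entry M b a = (if b = a then 1 else 0)" if b: "b \<in> basis X" for b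
  proof (cases "b = a")
    case False
    then have "entry A a b \<noteq> 0 \<Longrightarrow> height e a < height e b" "entry M b a \<noteq> 0 \<Longrightarrow> height e b < height e a"
      using tri a b by (auto simp: unitriangular_def)
    then show ?thesis using False by (metis less_asym mult_zero_left mult_zero_right)
  qed (use tri a in \<open>simp add: unitriangular_def\<close>)
  then have "entry (A * M) a a = (\<Sum>b\<in>basis X. if b = a then 1 else 0)"
    unfolding entry_times_basis[OF cl(1) a] by (rule sum.cong[OF refl])
  then show "entry (A * M) a a = 1" using a finite_basis by simp
next
  fix a c assume a: "a \<in> basis X" and nz: "entry (A * M) a c \<noteq> 0"
  obtain b where b: "entry A a b \<noteq> 0" "entry M b c \<noteq> 0" using nz by (rule entry_times_nonzero)
  then have "b \<in> basis X" using cl(1) a by (simp add: basis_closed_def)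
  then show "c = a \<or> height e a < height e c"
    using tri a b unfolding unitriangular_def by (metis less_trans)
qed

lemma unitriangular_root:
  assumes r: "r \<in> signed_roots e" shows "unitriangular e (root_matrix r \<zeta>)"
proof -
  have rr: "r \<in> roots X" using r by (simp add: signed_roots_def)
  have ht: "c = a \<and> n = 0 \<or> 0 < n \<and> height e a < height e c" if nz: "entry (D r n) a c \<noteq> 0" for a c n
  proof (cases "n = 0")
    case True
    then show ?thesis using nz by (auto simp: entry_one split: if_splits)
  next
    case False
    have "height e c = height e a + int n * height e (Root r)"
      by (simp add: height_def divided_power_nonzero(1)[OF rr nz] sum.distrib sum_distrib_left algebra_simps)
    then show ?thesis using height_root[OF r] False by simp
  qed
  have "entry (root_matrix r \<zeta>) a a = 1" for a
  proof -
    have "entry (D r n) a a = 0" if "n > 0" for n using ht[of n a a] that by auto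
    then show ?thesis by (simp add: root_matrix_expand entry_one flip: divided_power_1)
  qed
  moreover have "c = a \<or> height e a < height e c" if nz: "entry (root_matrix r \<zeta>) a c \<noteq> 0" for a c
  proof -
    obtain n where "entry (D r n) a c \<noteq> 0" by (rule entry_root_matrix_nonzero[OF nz])
    then show ?thesis using ht by blast
  qed
  ultimately show ?thesis by (auto simp: unitriangular_def)
qed

lemma unipotent_matrix:
  assumes "u \<in> unipotent e"
  obtains M where "represents X u M" "unitriangular e M"
proof -
  have gen: "\<exists>M. represents X (x r \<zeta>) M \<and> unitriangular e M" if "r \<in> signed_roots e" for r \<zeta>
    using represents_root[of r \<zeta>] unitriangular_root[OF that, of \<zeta>] that by (auto simp: signed_roots_def)
  have "\<exists>M. represents X u M \<and> unitriangular e M"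
    using assms unfolding unipotent_def
  proof (induction rule: generate.induct)
    case one
    show ?case using represents_C_one unitriangular_1 by blast
  next
    case (incl h)
    then show ?case using gen by blast
  next
    case (inv h)
    then obtain r \<zeta> where r: "r \<in> signed_roots e" "h = x r \<zeta>" by blast
    then have "inv\<^bsub>C\<^esub> h = x r (- \<zeta>)" by (simp add: x_inv signed_roots_def)
    then show ?case using gen r(1) by simp
  next
    case (eng h1 h2)
    then obtain A M where "represents X h1 A" "unitriangular e A" "represents X h2 M" "unitriangular e M" by blast
    then show ?case
      using represents_C_mult[of h1 A h2 M] unitriangular_times[of M A e] by (auto simp: represents_def)
  qed
  then show thesis using that by blast
qed

lemma subgroup_unipotent: "subgroup (unipotent e) C"
  unfolding unipotent_def by (rule C.generate_is_subgroup) (auto simp: signed_roots_def x_C)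

subsection \<open>The torus\<close>

text \<open>A torus element is recorded by its values \<open>t\<close> at the simple roots. The
  coefficients of a root, which may be negative, prescribe the value there.\<close>

definition character :: "(nat \<Rightarrow> 'k) \<Rightarrow> lie_index \<Rightarrow> 'k" where
  "character t a = (\<Prod>i<rank X. t i powi grade a i)"

definition toral :: "(nat \<Rightarrow> 'k) \<Rightarrow> 'k lie_map \<Rightarrow> bool" where
  "toral t h \<longleftrightarrow> (\<forall>i. t i \<noteq> 0) \<and> represents X h (diag (character t))"

lemma character_nonzero: "(\<And>i. t i \<noteq> 0) \<Longrightarrow> character t a \<noteq> 0"
  by (simp add: character_def)

lemma character_Cartan [simp]: "character t (Cartan i) = 1"
  by (simp add: character_def)

lemma character_shift:
  "(\<And>i. t i \<noteq> 0) \<Longrightarrow> grade c = (\<lambda>i. grade a i + int n * r i) \<Longrightarrow> character t c = character t a * character t (Root r) ^ n"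
  by (simp add: character_def power_int_add power_int_mult prod.distrib prod_power_distrib mult.commute[of "int n"])

lemma character_simple: "i < rank X \<Longrightarrow> character t (Root (simple_root i)) = t i"
proof -
  assume i: "i < rank X"
  have "(\<Prod>j<rank X. t j powi simple_root i j) = (\<Prod>j<rank X. if j = i then t i else 1)"
    by (rule prod.cong) (auto simp: simple_root_def)
  then show ?thesis using i by (simp add: character_def)
qed

text \<open>The group acts on the Lie algebra and so has adjoint form; all eigenvalues of a torus
  element are products of its values at the simple roots.\<close>

lemma toral_eq_one:
  assumes "toral t h" "\<And>i. i < rank X \<Longrightarrow> t i = 1" shows "h = \<one>\<^bsub>C\<^esub>"
proof -
  have "character t = (\<lambda>_. 1)" using assms(2) by (simp add: character_def fun_eq_iff)
  then have "diag (character t) = (1 :: (lie_index, 'k) rmat)" by (simp only: diag_one)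
  then show ?thesis using assms(1) represents_eq_iff[OF _ represents_C_one] by (auto simp: toral_def)
qed

lemma toral_one: "toral (\<lambda>_. 1) \<one>\<^bsub>C\<^esub>"
proof -
  have "character (\<lambda>_. 1) = (\<lambda>_. 1)" by (simp add: character_def fun_eq_iff)
  then show ?thesis using represents_C_one by (simp add: toral_def diag_one)
qed

lemma toral_mult: "toral t h \<Longrightarrow> toral t' h' \<Longrightarrow> toral (\<lambda>i. t i * t' i) (h \<otimes>\<^bsub>C\<^esub> h')"
  using represents_C_mult[of h "diag (character t)" h' "diag (character t')"]
  by (simp add: toral_def diag_times character_def[abs_def] power_int_mult_distrib prod.distrib mult.commute)

lemma toral_conj:
  assumes h: "toral t h" and r: "r \<in> roots X"
  shows "h \<otimes>\<^bsub>C\<^esub> x r \<zeta> = x r (character t (Root r) * \<zeta>) \<otimes>\<^bsub>C\<^esub> h"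
proof -
  let ?d = "diag (character t)" and ?\<chi> = "character t (Root r)"
  have t: "\<And>i. t i \<noteq> 0" and rep: "represents X h ?d" using h by (auto simp: toral_def)
  have "root_matrix r \<zeta> * ?d = ?d * root_matrix r (?\<chi> * \<zeta>)"
  proof (rule rmat_eqI)
    fix a c
    have "\<zeta> ^ n * of_int (entry (D r n) a c) * character t c = character t a * ((?\<chi> * \<zeta>) ^ n * of_int (entry (D r n) a c))" for n
    proof (cases "entry (D r n) a c = 0")
      case False
      then show ?thesis
        using character_shift[OF t divided_power_nonzero(1)[OF r False]] by (simp add: power_mult_distrib)
    qed simp
    then show "entry (root_matrix r \<zeta> * ?d) a c = entry (?d * root_matrix r (?\<chi> * \<zeta>)) a c"
      by (simp only: entry_times_diag entry_diag_times root_matrix_def entry_sum entry_smul entry_rmap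
          sum_distrib_left sum_distrib_right)
  qed
  then show ?thesis
    using represents_eq_iff[OF represents_C_mult[OF rep represents_root[OF r]] represents_C_mult[OF represents_root[OF r] rep]]
    by metis
qed

lemma cartan_int_expand:
  assumes r: "r \<in> roots X"
  shows "cartan_int X r s = (\<Sum>i<rank X. s i * cartan_int X r (simple_root i))"
proof -
  have "inner X r r * (\<Sum>i<rank X. s i * cartan_int X r (simple_root i)) =
      (\<Sum>i<rank X. s i * (inner X r r * cartan_int X r (simple_root i)))"
    by (simp add: sum_distrib_left mult.left_commute)
  also have "\<dots> = 2 * (\<Sum>i<rank X. s i * inner X (simple_root i) r)"
    by (simp add: cartan_int_eq[OF r] sum_distrib_left mult.left_commute inner_sym[of X r "simple_root _"])
  also have "(\<Sum>i<rank X. s i * inner X (simple_root i) r) = inner X s r"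
    unfolding inner_def[of X s r] by (simp add: inner_simple sum_distrib_left mult.assoc)
  also have "2 * inner X s r = inner X r r * cartan_int X r s"
    using cartan_int_eq[OF r, of s] inner_sym[of X s r] by simp
  finally show ?thesis by (rule cancel_norm[OF root_norm_bounds(1)[OF r], symmetric])
qed

lemma power_int_sum: "(z::'k) \<noteq> 0 \<Longrightarrow> z powi (\<Sum>i\<in>I. f i) = (\<Prod>i\<in>I. z powi f i)"
  by (induction I rule: infinite_finite_induct) (auto simp: power_int_add)

lemma represents_weyl:
  "r \<in> roots X \<Longrightarrow> represents X (weyl_element X N r \<zeta>) (weyl_matrix r (\<zeta> :: 'k))"
  unfolding weyl_element_def weyl_matrix_def mult.assoc
  by (intro represents_C_mult represents_root) (auto intro: uminus_root)

lemma toral_torus_element: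
  fixes \<zeta> :: 'k
  assumes r: "r \<in> roots X" and z: "\<zeta> \<noteq> 0"
  shows "toral (\<lambda>i. \<zeta> powi cartan_int X r (simple_root i)) (torus_element X N r \<zeta>)"
  unfolding toral_def
proof
  show "\<forall>i. \<zeta> powi cartan_int X r (simple_root i) \<noteq> 0" using z by simp
  have "represents X (torus_element X N r \<zeta>) (diag (\<lambda>a. \<zeta> powi weight r a))"
    unfolding torus_element_def torus_matrix[OF r z, symmetric]
    by (intro represents_C_mult represents_weyl r)
  then show "represents X (torus_element X N r \<zeta>) (diag (character (\<lambda>i. \<zeta> powi cartan_int X r (simple_root i))))"
  proof (rule represents_cong)
    fix a c assume "a \<in> basis X"
    then have "\<zeta> powi weight r a = character (\<lambda>i. \<zeta> powi cartan_int X r (simple_root i)) a"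
      using z by (simp add: weight_def character_def cartan_int_expand[OF r, of "grade a"] power_int_sum
          mult.commute flip: power_int_mult)
    then show "entry (diag (\<lambda>a. \<zeta> powi weight r a)) a c =
        entry (diag (character (\<lambda>i. \<zeta> powi cartan_int X r (simple_root i)))) a c"
      by (auto simp: entry_diag)
  qed
qed

lemma toral_inv:
  assumes h: "toral t h" "h \<in> carrier C" shows "toral (\<lambda>i. inverse (t i)) (inv\<^bsub>C\<^esub> h)"
proof -
  let ?d = "diag (character t)" and ?d' = "diag (character (\<lambda>i. inverse (t i)))"
  have t: "\<And>i. t i \<noteq> 0" and rep: "represents X h ?d" using h by (auto simp: toral_def)
  have "character t a * character (\<lambda>i. inverse (t i)) a = 1" for a
    unfolding character_def prod.distrib[symmetric] using t by (simp add: power_int_inverse)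
  then have one: "?d * ?d' = 1" "?d' * ?d = 1"
    by (simp_all add: diag_times diag_one mult.commute)
  have rep': "represents X (matrix_map X ?d') ?d'" by (rule represents_inverse[OF _ _ one(2,1)]) simp_all
  have hB: "h \<in> carrier B" "matrix_map X ?d' \<in> carrier B"
    using rep rep' by (simp_all only: represents_carrier)
  have "matrix_map X ?d' \<otimes>\<^bsub>B\<^esub> h = \<one>\<^bsub>B\<^esub>"
    using represents_eq_iff[OF represents_mult[OF rep' rep] represents_one] one by simp
  then have "inv\<^bsub>B\<^esub> h = matrix_map X ?d'" using hB by (intro B.inv_equality)
  moreover have "inv\<^bsub>C\<^esub> h = inv\<^bsub>B\<^esub> h"
  proof -
    have "C = B\<lparr>carrier := carrier C\<rparr>" by (simp add: chevalley_group_def)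
    then show ?thesis using B.m_inv_consistent[OF subgroup_C h(2)] by simp
  qed
  ultimately show ?thesis using rep' t by (simp add: toral_def)
qed

abbreviation T :: "'k lie_map set" where "T \<equiv> torus X N"

lemma weyl_C: "r \<in> roots X \<Longrightarrow> weyl_element X N r (\<zeta> :: 'k) \<in> carrier C"
  unfolding weyl_element_def by (intro C.m_closed x_C) (auto intro: uminus_root)

lemma torus_element_C: "r \<in> roots X \<Longrightarrow> torus_element X N r (\<zeta> :: 'k) \<in> carrier C"
  unfolding torus_element_def by (intro C.m_closed weyl_C)

lemma subgroup_T: "subgroup T C"
  unfolding torus_def by (rule C.generate_is_subgroup) (auto simp: torus_element_C)

lemma torus_toral:
  assumes "h \<in> T" obtains t where "toral t h"
proof -
  have "\<exists>t. toral t h"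
    using assms unfolding torus_def
  proof (induction rule: generate.induct)
    case one
    show ?case using toral_one by blast
  next
    case (incl h)
    then show ?case using toral_torus_element by blast
  next
    case (inv h)
    then show ?case using toral_torus_element toral_inv torus_element_C by blast
  next
    case (eng h1 h2)
    then show ?case using toral_mult by blast
  qed
  then show thesis using that by blast
qed

lemma conj_unipotent:
  assumes h: "h \<in> T" and u: "u \<in> unipotent e" shows "h \<otimes>\<^bsub>C\<^esub> u \<otimes>\<^bsub>C\<^esub> inv\<^bsub>C\<^esub> h \<in> unipotent e"
proof -
  obtain t where t: "toral t h" using h by (rule torus_toral)
  have hC: "h \<in> carrier C" using h subgroup_T by (rule subgroup.mem_carrier[rotated])
  let ?S = "{x r \<zeta> | r \<zeta>. r \<in> signed_roots e}"
  have conj_x: "h \<otimes>\<^bsub>C\<^esub> x r \<zeta> \<otimes>\<^bsub>C\<^esub> inv\<^bsub>C\<^esub> h \<in> ?S" if "r \<in> signed_roots e" for r \<zeta>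
  proof -
    have r: "r \<in> roots X" using that by (simp add: signed_roots_def)
    have "h \<otimes>\<^bsub>C\<^esub> x r \<zeta> \<otimes>\<^bsub>C\<^esub> inv\<^bsub>C\<^esub> h = x r (character t (Root r) * \<zeta>)"
      unfolding toral_conj[OF t r] using hC x_C[OF r] by (simp add: C.m_assoc)
    then show ?thesis using that by blast
  qed
  show ?thesis
    using u unfolding unipotent_def
  proof (induction rule: generate.induct)
    case one
    have "h \<otimes>\<^bsub>C\<^esub> \<one>\<^bsub>C\<^esub> \<otimes>\<^bsub>C\<^esub> inv\<^bsub>C\<^esub> h = \<one>\<^bsub>C\<^esub>" using hC by simp
    then show ?case by (simp only: generate.one)
  next
    case (incl u)
    then obtain r \<zeta> where u: "r \<in> signed_roots e" "u = x r \<zeta>" by blast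
    show ?case unfolding u(2) by (rule generate.incl[OF conj_x[OF u(1)]])
  next
    case (inv u)
    then obtain r \<zeta> where u: "r \<in> signed_roots e" "u = x r \<zeta>" by blast
    then have "inv\<^bsub>C\<^esub> u = x r (- \<zeta>)" by (simp add: x_inv signed_roots_def)
    then show ?case by (simp only: generate.incl[OF conj_x[OF u(1)]])
  next
    case (eng u1 u2)
    have uC: "u1 \<in> carrier C" "u2 \<in> carrier C"
      using eng(1,2) subgroup_unipotent[of e] by (auto simp: unipotent_def dest: subgroup.mem_carrier)
    have "h \<otimes>\<^bsub>C\<^esub> (u1 \<otimes>\<^bsub>C\<^esub> u2) \<otimes>\<^bsub>C\<^esub> inv\<^bsub>C\<^esub> h =
        (h \<otimes>\<^bsub>C\<^esub> u1 \<otimes>\<^bsub>C\<^esub> inv\<^bsub>C\<^esub> h) \<otimes>\<^bsub>C\<^esub> (h \<otimes>\<^bsub>C\<^esub> u2 \<otimes>\<^bsub>C\<^esub> inv\<^bsub>C\<^esub> h)"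
      using uC hC by (simp add: C.m_assoc C.cancel_left)
    then show ?case using generate.eng[OF eng.IH] by simp
  qed
qed

subsection \<open>Monomial matrices\<close>

text \<open>Only the root rows are monomial: on the Cartan part Weyl elements act by reflections,
  whose matrices are not monomial in general.\<close>

definition monomial_matrix :: "(lie_index, 'k) rmat \<Rightarrow> bool" where
  "monomial_matrix M \<longleftrightarrow> (\<forall>s\<in>roots X. \<exists>s'. \<forall>c. entry M (Root s) c \<noteq> 0 \<longrightarrow> c = Root s') \<and>
     (\<forall>i<rank X. \<forall>c. entry M (Cartan i) c \<noteq> 0 \<longrightarrow> (\<exists>j. c = Cartan j))"

lemma monomial_diag: "monomial_matrix (diag d)"
  by (auto simp: monomial_matrix_def entry_diag)

lemma monomial_times:
  assumes cl: "basis_closed X A" and mono: "monomial_matrix A" "monomial_matrix M"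
  shows "monomial_matrix (A * M)"
  unfolding monomial_matrix_def
proof (intro conjI ballI allI impI)
  fix s assume s: "s \<in> roots X"
  then obtain s' where s': "\<And>c. entry A (Root s) c \<noteq> 0 \<Longrightarrow> c = Root s'"
    using mono(1) unfolding monomial_matrix_def by blast
  show "\<exists>s''. \<forall>c. entry (A * M) (Root s) c \<noteq> 0 \<longrightarrow> c = Root s''"
  proof (cases "entry A (Root s) (Root s') = 0")
    case True
    then have "entry A (Root s) c = 0" for c using s' by metis
    then show ?thesis by (metis entry_times_nonzero)
  next
    case False
    then have "s' \<in> roots X" using cl s by (metis Root_basis basis_closed_def)
    then obtain s'' where "\<And>c. entry M (Root s') c \<noteq> 0 \<Longrightarrow> c = Root s''"
      using mono(2) unfolding monomial_matrix_def by blast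
    then show ?thesis using s' by (metis entry_times_nonzero)
  qed
next
  fix i c assume i: "i < rank X" and nz: "entry (A * M) (Cartan i) c \<noteq> 0"
  obtain b where b: "entry A (Cartan i) b \<noteq> 0" "entry M b c \<noteq> 0" using nz by (rule entry_times_nonzero)
  have "b \<in> basis X" using cl b(1) i by (auto simp: basis_closed_def)
  then show "\<exists>j. c = Cartan j" using mono b i unfolding monomial_matrix_def by (metis Cartan_basis)
qed

text \<open>Scaling by diagonal matrices creates no nonzero entries, so the integral case
  decides.\<close>

lemma monomial_weyl:
  fixes \<zeta> :: 'k
  assumes r: "r \<in> roots X" and z: "\<zeta> \<noteq> 0" shows "monomial_matrix (weyl_matrix r \<zeta>)"
proof -
  have 1: "monomial_matrix (weyl_matrix r 1)"
    unfolding monomial_matrix_def weyl_matrix_1 entry_rmap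
  proof (intro conjI ballI allI impI)
    show "\<exists>s'. \<forall>c. (of_int (entry (weyl_int r) (Root s) c) :: 'k) \<noteq> 0 \<longrightarrow> c = Root s'" if "s \<in> roots X" for s
      by (rule exI[of _ "\<lambda>i. s i - cartan_int X r s * r i"]) (use weyl_int_monomial(1)[OF r that] in \<open>metis of_int_0\<close>)
    show "\<exists>j. c = Cartan j" if "i < rank X" "(of_int (entry (weyl_int r) (Cartan i) c) :: 'k) \<noteq> 0" for i c
      using weyl_int_monomial(2)[OF r that(1), of c] that(2) by (metis of_int_0)
  qed
  have "entry (weyl_matrix r \<zeta>) a c \<noteq> 0 \<Longrightarrow> entry (weyl_matrix r (1 :: 'k)) a c \<noteq> 0" for a c
    unfolding scaling_weyl_matrix[OF r z] scaling_def entry_times_diag entry_diag_times by auto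
  then show ?thesis using 1 unfolding monomial_matrix_def by metis
qed

lemma weyl_inv:
  assumes r: "r \<in> roots X" shows "inv\<^bsub>C\<^esub> (weyl_element X N r (1 :: 'k)) = weyl_element X N r (- 1)"
proof (rule C.inv_equality)
  have "weyl_matrix r (1::'k) * weyl_matrix r (- 1) = 1"
    using weyl_matrix_minus[OF r, of "- 1 :: 'k"] by simp
  then show "weyl_element X N r (- 1) \<otimes>\<^bsub>C\<^esub> weyl_element X N r 1 = \<one>\<^bsub>C\<^esub>"
    using represents_eq_iff[OF represents_C_mult[OF represents_weyl[OF r] represents_weyl[OF r]] represents_C_one, of "- 1" 1]
    by simp
qed (use weyl_C r in auto)

lemma normalizer_monomial:
  assumes "n \<in> torus_normalizer X N" obtains M where "represents X n M" "monomial_matrix M"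
proof -
  have T_mono: "\<exists>M. represents X h M \<and> monomial_matrix M" if "h \<in> T" for h
    using that monomial_diag by (metis torus_toral toral_def)
  have "\<exists>M. represents X n M \<and> monomial_matrix M"
    using assms unfolding torus_normalizer_def
  proof (induction rule: generate.induct)
    case one
    show ?case using represents_C_one monomial_diag by (metis diag_one)
  next
    case (incl h)
    then consider "h \<in> T" | r where "r \<in> roots X" "h = weyl_element X N r 1" by blast
    then show ?case
    proof cases
      case 1
      then show ?thesis using T_mono by blast
    next
      case 2
      then show ?thesis using represents_weyl[of r 1] monomial_weyl[of r 1] by auto
    qed
  next
    case (inv h)
    then consider "h \<in> T" | r where "r \<in> roots X" "h = weyl_element X N r 1" by blast
    then show ?case
    proof cases
      case 1
      then show ?thesis using T_mono subgroup_T by (metis subgroup.m_inv_closed)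
    next
      case 2
      then show ?thesis using represents_weyl[of r "- 1"] monomial_weyl[of r "- 1"] weyl_inv by auto
    qed
  next
    case (eng h1 h2)
    then obtain A M where "represents X h1 A" "monomial_matrix A" "represents X h2 M" "monomial_matrix M" by blast
    then show ?case
      using represents_C_mult[of h1 A h2 M] monomial_times[of M A] by (auto simp: represents_def)
  qed
  then show thesis using that by blast
qed

text \<open>Up to a torus factor the matrix of \<open>u\<close> is both unitriangular and monomial.
  In a root row the diagonal entry leaves no room for another; a Cartan row stays at height 0, where
  a unitriangular matrix has only its diagonal.\<close>

lemma normalizer_unipotent_torus:
  assumes n: "n \<in> torus_normalizer X N" "n = u \<otimes>\<^bsub>C\<^esub> h" and u: "u \<in> unipotent e" and h: "h \<in> T"
  shows "u = \<one>\<^bsub>C\<^esub>"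
proof -
  obtain M where M: "represents X n M" "monomial_matrix M" using n(1) by (rule normalizer_monomial)
  obtain A where A: "represents X u A" "unitriangular e A" using u by (rule unipotent_matrix)
  obtain t where t: "toral t h" using h by (rule torus_toral)
  have nz: "character t a \<noteq> 0" for a using t character_nonzero by (auto simp: toral_def)
  have rep: "represents X n (diag (character t) * A)" unfolding n(2) using A(1) t by (auto simp: toral_def intro: represents_C_mult)
  have M_eq: "entry M a c = character t a * entry A a c" if "a \<in> basis X" for a c
    using iffD1[OF represents_eq_iff[OF M(1) rep] refl] that by (simp add: entry_diag_times)
  have supp: "entry M a c \<noteq> 0 \<longleftrightarrow> entry A a c \<noteq> 0" if "a \<in> basis X" for a c
    using M_eq[OF that] nz by simp
  have A1: "entry A a c = entry 1 a c" if a: "a \<in> basis X" for a c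
  proof -
    have diag: "entry A a a = 1" using A(2) a by (simp add: unitriangular_def)
    have "entry A a c = 0" if "c \<noteq> a"
    proof (rule ccontr)
      assume nz: "entry A a c \<noteq> 0"
      then have ht: "height e a < height e c" using A(2) a that by (auto simp: unitriangular_def)
      show False
      proof (cases a)
        case (Root s)
        then obtain s' where "\<forall>c. entry M a c \<noteq> 0 \<longrightarrow> c = Root s'" using M(2) a by (auto simp: monomial_matrix_def)
        then show False using supp[OF a] nz diag that by (metis zero_neq_one)
      next
        case (Cartan i)
        then obtain j where "c = Cartan j" using M(2) a supp[OF a] nz by (fastforce simp: monomial_matrix_def)
        then show False using ht Cartan by (simp add: height_def)
      qed
    qed
    then show ?thesis using diag by (auto simp: entry_one)
  qed
  then show ?thesis using represents_eq_iff[OF A(1) represents_C_one] by simp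
qed

text \<open>Up to a diagonal factor one matrix would both raise and lower heights, so nothing is
  left off the diagonal.\<close>

lemma unipotent_opposite:
  assumes u: "u \<in> unipotent e" and v: "v \<in> unipotent (- e)" and h: "h \<in> T" and eq: "u = v \<otimes>\<^bsub>C\<^esub> h"
  shows "u = \<one>\<^bsub>C\<^esub>"
proof -
  obtain A where A: "represents X u A" "unitriangular e A" using u by (rule unipotent_matrix)
  obtain M where M: "represents X v M" "unitriangular (- e) M" using v by (rule unipotent_matrix)
  obtain t where t: "toral t h" using h by (rule torus_toral)
  have rep: "represents X u (diag (character t) * M)" unfolding eq using M(1) t by (auto simp: toral_def intro: represents_C_mult)
  have A_eq: "entry A a c = character t a * entry M a c" if "a \<in> basis X" for a c
    using iffD1[OF represents_eq_iff[OF A(1) rep] refl] that by (simp add: entry_diag_times)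
  have "entry A a c = entry 1 a c" if a: "a \<in> basis X" for a c
  proof (cases "c = a")
    case True
    then show ?thesis using A(2) a by (simp add: unitriangular_def entry_one)
  next
    case False
    then have "entry A a c \<noteq> 0 \<Longrightarrow> height e a < height e c" "entry M a c \<noteq> 0 \<Longrightarrow> height (- e) a < height (- e) c"
      using A(2) M(2) a by (auto simp: unitriangular_def)
    then have "entry A a c = 0" using A_eq[OF a] by (fastforce simp: height_def)
    then show ?thesis using False by (simp add: entry_one)
  qed
  then show ?thesis using represents_eq_iff[OF A(1) represents_C_one] by simp
qed

end

section \<open>Reduction to regular pairs\<close>

locale lie_type = chevalley_field X N k for X N and k :: "'k::{field,finite} itself" +
  fixes \<sigma> :: "'k lie_map \<Rightarrow> 'k lie_map"
  assumes \<sigma>_hom: "\<sigma> \<in> hom C C"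
begin

abbreviation L where "L \<equiv> lie_type_group X N \<sigma>"

definition fixed :: "int \<Rightarrow> 'k lie_map set" where
  "fixed e = {u \<in> unipotent e. \<sigma> u = u}"

lemma \<sigma>_mult: "u \<in> carrier C \<Longrightarrow> v \<in> carrier C \<Longrightarrow> \<sigma> (u \<otimes>\<^bsub>C\<^esub> v) = \<sigma> u \<otimes>\<^bsub>C\<^esub> \<sigma> v"
  using \<sigma>_hom by (simp add: hom_mult)

lemma \<sigma>_one: "\<sigma> \<one>\<^bsub>C\<^esub> = \<one>\<^bsub>C\<^esub>"
  using hom_one[OF \<sigma>_hom group_C group_C] .

lemma \<sigma>_inv: "u \<in> carrier C \<Longrightarrow> \<sigma> (inv\<^bsub>C\<^esub> u) = inv\<^bsub>C\<^esub> (\<sigma> u)"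
  using group_hom.hom_inv[of C C \<sigma>] \<sigma>_hom group_C by (simp add: group_hom_def group_hom_axioms_def)

lemma unipotent_C: "u \<in> unipotent e \<Longrightarrow> u \<in> carrier C"
  by (rule subgroup.mem_carrier[OF subgroup_unipotent])

lemma subgroup_fixed: "subgroup (fixed e) C"
proof (rule C.subgroupI)
  show "fixed e \<subseteq> carrier C" using unipotent_C by (auto simp: fixed_def)
  have "\<one>\<^bsub>C\<^esub> \<in> fixed e"
    using \<sigma>_one subgroup.one_closed[OF subgroup_unipotent] by (simp add: fixed_def)
  then show "fixed e \<noteq> {}" by blast
  show "inv\<^bsub>C\<^esub> u \<in> fixed e" if "u \<in> fixed e" for u
    using that \<sigma>_inv[of u] unipotent_C[of u e] subgroup.m_inv_closed[OF subgroup_unipotent, of u e]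
    by (auto simp: fixed_def)
  show "u \<otimes>\<^bsub>C\<^esub> v \<in> fixed e" if "u \<in> fixed e" "v \<in> fixed e" for u v
    using that \<sigma>_mult[of u v] unipotent_C[of u e] unipotent_C[of v e]
      subgroup.m_closed[OF subgroup_unipotent, of u e v] by (auto simp: fixed_def)
qed

lemma carrier_L: "carrier L = generate C (fixed 1 \<union> fixed (- 1))"
  by (simp add: lie_type_group_def fixed_def unipotent_pos_eq unipotent_neg_eq)

lemma L_eq: "L = C\<lparr>carrier := carrier L\<rparr>"
  by (simp add: lie_type_group_def)

lemma mult_L: "u \<otimes>\<^bsub>L\<^esub> v = u \<otimes>\<^bsub>C\<^esub> v" and one_L: "\<one>\<^bsub>L\<^esub> = \<one>\<^bsub>C\<^esub>"
  by (simp_all add: lie_type_group_def)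

lemma subgroup_L: "subgroup (carrier L) C"
  unfolding carrier_L using subgroup_fixed[of 1] subgroup_fixed[of "- 1"]
  by (intro C.generate_is_subgroup) (auto dest: subgroup.mem_carrier)

lemma group_L: "group L"
  using C.subgroup_imp_group[OF subgroup_L] L_eq by simp

sublocale L: group L by (rule group_L)

lemma inv_L: "u \<in> carrier L \<Longrightarrow> inv\<^bsub>L\<^esub> u = inv\<^bsub>C\<^esub> u"
  using C.m_inv_consistent[OF subgroup_L] L_eq by simp

lemma L_C: "g \<in> carrier L \<Longrightarrow> g \<in> carrier C"
  using subgroup_L by (rule subgroup.mem_carrier)

lemma \<sigma>_L: "g \<in> carrier L \<Longrightarrow> \<sigma> g = g"
proof -
  assume "g \<in> carrier L"
  moreover have "subgroup {g \<in> carrier C. \<sigma> g = g} C"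
    using \<sigma>_one \<sigma>_mult \<sigma>_inv by (intro C.subgroupI) auto
  then have "generate C (fixed 1 \<union> fixed (- 1)) \<subseteq> {g \<in> carrier C. \<sigma> g = g}"
    by (rule C.generate_subgroup_incl[rotated]) (auto simp: fixed_def unipotent_C)
  ultimately show "\<sigma> g = g" by (auto simp: carrier_L)
qed

lemma fixed_L: "u \<in> fixed e \<Longrightarrow> e = 1 \<or> e = - 1 \<Longrightarrow> u \<in> carrier L"
  unfolding carrier_L by (blast intro: generate.incl)

text \<open>In a product of a unipotent and a torus element that lies in the normalizer the
  unipotent factor is trivial, by \<open>normalizer_unipotent_torus\<close>; so B \<inter> N is the
  part of the torus in the group.\<close>

lemma cartan_eq: "cartan X N \<sigma> = T \<inter> carrier L"
proof (intro equalityI subsetI)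
  fix n assume n: "n \<in> cartan X N \<sigma>"
  have "borel X N \<sigma> = (\<Union>u\<in>fixed 1. \<Union>h\<in>T \<inter> carrier L. {u \<otimes>\<^bsub>C\<^esub> h})"
    unfolding borel_def set_mult_def fixed_def unipotent_pos_eq ..
  moreover have "n \<in> borel X N \<sigma>" using n by (simp only: cartan_def IntD1)
  ultimately obtain u h where u: "u \<in> fixed 1" and h: "h \<in> T" "h \<in> carrier L" and nu: "n = u \<otimes>\<^bsub>C\<^esub> h"
    by blast
  have "n \<in> torus_normalizer X N" using n by (simp add: cartan_def monomial_def)
  then have "u = \<one>\<^bsub>C\<^esub>"
    using normalizer_unipotent_torus[OF _ nu _ h(1), of 1] u by (simp add: fixed_def)
  then have "n = h" using nu L_C[OF h(2)] by simp
  then show "n \<in> T \<inter> carrier L" using h by simp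
next
  fix h assume h: "h \<in> T \<inter> carrier L"
  have "\<one>\<^bsub>C\<^esub> \<in> fixed 1" by (rule subgroup.one_closed[OF subgroup_fixed])
  moreover have "h = \<one>\<^bsub>C\<^esub> \<otimes>\<^bsub>C\<^esub> h" using h L_C by simp
  ultimately have "h \<in> borel X N \<sigma>"
    using h unfolding borel_def set_mult_def fixed_def unipotent_pos_eq by blast
  moreover have "h \<in> torus_normalizer X N"
    using h unfolding torus_normalizer_def by (blast intro: generate.incl)
  ultimately show "h \<in> cartan X N \<sigma>" using h by (simp add: cartan_def monomial_def)
qed

abbreviation regular_pair :: "int \<Rightarrow> bool" where
  "regular_pair e \<equiv> \<exists>u\<in>fixed e. \<exists>w\<in>fixed e. regular C (T \<inter> carrier L) u \<and>
     regular C (T \<inter> carrier L) w \<and> regular C (T \<inter> carrier L) (u \<otimes>\<^bsub>C\<^esub> inv\<^bsub>C\<^esub> w)"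

theorem separable_if_regular_pairs:
  assumes reg: "regular_pair 1" "regular_pair (- 1)"
  shows "separable TYPE('b) 2 (cartan_scheme X N \<sigma>)"
proof -
  let ?H = "T \<inter> carrier L"
  have sub_L: "subgroup K L" if "subgroup K C" "K \<subseteq> carrier L" for K
    using C.subgroup_incl[OF that(1) subgroup_L that(2)] L_eq by simp
  have regular: "regular L ?H u = regular C ?H u" for u
    by (simp add: regular_def mult_L one_L)
  have conj: "h \<otimes>\<^bsub>L\<^esub> u \<otimes>\<^bsub>L\<^esub> inv\<^bsub>L\<^esub> h \<in> fixed e" if "h \<in> ?H" "u \<in> fixed e" for h u e
  proof -
    have C: "h \<in> carrier C" "u \<in> carrier C" using that L_C unipotent_C by (auto simp: fixed_def)
    have "h \<otimes>\<^bsub>C\<^esub> u \<otimes>\<^bsub>C\<^esub> inv\<^bsub>C\<^esub> h \<in> unipotent e" using that conj_unipotent by (auto simp: fixed_def)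
    moreover have "\<sigma> (h \<otimes>\<^bsub>C\<^esub> u \<otimes>\<^bsub>C\<^esub> inv\<^bsub>C\<^esub> h) = h \<otimes>\<^bsub>C\<^esub> u \<otimes>\<^bsub>C\<^esub> inv\<^bsub>C\<^esub> h"
      using C that \<sigma>_L by (simp add: \<sigma>_mult \<sigma>_inv fixed_def)
    ultimately show ?thesis using that by (simp add: fixed_def mult_L inv_L)
  qed
  have triv: "u = \<one>\<^bsub>L\<^esub>" if "u \<in> fixed e" "v \<in> fixed (- e)" "h \<in> ?H" "u = v \<otimes>\<^bsub>L\<^esub> h" for u v h e
    using unipotent_opposite[of u e v h] that by (auto simp: fixed_def mult_L one_L)
  have pair: "\<exists>u\<in>fixed e. \<exists>w\<in>fixed e. regular L ?H u \<and> regular L ?H w \<and> regular L ?H (u \<otimes>\<^bsub>L\<^esub> inv\<^bsub>L\<^esub> w)"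
    if "regular_pair e" "e = 1 \<or> e = - 1" for e
    using that inv_L[OF fixed_L] unfolding regular by (fastforce simp: mult_L)
  have "opposite_subgroups L ?H (fixed 1) (fixed (- 1))"
  proof (rule opposite_subgroups.intro[OF group_L], rule opposite_subgroups_axioms.intro)
    show "subgroup ?H L" using C.subgroups_Inter_pair[OF subgroup_T subgroup_L] by (intro sub_L) auto
    show "subgroup (fixed 1) L" "subgroup (fixed (- 1)) L" using fixed_L by (auto intro!: sub_L subgroup_fixed)
    show "carrier L = generate L (fixed 1 \<union> fixed (- 1))"
      using C.generate_consistent[of "fixed 1 \<union> fixed (- 1)" "carrier L", OF _ subgroup_L] fixed_L L_eq carrier_L by auto
    show "v = \<one>\<^bsub>L\<^esub>" if "u \<in> fixed 1" "v \<in> fixed (- 1)" "h \<in> ?H" "v = u \<otimes>\<^bsub>L\<^esub> h" for u v h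
      using triv[of v "- 1" u h] that by simp
  qed (use conj triv pair[OF reg(1)] pair[OF reg(2)] in blast)+
  then show ?thesis
    unfolding cartan_scheme_def cartan_eq by (rule opposite_subgroups.separable_2_scheme)
qed

end

section \<open>Regular pairs from coordinates\<close>

definition signed_simple :: "int \<Rightarrow> nat \<Rightarrow> root" where
  "signed_simple e i = (\<lambda>j. e * simple_root i j)"

lemma signed_simple_apply: "signed_simple e i j = (if j = i then e else 0)"
  by (simp add: signed_simple_def simple_root_def)

lemma signed_simple_inj: "e \<noteq> 0 \<Longrightarrow> signed_simple e i = signed_simple e j \<longleftrightarrow> i = j"
  by (metis signed_simple_apply)

lemma uminus_signed_simple: "- signed_simple e i = signed_simple (- e) i"
  by (auto simp: signed_simple_def)

lemma signed_simple_root: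
  assumes "i < rank X" "e = 1 \<or> e = - 1" shows "signed_simple e i \<in> roots X"
proof -
  have 1: "signed_simple 1 i \<in> roots X" using roots.simple[OF assms(1)] by (simp add: signed_simple_def)
  then show ?thesis using assms(2) uminus_root[OF 1] by (auto simp: uminus_signed_simple)
qed

context lie_type
begin

lemma signed_simple_signed: "i < rank X \<Longrightarrow> e = 1 \<or> e = - 1 \<Longrightarrow> signed_simple e i \<in> signed_roots e"
  by (auto simp: signed_roots_def signed_simple_root signed_simple_apply split: if_splits)

text \<open>The image of the opposite simple root vector is evaluated at h_i. Up to sign this adds
  up the parameters of all factors at the simple root \<open>i\<close>, however \<open>u\<close> is
  written as a product of root elements.\<close>

definition coord :: "int \<Rightarrow> nat \<Rightarrow> 'k lie_map \<Rightarrow> 'k" where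
  "coord e i u = u (\<lambda>b. if b = Root (signed_simple (- e) i) then 1 else 0) (Cartan i)"

lemma coord_entry:
  assumes i: "i < rank X" and e: "e = 1 \<or> e = - 1" and u: "represents X u M"
  shows "coord e i u = entry M (Root (signed_simple (- e) i)) (Cartan i)"
proof -
  let ?a = "Root (signed_simple (- e) i)"
  have a: "?a \<in> basis X" using signed_simple_root[OF i, of "- e"] e by auto
  have "u = matrix_map X M" using u unfolding represents_def by blast
  moreover have "(\<lambda>b. if b = ?a then 1 else 0 :: 'k) \<in> lie_space X" using a by (auto simp: lie_space_def)
  moreover have "(\<Sum>b\<in>basis X. (if b = ?a then 1 else 0) * entry M b (Cartan i)) =
      (\<Sum>b\<in>basis X. if b = ?a then entry M b (Cartan i) else 0)" by (rule sum.cong) auto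
  ultimately show ?thesis using a finite_basis by (simp add: coord_def matrix_map_def)
qed

lemma height_simple: "i < rank X \<Longrightarrow> height e (Root (signed_simple e' i)) = e * e'"
  by (simp add: height_def signed_simple_apply)

lemma unitriangularD: "unitriangular e M \<Longrightarrow> a \<in> basis X \<Longrightarrow> entry M a c \<noteq> 0 \<Longrightarrow> c \<noteq> a \<Longrightarrow> height e a < height e c"
  unfolding unitriangular_def by blast

text \<open>The opposite root vector has height -1 and the Cartan part height 0, with no level
  between them; in the product of matrices only the two end points contribute.\<close>

lemma coord_mult:
  assumes i: "i < rank X" and e: "e = 1 \<or> e = - 1" and uv: "u \<in> unipotent e" "v \<in> unipotent e"
  shows "coord e i (u \<otimes>\<^bsub>C\<^esub> v) = coord e i u + coord e i v"
proof -
  obtain A where A: "represents X u A" "unitriangular e A" using uv(1) by (rule unipotent_matrix)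
  obtain M where M: "represents X v M" "unitriangular e M" using uv(2) by (rule unipotent_matrix)
  let ?a = "Root (signed_simple (- e) i)" and ?c = "Cartan i"
  have a: "?a \<in> basis X" and c: "?c \<in> basis X" using signed_simple_root[OF i, of "- e"] e i by auto
  have "height e ?a = e * - e" by (rule height_simple[OF i])
  then have ht: "height e ?a = - 1" "height e ?c = 0" using e by (auto simp: height_def)
  have cl: "basis_closed X M" using M(1) unfolding represents_def by blast
  have "entry (M * A) ?a ?c = (\<Sum>b\<in>basis X. entry M ?a b * entry A b ?c)"
    by (rule entry_times_basis[OF cl a])
  also have "\<dots> = (\<Sum>b\<in>{?a, ?c}. entry M ?a b * entry A b ?c)"
  proof (rule sum.mono_neutral_right)
    show "\<forall>b\<in>basis X - {?a, ?c}. entry M ?a b * entry A b ?c = 0"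
    proof
      fix b assume b: "b \<in> basis X - {?a, ?c}"
      have "- 1 < height e b" if "entry M ?a b \<noteq> 0"
        using unitriangularD[OF M(2) a that] b unfolding ht by simp
      moreover have "height e b < 0" if "entry A b ?c \<noteq> 0"
        using unitriangularD[OF A(2) _ that] b unfolding ht by auto
      ultimately show "entry M ?a b * entry A b ?c = 0"
        by (cases "entry M ?a b = 0"; cases "entry A b ?c = 0") auto
    qed
  qed (use finite_basis a c in auto)
  also have "\<dots> = entry A ?a ?c + entry M ?a ?c"
    using A(2) M(2) a c by (simp add: unitriangular_def)
  finally show ?thesis
    using coord_entry[OF i e A(1)] coord_entry[OF i e M(1)] coord_entry[OF i e represents_C_mult[OF A(1) M(1)]] by simp
qed

lemma coord_x:
  assumes i: "i < rank X" and e: "e = 1 \<or> e = - 1" and r: "r \<in> roots X"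
  shows "coord e i (x r \<zeta>) = (if r = signed_simple e i then of_int e * \<zeta> else 0)"
proof -
  let ?a = "Root (signed_simple (- e) i)" and ?c = "Cartan i"
  have coord: "coord e i (x r \<zeta>) = (\<Sum>n<4. \<zeta> ^ n * of_int (entry (D r n) ?a ?c))"
    using coord_entry[OF i e represents_root[OF r]] by (simp add: root_matrix_def entry_sum)
  have nz: "n = 1 \<and> r = signed_simple e i" if "entry (D r n) ?a ?c \<noteq> 0" for n
  proof -
    have g: "0 = (\<lambda>j. signed_simple (- e) i j + int n * r j)"
      using divided_power_nonzero(1)[OF r that] by simp
    then have gj: "int n * r j = signed_simple e i j" for j
      using fun_cong[OF g, of j] by (simp add: signed_simple_apply split: if_splits)
    have "int n * r i = e" using gj[of i] by (simp add: signed_simple_apply)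
    then have "int n dvd 1" using e by (metis dvd_minus_iff dvd_triv_left minus_minus)
    then have "n = 1" by simp
    then show ?thesis using gj by auto
  qed
  show ?thesis
  proof (cases "r = signed_simple e i")
    case True
    have "entry (D r n) ?a ?c = (if n = 1 then e else 0)" for n
    proof (cases "n = 1")
      case True
      have cor: "coroot X (signed_simple e i) i = e"
        using coroot_simple[OF i, of i] coroot_uminus[OF roots.simple[OF i] i] e
        by (auto simp: signed_simple_def simple_root_def fun_Compl_def)
      have "entry (E r) (Root (- r)) ?c = e" using E_row_opposite[OF r, of ?c] cor \<open>r = signed_simple e i\<close> by simp
      then show ?thesis using True \<open>r = signed_simple e i\<close> by (simp add: uminus_signed_simple)
    qed (use nz in auto)
    then have "coord e i (x r \<zeta>) = (\<Sum>n<4. if n = 1 then \<zeta> ^ n * of_int e else 0)"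
      unfolding coord by (intro sum.cong) auto
    then show ?thesis using True by (simp add: mult.commute)
  next
    case False
    then have "entry (D r n) ?a ?c = 0" for n using nz by blast
    then show ?thesis using False coord by simp
  qed
qed

lemma coord_one: "i < rank X \<Longrightarrow> e = 1 \<or> e = - 1 \<Longrightarrow> coord e i \<one>\<^bsub>C\<^esub> = 0"
  by (simp add: coord_entry[OF _ _ represents_C_one] entry_one)

lemma coord_diff:
  assumes i: "i < rank X" and e: "e = 1 \<or> e = - 1" and uv: "u \<in> unipotent e" "v \<in> unipotent e"
  shows "coord e i (u \<otimes>\<^bsub>C\<^esub> inv\<^bsub>C\<^esub> v) = coord e i u - coord e i v"
proof -
  have v': "inv\<^bsub>C\<^esub> v \<in> unipotent e" using uv(2) subgroup.m_inv_closed[OF subgroup_unipotent] by blast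
  have "coord e i (v \<otimes>\<^bsub>C\<^esub> inv\<^bsub>C\<^esub> v) = 0" using uv(2) unipotent_C coord_one[OF i e] by simp
  then have "coord e i (inv\<^bsub>C\<^esub> v) = - coord e i v" using coord_mult[OF i e uv(2) v'] by (simp add: add_eq_0_iff)
  then show ?thesis using coord_mult[OF i e uv(1) v'] by simp
qed

abbreviation cartan_group where "cartan_group \<equiv> T \<inter> carrier L"

text \<open>At such a node a regular element meets no condition. This covers a field with two
  elements, and a fixed node of the diagram when the field automorphism fixes two elements
  only.\<close>

definition trivial_at :: "nat \<Rightarrow> bool" where
  "trivial_at i \<longleftrightarrow> (\<forall>h\<in>cartan_group. \<forall>t. toral t h \<longrightarrow> t i = 1)"

lemma toral_commute_entry:
  assumes h: "toral t h" and u: "represents X u M" and comm: "h \<otimes>\<^bsub>C\<^esub> u = u \<otimes>\<^bsub>C\<^esub> h"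
    and a: "a \<in> basis X" and nz: "entry M a c \<noteq> 0"
  shows "character t a = character t c"
proof -
  have rep: "represents X h (diag (character t))" using h by (simp add: toral_def)
  have "entry (M * diag (character t)) a c = entry (diag (character t) * M) a c"
    using iffD1[OF represents_eq_iff[OF represents_C_mult[OF rep u] represents_C_mult[OF u rep]] comm] a by blast
  then show ?thesis using nz by (simp add: entry_times_diag entry_diag_times)
qed

lemma toral_commute_coord:
  assumes i: "i < rank X" and e: "e = 1 \<or> e = - 1" and h: "toral t h" and u: "u \<in> unipotent e"
    and comm: "h \<otimes>\<^bsub>C\<^esub> u = u \<otimes>\<^bsub>C\<^esub> h" and nz: "coord e i u \<noteq> 0"
  shows "t i = 1"
proof -
  obtain M where M: "represents X u M" using u by (rule unipotent_matrix)
  let ?a = "Root (signed_simple (- e) i)"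
  have "?a \<in> basis X" using signed_simple_root[OF i, of "- e"] e by auto
  then have 1: "character t ?a = 1"
    using toral_commute_entry[OF h M comm, of ?a "Cartan i"] nz coord_entry[OF i e M] by simp
  have "character t ?a = (\<Prod>j<rank X. if j = i then t j powi (- e) else 1)"
    unfolding character_def by (rule prod.cong) (auto simp: signed_simple_apply)
  then have "t i powi (- e) = 1" using 1 i by simp
  then show ?thesis using e by (auto simp: power_int_minus)
qed

lemma regular_if_coord:
  assumes e: "e = 1 \<or> e = - 1" and u: "u \<in> unipotent e"
    and nz: "\<And>i. i < rank X \<Longrightarrow> coord e i u \<noteq> 0 \<or> trivial_at i"
  shows "regular C cartan_group u"
  unfolding regular_def
proof (intro ballI impI)
  fix h assume h: "h \<in> cartan_group" and comm: "h \<otimes>\<^bsub>C\<^esub> u = u \<otimes>\<^bsub>C\<^esub> h"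
  obtain t where t: "toral t h" using h torus_toral by blast
  have "t i = 1" if "i < rank X" for i
    using nz[OF that] toral_commute_coord[OF that e t u comm] h t by (auto simp: trivial_at_def)
  then show "h = \<one>\<^bsub>C\<^esub>" by (rule toral_eq_one[OF t])
qed

text \<open>By \<open>coord_diff\<close> the last inequality makes the coordinate of the quotient
  nonzero as well.\<close>

definition separated :: "int \<Rightarrow> nat \<Rightarrow> 'k lie_map \<Rightarrow> 'k lie_map \<Rightarrow> bool" where
  "separated e i u w \<longleftrightarrow> trivial_at i \<or> coord e i u \<noteq> 0 \<and> coord e i w \<noteq> 0 \<and> coord e i u \<noteq> coord e i w"

lemma fixed_unipotent: "u \<in> fixed e \<Longrightarrow> u \<in> unipotent e"
  by (simp add: fixed_def)

lemma regular_pair_if_separated: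
  assumes e: "e = 1 \<or> e = - 1" and uw: "u \<in> fixed e" "w \<in> fixed e"
    and sep: "\<And>i. i < rank X \<Longrightarrow> separated e i u w"
  shows "regular_pair e"
proof (rule bexI[of _ u], rule bexI[of _ w], intro conjI)
  have uw': "u \<in> unipotent e" "w \<in> unipotent e" using uw fixed_unipotent by auto
  then have "u \<otimes>\<^bsub>C\<^esub> inv\<^bsub>C\<^esub> w \<in> unipotent e"
    using subgroup.m_closed[OF subgroup_unipotent] subgroup.m_inv_closed[OF subgroup_unipotent] by blast
  then show "regular C cartan_group (u \<otimes>\<^bsub>C\<^esub> inv\<^bsub>C\<^esub> w)"
    by (rule regular_if_coord[OF e]) (use sep coord_diff[OF _ e uw'] in \<open>auto simp: separated_def\<close>)
  show "regular C cartan_group u" "regular C cartan_group w"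
    using sep by (auto intro!: regular_if_coord[OF e] uw' simp: separated_def)
qed (use uw in auto)

text \<open>The elements for single orbits are multiplied together. Coordinates add, and each factor
  is invisible outside its own orbit, so earlier orbits are not disturbed.\<close>

lemma regular_pair_if_orbits:
  assumes e: "e = 1 \<or> e = - 1"
    and orb: "\<And>i. i < rank X \<Longrightarrow> i \<in> orb i" "\<And>i j. i < rank X \<Longrightarrow> j \<in> orb i \<Longrightarrow> orb j = orb i"
    and sep: "\<And>i. i < rank X \<Longrightarrow> \<exists>u\<in>fixed e. \<exists>w\<in>fixed e. \<forall>j<rank X.
      if j \<in> orb i then separated e j u w else coord e j u = 0 \<and> coord e j w = 0"
  shows "regular_pair e"
proof -
  have "\<exists>u\<in>fixed e. \<exists>w\<in>fixed e. \<forall>j<rank X.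
      if \<exists>i<n. j \<in> orb i then separated e j u w else coord e j u = 0 \<and> coord e j w = 0" if "n \<le> rank X" for n
    using that
  proof (induction n)
    case 0
    have "\<one>\<^bsub>C\<^esub> \<in> fixed e" by (rule subgroup.one_closed[OF subgroup_fixed])
    then show ?case using coord_one[OF _ e] by auto
  next
    case (Suc n)
    then obtain u w where uw: "u \<in> fixed e" "w \<in> fixed e" and
      P: "\<And>j. j < rank X \<Longrightarrow> if \<exists>i<n. j \<in> orb i then separated e j u w else coord e j u = 0 \<and> coord e j w = 0"
      by auto
    have n: "n < rank X" using Suc.prems by simp
    show ?case
    proof (cases "\<exists>i<n. n \<in> orb i")
      case True
      then obtain i where "i < n" "n \<in> orb i" by blast
      then have "orb n = orb i" using orb(2)[of i n] n by simp
      then have iff: "(\<exists>i<Suc n. j \<in> orb i) \<longleftrightarrow> (\<exists>i<n. j \<in> orb i)" for j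
        using \<open>i < n\<close> by (auto simp: less_Suc_eq)
      show ?thesis unfolding iff using P uw by blast
    next
      case False
      obtain y z where yz: "y \<in> fixed e" "z \<in> fixed e" and
        Q: "\<And>j. j < rank X \<Longrightarrow> if j \<in> orb n then separated e j y z else coord e j y = 0 \<and> coord e j z = 0"
        using sep[OF n] by blast
      have disj: "\<not> (\<exists>i<n. j \<in> orb i)" if j: "j < rank X" "j \<in> orb n" for j
      proof
        assume "\<exists>i<n. j \<in> orb i"
        then obtain i where i: "i < n" "j \<in> orb i" by blast
        then have "orb j = orb i" "orb j = orb n" using orb(2)[of i j] orb(2)[of n j] n j by auto
        then show False using False i(1) orb(1)[OF n] by auto
      qed
      show ?thesis
      proof (intro bexI allI impI)
        fix j assume j: "j < rank X"
        have c: "coord e j (u \<otimes>\<^bsub>C\<^esub> y) = coord e j u + coord e j y" "coord e j (w \<otimes>\<^bsub>C\<^esub> z) = coord e j w + coord e j z"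
          using coord_mult[OF j e] fixed_unipotent uw yz by auto
        show "if \<exists>i<Suc n. j \<in> orb i then separated e j (u \<otimes>\<^bsub>C\<^esub> y) (w \<otimes>\<^bsub>C\<^esub> z)
            else coord e j (u \<otimes>\<^bsub>C\<^esub> y) = 0 \<and> coord e j (w \<otimes>\<^bsub>C\<^esub> z) = 0"
          using P[OF j] Q[OF j] disj[OF j] c by (auto simp: less_Suc_eq separated_def split: if_splits)
      qed (use uw yz subgroup.m_closed[OF subgroup_fixed] in auto)
    qed
  qed
  from this[of "rank X"] obtain u w where uw: "u \<in> fixed e" "w \<in> fixed e"
    and P: "\<And>j. j < rank X \<Longrightarrow> if \<exists>i<rank X. j \<in> orb i then separated e j u w else coord e j u = 0 \<and> coord e j w = 0"
    by blast
  show ?thesis by (rule regular_pair_if_separated[OF e uw]) (use P orb(1) in metis)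
qed

lemma trivial_if_two:
  assumes "\<And>\<zeta> :: 'k. \<zeta> = 0 \<or> \<zeta> = 1" shows "trivial_at i"
  using assms by (metis toral_def trivial_at_def)

lemma x_unipotent: "r \<in> signed_roots e \<Longrightarrow> x r \<zeta> \<in> unipotent e"
  unfolding unipotent_def by (rule generate.incl) blast

lemma regular_pair_untwisted:
  assumes id: "\<And>u. \<sigma> u = u" and e: "e = 1 \<or> e = - 1"
  shows "regular_pair e"
proof (rule regular_pair_if_orbits[OF e, where orb = "\<lambda>i. {i}"])
  fix i assume i: "i < rank X"
  have fixed: "x (signed_simple e i) \<zeta> \<in> fixed e" for \<zeta>
    using x_unipotent[OF signed_simple_signed[OF i e]] id by (simp add: fixed_def)
  have coord: "coord e j (x (signed_simple e i) \<zeta>) = (if j = i then of_int e * \<zeta> else 0)" if "j < rank X" for j \<zeta>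
    using coord_x[OF that e signed_simple_root[OF i e]] e signed_simple_inj[of e i j] by auto
  obtain \<zeta> :: 'k where z: "trivial_at i \<or> \<zeta> \<noteq> 0 \<and> \<zeta> \<noteq> 1" using trivial_if_two by metis
  show "\<exists>u\<in>fixed e. \<exists>w\<in>fixed e. \<forall>j<rank X.
      if j \<in> {i} then separated e j u w else coord e j u = 0 \<and> coord e j w = 0"
    using z e coord by (intro bexI[OF _ fixed[of 1]] bexI[OF _ fixed[of \<zeta>]]) (auto simp: separated_def)
qed auto

end

section \<open>Commutator relations\<close>

lemma smul_sum: "smul k (\<Sum>i\<in>I. A i) = (\<Sum>i\<in>I. smul k (A i))"
  by (rule rmat_eqI) (simp add: entry_sum sum_distrib_left)

lemma smul_eq_0_int: "smul (k::int) A = 0 \<Longrightarrow> k \<noteq> 0 \<Longrightarrow> A = 0"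
  by (rule rmat_eqI) (metis entry_smul mult_eq_0_iff zero_rmat.rep_eq)

context chevalley
begin

lemma E_commute:
  assumes "r \<in> roots X" "s \<in> roots X" "r + s \<notin> roots X" "s \<noteq> - r"
  shows "E r * E s = E s * E r"
  using ad_commute[of "Root r" "Root s"] assms by simp

lemma E_commutator:
  assumes "r \<in> roots X" "s \<in> roots X" "r + s \<in> roots X"
  shows "E s * E r = E r * E s + smul (N r s) (E (r + s))"
proof -
  have "s \<noteq> - r" using assms(3) by auto
  then have "basis_bracket X N (Root r) (Root s) = (\<lambda>c. N r s * unit_vector (Root (r + s)) c)" using assms by simp
  moreover have "(\<Sum>b\<in>basis X. smul (N r s * unit_vector (Root (r + s)) b) (ad_matrix X N b)) =
      (\<Sum>b\<in>basis X. if b = Root (r + s) then smul (N r s) (E (r + s)) else 0)"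
    by (rule sum.cong) (auto simp: unit_vector_def)
  ultimately show ?thesis
    using ad_commute[of "Root r" "Root s"] assms finite_basis by (simp del: basis_bracket.simps)
qed

lemma divided_power_commute:
  assumes rs: "r \<in> roots X" "s \<in> roots X" and comm: "E r * E s = E s * E r"
  shows "D r m * D s n = D s n * D r m"
proof (rule smul_cancel)
  let ?k = "fact m * fact n :: int"
  show "?k \<noteq> 0" by simp
  have "E r ^ m * E s ^ n = E s ^ n * E r ^ m"
    by (rule power_commuting_commutes[OF power_commuting_commutes[OF comm[symmetric], symmetric]])
  then have "smul (fact m) (D r m) * smul (fact n) (D s n) = smul (fact n) (D s n) * smul (fact m) (D r m)"
    by (simp only: fact_divided_power rs)
  then show "smul ?k (D r m * D s n) = smul ?k (D s n * D r m)"
    by (simp add: smul_times_left smul_times_right mult.commute)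
qed

lemma root_matrix_commute:
  assumes rs: "r \<in> roots X" "s \<in> roots X" and comm: "E r * E s = E s * E r"
  shows "root_matrix r \<zeta> * root_matrix s \<eta> = root_matrix s \<eta> * root_matrix r \<zeta>"
proof -
  have "rmap (D r m) * rmap (D s n) = (rmap (D s n) * rmap (D r m) :: (lie_index, 'a) rmat)" for m n
    using divided_power_commute[OF assms, of m n] by (metis rmap_times)
  then show ?thesis
    unfolding root_matrix_def sum_distrib_left sum_distrib_right smul_times_left smul_times_right smul_smul
      smul_sum
    by (subst sum.swap) (simp add: mult.commute)
qed

end

text \<open>\<open>A\<close>, \<open>B\<close>, \<open>K\<close> form a Heisenberg algebra, and
  \<open>A2\<close>, \<open>B2\<close>, \<open>K2\<close> stand for half their squares. Identities
  are proved after doubling or tripling, and the torsion hypothesis divides them back; integral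
  matrices satisfy it, and the results can be reduced to any characteristic.\<close>

lemma heisenberg_divided_powers:
  fixes A B K :: "'a::ring_1"
  assumes AB: "A * B = B * A + K" and KA: "K * A = A * K" and KB: "K * B = B * K"
    and cube: "A * (A * A) = 0" "B * (B * B) = 0"
    and A2: "A2 + A2 = A * A" and B2: "B2 + B2 = B * B" and K2: "K2 + K2 = K * K"
    and tors: "\<forall>x y :: 'a. x + x = y + y \<longrightarrow> x = y" "\<forall>x :: 'a. x + x + x = 0 \<longrightarrow> x = 0"
  shows "A * B2 = B2 * A + B * K" "A2 * B = B * A2 + A * K" "A2 * B2 = B2 * A2 + B * A * K + K2"
    "A2 * K = 0" "B2 * K = 0" "A * K2 = 0" "B * K2 = 0" "A2 * K2 = 0" "B2 * K2 = 0" "B2 * (A * K) = 0"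
proof -
  have torsion2: "x = y" if "x + x = y + y" for x y :: 'a using tors(1) that by blast
  have torsion3: "x = 0" if "x + x + x = 0" for x :: 'a using tors(2) that by blast
  have AB': "A * (B * x) = B * (A * x) + K * x" for x using AB by (metis distrib_right mult.assoc)
  have KA': "K * (A * x) = A * (K * x)" for x using KA by (metis mult.assoc)
  have KB': "K * (B * x) = B * (K * x)" for x using KB by (metis mult.assoc)
  note norm = AB AB' KA KA' KB KB' distrib_left distrib_right mult.assoc
  have t2: "x = 0" if "x + x = 0" for x :: 'a using torsion2[of x 0] that by simp
  \<comment> \<open>Moving \<open>B\<close> to the left through the vanishing cube of
    \<open>A\<close> leaves three times this product.\<close>
  have AAK: "A * (A * K) = 0"
  proof (rule torsion3)
    have "A * (A * (A * B)) = (A * (A * A)) * B" by (simp only: mult.assoc)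
    then show "A * (A * K) + A * (A * K) + A * (A * K) = 0" by (simp add: norm cube add_ac)
  qed
  have BBK: "B * (B * K) = 0"
  proof (rule torsion3)
    have "A * (B * (B * B)) = 0" using cube(2) by simp
    moreover have "B * (B * (B * A)) = (B * (B * B)) * A" by (simp only: mult.assoc)
    then have "B * (B * (B * A)) = 0" using cube(2) by simp
    ultimately show "B * (B * K) + B * (B * K) + B * (B * K) = 0" by (simp add: norm add_ac)
  qed
  have AKK: "A * (K * K) = 0"
  proof (rule t2)
    have "A * (A * (K * B)) = (A * (A * K)) * B" by (simp only: mult.assoc)
    then show "A * (K * K) + A * (K * K) = 0" by (simp add: norm AAK add_ac)
  qed
  have BKK: "B * (K * K) = 0"
  proof (rule t2)
    have "A * (B * (B * K)) = 0" using BBK by simp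
    moreover have "B * (B * (A * K)) = (B * (B * K)) * A" by (simp only: KA mult.assoc)
    then have "B * (B * (A * K)) = 0" using BBK by simp
    ultimately show "B * (K * K) + B * (K * K) = 0" by (simp add: norm add_ac)
  qed
  show 1: "A * B2 = B2 * A + B * K"
  proof (rule torsion2)
    have "A * B2 + A * B2 = A * (B * B)" by (simp flip: B2 add: distrib_left)
    also have "\<dots> = (B2 + B2) * A + (B * K + B * K)" unfolding B2 by (simp add: norm add_ac)
    finally show "A * B2 + A * B2 = (B2 * A + B * K) + (B2 * A + B * K)" by (simp add: distrib_right add_ac)
  qed
  show 2: "A2 * B = B * A2 + A * K"
  proof (rule torsion2)
    have "A2 * B + A2 * B = A * A * B" by (simp flip: A2 add: distrib_right)
    also have "\<dots> = B * (A2 + A2) + (A * K + A * K)" unfolding A2 by (simp add: norm add_ac)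
    finally show "A2 * B + A2 * B = (B * A2 + A * K) + (B * A2 + A * K)" by (simp add: distrib_left add_ac)
  qed
  show "A2 * B2 = B2 * A2 + B * A * K + K2"
  proof (rule torsion2)
    have "A2 * B2 + A2 * B2 = A2 * (B * B)" by (simp flip: B2 add: distrib_left)
    also have "\<dots> = (A2 * B) * B" by (simp only: mult.assoc)
    also have "\<dots> = (B * A2 + A * K) * B" by (simp only: 2)
    also have "\<dots> = B * (A2 * B) + A * (K * B)" by (simp only: distrib_right mult.assoc)
    also have "\<dots> = B * (B * A2) + B * (A * K) + (B * (A * K) + K * K)"
      unfolding 2 KB by (simp add: norm)
    also have "\<dots> = (B2 + B2) * A2 + (B * A * K + B * A * K) + (K2 + K2)"
      unfolding B2 K2 by (simp add: mult.assoc add_ac)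
    finally show "A2 * B2 + A2 * B2 = (B2 * A2 + B * A * K + K2) + (B2 * A2 + B * A * K + K2)"
      by (simp add: distrib_right add_ac)
  qed
  have "A2 * K + A2 * K = A * (A * K)" by (simp flip: A2 mult.assoc add: distrib_right)
  then show "A2 * K = 0" unfolding AAK by (rule t2)
  have "B2 * K + B2 * K = B * (B * K)" by (simp flip: B2 mult.assoc add: distrib_right)
  then show B2K: "B2 * K = 0" unfolding BBK by (rule t2)
  have "A * K2 + A * K2 = A * (K * K)" by (simp flip: K2 add: distrib_left)
  then show AK2: "A * K2 = 0" unfolding AKK by (rule t2)
  have "B * K2 + B * K2 = B * (K * K)" by (simp flip: K2 add: distrib_left)
  then show BK2: "B * K2 = 0" unfolding BKK by (rule t2)
  have "A2 * K2 + A2 * K2 = A * (A * K2)" by (simp flip: A2 mult.assoc add: distrib_right)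
  then show "A2 * K2 = 0" unfolding AK2 mult_zero_right by (rule t2)
  have "B2 * K2 + B2 * K2 = B * (B * K2)" by (simp flip: B2 mult.assoc add: distrib_right)
  then show "B2 * K2 = 0" unfolding BK2 mult_zero_right by (rule t2)
  have "A * (B2 * K) = B2 * (A * K) + B * (K * K)" using 1 by (metis distrib_right mult.assoc)
  then show "B2 * (A * K) = 0" using B2K BKK by simp
qed

context chevalley
begin

text \<open>Chevalley's commutator formula in type A2. The exponentials end with their quadratic
  terms, and comparing the expanded sides leaves the identities of
  \<open>heisenberg_divided_powers\<close>.\<close>

lemma A2_commutator:
  fixes \<zeta> \<eta> :: "'k::comm_ring_1"
  assumes roots: "r \<in> roots X" "s \<in> roots X" "r + s \<in> roots X"
    and comm: "E r * E (r + s) = E (r + s) * E r" "E s * E (r + s) = E (r + s) * E s"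
    and cube: "E r ^ 3 = 0" "E s ^ 3 = 0" "E (r + s) ^ 3 = 0"
    and N: "N r s * N r s = 1"
  shows "root_matrix r \<zeta> * root_matrix s \<eta> =
    root_matrix s \<eta> * root_matrix r \<zeta> * root_matrix (r + s) (of_int (- N r s) * (\<zeta> * \<eta>))"
proof -
  let ?\<epsilon> = "- N r s"
  let ?A = "E r" and ?B = "E s" and ?K = "smul ?\<epsilon> (E (r + s))"
  let ?A2 = "D r 2" and ?B2 = "D s 2" and ?K2 = "D (r + s) 2"
  have two: "D q 2 + D q 2 = E q * E q" if "q \<in> roots X" for q
    using fact_divided_power[OF that, of 2] smul_add_scalar[of 1 1 "D q 2"] by (simp add: power2_eq_square fact_2)
  have D3: "D q 3 = 0" if "q \<in> roots X" "E q ^ 3 = 0" for q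
    by (rule rmat_eqI) (simp add: entry_divided_power that)
  have AB: "?A * ?B = ?B * ?A + ?K"
    using E_commutator[OF roots] by (simp add: smul_uminus_scalar)
  have K: "?K * ?A = ?A * ?K" "?K * ?B = ?B * ?K"
    using comm by (simp_all add: smul_times_left smul_times_right)
  have cube': "?A * (?A * ?A) = 0" "?B * (?B * ?B) = 0"
    using cube by (simp_all add: power3_eq_cube mult.assoc)
  have sq: "?A2 + ?A2 = ?A * ?A" "?B2 + ?B2 = ?B * ?B" "?K2 + ?K2 = ?K * ?K"
    using two roots N by (simp_all add: smul_times_left smul_times_right)
  have t2: "M = M'" if "M + M = M' + M'" for M M' :: "(lie_index, int) rmat"
  proof (rule smul_cancel[of 2])
    show "smul 2 M = smul 2 M'" using that smul_add_scalar[of 1 1 M] smul_add_scalar[of 1 1 M'] by simp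
  qed simp
  have t3: "M = 0" if "M + M + M = 0" for M :: "(lie_index, int) rmat"
  proof (rule smul_eq_0_int[of 3])
    show "smul 3 M = 0" using that smul_add_scalar[of 2 1 M] smul_add_scalar[of 1 1 M] by simp
  qed simp
  have tors: "\<forall>M M' :: (lie_index, int) rmat. M + M = M' + M' \<longrightarrow> M = M'"
    "\<forall>M :: (lie_index, int) rmat. M + M + M = 0 \<longrightarrow> M = 0" using t2 t3 by blast+
  note H = AB heisenberg_divided_powers[OF AB K cube' sq tors]
  let ?m = "rmap :: (lie_index, int) rmat \<Rightarrow> (lie_index, 'k) rmat"
  have "?m ?A * ?m ?B = ?m ?B * ?m ?A + ?m ?K" "?m ?A * ?m ?B2 = ?m ?B2 * ?m ?A + ?m ?B * ?m ?K"
    "?m ?A2 * ?m ?B = ?m ?B * ?m ?A2 + ?m ?A * ?m ?K"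
    "?m ?A2 * ?m ?B2 = ?m ?B2 * ?m ?A2 + ?m ?B * ?m ?A * ?m ?K + ?m ?K2"
    "?m ?A2 * ?m ?K = 0" "?m ?B2 * ?m ?K = 0" "?m ?A * ?m ?K2 = 0" "?m ?B * ?m ?K2 = 0"
    "?m ?A2 * ?m ?K2 = 0" "?m ?B2 * ?m ?K2 = 0" "?m ?B2 * (?m ?A * ?m ?K) = 0"
    unfolding rmap_times[symmetric] rmap_add[symmetric] H by simp_all
  note M = this
  define A B A2 B2 K K2 where AB_def: "A = ?m ?A" "B = ?m ?B" "A2 = ?m ?A2" "B2 = ?m ?B2" "K = ?m ?K" "K2 = ?m ?K2"
  have X: "root_matrix r \<zeta> = 1 + smul \<zeta> A + smul (\<zeta> ^ 2) A2" "root_matrix s \<eta> = 1 + smul \<eta> B + smul (\<eta> ^ 2) B2"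
    using D3 roots cube by (simp_all add: root_matrix_expand AB_def)
  have "of_int ?\<epsilon> * of_int ?\<epsilon> = (1 :: 'k)" using N by (metis mult_minus_left mult_minus_right minus_minus of_int_1 of_int_mult)
  then have XK: "root_matrix (r + s) (of_int ?\<epsilon> * (\<zeta> * \<eta>)) = 1 + smul (\<zeta> * \<eta>) K + smul (\<zeta> ^ 2 * \<eta> ^ 2) K2"
    using D3[OF roots(3) cube(3)]
    by (simp add: root_matrix_expand AB_def rmap_smul power_mult_distrib power2_eq_square mult_ac)
  show ?thesis
    unfolding X XK
    by (rule rmat_eqI)
      (simp add: distrib_left distrib_right smul_times_left smul_times_right smul_add M[folded AB_def] mult.assoc,
       simp add: algebra_simps power2_eq_square)
qed

end

section \<open>Twisted groups with roots of one length\<close>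

lemma field_automorphism_simps:
  assumes f: "field_automorphism f"
  shows "f 0 = 0" "f 1 = 1" "f (x + y) = f x + f y" "f (x * y) = f x * f y" "f (- x) = - f x"
    "f x = f y \<longleftrightarrow> x = y" "f (inverse x) = inverse (f x)"
proof -
  show add: "f (x + y) = f x + f y" and mult: "f (x * y) = f x * f y" for x y
    using f by (auto simp: field_automorphism_def)
  show 0: "f 0 = 0" using add[of 0 0] by (metis add.right_neutral add_left_cancel)
  show eq: "f x = f y \<longleftrightarrow> x = y" for x y using f by (auto simp: field_automorphism_def bij_def inj_eq)
  have "f 1 \<noteq> 0" using eq[of 1 0] 0 by simp
  then show 1: "f 1 = 1" using mult[of 1 1] by simp
  have "f (- x) + f x = 0" using add[of "- x" x] 0 by simp
  then show "f (- x) = - f x" by (simp add: add_eq_0_iff2)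
  show "f (inverse x) = inverse (f x)"
  proof (cases "x = 0")
    case False
    then have "f (inverse x) * f x = 1" using mult[of "inverse x" x] 1 by simp
    then show ?thesis by (metis inverse_unique mult.commute)
  qed (simp add: 0)
qed

context chevalley
begin

text \<open>The norms of the grades after 0 to 3 steps satisfy q0 + q3 = q1 + q2 + 4 (r, r), which
  is at least 8, whereas all norms are at most 2.\<close>

lemma power_3:
  assumes len: "\<And>i. i < rank X \<Longrightarrow> sqlen X i = 2" and r: "r \<in> roots X"
  shows "E r ^ 3 = 0"
proof (rule rmat_eqI, rule ccontr)
  fix a c assume "entry (E r ^ 3) a c \<noteq> entry 0 a c"
  then have ac: "entry (E r ^ 3) a c \<noteq> 0" by simp
  then have "entry (E r ^ 1 * E r ^ 2) a c \<noteq> 0" by (simp flip: power_add add: eval_nat_numeral)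
  then obtain b where b: "entry (E r ^ 1) a b \<noteq> 0" by (rule entry_times_nonzero)
  have "entry (E r ^ 2 * E r ^ 1) a c \<noteq> 0" using ac by (simp only: power_add[symmetric]) simp
  then obtain d where d: "entry (E r ^ 2) a d \<noteq> 0" by (rule entry_times_nonzero)
  have norm2: "inner X s s = 2" if "s \<in> roots X" for s using root_norm[OF that] len by metis
  have a: "a \<in> basis X" using power_nonzero(3)[OF r ac] by simp
  have bcd: "b \<in> basis X" "d \<in> basis X" "c \<in> basis X" using power_nonzero(2)[OF r] a b d ac by blast+
  have norm: "0 \<le> inner X (grade q) (grade q) \<and> inner X (grade q) (grade q) \<le> 2" if "q \<in> basis X" for q
    using basis_grade[OF that] norm2[of "grade q"] by auto
  note norms = norm[OF a] norm[OF bcd(1)] norm[OF bcd(2)] norm[OF bcd(3)]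
  let ?g = "grade a"
  have g: "grade b = (\<lambda>i. ?g i + 1 * r i)" "grade d = (\<lambda>i. ?g i + 2 * r i)" "grade c = (\<lambda>i. ?g i + 3 * r i)"
    using power_nonzero(1)[OF r b] power_nonzero(1)[OF r d] power_nonzero(1)[OF r ac] by auto
  have n: "inner X (\<lambda>i. ?g i + k * r i) (\<lambda>i. ?g i + k * r i) = inner X ?g ?g + 2 * k * inner X ?g r + k * k * inner X r r" for k
    by (simp only: inner_lin inner_lin_right inner_sym[of X r ?g]) (simp add: algebra_simps)
  show False using norms norm2[OF r] unfolding g n by linarith
qed

end

context lie_type
begin

text \<open>From \<open>- r\<close> a Cartan index is reached by a single step of \<open>r\<close>
  and by no other root. This entry tells root subgroups apart and recovers the parameter.\<close>

lemma root_matrix_opposite: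
  assumes r: "r \<in> roots X" and s: "s \<in> roots X"
  shows "entry (root_matrix s \<zeta>) (Root (- r)) (Cartan i) = (if s = r then of_int (coroot X r i) * \<zeta> else 0 :: 'k)"
proof -
  have "entry (D s n) (Root (- r)) (Cartan i) = (if n = 1 \<and> s = r then coroot X r i else 0)" for n
  proof (cases "n = 1 \<and> s = r")
    case True
    then show ?thesis using E_row_opposite[OF r, of "Cartan i"] by simp
  next
    case False
    have "entry (D s n) (Root (- r)) (Cartan i) = 0"
    proof (rule ccontr)
      assume nz: "entry (D s n) (Root (- r)) (Cartan i) \<noteq> 0"
      have "(\<lambda>j. int n * s j) = r"
        using divided_power_nonzero(1)[OF s nz] by (auto simp: fun_eq_iff algebra_simps)
      moreover from this have "\<bar>int n\<bar> = 1" using root_multiple[OF s, of "int n"] r by simp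
      ultimately show False using False by auto
    qed
    then show ?thesis by (simp only: if_not_P[OF False])
  qed
  then have "entry (root_matrix s \<zeta>) (Root (- r)) (Cartan i) =
      (\<Sum>n<4::nat. if n = 1 then (if s = r then of_int (coroot X r i) * \<zeta> else 0) else 0)"
    unfolding root_matrix_def entry_sum by (intro sum.cong) auto
  then show ?thesis by simp
qed

text \<open>The coroot coefficient stays in the conclusion because it may vanish in the field; each
  application chooses a node where it does not.\<close>

lemma x_injective:
  assumes r: "r \<in> roots X" and one: "x r \<zeta> = \<one>\<^bsub>C\<^esub>"
  shows "of_int (coroot X r i) * \<zeta> = 0"
proof -
  have "Root (- r) \<in> basis X" using uminus_root[OF r] by simp
  then have "entry (root_matrix r \<zeta>) (Root (- r)) (Cartan i) = entry 1 (Root (- r)) (Cartan i)"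
    using iffD1[OF represents_eq_iff[OF represents_root[OF r] represents_C_one] one] by blast
  then show ?thesis using root_matrix_opposite[OF r r, of \<zeta> i] by (simp add: entry_one)
qed

lemma x_commute:
  assumes "r \<in> roots X" "s \<in> roots X" "r + s \<notin> roots X" "s \<noteq> - r"
  shows "x r \<zeta> \<otimes>\<^bsub>C\<^esub> x s \<eta> = x s \<eta> \<otimes>\<^bsub>C\<^esub> x r \<zeta>"
  using represents_eq_iff[OF represents_C_mult[OF represents_root[OF assms(1)] represents_root[OF assms(2)]]
      represents_C_mult[OF represents_root[OF assms(2)] represents_root[OF assms(1)]]]
    root_matrix_commute[OF assms(1,2) E_commute[OF assms]] by metis

end

locale simply_laced_twist = lie_type X N k \<sigma>
  for X N and k :: "'k::{field,finite} itself" and \<sigma> +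
  fixes \<rho> :: "nat \<Rightarrow> nat" and f :: "'k \<Rightarrow> 'k" and \<gamma> :: "root \<Rightarrow> 'k"
  assumes f: "field_automorphism f" and f_id: "f \<noteq> id"
    and len: "i < rank X \<Longrightarrow> sqlen X i = 2"
    and \<rho>: "bij_betw \<rho> {..<rank X} {..<rank X}"
    and \<rho>_gram: "i < rank X \<Longrightarrow> j < rank X \<Longrightarrow> gram X (\<rho> i) (\<rho> j) = gram X i j"
    and \<sigma>_x: "r \<in> roots X \<Longrightarrow> \<sigma> (x r \<zeta>) = x (root_bar X \<rho> r) (\<gamma> r * f \<zeta>)"
    and \<gamma>: "\<gamma> r = 1 \<or> \<gamma> r = - 1" "i < rank X \<Longrightarrow> \<gamma> (simple_root i) = 1" "i < rank X \<Longrightarrow> \<gamma> (- simple_root i) = 1"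
begin

lemmas f_simps = field_automorphism_simps[OF f]

lemma \<rho>_less: "i < rank X \<Longrightarrow> \<rho> i < rank X"
  using \<rho> by (auto simp: bij_betw_def)

lemma norm2: "r \<in> roots X \<Longrightarrow> inner X r r = 2"
  using root_norm len by metis

lemma coroot2: "r \<in> roots X \<Longrightarrow> i < rank X \<Longrightarrow> coroot X r i = r i"
  using coroot_eq[of r X i] by (simp add: norm2 len)

lemma root_bar_eq: "r \<in> roots X \<Longrightarrow> root_bar X \<rho> r = (\<lambda>j. \<Sum>i<rank X. r i * simple_root (\<rho> i) j)"
  unfolding root_bar_def by (intro ext sum.cong) (auto simp: coroot2)

lemma sum_signed_simple:
  "i < rank X \<Longrightarrow> (\<Sum>j<rank X. signed_simple e i j * simple_root (\<rho> j) l) = signed_simple e (\<rho> i) l"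
proof -
  assume i: "i < rank X"
  have "(\<Sum>j<rank X. signed_simple e i j * simple_root (\<rho> j) l) =
      (\<Sum>j<rank X. if j = i then e * simple_root (\<rho> i) l else 0)"
    by (rule sum.cong) (auto simp: signed_simple_apply)
  then show ?thesis using i by (simp add: signed_simple_def)
qed

lemma \<sigma>_simple:
  assumes i: "i < rank X" and e: "e = 1 \<or> e = - 1"
  shows "\<sigma> (x (signed_simple e i) \<zeta>) = x (signed_simple e (\<rho> i)) (f \<zeta>)"
proof -
  have "root_bar X \<rho> (signed_simple e i) = signed_simple e (\<rho> i)"
    unfolding root_bar_eq[OF signed_simple_root[OF i e]] using sum_signed_simple[OF i] by (intro ext)
  moreover have "\<gamma> (signed_simple e i) = 1"
    using e \<gamma>(2,3)[OF i] by (auto simp: signed_simple_def fun_Compl_def)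
  ultimately show ?thesis using \<sigma>_x[OF signed_simple_root[OF i e]] by simp
qed

lemma inner_signed_simple:
  assumes "i < rank X" "j < rank X" "e = 1 \<or> e = - 1"
  shows "inner X (signed_simple e i) (signed_simple e j) = gram X i j"
proof -
  have "inner X (simple_root i) (simple_root j) = gram X i j"
  proof -
    have "(\<Sum>l<rank X. simple_root j l * gram X i l) = (\<Sum>l<rank X. if l = j then gram X i j else 0)"
      by (rule sum.cong) (auto simp: simple_root_def)
    then show ?thesis using assms by (simp add: inner_simple)
  qed
  then have 1: "inner X (signed_simple 1 i) (signed_simple 1 j) = gram X i j" by (simp add: signed_simple_def)
  have "inner X (- signed_simple 1 i) (- signed_simple 1 j) = gram X i j"
    unfolding inner_uminus inner_uminus_right 1 by simp
  then show ?thesis using 1 assms(3) by (auto simp: uminus_signed_simple)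
qed

lemma x_commute_orthogonal:
  assumes ij: "i < rank X" "j < rank X" "i \<noteq> j" "gram X i j = 0" and e: "e = 1 \<or> e = - 1"
  shows "x (signed_simple e i) \<zeta> \<otimes>\<^bsub>C\<^esub> x (signed_simple e j) \<eta> =
    x (signed_simple e j) \<eta> \<otimes>\<^bsub>C\<^esub> x (signed_simple e i) \<zeta>"
proof (rule x_commute)
  let ?r = "signed_simple e i" and ?s = "signed_simple e j"
  show roots: "?r \<in> roots X" "?s \<in> roots X" using signed_simple_root ij e by auto
  have "inner X (?r + ?s) (?r + ?s) = 4"
    using norm2[OF roots(1)] norm2[OF roots(2)] inner_signed_simple[OF ij(1,2) e] ij(4)
    by (simp add: inner_add inner_add_right inner_sym[of X ?s ?r])
  then show "?r + ?s \<notin> roots X" using norm2 by fastforce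
  show "?s \<noteq> - ?r" using e ij(3) by (metis add.inverse_neutral signed_simple_apply uminus_signed_simple zero_neq_neg_one zero_neq_one)
qed

lemma ex_moved: "\<exists>\<zeta>. f \<zeta> \<noteq> \<zeta>"
  using f_id by (auto simp: fun_eq_iff)

text \<open>Elements of the twisted group are fixed by \<sigma>. Applied to the conjugation of a
  simple root element this puts \<open>t i\<close> into the fixed field of \<open>f\<close>, whose
  only nonzero element is 1.\<close>

lemma trivial_at_fixed_node:
  assumes i: "i < rank X" "\<rho> i = i" and fix_f: "\<And>\<zeta>. f \<zeta> = \<zeta> \<Longrightarrow> \<zeta> = 0 \<or> \<zeta> = 1"
  shows "trivial_at i"
  unfolding trivial_at_def
proof (intro ballI allI impI)
  fix h t assume h: "h \<in> cartan_group" and t: "toral t h"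
  let ?r = "signed_simple 1 i"
  have r: "?r \<in> roots X" using signed_simple_root[OF i(1)] by simp
  have hC: "h \<in> carrier C" using h L_C by blast
  have ti: "character t (Root ?r) = t i" using character_simple[OF i(1)] by (simp add: signed_simple_def)
  have 1: "h \<otimes>\<^bsub>C\<^esub> x ?r 1 = x ?r (t i) \<otimes>\<^bsub>C\<^esub> h" using toral_conj[OF t r, of 1] ti by simp
  have "\<sigma> (h \<otimes>\<^bsub>C\<^esub> x ?r 1) = \<sigma> (x ?r (t i) \<otimes>\<^bsub>C\<^esub> h)" by (simp only: 1)
  then have "h \<otimes>\<^bsub>C\<^esub> x ?r 1 = x ?r (f (t i)) \<otimes>\<^bsub>C\<^esub> h"
    using \<sigma>_simple[OF i(1), of 1] i(2) h \<sigma>_L hC x_C[OF r] by (simp add: \<sigma>_mult f_simps)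
  then have "x ?r (t i) = x ?r (f (t i))" using 1 hC x_C[OF r] by simp
  then have "coord 1 i (x ?r (t i)) = coord 1 i (x ?r (f (t i)))" by simp
  then have "f (t i) = t i" using coord_x[OF i(1) _ r, of 1] by simp
  then show "t i = 1" using fix_f t by (auto simp: toral_def)
qed

lemma separated_fixed_node:
  assumes i: "i < rank X" "\<rho> i = i" and e: "e = 1 \<or> e = - 1"
  shows "\<exists>u\<in>fixed e. \<exists>w\<in>fixed e. \<forall>j<rank X.
    if j \<in> {i} then separated e j u w else coord e j u = 0 \<and> coord e j w = 0"
proof -
  have fixed: "x (signed_simple e i) \<zeta> \<in> fixed e" if "f \<zeta> = \<zeta>" for \<zeta>
    using x_unipotent[OF signed_simple_signed[OF i(1) e]] \<sigma>_simple[OF i(1) e] i(2) that by (simp add: fixed_def)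
  have coord: "coord e j (x (signed_simple e i) \<zeta>) = (if j = i then of_int e * \<zeta> else 0)" if "j < rank X" for j \<zeta>
    using coord_x[OF that e signed_simple_root[OF i(1) e]] e signed_simple_inj[of e i j] by auto
  obtain \<zeta> where z: "f \<zeta> = \<zeta>" "trivial_at i \<or> \<zeta> \<noteq> 0 \<and> \<zeta> \<noteq> 1"
    using trivial_at_fixed_node[OF i] f_simps(2) by metis
  show ?thesis
    using z(2) e coord by (intro bexI[OF _ fixed[of 1]] bexI[OF _ fixed[OF z(1)]]) (auto simp: separated_def f_simps)
qed

text \<open>Surjectivity of the trace onto the fixed field. If all traces were 0, then
  \<open>f\<close> would be negation, and \<open>f 1 = 1\<close> would turn it into the
  identity.\<close>

lemma ex_trace:
  assumes invol: "\<And>\<zeta>. f (f \<zeta>) = \<zeta>" and c: "f c = c"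
  shows "\<exists>\<mu>. \<mu> + f \<mu> = c"
proof -
  have "\<exists>\<theta>. \<theta> + f \<theta> \<noteq> 0"
  proof (rule ccontr)
    assume "\<not> ?thesis"
    then have neg: "f \<theta> = - \<theta>" for \<theta> by (metis add_eq_0_iff)
    then have "(1 :: 'k) = - 1" using f_simps(2) by metis
    then have "\<theta> = - \<theta>" for \<theta> :: 'k by (metis mult_1 mult_minus_left)
    then have "f \<theta> = \<theta>" for \<theta> using neg by metis
    then show False using ex_moved by blast
  qed
  then obtain \<theta> where \<theta>: "\<theta> + f \<theta> \<noteq> 0" by blast
  let ?d = "\<theta> + f \<theta>"
  have "f ?d = ?d" using invol by (simp add: f_simps add.commute)
  then have "c * inverse ?d * \<theta> + f (c * inverse ?d * \<theta>) = c * inverse ?d * ?d"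
    by (simp add: f_simps(4,7) c distrib_left)
  then show ?thesis using \<theta> by (intro exI[of _ "c * inverse ?d * \<theta>"]) (simp add: mult.assoc)
qed

text \<open>The case of two adjacent exchanged nodes, as in the middle of the diagram
  \<open>An l\<close> with even \<open>l\<close>. Applying \<sigma> reverses the two simple factors;
  restoring their order costs a factor at the sum \<open>q\<close> of the roots, which
  \<open>x q \<mu>\<close> absorbs.\<close>

lemma A2_fixed_element:
  assumes i: "i < rank X" "\<rho> (\<rho> i) = i" "gram X i (\<rho> i) = - 1" and invol: "\<And>\<zeta>. f (f \<zeta>) = \<zeta>" and e: "e = 1 \<or> e = - 1"
  shows "\<exists>q\<in>roots X. \<exists>\<mu>. q = signed_simple e i + signed_simple e (\<rho> i) \<and>
    x q \<mu> \<otimes>\<^bsub>C\<^esub> (x (signed_simple e i) \<zeta> \<otimes>\<^bsub>C\<^esub> x (signed_simple e (\<rho> i)) (f \<zeta>)) \<in> fixed e"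
proof -
  let ?r = "signed_simple e i" and ?s = "signed_simple e (\<rho> i)"
  let ?q = "?r + ?s"
  have i': "\<rho> i < rank X" using \<rho>_less[OF i(1)] .
  have ne: "\<rho> i \<noteq> i" using i(1,3) len[OF i(1)] by auto
  have r: "?r \<in> roots X" and s: "?s \<in> roots X" using signed_simple_root i(1) i' e by auto
  have rs: "inner X ?r ?s = - 1" using inner_signed_simple[OF i(1) i' e] i(3) by simp
  have q: "?q \<in> roots X"
  proof -
    have "inner X (simple_root i) ?s = - e"
    proof -
      have "inner X (signed_simple 1 i) ?s = - e"
        using e inner_signed_simple[OF i(1) i', of 1] i(3) inner_uminus_right[of X "signed_simple 1 i" "signed_simple 1 (\<rho> i)"]
        by (auto simp: uminus_signed_simple)
      then show ?thesis by (simp add: signed_simple_def)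
    qed
    then have "cartan_int X (simple_root i) ?s = - e"
      using cartan_simple[OF i(1), of ?s] by (simp add: len[OF i(1)])
    then have "simple_reflection X i ?s = ?q"
      by (auto simp: simple_reflection_def signed_simple_def)
    then show ?thesis using roots_reflection[OF s i(1)] by simp
  qed
  have not_root: "t \<notin> roots X" if "inner X t t = 6" for t using norm2[of t] that by auto
  have rq: "?r + ?q \<notin> roots X" "?q \<noteq> - ?r" and sq: "?s + ?q \<notin> roots X" "?q \<noteq> - ?s"
  proof -
    have "inner X (?r + ?q) (?r + ?q) = 6" "inner X (?s + ?q) (?s + ?q) = 6"
      unfolding inner_add inner_add_right using rs norm2[OF r] norm2[OF s] inner_sym[of X ?s ?r] by simp_all
    then show "?r + ?q \<notin> roots X" "?s + ?q \<notin> roots X" using not_root by auto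
    have "?q (\<rho> i) = e" "(- ?r) (\<rho> i) = 0" "?q i = e" "(- ?s) i = 0" using ne by (auto simp: signed_simple_apply)
    then show "?q \<noteq> - ?r" "?q \<noteq> - ?s" using e by (metis zero_neq_neg_one zero_neq_one)+
  qed
  \<comment> \<open>The norm of s - p r is 2 + 2 p + 2 p^2, which is 2 for p = 0 only; so the string
    starts at \<open>?s\<close>.\<close>
  have Nrs: "N ?r ?s * N ?r ?s = 1"
  proof -
    have "{p. (\<lambda>l. ?s l - int p * ?r l) \<in> roots X} = {0}"
    proof (intro equalityI subsetI)
      fix p assume p: "p \<in> {p. (\<lambda>l. ?s l - int p * ?r l) \<in> roots X}"
      let ?t = "\<lambda>l. ?s l + (- int p) * ?r l"
      have "?t \<in> roots X" using p by simp
      then have "inner X ?t ?t = 2" by (rule norm2)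
      moreover have "inner X ?t ?t = 2 + 2 * int p + 2 * int p * int p"
        using rs norm2[OF r] norm2[OF s] inner_sym[of X ?s ?r]
        by (simp only: inner_lin inner_lin_right) (simp add: algebra_simps)
      ultimately have "int p + int p * int p = 0" by simp
      then have "p + p * p = 0" by (simp flip: of_nat_mult of_nat_add)
      then show "p \<in> {0}" by simp
    qed (use s in simp)
    then have "\<bar>N ?r ?s\<bar> = 1" using N_abs[OF r s q] by simp
    then show ?thesis by (metis abs_mult_self_eq mult_1)
  qed
  define \<epsilon> :: 'k where "\<epsilon> = of_int (- N ?r ?s)"
  have eps: "\<epsilon> * \<epsilon> = 1" unfolding \<epsilon>_def of_int_mult[symmetric] using Nrs by simp
  have fe: "f \<epsilon> = \<epsilon>"
  proof -
    have "(\<epsilon> - 1) * (\<epsilon> + 1) = 0" using eps by (simp add: algebra_simps)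
    then have "\<epsilon> = 1 \<or> \<epsilon> = - 1" by (auto simp: add_eq_0_iff2)
    then show ?thesis by (auto simp: f_simps)
  qed
  note car = x_C[OF r] x_C[OF s] x_C[OF q]
  have comm: "x ?s b \<otimes>\<^bsub>C\<^esub> x ?r a = x ?q (\<epsilon> * (a * b)) \<otimes>\<^bsub>C\<^esub> (x ?r a \<otimes>\<^bsub>C\<^esub> x ?s b)" for a b
  proof -
    note M = A2_commutator[OF r s q E_commute[OF r q rq] E_commute[OF s q sq] power_3[OF len r] power_3[OF len s]
        power_3[OF len q] Nrs, of a b, folded \<epsilon>_def]
    have "represents X (x ?q (\<epsilon> * (a * b)) \<otimes>\<^bsub>C\<^esub> (x ?r a \<otimes>\<^bsub>C\<^esub> x ?s b))
        (root_matrix ?s b * root_matrix ?r a * root_matrix ?q (\<epsilon> * (a * b)))"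
      by (intro represents_C_mult represents_root r s q)
    then show ?thesis
      using represents_eq_iff[OF represents_C_mult[OF represents_root[OF s] represents_root[OF r], of b a]] M by simp
  qed
  have \<sigma>r: "\<sigma> (x ?r a) = x ?s (f a)" and \<sigma>s: "\<sigma> (x ?s a) = x ?r (f a)" for a
    using \<sigma>_simple[OF i(1) e] \<sigma>_simple[OF i' e] i(2) by simp_all
  have \<sigma>q: "\<sigma> (x ?q a) = x ?q (\<gamma> ?q * f a)" for a
  proof -
    have "root_bar X \<rho> ?q = ?q"
    proof
      fix l
      have "root_bar X \<rho> ?q l = (\<Sum>j<rank X. ?r j * simple_root (\<rho> j) l) + (\<Sum>j<rank X. ?s j * simple_root (\<rho> j) l)"
        by (simp add: root_bar_eq[OF q] distrib_right sum.distrib)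
      then show "root_bar X \<rho> ?q l = ?q l" by (simp add: sum_signed_simple i(1) i' i(2))
    qed
    then show ?thesis using \<sigma>_x[OF q] by simp
  qed
  \<comment> \<open>The sign at \<open>q\<close> is not prescribed. Applying \<sigma> to the
    commutator relation with parameters 1 exchanges its sides, which is consistent only if this sign
    is -1.\<close>
  have gam: "\<gamma> ?q = - 1"
  proof -
    have "\<sigma> (x ?s 1 \<otimes>\<^bsub>C\<^esub> x ?r 1) = \<sigma> (x ?q \<epsilon> \<otimes>\<^bsub>C\<^esub> (x ?r 1 \<otimes>\<^bsub>C\<^esub> x ?s 1))" using comm[of 1 1] by simp
    then have "x ?r 1 \<otimes>\<^bsub>C\<^esub> x ?s 1 = x ?q (\<gamma> ?q * \<epsilon>) \<otimes>\<^bsub>C\<^esub> (x ?s 1 \<otimes>\<^bsub>C\<^esub> x ?r 1)"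
      using car by (simp add: \<sigma>_mult \<sigma>r \<sigma>s \<sigma>q f_simps fe)
    also have "\<dots> = x ?q (\<gamma> ?q * \<epsilon> + \<epsilon>) \<otimes>\<^bsub>C\<^esub> (x ?r 1 \<otimes>\<^bsub>C\<^esub> x ?s 1)"
      using comm[of 1 1] car by (simp add: x_add[OF q] flip: C.m_assoc)
    finally have "x ?q (\<gamma> ?q * \<epsilon> + \<epsilon>) = \<one>\<^bsub>C\<^esub>" using car by (metis C.m_closed C.l_cancel_one' C.r_cancel_one)
    then have "of_int (coroot X ?q i) * (\<gamma> ?q * \<epsilon> + \<epsilon>) = 0" by (rule x_injective[OF q])
    moreover have "coroot X ?q i = e" using coroot2[OF q i(1)] ne by (simp add: signed_simple_apply)
    ultimately have "\<gamma> ?q * \<epsilon> + \<epsilon> = 0" using e by (elim disjE) simp_all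
    then have "(\<gamma> ?q + 1) * \<epsilon> = 0" by (simp add: distrib_right)
    then show ?thesis using eps by (auto simp: add_eq_0_iff2)
  qed
  \<comment> \<open>\<mu> is chosen such that \<open>- f \<mu>\<close>, which \<sigma> makes of it,
    plus the parameter created by the reordering is \<mu> again. This is a trace equation because
    the latter parameter is fixed by \<open>f\<close>.\<close>
  have "f (\<epsilon> * (\<zeta> * f \<zeta>)) = \<epsilon> * (\<zeta> * f \<zeta>)" by (simp add: f_simps fe invol mult.commute)
  then obtain \<mu> where mu: "\<mu> + f \<mu> = \<epsilon> * (\<zeta> * f \<zeta>)" using ex_trace[OF invol] by blast
  let ?y = "x ?q \<mu> \<otimes>\<^bsub>C\<^esub> (x ?r \<zeta> \<otimes>\<^bsub>C\<^esub> x ?s (f \<zeta>))"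
  have "\<sigma> ?y = x ?q (- f \<mu>) \<otimes>\<^bsub>C\<^esub> (x ?s (f \<zeta>) \<otimes>\<^bsub>C\<^esub> x ?r \<zeta>)"
    using car by (simp add: \<sigma>_mult \<sigma>r \<sigma>s \<sigma>q gam invol)
  also have "\<dots> = x ?q (- f \<mu> + \<epsilon> * (\<zeta> * f \<zeta>)) \<otimes>\<^bsub>C\<^esub> (x ?r \<zeta> \<otimes>\<^bsub>C\<^esub> x ?s (f \<zeta>))"
    unfolding comm using car by (simp add: x_add[OF q] flip: C.m_assoc)
  also have "- f \<mu> + \<epsilon> * (\<zeta> * f \<zeta>) = \<mu>" using mu by (simp add: algebra_simps)
  finally have fix_y: "\<sigma> ?y = ?y" .
  have "?q \<in> signed_roots e" using q e by (auto simp: signed_roots_def signed_simple_apply split: if_splits)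
  then have "?y \<in> unipotent e"
    using signed_simple_signed i(1) i' e by (intro subgroup.m_closed[OF subgroup_unipotent] x_unipotent) auto
  then show ?thesis using q fix_y by (auto simp: fixed_def)
qed

lemma coord_signed_simple:
  assumes "i < rank X" "j < rank X" "e = 1 \<or> e = - 1"
  shows "coord e j (x (signed_simple e i) \<zeta>) = (if j = i then of_int e * \<zeta> else 0)"
  using coord_x[OF assms(2,3) signed_simple_root[OF assms(1,3)]] assms(3) signed_simple_inj[of e i j] by auto

text \<open>For orthogonal nodes the two simple factors commute and their product is fixed; for
  adjacent nodes the correction at the sum of the roots is added, which no coordinate sees.\<close>

lemma pair_fixed_element:
  assumes i: "i < rank X" "\<rho> i \<noteq> i" "\<rho> (\<rho> i) = i" and invol: "\<And>\<zeta>. f (f \<zeta>) = \<zeta>" and e: "e = 1 \<or> e = - 1"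
  shows "\<exists>y\<in>fixed e. \<forall>j<rank X. coord e j y = (if j = i then of_int e * \<zeta> else if j = \<rho> i then of_int e * f \<zeta> else 0)"
proof -
  let ?r = "signed_simple e i" and ?s = "signed_simple e (\<rho> i)"
  let ?y = "x ?r \<zeta> \<otimes>\<^bsub>C\<^esub> x ?s (f \<zeta>)"
  have i': "\<rho> i < rank X" using \<rho>_less[OF i(1)] .
  have r: "?r \<in> roots X" and s: "?s \<in> roots X" using signed_simple_root i(1) i' e by auto
  have U: "x ?r a \<in> unipotent e" "x ?s a \<in> unipotent e" for a
    using x_unipotent signed_simple_signed i(1) i' e by auto
  have Uy: "?y \<in> unipotent e" using U by (intro subgroup.m_closed[OF subgroup_unipotent])
  have cy: "coord e j ?y = (if j = i then of_int e * \<zeta> else if j = \<rho> i then of_int e * f \<zeta> else 0)" if "j < rank X" for j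
    using coord_mult[OF that e U] coord_signed_simple[OF i(1) that e] coord_signed_simple[OF i' that e] i(2) by auto
  show ?thesis
  proof (cases "gram X i (\<rho> i) = 0")
    case True
    have "\<sigma> ?y = ?y"
      using \<sigma>_simple[OF i(1) e] \<sigma>_simple[OF i' e] i(3) x_C[OF r] x_C[OF s] invol
        x_commute_orthogonal[OF i(1) i' i(2)[symmetric] True e] by (simp add: \<sigma>_mult)
    then show ?thesis using Uy cy by (intro bexI[of _ ?y]) (auto simp: fixed_def)
  next
    case False
    then have "gram X i (\<rho> i) = - 1" using len i(1,2) i' by (simp add: gram_def split: if_splits)
    then obtain q \<mu> where q: "q \<in> roots X" "q = ?r + ?s" and fixq: "x q \<mu> \<otimes>\<^bsub>C\<^esub> ?y \<in> fixed e"
      using A2_fixed_element[OF i(1,3) _ invol e] by blast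
    have qs: "q \<in> signed_roots e" using q e by (auto simp: signed_roots_def signed_simple_apply split: if_splits)
    have "coord e j (x q \<mu> \<otimes>\<^bsub>C\<^esub> ?y) = coord e j ?y" if "j < rank X" for j
    proof -
      have "q i = e" "q (\<rho> i) = e" using q(2) i(2) by (simp_all add: signed_simple_apply)
      then have "q \<noteq> signed_simple e j" using e i(2) by (metis signed_simple_apply zero_neq_neg_one zero_neq_one)
      then show ?thesis using coord_mult[OF that e x_unipotent[OF qs] Uy] coord_x[OF that e q(1)] by simp
    qed
    then show ?thesis using fixq cy by (intro bexI[of _ "x q \<mu> \<otimes>\<^bsub>C\<^esub> ?y"]) auto
  qed
qed

text \<open>Any element moved by \<open>f\<close> will do, since 0 and 1 are fixed.\<close>

lemma ex_generic: "\<exists>\<zeta>. \<zeta> \<noteq> 0 \<and> \<zeta> \<noteq> 1 \<and> f \<zeta> \<noteq> 0 \<and> f \<zeta> \<noteq> 1"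
  using ex_moved f_simps(1,2,6) by metis

lemma regular_pair_involution:
  assumes \<rho>2: "\<And>i. i < rank X \<Longrightarrow> \<rho> (\<rho> i) = i" and invol: "\<And>\<zeta>. f (f \<zeta>) = \<zeta>" and e: "e = 1 \<or> e = - 1"
  shows "regular_pair e"
proof (rule regular_pair_if_orbits[OF e, where orb = "\<lambda>i. {i, \<rho> i}"])
  fix i assume i: "i < rank X"
  show "\<exists>u\<in>fixed e. \<exists>w\<in>fixed e. \<forall>j<rank X.
      if j \<in> {i, \<rho> i} then separated e j u w else coord e j u = 0 \<and> coord e j w = 0"
  proof (cases "\<rho> i = i")
    case True
    then show ?thesis using separated_fixed_node[OF i True e] by simp
  next
    case False
    obtain \<zeta> where z: "\<zeta> \<noteq> 0" "\<zeta> \<noteq> 1" "f \<zeta> \<noteq> 0" "f \<zeta> \<noteq> 1" using ex_generic by blast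
    obtain u where u: "u \<in> fixed e" "\<And>j. j < rank X \<Longrightarrow>
        coord e j u = (if j = i then of_int e * 1 else if j = \<rho> i then of_int e * f 1 else 0)"
      using pair_fixed_element[OF i False \<rho>2[OF i] invol e, of 1] by blast
    obtain w where w: "w \<in> fixed e" "\<And>j. j < rank X \<Longrightarrow>
        coord e j w = (if j = i then of_int e * \<zeta> else if j = \<rho> i then of_int e * f \<zeta> else 0)"
      using pair_fixed_element[OF i False \<rho>2[OF i] invol e, of \<zeta>] by blast
    show ?thesis
      using u w z e False by (intro bexI[OF _ u(1)] bexI[OF _ w(1)]) (auto simp: separated_def f_simps)
  qed
qed (use \<rho>2 in auto)

text \<open>The nodes of a moved orbit are pairwise orthogonal, so the three factors, which \<sigma>
  permutes cyclically, can be put back in order.\<close>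

lemma regular_pair_triality:
  assumes \<rho>3: "\<And>i. i < rank X \<Longrightarrow> \<rho> (\<rho> (\<rho> i)) = i" and order3: "\<And>\<zeta>. f (f (f \<zeta>)) = \<zeta>" and e: "e = 1 \<or> e = - 1"
    and orth: "\<And>i. i < rank X \<Longrightarrow> \<rho> i \<noteq> i \<Longrightarrow> gram X i (\<rho> i) = 0"
  shows "regular_pair e"
proof (rule regular_pair_if_orbits[OF e, where orb = "\<lambda>i. {i, \<rho> i, \<rho> (\<rho> i)}"])
  fix i assume i: "i < rank X"
  show "\<exists>u\<in>fixed e. \<exists>w\<in>fixed e. \<forall>j<rank X.
      if j \<in> {i, \<rho> i, \<rho> (\<rho> i)} then separated e j u w else coord e j u = 0 \<and> coord e j w = 0"
  proof (cases "\<rho> i = i")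
    case True
    then show ?thesis using separated_fixed_node[OF i True e] by simp
  next
    case ne: False
    let ?j = "\<rho> i" and ?l = "\<rho> (\<rho> i)"
    have less: "?j < rank X" "?l < rank X" using \<rho>_less i by auto
    have ne': "?l \<noteq> ?j" "?l \<noteq> i" using ne \<rho>3[OF i] by metis+
    let ?r = "\<lambda>i. signed_simple e i"
    let ?y = "\<lambda>\<zeta>. x (?r i) \<zeta> \<otimes>\<^bsub>C\<^esub> (x (?r ?j) (f \<zeta>) \<otimes>\<^bsub>C\<^esub> x (?r ?l) (f (f \<zeta>)))"
    have car: "x (?r i) a \<in> carrier C" "x (?r ?j) a \<in> carrier C" "x (?r ?l) a \<in> carrier C" for a
      using x_C signed_simple_root i less e by auto
    have U: "x (?r i) a \<in> unipotent e" "x (?r ?j) a \<in> unipotent e" "x (?r ?l) a \<in> unipotent e" for a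
      using x_unipotent signed_simple_signed i less e by auto
    have Uy: "x (?r ?j) a \<otimes>\<^bsub>C\<^esub> x (?r ?l) b \<in> unipotent e" for a b
      using U by (intro subgroup.m_closed[OF subgroup_unipotent])
    have g: "gram X i ?j = 0" "gram X ?j ?l = 0" "gram X ?l i = 0"
      using orth[OF i ne] orth[OF less(1) ne'(1)] orth[OF less(2)] \<rho>3[OF i] ne' by auto
    have g': "gram X i ?l = 0" using g(3) by (simp add: gram_sym)
    have "\<sigma> (?y \<zeta>) = ?y \<zeta>" for \<zeta>
    proof -
      have "\<sigma> (?y \<zeta>) = x (?r ?j) (f \<zeta>) \<otimes>\<^bsub>C\<^esub> (x (?r ?l) (f (f \<zeta>)) \<otimes>\<^bsub>C\<^esub> x (?r i) \<zeta>)"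
        using car \<sigma>_simple[OF i e] \<sigma>_simple[OF less(1) e] \<sigma>_simple[OF less(2) e] by (simp add: \<sigma>_mult \<rho>3[OF i] order3)
      also have "\<dots> = (x (?r ?j) (f \<zeta>) \<otimes>\<^bsub>C\<^esub> x (?r i) \<zeta>) \<otimes>\<^bsub>C\<^esub> x (?r ?l) (f (f \<zeta>))"
        using x_commute_orthogonal[OF i less(2) ne'(2)[symmetric] g' e] car by (simp add: C.m_assoc)
      also have "\<dots> = ?y \<zeta>"
        using x_commute_orthogonal[OF i less(1) ne[symmetric] g(1) e] car by (simp flip: C.m_assoc)
      finally show ?thesis .
    qed
    then have fixed: "?y \<zeta> \<in> fixed e" for \<zeta>
      using subgroup.m_closed[OF subgroup_unipotent U(1) Uy] by (simp add: fixed_def)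
    have coord: "coord e j (?y \<zeta>) = (if j = i then of_int e * \<zeta> else if j = ?j then of_int e * f \<zeta>
        else if j = ?l then of_int e * f (f \<zeta>) else 0)" if j: "j < rank X" for j \<zeta>
      using coord_mult[OF j e U(1) Uy] coord_mult[OF j e U(2,3)] coord_signed_simple[OF i j e]
        coord_signed_simple[OF less(1) j e] coord_signed_simple[OF less(2) j e] ne ne' by auto
    obtain \<zeta> where z: "\<zeta> \<noteq> 0" "\<zeta> \<noteq> 1" "f \<zeta> \<noteq> 0" "f \<zeta> \<noteq> 1" using ex_generic by blast
    then have z': "f (f \<zeta>) \<noteq> 0" "f (f \<zeta>) \<noteq> 1" using f_simps(1,2,6) by metis+
    obtain u where u: "u \<in> fixed e" "\<And>j. j < rank X \<Longrightarrow> coord e j u = (if j = i then of_int e * 1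
        else if j = ?j then of_int e * f 1 else if j = ?l then of_int e * f (f 1) else 0)"
      using fixed[of 1] coord[of _ 1] by blast
    obtain w where w: "w \<in> fixed e" "\<And>j. j < rank X \<Longrightarrow> coord e j w = (if j = i then of_int e * \<zeta>
        else if j = ?j then of_int e * f \<zeta> else if j = ?l then of_int e * f (f \<zeta>) else 0)"
      using fixed[of \<zeta>] coord[of _ \<zeta>] by blast
    show ?thesis
      using u w z z' e ne ne' by (intro bexI[OF _ u(1)] bexI[OF _ w(1)]) (auto simp: separated_def f_simps)
  qed
qed (use \<rho>3 in auto)

end

section \<open>Conjugation of root elements by Weyl elements\<close>

context chevalley
begin

text \<open>The adjoint matrix of an integral vector. The goal is \<open>ad_vector_weyl\<close>:
  conjugation by a Weyl element takes it to the adjoint matrix of the transformed vector, whence the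
  action of Weyl elements on root subgroups.\<close>

definition ad_vector :: "(lie_index \<Rightarrow> int) \<Rightarrow> (lie_index, int) rmat" where
  "ad_vector v = (\<Sum>b\<in>basis X. smul (v b) (ad_matrix X N b))"

definition row_times :: "(lie_index \<Rightarrow> int) \<Rightarrow> (lie_index, int) rmat \<Rightarrow> lie_index \<Rightarrow> int" where
  "row_times v M = (\<lambda>c. \<Sum>b\<in>basis X. v b * entry M b c)"

lemma ad_vector_sum: "ad_vector (\<lambda>b. \<Sum>i\<in>I. v i b) = (\<Sum>i\<in>I. ad_vector (v i))"
  unfolding ad_vector_def by (subst sum.swap, rule sum.cong[OF refl], rule rmat_eqI)
    (simp add: entry_sum sum_distrib_right)

lemma ad_vector_smul: "ad_vector (\<lambda>b. k * v b) = smul k (ad_vector v)"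
  by (simp add: ad_vector_def smul_sum)

lemma row_times_mult:
  assumes "\<And>a c. a \<in> basis X \<Longrightarrow> entry A a c \<noteq> 0 \<Longrightarrow> c \<in> basis X"
  shows "row_times v (A * M) = row_times (row_times v A) M"
proof
  fix c
  have "row_times v (A * M) c = (\<Sum>b\<in>basis X. \<Sum>d\<in>basis X. v b * entry A b d * entry M d c)"
    unfolding row_times_def
  proof (rule sum.cong[OF refl])
    fix b assume "b \<in> basis X"
    then have "entry (A * M) b c = (\<Sum>d\<in>basis X. entry A b d * entry M d c)"
      using assms by (intro entry_times finite_basis) auto
    then show "v b * entry (A * M) b c = (\<Sum>d\<in>basis X. v b * entry A b d * entry M d c)"
      by (simp add: sum_distrib_left mult.assoc)
  qed
  also have "\<dots> = row_times (row_times v A) M c"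
    unfolding row_times_def by (subst sum.swap) (simp add: sum_distrib_right)
  finally show "row_times v (A * M) c = row_times (row_times v A) M c" .
qed

lemma ad_vector_E:
  assumes r: "r \<in> roots X"
  shows "ad_vector v * E r = E r * ad_vector v + ad_vector (row_times v (E r))"
proof -
  have "ad_vector v * E r = (\<Sum>b\<in>basis X. smul (v b) (ad_matrix X N b * E r))"
    by (simp add: ad_vector_def sum_distrib_right smul_times_left)
  also have "\<dots> = (\<Sum>b\<in>basis X. smul (v b) (E r * ad_matrix X N b) +
      (\<Sum>d\<in>basis X. smul (v b * entry (E r) b d) (ad_matrix X N d)))"
    using r by (intro sum.cong[OF refl]) (simp add: ad_commute[of "Root r"] smul_add smul_sum entry_ad)
  also have "\<dots> = E r * ad_vector v + ad_vector (row_times v (E r))"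
  proof -
    have "(\<Sum>b\<in>basis X. \<Sum>d\<in>basis X. smul (v b * entry (E r) b d) (ad_matrix X N d)) =
        ad_vector (row_times v (E r))"
      unfolding row_times_def ad_vector_sum[of "\<lambda>b d. v b * entry (E r) b d"] by (simp add: ad_vector_def)
    then show ?thesis by (simp add: sum.distrib ad_vector_def sum_distrib_left smul_times_right)
  qed
  finally show ?thesis .
qed

lemma ad_vector_row_one: "ad_vector (row_times v 1) = ad_vector v"
proof -
  have "row_times v 1 b = v b" if "b \<in> basis X" for b
  proof -
    have "row_times v 1 b = (\<Sum>d\<in>basis X. if d = b then v d else 0)"
      unfolding row_times_def by (rule sum.cong) (auto simp: entry_one)
    then show ?thesis using finite_basis that by simp
  qed
  then show ?thesis unfolding ad_vector_def by (intro sum.cong) auto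
qed

text \<open>Leibniz' rule, which makes \<open>exp (ad e\<^sub>r)\<close> an automorphism of the Lie ring.\<close>

lemma ad_vector_power:
  assumes r: "r \<in> roots X"
  shows "ad_vector v * E r ^ n = (\<Sum>j\<le>n. of_nat (n choose j) * (E r ^ (n - j) * ad_vector (row_times v (E r ^ j))))"
proof (induction n)
  case 0
  then show ?case by (simp add: ad_vector_row_one)
next
  case (Suc n)
  let ?g = "\<lambda>i j. E r ^ i * ad_vector (row_times v (E r ^ j))"
  have cl: "c \<in> basis X" if "a \<in> basis X" "entry (E r ^ j) a c \<noteq> 0" for a c j
    using power_nonzero(2)[OF r] that by blast
  have step: "?g i j * E r = ?g (Suc i) j + ?g i (Suc j)" for i j
  proof -
    have "row_times v (E r ^ Suc j) = row_times (row_times v (E r ^ j)) (E r)"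
      unfolding power_Suc2 by (rule row_times_mult[OF cl])
    then show ?thesis by (simp only: mult.assoc ad_vector_E[OF r] distrib_left power_Suc2)
  qed
  have "ad_vector v * E r ^ Suc n = (\<Sum>j\<le>n. of_nat (n choose j) * ?g (n - j) j) * E r"
    unfolding Suc.IH[symmetric] by (simp only: power_Suc2 mult.assoc)
  also have "\<dots> = (\<Sum>j\<le>n. of_nat (n choose j) * ?g (Suc n - j) j) + (\<Sum>j\<le>n. of_nat (n choose j) * ?g (n - j) (Suc j))"
    unfolding sum_distrib_right sum.distrib[symmetric]
  proof (rule sum.cong[OF refl])
    fix j assume "j \<in> {..n}"
    then have "Suc (n - j) = Suc n - j" by auto
    then show "of_nat (n choose j) * ?g (n - j) j * E r =
        of_nat (n choose j) * ?g (Suc n - j) j + of_nat (n choose j) * ?g (n - j) (Suc j)"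
      using step[of "n - j" j] by (simp only: mult.assoc[of "of_nat _"] distrib_left)
  qed
  also have "(\<Sum>j\<le>n. of_nat (n choose j) * ?g (Suc n - j) j) =
      ?g (Suc n) 0 + (\<Sum>j\<le>n. of_nat (n choose Suc j) * ?g (n - j) (Suc j))"
  proof -
    have "(\<Sum>j\<le>n. of_nat (n choose j) * ?g (Suc n - j) j) = (\<Sum>j\<le>Suc n. of_nat (n choose j) * ?g (Suc n - j) j)"
      by (simp add: binomial_eq_0)
    then show ?thesis unfolding sum.atMost_Suc_shift by simp
  qed
  also have "?g (Suc n) 0 + (\<Sum>j\<le>n. of_nat (n choose Suc j) * ?g (n - j) (Suc j)) +
      (\<Sum>j\<le>n. of_nat (n choose j) * ?g (n - j) (Suc j)) =
      (\<Sum>j\<le>Suc n. of_nat (Suc n choose j) * ?g (Suc n - j) j)"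
    unfolding sum.atMost_Suc_shift by (simp add: distrib_right sum.distrib add_ac)
  finally show ?case .
qed

lemma of_nat_times_smul: "of_nat k * A = smul (int k) (A :: (lie_index, int) rmat)"
  by (induction k) (simp_all add: distrib_right smul_add_scalar)

lemma row_times_smul: "row_times v (smul k M) = (\<lambda>c. k * row_times v M c)"
  by (auto simp: row_times_def sum_distrib_left mult.left_commute)

lemma ad_vector_divided_power:
  assumes r: "r \<in> roots X"
  shows "ad_vector v * D r n = (\<Sum>j\<le>n. D r (n - j) * ad_vector (row_times v (D r j)))"
proof (rule smul_cancel)
  show "(fact n :: int) \<noteq> 0" by simp
  have "smul (fact n) (ad_vector v * D r n) = ad_vector v * E r ^ n"
    using smul_times_right[of "ad_vector v" "fact n" "D r n"] by (simp add: fact_divided_power[OF r])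
  also have "\<dots> = (\<Sum>j\<le>n. smul (fact n) (D r (n - j) * ad_vector (row_times v (D r j))))"
    unfolding ad_vector_power[OF r]
  proof (rule sum.cong[OF refl])
    fix j assume "j \<in> {..n}"
    then have "int (fact j * fact (n - j) * (n choose j)) = int (fact n)" using binomial_fact_lemma[of j n] by simp
    then have bin: "int (n choose j) * (fact (n - j) * fact j) = fact n"
      by (simp only: of_nat_mult of_nat_fact mult_ac)
    have "of_nat (n choose j) * (E r ^ (n - j) * ad_vector (row_times v (E r ^ j))) =
        smul (int (n choose j)) (smul (fact (n - j)) (D r (n - j)) * ad_vector (row_times v (smul (fact j) (D r j))))"
      by (simp only: of_nat_times_smul fact_divided_power[OF r])
    also have "\<dots> = smul (int (n choose j) * (fact (n - j) * fact j)) (D r (n - j) * ad_vector (row_times v (D r j)))"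
      by (simp only: row_times_smul ad_vector_smul smul_times_left smul_times_right smul_smul mult.commute)
    finally show "of_nat (n choose j) * (E r ^ (n - j) * ad_vector (row_times v (E r ^ j))) =
        smul (fact n) (D r (n - j) * ad_vector (row_times v (D r j)))" unfolding bin .
  qed
  finally show "smul (fact n) (ad_vector v * D r n) =
      smul (fact n) (\<Sum>j\<le>n. D r (n - j) * ad_vector (row_times v (D r j)))" by (simp only: smul_sum)
qed

text \<open>The Cauchy product of two sequences that vanish from degree 4 on; the highest degree is
  6, hence the bound 7.\<close>

lemma sum_antidiagonal:
  fixes g :: "nat \<Rightarrow> nat \<Rightarrow> 'a::comm_monoid_add"
  assumes "\<And>i j. 4 \<le> i \<or> 4 \<le> j \<Longrightarrow> g i j = 0"
  shows "(\<Sum>n<7. \<Sum>j\<le>n. g (n - j) j) = (\<Sum>i<4. \<Sum>j<4. g i j)"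
proof -
  have "{..<7} = {0, 1, 2, 3, 4, 5, 6 :: nat}" "{..<4} = {0, 1, 2, 3 :: nat}" "{..0} = {0 :: nat}" "{..1} = {0, 1 :: nat}"
    "{..2} = {0, 1, 2 :: nat}" "{..3} = {0, 1, 2, 3 :: nat}" "{..4} = {0, 1, 2, 3, 4 :: nat}"
    "{..5} = {0, 1, 2, 3, 4, 5 :: nat}" "{..6} = {0, 1, 2, 3, 4, 5, 6 :: nat}" by auto
  then show ?thesis by (simp add: assms add_ac)
qed

text \<open>Leibniz' rule in its divided form, summed with powers of \<open>z\<close>: a root
  element is an automorphism of the Lie ring.\<close>

lemma ad_vector_root_matrix:
  fixes z :: int assumes r: "r \<in> roots X"
  shows "ad_vector v * root_matrix r z = root_matrix r z * ad_vector (row_times v (root_matrix r z))"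
proof -
  let ?g = "\<lambda>i j. smul (z ^ i) (D r i) * ad_vector (row_times v (smul (z ^ j) (D r j)))"
  have g0: "?g i j = 0" if "4 \<le> i \<or> 4 \<le> j" for i j
    using that divided_power_ge_4[OF r] by (auto simp: row_times_smul row_times_def ad_vector_def)
  have D: "ad_vector v * smul (z ^ n) (D r n) = (\<Sum>j\<le>n. ?g (n - j) j)" for n
    unfolding smul_times_right ad_vector_divided_power[OF r] smul_sum
  proof (rule sum.cong[OF refl])
    fix j assume "j \<in> {..n}"
    then have "z ^ n = z ^ (n - j) * z ^ j" by (simp flip: power_add)
    then show "smul (z ^ n) (D r (n - j) * ad_vector (row_times v (D r j))) = ?g (n - j) j"
      by (simp add: row_times_smul ad_vector_smul smul_times_left smul_times_right mult.commute)
  qed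
  have root: "root_matrix r z = (\<Sum>n<4. smul (z ^ n) (D r n))" by (simp add: root_matrix_def rmap_id)
  have "root_matrix r z = (\<Sum>n<7. smul (z ^ n) (D r n))"
    unfolding root by (rule sum.mono_neutral_left) (auto simp: divided_power_ge_4[OF r])
  then have "ad_vector v * root_matrix r z = (\<Sum>n<7. \<Sum>j\<le>n. ?g (n - j) j)"
    by (simp only: sum_distrib_left D)
  also have "\<dots> = (\<Sum>i<4. \<Sum>j<4. ?g i j)" by (rule sum_antidiagonal[OF g0])
  also have "\<dots> = root_matrix r z * ad_vector (\<lambda>b. \<Sum>j<4. row_times v (smul (z ^ j) (D r j)) b)"
    unfolding ad_vector_sum root sum_distrib_right by (simp only: sum_distrib_left)
  also have "(\<lambda>b. \<Sum>j<4. row_times v (smul (z ^ j) (D r j)) b) = row_times v (root_matrix r z)"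
    unfolding root row_times_def entry_sum sum_distrib_left by (rule ext, rule sum.swap)
  finally show ?thesis .
qed

lemma root_matrix_basis:
  assumes "r \<in> roots X" "a \<in> basis X" "entry (root_matrix r z) a c \<noteq> 0" shows "c \<in> basis X"
proof -
  obtain n where "entry (D r n) a c \<noteq> 0" by (rule entry_root_matrix_nonzero[OF assms(3)])
  then show ?thesis using divided_power_nonzero(2)[OF assms(1) _ assms(2)] by blast
qed

lemma ad_vector_weyl:
  assumes r: "r \<in> roots X"
  shows "ad_vector v * weyl_int r = weyl_int r * ad_vector (row_times v (weyl_int r))"
proof -
  have mr: "- r \<in> roots X" by (rule uminus_root[OF r])
  let ?X = "root_matrix r (1::int)" and ?Y = "root_matrix (- r) (- 1::int)"
  have row: "row_times v (weyl_int r) = row_times (row_times (row_times v ?X) ?Y) ?X"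
    unfolding weyl_int_def mult.assoc
    by (simp only: row_times_mult[OF root_matrix_basis[OF r]] row_times_mult[OF root_matrix_basis[OF mr]])
  have swap: "ad_vector w * (root_matrix q z * A) = root_matrix q z * (ad_vector (row_times w (root_matrix q z)) * A)"
    if "q \<in> roots X" for w q and z :: int and A
    using ad_vector_root_matrix[OF that, of w z] by (simp flip: mult.assoc)
  show ?thesis
    unfolding row unfolding weyl_int_def
    by (simp only: mult.assoc swap[OF r] swap[OF mr] ad_vector_root_matrix[OF r])
qed

text \<open>The row of \<open>q\<close> in the Weyl matrix has a single nonzero entry. The matrix is
  invertible over the integers, so this entry is 1 or -1.\<close>

lemma weyl_conj_int:
  assumes r: "r \<in> roots X" and q: "q \<in> roots X"
  defines "q' \<equiv> (\<lambda>i. q i - cartan_int X r q * r i)"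
  shows "q' \<in> roots X" "\<exists>c. \<bar>c\<bar> = 1 \<and> E q * weyl_int r = smul c (weyl_int r * E q')"
proof -
  have mr: "- r \<in> roots X" by (rule uminus_root[OF r])
  let ?n = "weyl_int r"
  let ?m = "root_matrix r (- 1) * root_matrix (- r) 1 * root_matrix r (- 1::int)"
  have cancel: "root_matrix s z * (root_matrix s (- z) * A) = A" if "s \<in> roots X" for s and z :: int and A
    using root_matrix_add[OF that, of z "- z"] by (simp flip: mult.assoc)
  have inv: "?n * ?m = 1"
    using cancel[OF r, of 1] cancel[OF mr, of "- 1"] root_matrix_add[OF r, of "1::int" "- 1"]
    by (simp add: weyl_int_def mult.assoc)
  let ?c = "entry ?n (Root q) (Root q')"
  have row: "entry ?n (Root q) b = (if b = Root q' then ?c else 0)" for b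
    using weyl_int_monomial(1)[OF r q, of b] by (auto simp: q'_def)
  have "entry (?n * ?m) (Root q) (Root q) = ?c * entry ?m (Root q') (Root q)"
    by (rule entry_times_single) (use row in auto)
  then have "1 = ?c * entry ?m (Root q') (Root q)" unfolding inv by (simp add: entry_one)
  then have "?c dvd 1" by (rule dvdI)
  then have c: "\<bar>?c\<bar> = 1" by simp
  then have "?c \<noteq> 0" by auto
  then show q': "q' \<in> roots X" using weyl_int_nonzero(3)[OF r] q by force
  have "ad_vector (unit_vector (Root q)) = E q"
  proof -
    have "ad_vector (unit_vector (Root q)) = (\<Sum>b\<in>basis X. if b = Root q then E q else 0)"
      unfolding ad_vector_def by (rule sum.cong) (auto simp: unit_vector_def)
    then show ?thesis using q finite_basis by simp
  qed
  moreover have "ad_vector (row_times (unit_vector (Root q)) ?n) = smul ?c (E q')"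
  proof -
    have "row_times (unit_vector (Root q)) ?n b = (if b = Root q' then ?c else 0)" for b
    proof -
      have "row_times (unit_vector (Root q)) ?n b = (\<Sum>a\<in>basis X. if a = Root q then entry ?n a b else 0)"
        unfolding row_times_def by (rule sum.cong) (auto simp: unit_vector_def)
      then show ?thesis using q finite_basis row[of b] by simp
    qed
    then have "ad_vector (row_times (unit_vector (Root q)) ?n) =
        (\<Sum>b\<in>basis X. if b = Root q' then smul ?c (E q') else 0)"
      unfolding ad_vector_def by (intro sum.cong) auto
    then show ?thesis using q' finite_basis by simp
  qed
  ultimately have "E q * ?n = smul ?c (?n * E q')"
    using ad_vector_weyl[OF r, of "unit_vector (Root q)"] by (simp add: smul_times_right)
  then show "\<exists>c. \<bar>c\<bar> = 1 \<and> E q * ?n = smul c (?n * E q')" using c by blast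
qed

lemma weyl_conj_matrix:
  assumes r: "r \<in> roots X" and q: "q \<in> roots X"
  defines "q' \<equiv> (\<lambda>i. q i - cartan_int X r q * r i)"
  shows "\<exists>c. c * c = 1 \<and> (\<forall>\<zeta> :: 'k::field. root_matrix q \<zeta> * weyl_matrix r 1 = weyl_matrix r 1 * root_matrix q' (c * \<zeta>))"
proof -
  let ?n = "weyl_int r"
  have q': "q' \<in> roots X" using weyl_conj_int(1)[OF r q] by (simp add: q'_def)
  obtain c where c: "\<bar>c\<bar> = 1" and En: "E q * ?n = smul c (?n * E q')"
    using weyl_conj_int(2)[OF r q] unfolding q'_def by blast
  have pow: "E q ^ m * ?n = smul (c ^ m) (?n * E q' ^ m)" for m
  proof (induction m)
    case (Suc m)
    have "E q ^ Suc m * ?n = E q * (E q ^ m * ?n)" by (simp add: mult.assoc)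
    also have "\<dots> = smul (c ^ m) ((E q * ?n) * E q' ^ m)" unfolding Suc.IH by (simp add: smul_times_right mult.assoc)
    also have "\<dots> = smul (c ^ Suc m) (?n * E q' ^ Suc m)" unfolding En by (simp add: smul_times_left mult.assoc mult.commute)
    finally show ?case .
  qed simp
  have Dn: "D q m * ?n = smul (c ^ m) (?n * D q' m)" for m
  proof (rule smul_cancel[of "fact m"])
    have "smul (fact m) (D q m * ?n) = E q ^ m * ?n" by (simp add: fact_divided_power[OF q] flip: smul_times_left)
    also have "\<dots> = smul (c ^ m) (?n * smul (fact m) (D q' m))" by (simp add: pow fact_divided_power[OF q'])
    finally show "smul (fact m) (D q m * ?n) = smul (fact m) (smul (c ^ m) (?n * D q' m))"
      by (simp add: smul_times_right mult.commute)
  qed simp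
  have "root_matrix q \<zeta> * weyl_matrix r 1 = weyl_matrix r 1 * root_matrix q' (of_int c * \<zeta> :: 'k)" for \<zeta>
  proof -
    have "rmap (D q m) * rmap ?n = smul (of_int c ^ m) (rmap ?n * rmap (D q' m) :: (lie_index, 'k) rmat)" for m
      by (simp only: rmap_times[symmetric] Dn rmap_smul of_int_power)
    then show ?thesis
      unfolding weyl_matrix_1 root_matrix_def sum_distrib_left sum_distrib_right
      by (intro sum.cong) (auto simp: smul_times_left smul_times_right power_mult_distrib mult.commute)
  qed
  moreover have "of_int c * of_int c = (1 :: 'k)"
    using c by (metis abs_mult_self_eq mult_1 of_int_1 of_int_mult)
  ultimately show ?thesis by blast
qed

end

context chevalley_field
begin

text \<open>Serves to determine a sign of the graph automorphism of \<open>G2\<close> in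
  \<open>\<gamma>_short_long\<close>.\<close>

lemma weyl_conj:
  assumes r: "r \<in> roots X" and q: "q \<in> roots X"
  defines "q' \<equiv> (\<lambda>i. q i - cartan_int X r q * r i)"
  shows "\<exists>c. c * c = 1 \<and> (\<forall>\<zeta>. weyl_element X N r 1 \<otimes>\<^bsub>C\<^esub> x q \<zeta> = x q' (c * \<zeta>) \<otimes>\<^bsub>C\<^esub> weyl_element X N r 1)"
proof -
  have q': "q' \<in> roots X" using weyl_conj_int(1)[OF r q] by (simp add: q'_def)
  obtain c :: 'k where c: "c * c = 1"
    "\<And>\<zeta>. root_matrix q \<zeta> * weyl_matrix r 1 = weyl_matrix r 1 * root_matrix q' (c * \<zeta>)"
    using weyl_conj_matrix[OF r q, where 'k = 'k] unfolding q'_def by blast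
  have "weyl_element X N r 1 \<otimes>\<^bsub>C\<^esub> x q \<zeta> = x q' (c * \<zeta>) \<otimes>\<^bsub>C\<^esub> weyl_element X N r 1" for \<zeta>
    using represents_eq_iff[OF represents_C_mult[OF represents_weyl[OF r] represents_root[OF q]]
        represents_C_mult[OF represents_root[OF q'] represents_weyl[OF r]]] c(2) by metis
  then show "\<exists>c. c * c = 1 \<and> (\<forall>\<zeta>. weyl_element X N r 1 \<otimes>\<^bsub>C\<^esub> x q \<zeta> = x q' (c * \<zeta>) \<otimes>\<^bsub>C\<^esub> weyl_element X N r 1)"
    using c(1) by blast
qed

end

section \<open>Twisted groups with roots of two lengths\<close>

definition comb :: "nat \<Rightarrow> nat \<Rightarrow> int \<Rightarrow> int \<Rightarrow> root" where
  "comb i j a b = (\<lambda>l. if l = i then a else if l = j then b else 0)"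

lemma comb_apply [simp]: "comb i j a b i = a" "i \<noteq> j \<Longrightarrow> comb i j a b j = b"
  by (auto simp: comb_def)

lemma sum_comb:
  assumes "i < n" "j < n" "i \<noteq> j"
  shows "(\<Sum>l<n. comb i j a b l * g l) = a * g i + b * g j"
proof -
  have "(\<Sum>l<n. comb i j a b l * g l) = (\<Sum>l\<in>{i, j}. comb i j a b l * g l)"
    using assms by (intro sum.mono_neutral_right) (auto simp: comb_def)
  then show ?thesis using assms by (simp add: comb_def)
qed

lemma inner_comb:
  assumes ij: "i < rank X" "j < rank X" "i \<noteq> j"
  shows "inner X (comb i j a b) (comb i j c d) = a * c * sqlen X i + (a * d + b * c) * gram X i j + b * d * sqlen X j"
proof -
  have "inner X (comb i j a b) (comb i j c d) =
      (\<Sum>l<rank X. comb i j a b l * (\<Sum>m<rank X. comb i j c d m * gram X l m))"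
    by (simp add: inner_def sum_distrib_left mult.assoc)
  then show ?thesis using gram_sym[of X j i] by (simp only: sum_comb[OF ij]) (simp add: algebra_simps)
qed

lemma signed_simple_comb: "i \<noteq> j \<Longrightarrow> signed_simple e i = comb i j e 0" "i \<noteq> j \<Longrightarrow> signed_simple e j = comb i j 0 e"
  by (auto simp: signed_simple_def simple_root_def comb_def)

text \<open>\<open>m\<close> is the Cartan integer between the two simple roots, given by an
  equation instead of a division.\<close>

lemma simple_reflection_comb:
  assumes ij: "i < rank X" "j < rank X" "i \<noteq> j"
  shows "sqlen X i * m = 2 * gram X i j \<Longrightarrow> simple_reflection X i (comb i j a b) = comb i j (- a - m * b) b"
    "sqlen X j * m = 2 * gram X i j \<Longrightarrow> simple_reflection X j (comb i j a b) = comb i j a (- b - m * a)"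
proof -
  have inner: "inner X (simple_root i) (comb i j a b) = a * sqlen X i + b * gram X i j"
    "inner X (simple_root j) (comb i j a b) = a * gram X i j + b * sqlen X j"
    using inner_simple[OF ij(1)] inner_simple[OF ij(2)] sum_comb[OF ij] gram_sym[of X j i] by simp_all
  assume m: "sqlen X i * m = 2 * gram X i j"
  have "sqlen X i * cartan_int X (simple_root i) (comb i j a b) = 2 * (a * sqlen X i) + b * (2 * gram X i j)"
    using cartan_simple[OF ij(1), of "comb i j a b"] inner by simp
  also have "\<dots> = sqlen X i * (2 * a + m * b)" unfolding m[symmetric] by (simp add: algebra_simps)
  finally have "cartan_int X (simple_root i) (comb i j a b) = 2 * a + m * b" by (rule cancel_norm[OF sqlen_bounds(1)])
  then show "simple_reflection X i (comb i j a b) = comb i j (- a - m * b) b"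
    using ij(3) by (auto simp: simple_reflection_def comb_def simple_root_def)
next
  have inner: "inner X (simple_root j) (comb i j a b) = a * gram X i j + b * sqlen X j"
    using inner_simple[OF ij(2)] sum_comb[OF ij] gram_sym[of X j i] by simp
  assume m: "sqlen X j * m = 2 * gram X i j"
  have "sqlen X j * cartan_int X (simple_root j) (comb i j a b) = 2 * (b * sqlen X j) + a * (2 * gram X i j)"
    using cartan_simple[OF ij(2), of "comb i j a b"] inner by simp
  also have "\<dots> = sqlen X j * (2 * b + m * a)" unfolding m[symmetric] by (simp add: algebra_simps)
  finally have "cartan_int X (simple_root j) (comb i j a b) = 2 * b + m * a" by (rule cancel_norm[OF sqlen_bounds(1)])
  then show "simple_reflection X j (comb i j a b) = comb i j a (- b - m * a)"
    using ij(3) by (auto simp: simple_reflection_def comb_def simple_root_def)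
qed

context lie_type
begin

lemma regular_pair_two_elements:
  assumes e: "e = 1 \<or> e = - 1" and two: "\<And>\<zeta> :: 'k. \<zeta> = 0 \<or> \<zeta> = 1"
  shows "regular_pair e"
proof -
  have one: "\<one>\<^bsub>C\<^esub> \<in> fixed e" by (rule subgroup.one_closed[OF subgroup_fixed])
  show ?thesis
    using trivial_if_two[OF two] by (intro regular_pair_if_separated[OF e one one]) (simp add: separated_def)
qed

lemma x_independent:
  assumes r: "r \<in> roots X" and s: "s \<in> roots X" and "r \<noteq> s" and eq: "x r \<zeta> = x s \<eta>"
  shows "of_int (coroot X r i) * \<zeta> = 0"
proof -
  have "Root (- r) \<in> basis X" using uminus_root[OF r] by simp
  then have "entry (root_matrix r \<zeta>) (Root (- r)) (Cartan i) = entry (root_matrix s \<eta>) (Root (- r)) (Cartan i)"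
    using iffD1[OF represents_eq_iff[OF represents_root[OF r] represents_root[OF s]] eq] by blast
  then show ?thesis using root_matrix_opposite[OF r r, of \<zeta> i] root_matrix_opposite[OF r s, of \<eta> i] assms(3) by simp
qed

text \<open>Commutation with \<open>h\<close> can be sorted into an equality between an element of
  the root subgroup of \<open>r\<close> and one of that of \<open>s\<close>. Both are trivial, and
  the coroot hypotheses make their parameters visible in the field.\<close>

lemma toral_commute_pair:
  assumes h: "toral t h" "h \<in> carrier C" and r: "r \<in> roots X" and s: "s \<in> roots X" and "r \<noteq> s"
    and nz: "\<zeta> \<noteq> 0" "\<eta> \<noteq> 0" "of_int (coroot X r i) \<noteq> (0 :: 'k)" "of_int (coroot X s j) \<noteq> (0 :: 'k)"
    and comm: "h \<otimes>\<^bsub>C\<^esub> (x r \<zeta> \<otimes>\<^bsub>C\<^esub> x s \<eta>) = (x r \<zeta> \<otimes>\<^bsub>C\<^esub> x s \<eta>) \<otimes>\<^bsub>C\<^esub> h"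
  shows "character t (Root r) = 1" "character t (Root s) = 1"
proof -
  let ?a = "character t (Root r)" and ?b = "character t (Root s)"
  note car = x_C[OF r] x_C[OF s] h(2)
  have "h \<otimes>\<^bsub>C\<^esub> (x r \<zeta> \<otimes>\<^bsub>C\<^esub> x s \<eta>) = x r (?a * \<zeta>) \<otimes>\<^bsub>C\<^esub> (h \<otimes>\<^bsub>C\<^esub> x s \<eta>)"
    using toral_conj[OF h(1) r, of \<zeta>] car by (simp flip: C.m_assoc)
  also have "\<dots> = (x r (?a * \<zeta>) \<otimes>\<^bsub>C\<^esub> x s (?b * \<eta>)) \<otimes>\<^bsub>C\<^esub> h"
    using toral_conj[OF h(1) s, of \<eta>] car by (simp add: C.m_assoc)
  finally have "x r (?a * \<zeta>) \<otimes>\<^bsub>C\<^esub> x s (?b * \<eta>) = x r \<zeta> \<otimes>\<^bsub>C\<^esub> x s \<eta>" using comm car by simp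
  then have "x r (- \<zeta>) \<otimes>\<^bsub>C\<^esub> (x r (?a * \<zeta>) \<otimes>\<^bsub>C\<^esub> x s (?b * \<eta>)) \<otimes>\<^bsub>C\<^esub> x s (- (?b * \<eta>)) =
      x r (- \<zeta>) \<otimes>\<^bsub>C\<^esub> (x r \<zeta> \<otimes>\<^bsub>C\<^esub> x s \<eta>) \<otimes>\<^bsub>C\<^esub> x s (- (?b * \<eta>))" by simp
  also have "x r (- \<zeta>) \<otimes>\<^bsub>C\<^esub> (x r (?a * \<zeta>) \<otimes>\<^bsub>C\<^esub> x s (?b * \<eta>)) \<otimes>\<^bsub>C\<^esub> x s (- (?b * \<eta>)) =
      (x r (- \<zeta>) \<otimes>\<^bsub>C\<^esub> x r (?a * \<zeta>)) \<otimes>\<^bsub>C\<^esub> (x s (?b * \<eta>) \<otimes>\<^bsub>C\<^esub> x s (- (?b * \<eta>)))"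
    using car by (simp only: C.m_assoc C.m_closed)
  also have "x r (- \<zeta>) \<otimes>\<^bsub>C\<^esub> (x r \<zeta> \<otimes>\<^bsub>C\<^esub> x s \<eta>) \<otimes>\<^bsub>C\<^esub> x s (- (?b * \<eta>)) =
      (x r (- \<zeta>) \<otimes>\<^bsub>C\<^esub> x r \<zeta>) \<otimes>\<^bsub>C\<^esub> (x s \<eta> \<otimes>\<^bsub>C\<^esub> x s (- (?b * \<eta>)))"
    using car by (simp only: C.m_assoc C.m_closed)
  finally have eq: "x r (?a * \<zeta> - \<zeta>) = x s (\<eta> - ?b * \<eta>)"
    using car by (simp add: x_add[OF r] x_add[OF s] x_0[OF r] x_0[OF s])
  then have "of_int (coroot X r i) * (?a * \<zeta> - \<zeta>) = 0" by (rule x_independent[OF r s \<open>r \<noteq> s\<close>])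
  then have a: "?a * \<zeta> = \<zeta>" using nz by simp
  then show "?a = 1" using nz by simp
  have "x s (\<eta> - ?b * \<eta>) = \<one>\<^bsub>C\<^esub>" using eq a x_0[OF r] by simp
  then have "of_int (coroot X s j) * (\<eta> - ?b * \<eta>) = 0" by (rule x_injective[OF s])
  then have "?b * \<eta> = \<eta>" using nz by simp
  then show "?b = 1" using nz by simp
qed

lemma character_comb:
  assumes "i < rank X" "j < rank X" "i \<noteq> j"
  shows "character t (Root (comb i j a b)) = t i powi a * t j powi b"
proof -
  have "character t (Root (comb i j a b)) = (\<Prod>l\<in>{i, j}. t l powi comb i j a b l)"
    unfolding character_def grade.simps using assms by (intro prod.mono_neutral_right) (auto simp: comb_def)
  then show ?thesis using assms by (simp add: comb_def)
qed

end

section \<open>Graph automorphisms that exchange short and long roots\<close>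

locale special_twist = lie_type X N k \<sigma>
  for X N and k :: "'k::{field,finite} itself" and \<sigma> +
  fixes \<rho> :: "nat \<Rightarrow> nat" and f :: "'k \<Rightarrow> 'k" and \<gamma> :: "root \<Rightarrow> 'k" and p :: nat
  assumes f: "field_automorphism f" and p: "p = 2 \<or> p = 3" and char: "of_nat p = (0 :: 'k)"
    and f_f: "f (f \<zeta>) ^ p = \<zeta>"
    and min_len: "Min (sqlen X ` {..<rank X}) = 2"
    and \<sigma>_x: "r \<in> roots X \<Longrightarrow>
      \<sigma> (x r \<zeta>) = x (root_bar X \<rho> r) (\<gamma> r * f \<zeta> ^ root_exponent X (root_bar X \<rho> r))"
    and \<gamma>: "\<gamma> r = 1 \<or> \<gamma> r = - 1" "i < rank X \<Longrightarrow> \<gamma> (simple_root i) = 1" "i < rank X \<Longrightarrow> \<gamma> (- simple_root i) = 1"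
begin

lemmas f_simps = field_automorphism_simps[OF f]

lemma f_power: "f (\<zeta> ^ n) = f \<zeta> ^ n"
  by (induction n) (simp_all add: f_simps)

lemma \<gamma>_simps [simp]: "f (\<gamma> r) = \<gamma> r" "\<gamma> r ^ p = \<gamma> r" "\<gamma> r * \<gamma> r = 1" "\<gamma> r \<noteq> 0"
proof -
  show "f (\<gamma> r) = \<gamma> r" "\<gamma> r * \<gamma> r = 1" "\<gamma> r \<noteq> 0" using \<gamma>(1)[of r] by (auto simp: f_simps)
  show "\<gamma> r ^ p = \<gamma> r" using \<gamma>(1)[of r] p char by (auto simp: eval_nat_numeral add_eq_0_iff2)
qed

lemma add_power_p: "(a + b :: 'k) ^ p = a ^ p + b ^ p"
proof -
  have "(a + b) ^ p = a ^ p + b ^ p + of_nat p * (if p = 2 then a * b else a * a * b + a * b * b)"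
    using p by (auto simp: power2_eq_square power3_eq_cube algebra_simps)
  then show ?thesis by (simp add: char)
qed

text \<open>The order matters: the first root is the short one, and only the passage from short to
  long raises the parameter to the power \<open>p\<close>.\<close>

definition exchanged :: "root \<Rightarrow> root \<Rightarrow> bool" where
  "exchanged r s \<longleftrightarrow> r \<in> roots X \<and> s \<in> roots X \<and> root_bar X \<rho> r = s \<and> root_bar X \<rho> s = r \<and>
     inner X r r = 2 \<and> inner X s s = 2 * int p"

lemma \<sigma>_exchanged:
  assumes "exchanged r s"
  shows "\<sigma> (x r \<zeta>) = x s (\<gamma> r * f \<zeta> ^ p)" "\<sigma> (x s \<zeta>) = x r (\<gamma> s * f \<zeta>)"
  using \<sigma>_x[of r \<zeta>] \<sigma>_x[of s \<zeta>] assms by (simp_all add: exchanged_def root_exponent_def min_len)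

text \<open>The relation between \<open>f\<close> and the power \<open>p\<close> removes the field
  automorphism, so that of the square of \<sigma> only signs are left.\<close>

lemma \<sigma>_\<sigma>_exchanged:
  assumes "exchanged r s"
  shows "\<sigma> (\<sigma> (x r \<zeta>)) = x r (\<gamma> r * \<gamma> s * \<zeta>)" "\<sigma> (\<sigma> (x s \<zeta>)) = x s (\<gamma> r * \<gamma> s * \<zeta>)"
  by (simp_all add: \<sigma>_exchanged[OF assms] f_simps f_power f_f power_mult_distrib mult_ac)

text \<open>A short root element times its image under \<sigma>.\<close>

definition y :: "root \<Rightarrow> root \<Rightarrow> 'k \<Rightarrow> 'k lie_map" where
  "y r s \<zeta> = x r \<zeta> \<otimes>\<^bsub>C\<^esub> x s (\<gamma> r * f \<zeta> ^ p)"

lemma exchanged_neq: "exchanged r s \<Longrightarrow> s \<noteq> - r" "exchanged r s \<Longrightarrow> r \<noteq> s"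
  using p inner_uminus[of X r "- r"] inner_uminus_right[of X r r] by (auto simp: exchanged_def)

lemma y_C: "exchanged r s \<Longrightarrow> y r s \<zeta> \<in> carrier C"
  by (auto simp: y_def exchanged_def intro: x_C)

text \<open>The sign condition makes the square of \<sigma> trivial on both factors, so \<sigma>
  interchanges them; as they commute, the product is fixed.\<close>

lemma y_fixed:
  assumes ex: "exchanged r s" and rs: "r + s \<notin> roots X" "\<gamma> r * \<gamma> s = 1" and sg: "r \<in> signed_roots e" "s \<in> signed_roots e"
  shows "y r s \<zeta> \<in> fixed e"
proof -
  have r: "r \<in> roots X" and s: "s \<in> roots X" using ex by (auto simp: exchanged_def)
  have "\<sigma> (y r s \<zeta>) = \<sigma> (x r \<zeta>) \<otimes>\<^bsub>C\<^esub> \<sigma> (\<sigma> (x r \<zeta>))"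
    unfolding y_def using x_C[OF r] x_C[OF s] by (simp add: \<sigma>_mult \<sigma>_exchanged(1)[OF ex])
  also have "\<dots> = \<sigma> (x r \<zeta>) \<otimes>\<^bsub>C\<^esub> x r \<zeta>"
    by (simp only: \<sigma>_\<sigma>_exchanged(1)[OF ex] rs(2) mult_1)
  also have "\<dots> = y r s \<zeta>"
    unfolding \<sigma>_exchanged(1)[OF ex]
    using x_commute[OF r s rs(1) exchanged_neq(1)[OF ex]] by (simp add: y_def)
  finally show ?thesis
    using subgroup.m_closed[OF subgroup_unipotent x_unipotent[OF sg(1)] x_unipotent[OF sg(2)]]
    by (simp add: fixed_def y_def)
qed

text \<open>The second parameter depends additively on the first, as raising to the power
  \<open>p\<close> is additive in characteristic \<open>p\<close>.\<close>

lemma y_add: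
  assumes ex: "exchanged r s" and rs: "r + s \<notin> roots X"
  shows "y r s a \<otimes>\<^bsub>C\<^esub> y r s b = y r s (a + b)"
proof -
  have r: "r \<in> roots X" and s: "s \<in> roots X" using ex by (auto simp: exchanged_def)
  note car = x_C[OF r] x_C[OF s]
  let ?g = "\<lambda>a. \<gamma> r * f a ^ p"
  have "y r s a \<otimes>\<^bsub>C\<^esub> y r s b = x r a \<otimes>\<^bsub>C\<^esub> ((x s (?g a) \<otimes>\<^bsub>C\<^esub> x r b) \<otimes>\<^bsub>C\<^esub> x s (?g b))"
    unfolding y_def using car by (simp only: C.m_assoc C.m_closed)
  also have "\<dots> = (x r a \<otimes>\<^bsub>C\<^esub> x r b) \<otimes>\<^bsub>C\<^esub> (x s (?g a) \<otimes>\<^bsub>C\<^esub> x s (?g b))"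
    unfolding x_commute[OF r s rs exchanged_neq(1)[OF ex], symmetric] using car by (simp only: C.m_assoc C.m_closed)
  also have "\<dots> = y r s (a + b)"
    by (simp add: x_add[OF r] x_add[OF s] y_def f_simps add_power_p distrib_left)
  finally show ?thesis .
qed

lemma y_0: "exchanged r s \<Longrightarrow> y r s 0 = \<one>\<^bsub>C\<^esub>"
  using p by (auto simp: y_def exchanged_def f_simps x_0)

lemma y_inv:
  assumes "exchanged r s" "r + s \<notin> roots X"
  shows "inv\<^bsub>C\<^esub> (y r s \<zeta>) = y r s (- \<zeta>)"
  by (rule C.inv_equality) (simp_all add: y_add[OF assms] y_0[OF assms(1)] y_C[OF assms(1)])

lemma y_toral:
  assumes ex: "exchanged r s" and h: "toral t h" "h \<in> carrier C" and "\<zeta> \<noteq> 0"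
    and cor: "of_int (coroot X r i) \<noteq> (0 :: 'k)" "of_int (coroot X s j) \<noteq> (0 :: 'k)"
    and comm: "h \<otimes>\<^bsub>C\<^esub> y r s \<zeta> = y r s \<zeta> \<otimes>\<^bsub>C\<^esub> h"
  shows "character t (Root r) = 1" "character t (Root s) = 1"
proof -
  have r: "r \<in> roots X" and s: "s \<in> roots X" using ex by (auto simp: exchanged_def)
  have "\<gamma> r * f \<zeta> ^ p \<noteq> 0" using \<open>\<zeta> \<noteq> 0\<close> f_simps(1) f_simps(6)[of \<zeta> 0] by simp
  from toral_commute_pair[OF h r s exchanged_neq(2)[OF ex] \<open>\<zeta> \<noteq> 0\<close> this cor comm[unfolded y_def]]
  show "character t (Root r) = 1" "character t (Root s) = 1" .
qed

end

locale exchanged_nodes = special_twist X N k \<sigma> \<rho> f \<gamma> p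
  for X N and k :: "'k::{field,finite} itself" and \<sigma> \<rho> f \<gamma> p +
  fixes i j :: nat
  assumes ij: "i < rank X" "j < rank X" "i \<noteq> j" and \<rho>_ij: "\<rho> i = j" "\<rho> j = i"
    and len_ij: "sqlen X i = 2" "sqlen X j = 2 * int p"
begin

abbreviation c where "c \<equiv> comb i j"

text \<open>The coefficients are named for their positions after the swap in
  \<open>root_bar\<close>: \<open>a'\<close> belongs to node \<open>j\<close> and \<open>b'\<close>
  to node \<open>i\<close>.\<close>

lemma coroot_comb:
  assumes r: "c a b \<in> roots X" and ab': "inner X (c a b) (c a b) * a' = b * sqlen X j" "inner X (c a b) (c a b) * b' = a * sqlen X i"
  shows "coroot X (c a b) l = c b' a' l"
proof -
  have nz: "inner X (c a b) (c a b) \<noteq> 0" using root_norm_bounds(1)[OF r] by simp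
  have "c a b j = b" "c a b i = a" using ij by (auto simp: comb_def)
  then show ?thesis using nz ab'[symmetric] by (auto simp: coroot_def comb_def)
qed

lemma root_bar_comb:
  assumes r: "c a b \<in> roots X" and ab': "inner X (c a b) (c a b) * a' = b * sqlen X j" "inner X (c a b) (c a b) * b' = a * sqlen X i"
  shows "root_bar X \<rho> (c a b) = c a' b'"
proof
  fix l
  have "root_bar X \<rho> (c a b) l = (\<Sum>m<rank X. c b' a' m * simple_root (\<rho> m) l)"
    by (simp add: root_bar_def coroot_comb[OF assms])
  also have "\<dots> = b' * simple_root (\<rho> i) l + a' * simple_root (\<rho> j) l" by (rule sum_comb[OF ij])
  finally show "root_bar X \<rho> (c a b) l = c a' b' l" using ij \<rho>_ij by (auto simp: comb_def simple_root_def)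
qed

lemma comb_simple_root:
  assumes "e = 1 \<or> e = - 1" shows "c e 0 \<in> roots X" "c 0 e \<in> roots X"
  using signed_simple_root[OF ij(1) assms] signed_simple_root[OF ij(2) assms] signed_simple_comb[OF ij(3)] by auto

lemma exchanged_simple:
  assumes e: "e = 1 \<or> e = - 1" shows "exchanged (c e 0) (c 0 e)"
proof -
  note r = comb_simple_root[OF e]
  have ee: "e * e = 1" using e by auto
  have n: "inner X (c e 0) (c e 0) = 2" "inner X (c 0 e) (c 0 e) = 2 * int p"
    by (simp_all add: inner_comb[OF ij] len_ij ee)
  have "root_bar X \<rho> (c e 0) = c 0 e" by (rule root_bar_comb[OF r(1)]) (simp_all add: n len_ij)
  moreover have "root_bar X \<rho> (c 0 e) = c e 0" by (rule root_bar_comb[OF r(2)]) (simp_all add: n len_ij)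
  ultimately show ?thesis using r n by (simp add: exchanged_def)
qed

lemma \<gamma>_simple:
  assumes "e = 1 \<or> e = - 1" shows "\<gamma> (c e 0) = 1" "\<gamma> (c 0 e) = 1"
proof -
  have "\<gamma> (signed_simple e l) = 1" if "l < rank X" for l
    using assms \<gamma>(2,3)[OF that] by (auto simp: signed_simple_def fun_Compl_def)
  then show "\<gamma> (c e 0) = 1" "\<gamma> (c 0 e) = 1" using ij signed_simple_comb[OF ij(3)] by metis+
qed

text \<open>The two highest roots of the system of type \<open>B\<^sub>2\<close> (\<open>p = 2\<close>) or \<open>G\<^sub>2\<close> (\<open>p = 3\<close>) spanned by
  a short root \<open>i\<close> and a long root \<open>j\<close>. They are exchanged by \<open>root_bar\<close>, their root subgroups
  commute, and their characters separate the points of the torus.\<close>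

abbreviation short where "short e \<equiv> c (e * (int p - 1)) e"
abbreviation long where "long e \<equiv> c (e * int p) (e * (int p - 1))"

context
  assumes gram_ij: "gram X i j = - int p"
begin

lemma reflection_comb:
  "simple_reflection X i (c a b) = c (int p * b - a) b" "simple_reflection X j (c a b) = c a (a - b)"
  using simple_reflection_comb(1)[OF ij, of "- int p" a b] simple_reflection_comb(2)[OF ij, of "- 1" a b]
  by (simp_all add: gram_ij len_ij algebra_simps)

lemma reflect_comb: "c a b \<in> roots X \<Longrightarrow> c (int p * b - a) b \<in> roots X" "c a b \<in> roots X \<Longrightarrow> c a (a - b) \<in> roots X"
  using roots_reflection[of "c a b" X] ij(1,2) reflection_comb by metis+

lemma norm_comb: "inner X (c a b) (c a b) = 2 * a * a - 2 * int p * a * b + 2 * int p * b * b"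
  by (simp add: inner_comb[OF ij] gram_ij len_ij algebra_simps)

lemma short_long_roots:
  assumes e: "e = 1 \<or> e = - 1" shows "short e \<in> roots X" "long e \<in> roots X"
proof -
  have 1: "c e e \<in> roots X" using reflect_comb(2)[OF comb_simple_root(1)[OF e]] by simp
  have 2: "c (int p * e) e \<in> roots X" using reflect_comb(1)[OF comb_simple_root(2)[OF e]] by simp
  \<comment> \<open>For p = 2 the roots found so far are the two highest ones already; for p = 3 one
    more reflection of each is needed.\<close>
  show "short e \<in> roots X" "long e \<in> roots X"
    using p 1 2 reflect_comb(1)[OF 1] reflect_comb(2)[OF 2] by (auto simp: algebra_simps)
qed

lemma norm_short_long:
  assumes e: "e = 1 \<or> e = - 1" shows "inner X (short e) (short e) = 2" "inner X (long e) (long e) = 2 * int p"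
  using e p by (auto simp: norm_comb)

lemma exchanged_short_long:
  assumes e: "e = 1 \<or> e = - 1" shows "exchanged (short e) (long e)"
proof -
  note r = short_long_roots[OF e] and n = norm_short_long[OF e]
  have "root_bar X \<rho> (short e) = long e" by (rule root_bar_comb[OF r(1)]) (simp_all add: n len_ij)
  moreover have "root_bar X \<rho> (long e) = short e" by (rule root_bar_comb[OF r(2)]) (simp_all add: n len_ij)
  ultimately show ?thesis using r n by (simp add: exchanged_def)
qed

text \<open>Up to sign the coefficients at the short node \<open>i\<close> are p - 1 and 1, both
  units modulo \<open>p\<close>.\<close>

lemma coroot_short_long:
  assumes e: "e = 1 \<or> e = - 1"
  shows "of_int (coroot X (short e) i) \<noteq> (0 :: 'k)" "of_int (coroot X (long e) i) \<noteq> (0 :: 'k)"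
proof -
  note r = short_long_roots[OF e] and n = norm_short_long[OF e]
  have "coroot X (short e) i = e * (int p - 1)" "coroot X (long e) i = e"
    using coroot_comb[OF r(1), of "e * int p" "e * (int p - 1)" i] coroot_comb[OF r(2), of "e * (int p - 1)" e i]
    by (simp_all add: n len_ij)
  then show "of_int (coroot X (short e) i) \<noteq> (0 :: 'k)" "of_int (coroot X (long e) i) \<noteq> (0 :: 'k)"
    using e char by auto
qed

text \<open>The sum has norm 10 for p = 2 and 14 for p = 3, more than any root.\<close>

lemma short_plus_long:
  assumes e: "e = 1 \<or> e = - 1" shows "short e + long e \<notin> roots X"
proof
  assume r: "short e + long e \<in> roots X"
  have "short e + long e = c (e * (2 * int p - 1)) (e * int p)"
    by (auto simp: comb_def algebra_simps)
  then have "inner X (short e + long e) (short e + long e) > 6" using e p by (auto simp: norm_comb)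
  then show False using root_norm_bounds(2)[OF r] by simp
qed

lemma short_long_signed:
  assumes e: "e = 1 \<or> e = - 1" shows "short e \<in> signed_roots e" "long e \<in> signed_roots e"
  using short_long_roots[OF e] e p by (auto simp: signed_roots_def comb_def)

text \<open>Up to the sign \<open>e\<close> the exponents form an integral matrix with determinant
  (p - 1)^2 - p, which is -1 or 1 for the two values of \<open>p\<close>; hence the two characters
  determine both values of \<open>t\<close>.\<close>

lemma character_short_long:
  assumes t: "\<And>i. t i \<noteq> 0" and e: "e = 1 \<or> e = - 1"
    and one: "character t (Root (short e)) = 1" "character t (Root (long e)) = 1"
  shows "t i = 1" "t j = 1"
proof -
  have a: "t i powi (e * (int p - 1)) * t j powi e = 1" and b: "t i powi (e * int p) * t j powi (e * (int p - 1)) = 1"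
    using one by (simp_all add: character_comb[OF ij])
  have "t i powi (e * (int p - 1)) * t j powi e = (t i ^ (p - 1) * t j) powi e"
    "t i powi (e * int p) * t j powi (e * (int p - 1)) = (t i ^ p * t j ^ (p - 1)) powi e"
    using e p by (auto simp: power_int_minus power_int_def power_inverse)
  moreover have root1: "\<mu> powi e = 1 \<Longrightarrow> \<mu> = 1" for \<mu> :: 'k using e by (auto simp: power_int_minus)
  ultimately have 1: "t i ^ (p - 1) * t j = 1" "t i ^ p * t j ^ (p - 1) = 1"
    using a b root1 by metis+
  have "t i = 1"
  proof (cases "p = 2")
    case True
    then show ?thesis using 1 t[of j] by (simp add: power2_eq_square mult.assoc)
  next
    case False
    then have p3: "p = 3" using p by simp
    then have "t i * (t i ^ 3 * t j ^ 2) = (t i ^ 2 * t j) ^ 2"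
      by (simp add: power2_eq_square power3_eq_cube mult_ac)
    then show ?thesis using 1 p3 by simp
  qed
  then show "t i = 1" "t j = 1" using 1(1) by auto
qed

text \<open>The square of \<open>\<sigma>\<close> fixes the root elements of \<open>\<plusminus>\<close> the simple roots, hence the corresponding
  Weyl elements; conjugation by these carries a simple root to \<open>long e\<close>.\<close>

lemma \<gamma>_short_long:
  assumes e: "e = 1 \<or> e = - 1" shows "\<gamma> (short e) * \<gamma> (long e) = 1"
proof (cases "p = 2")
  case True
  then have "(- 1 :: 'k) = 1" using char by (simp add: add_eq_0_iff2)
  then have "\<gamma> r = 1" for r using \<gamma>(1)[of r] by auto
  then show ?thesis by simp
next
  case False
  then have p3: "p = 3" using p by simp
  let ?\<tau> = "\<lambda>g. \<sigma> (\<sigma> g)"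
  have \<sigma>_C: "\<sigma> g \<in> carrier C" if "g \<in> carrier C" for g using \<sigma>_hom that by (rule hom_in_carrier)
  have \<tau>_mult: "?\<tau> (g \<otimes>\<^bsub>C\<^esub> h) = ?\<tau> g \<otimes>\<^bsub>C\<^esub> ?\<tau> h" if "g \<in> carrier C" "h \<in> carrier C" for g h
    using that \<sigma>_C by (simp add: \<sigma>_mult)
  have \<tau>_simple: "?\<tau> (x (signed_simple d l) \<zeta>) = x (signed_simple d l) \<zeta>" if "d = 1 \<or> d = - 1" "l = i \<or> l = j" for d l \<zeta>
    using \<sigma>_\<sigma>_exchanged[OF exchanged_simple[OF that(1)]] \<gamma>_simple[OF that(1)] signed_simple_comb[OF ij(3)] that(2) by auto
  have \<tau>_weyl: "?\<tau> (weyl_element X N (simple_root l) 1) = weyl_element X N (simple_root l) 1" if "l = i \<or> l = j" for l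
  proof -
    have s: "simple_root l = signed_simple 1 l" by (simp add: signed_simple_def)
    have "l < rank X" using that ij by auto
    then have "signed_simple 1 l \<in> roots X" "signed_simple (- 1) l \<in> roots X" using signed_simple_root by auto
    then show ?thesis
      unfolding weyl_element_def s using x_C \<tau>_simple that by (simp add: \<tau>_mult uminus_signed_simple)
  qed
  have \<tau>_reflection: "?\<tau> (x (simple_reflection X l q) \<zeta>) = x (simple_reflection X l q) \<zeta>"
    if l: "l = i \<or> l = j" and q: "q \<in> roots X" and fix_q: "\<And>\<zeta>. ?\<tau> (x q \<zeta>) = x q \<zeta>" for l q \<zeta>
  proof -
    let ?w = "weyl_element X N (simple_root l) (1 :: 'k)"
    have sl: "simple_root l \<in> roots X" using l ij roots.simple by auto
    obtain d where d: "d * d = 1" "\<And>\<zeta>. ?w \<otimes>\<^bsub>C\<^esub> x q \<zeta> = x (simple_reflection X l q) (d * \<zeta>) \<otimes>\<^bsub>C\<^esub> ?w"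
      using weyl_conj[OF sl q] unfolding simple_reflection_def by blast
    have q': "simple_reflection X l q \<in> roots X" using roots_reflection[OF q] l ij by auto
    note car = x_C[OF q] x_C[OF q'] weyl_C[OF sl]
    \<comment> \<open>The unknown sign \<open>d\<close> is put into the parameter on the left, so
      that it disappears on the right.\<close>
    have eq: "?w \<otimes>\<^bsub>C\<^esub> x q (d * \<zeta>) = x (simple_reflection X l q) \<zeta> \<otimes>\<^bsub>C\<^esub> ?w"
      using d(2)[of "d * \<zeta>"] by (simp add: d(1) flip: mult.assoc)
    have "?\<tau> (x (simple_reflection X l q) \<zeta>) \<otimes>\<^bsub>C\<^esub> ?w = ?\<tau> (?w \<otimes>\<^bsub>C\<^esub> x q (d * \<zeta>))"
      by (simp only: eq \<tau>_mult[OF car(2,3)] \<tau>_weyl[OF l])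
    also have "\<dots> = ?w \<otimes>\<^bsub>C\<^esub> x q (d * \<zeta>)"
      by (simp only: \<tau>_mult[OF car(3,1)] \<tau>_weyl[OF l] fix_q)
    also note eq
    finally have "?\<tau> (x (simple_reflection X l q) \<zeta>) \<otimes>\<^bsub>C\<^esub> ?w = x (simple_reflection X l q) \<zeta> \<otimes>\<^bsub>C\<^esub> ?w" .
    then show ?thesis using car \<sigma>_C by simp
  qed
  let ?q = "c (int p * e) e"
  have q: "?q \<in> roots X" "?q = simple_reflection X i (c 0 e)"
    using reflect_comb(1)[OF comb_simple_root(2)[OF e]] reflection_comb(1)[of 0 e] by simp_all
  have s: "long e = simple_reflection X j ?q"
    unfolding reflection_comb by (simp add: p3 algebra_simps)
  have "?\<tau> (x (c 0 e) \<zeta>) = x (c 0 e) \<zeta>" for \<zeta>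
    using \<tau>_simple[OF e, of j] signed_simple_comb(2)[OF ij(3)] by simp
  then have "?\<tau> (x ?q \<zeta>) = x ?q \<zeta>" for \<zeta>
    unfolding q(2) by (intro \<tau>_reflection comb_simple_root e) auto
  then have "?\<tau> (x (long e) 1) = x (long e) 1"
    unfolding s by (intro \<tau>_reflection q(1)) auto
  then have eq: "x (long e) (\<gamma> (short e) * \<gamma> (long e)) = x (long e) 1"
    using \<sigma>_\<sigma>_exchanged(2)[OF exchanged_short_long[OF e], of 1] by simp
  have "x (long e) (\<gamma> (short e) * \<gamma> (long e) - 1) = x (long e) (\<gamma> (short e) * \<gamma> (long e)) \<otimes>\<^bsub>C\<^esub> x (long e) (- 1)"
    by (simp add: x_add[OF short_long_roots(2)[OF e]])
  also have "\<dots> = \<one>\<^bsub>C\<^esub>"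
    unfolding eq by (simp add: x_add[OF short_long_roots(2)[OF e]] x_0[OF short_long_roots(2)[OF e]])
  finally have "of_int (coroot X (long e) i) * (\<gamma> (short e) * \<gamma> (long e) - 1) = 0"
    by (rule x_injective[OF short_long_roots(2)[OF e]])
  then show ?thesis using coroot_short_long(2)[OF e] by simp
qed

abbreviation z where "z e \<equiv> y (short e) (long e)"

lemma z_fixed: "e = 1 \<or> e = - 1 \<Longrightarrow> z e \<zeta> \<in> fixed e"
  using y_fixed[OF exchanged_short_long short_plus_long \<gamma>_short_long short_long_signed] by blast

lemma z_toral:
  assumes e: "e = 1 \<or> e = - 1" and h: "toral t h" "h \<in> carrier C" and "\<zeta> \<noteq> 0"
    and comm: "h \<otimes>\<^bsub>C\<^esub> z e \<zeta> = z e \<zeta> \<otimes>\<^bsub>C\<^esub> h"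
  shows "t i = 1" "t j = 1"
proof -
  have "character t (Root (short e)) = 1" "character t (Root (long e)) = 1"
    using y_toral[OF exchanged_short_long[OF e] h \<open>\<zeta> \<noteq> 0\<close> coroot_short_long[OF e] comm] by auto
  then show "t i = 1" "t j = 1" using character_short_long[OF _ e] h(1) by (auto simp: toral_def)
qed

text \<open>\<open>z\<close> is additive in its parameter and regular at every nonzero one, so a
  third field element \<zeta> suffices: the parameters 1, \<zeta> and 1 - \<zeta> are all
  nonzero.\<close>

lemma regular_pair_rank_2:
  assumes e: "e = 1 \<or> e = - 1" and rank: "rank X = 2"
  shows "regular_pair e"
proof (cases "\<exists>\<zeta> :: 'k. \<zeta> \<noteq> 0 \<and> \<zeta> \<noteq> 1")
  case True
  then obtain \<zeta> :: 'k where zeta: "\<zeta> \<noteq> 0" "\<zeta> \<noteq> 1" by blast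
  have nodes: "l = i \<or> l = j" if "l < rank X" for l using that ij rank by auto
  have reg: "regular C cartan_group (z e \<mu>)" if "\<mu> \<noteq> 0" for \<mu>
    unfolding regular_def
  proof (intro ballI impI)
    fix h assume h: "h \<in> cartan_group" and comm: "h \<otimes>\<^bsub>C\<^esub> z e \<mu> = z e \<mu> \<otimes>\<^bsub>C\<^esub> h"
    obtain t where t: "toral t h" using h torus_toral by blast
    have "h \<in> carrier C" using h L_C by blast
    then show "h = \<one>\<^bsub>C\<^esub>" using z_toral[OF e t _ that comm] nodes by (intro toral_eq_one[OF t]) blast
  qed
  have "z e 1 \<otimes>\<^bsub>C\<^esub> inv\<^bsub>C\<^esub> (z e \<zeta>) = z e (1 - \<zeta>)"
    by (simp add: y_inv[OF exchanged_short_long[OF e] short_plus_long[OF e]] y_add[OF exchanged_short_long[OF e] short_plus_long[OF e]])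
  then show ?thesis
    using reg[of 1] reg[OF zeta(1)] reg[of "1 - \<zeta>"] zeta(2)
    by (intro bexI[of _ "z e 1"] bexI[of _ "z e \<zeta>"] z_fixed[OF e]) auto
next
  case False
  then show ?thesis using regular_pair_two_elements[OF e] by blast
qed

end

end

context special_twist
begin

text \<open>The nodes 0 and 3 are orthogonal, so their simple root elements serve; the nodes 1 and 2
  span a system of type B2, whose two highest roots take over.\<close>

lemma regular_pair_F4:
  assumes X: "X = F4" and \<rho>: "\<rho> 0 = 3" "\<rho> 1 = 2" "\<rho> 2 = 1" "\<rho> 3 = 0" and p2: "p = 2" and e: "e = 1 \<or> e = - 1"
  shows "regular_pair e"
proof (cases "\<exists>\<zeta> :: 'k. \<zeta> \<noteq> 0 \<and> \<zeta> \<noteq> 1")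
  case False
  then show ?thesis using regular_pair_two_elements[OF e] by blast
next
  case True
  then obtain \<zeta> :: 'k where zeta: "\<zeta> \<noteq> 0" "\<zeta> \<noteq> 1" by blast
  interpret A: exchanged_nodes X N k \<sigma> \<rho> f \<gamma> p 3 0 by unfold_locales (simp_all add: X \<rho> p2)
  interpret B: exchanged_nodes X N k \<sigma> \<rho> f \<gamma> p 2 1 by unfold_locales (use \<rho> in \<open>simp_all add: X p2\<close>)
  have gram: "gram X 2 1 = - int p" "gram X 3 0 = 0" by (simp_all add: X p2 gram_def)
  let ?r = "comb 3 0 e 0" and ?s = "comb 3 0 0 e"
  note ex = A.exchanged_simple[OF e] and rs_root = A.comb_simple_root[OF e]
  have rs: "?r = signed_simple e 3" "?s = signed_simple e 0"
    using signed_simple_comb[of 3 0 e] by simp_all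
  have rs_sum: "?r + ?s \<notin> roots X"
  proof
    assume r: "?r + ?s \<in> roots X"
    obtain l where "inner X (?r + ?s) (?r + ?s) = sqlen X l" using root_norm[OF r] .
    moreover have "?r + ?s = comb 3 0 e e" by (auto simp: comb_def)
    moreover have "inner X (comb 3 0 e e) (comb 3 0 e e) = 6"
      using e gram(2) A.len_ij p2 by (auto simp: inner_comb[OF A.ij])
    ultimately show False by (simp add: X split: if_splits)
  qed
  let ?y = "y ?r ?s" and ?z = "B.z e"
  have rank: "l = 3 \<or> l = 0 \<or> l = 2 \<or> l = 1" if "l < rank X" for l using that X by auto
  have signed: "?r \<in> signed_roots e" "?s \<in> signed_roots e"
    unfolding rs using A.ij by (auto intro!: signed_simple_signed e)
  have y_fixed: "?y a \<in> fixed e" for a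
    using y_fixed[OF ex rs_sum _ signed] A.\<gamma>_simple[OF e] by simp
  have z_fixed: "?z a \<in> fixed e" for a by (rule B.z_fixed[OF gram(1) e])
  note zz = B.exchanged_short_long[OF gram(1) e] B.short_plus_long[OF gram(1) e]
  have U: "?y a \<in> unipotent e" "?z a \<in> unipotent e" "?z a \<otimes>\<^bsub>C\<^esub> ?y b \<in> unipotent e" for a b
    using y_fixed z_fixed subgroup.m_closed[OF subgroup_fixed, of "?z a" e "?y b"] by (auto intro: fixed_unipotent)
  have coord_y: "coord e 3 (?y a) = of_int e * a" "coord e 0 (?y a) = of_int e * (f a ^ p)" for a
    using coord_mult[OF A.ij(1) e x_unipotent[OF signed(1)] x_unipotent[OF signed(2)]]
      coord_mult[OF A.ij(2) e x_unipotent[OF signed(1)] x_unipotent[OF signed(2)]]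
      coord_x[OF A.ij(1) e] coord_x[OF A.ij(2) e] rs_root A.\<gamma>_simple[OF e] signed_simple_inj[of e 0 3] e
    unfolding y_def by (auto simp: rs)
  have coord_z: "coord e l (?z a) = 0" if l: "l = 3 \<or> l = 0" for l a
  proof -
    have l': "l < rank X" using l A.ij by auto
    note short = B.short_long_roots[OF gram(1) e] and sg = B.short_long_signed[OF gram(1) e]
    have ne: "B.short e \<noteq> signed_simple e l" "B.long e \<noteq> signed_simple e l"
    proof -
      have "B.short e 1 \<noteq> 0" "B.long e 1 \<noteq> 0" "signed_simple e l 1 = 0"
        using e l p2 by (auto simp: signed_simple_apply)
      then show "B.short e \<noteq> signed_simple e l" "B.long e \<noteq> signed_simple e l" by metis+
    qed
    show ?thesis
      unfolding y_def coord_mult[OF l' e x_unipotent[OF sg(1)] x_unipotent[OF sg(2)]]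
        coord_x[OF l' e short(1)] coord_x[OF l' e short(2)] using ne by simp
  qed
  \<comment> \<open>A quotient of two products y z takes this shape y z y. The factor
    \<open>?z\<close> is invisible at the nodes 3 and 0, so the coordinates there give t 3 = t 0 =
    1; then \<open>h\<close> commutes with the outer factors, which cancel and leave
    \<open>?z\<close>.\<close>
  have reg: "regular C cartan_group (?y a \<otimes>\<^bsub>C\<^esub> (?z b \<otimes>\<^bsub>C\<^esub> ?y d))" if "a + d \<noteq> 0" "b \<noteq> 0" for a b d
    unfolding regular_def
  proof (intro ballI impI)
    let ?u = "?y a \<otimes>\<^bsub>C\<^esub> (?z b \<otimes>\<^bsub>C\<^esub> ?y d)"
    fix h assume h: "h \<in> cartan_group" and comm: "h \<otimes>\<^bsub>C\<^esub> ?u = ?u \<otimes>\<^bsub>C\<^esub> h"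
    obtain t where t: "toral t h" using h torus_toral by blast
    have hC: "h \<in> carrier C" using h L_C by blast
    have u: "?u \<in> unipotent e" using U by (intro subgroup.m_closed[OF subgroup_unipotent])
    have "coord e l ?u = coord e l (?y a) + coord e l (?y d)" if "l = 3 \<or> l = 0" for l
    proof -
      have l: "l < rank X" using that A.ij by auto
      show ?thesis using coord_mult[OF l e U(1,3)] coord_mult[OF l e U(2,1)] coord_z[OF that] by simp
    qed
    then have "coord e 3 ?u = of_int e * (a + d)" "coord e 0 ?u = of_int e * (f (a + d) ^ p)"
      by (simp_all add: coord_y f_simps add_power_p distrib_left)
    moreover have "f (a + d) \<noteq> 0" using that f_simps(1) f_simps(6)[of "a + d" 0] by simp
    ultimately have "coord e 3 ?u \<noteq> 0" "coord e 0 ?u \<noteq> 0" using that e by auto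
    then have t30: "t 3 = 1" "t 0 = 1"
      using toral_commute_coord[OF A.ij(1) e t u comm] toral_commute_coord[OF A.ij(2) e t u comm] by auto
    have xC: "x ?r \<mu> \<in> carrier C" "x ?s \<mu> \<in> carrier C" for \<mu> using x_C rs_root by auto
    have "h \<otimes>\<^bsub>C\<^esub> x ?r \<mu> = x ?r \<mu> \<otimes>\<^bsub>C\<^esub> h" "h \<otimes>\<^bsub>C\<^esub> x ?s \<mu> = x ?s \<mu> \<otimes>\<^bsub>C\<^esub> h" for \<mu>
      using toral_conj[OF t rs_root(1)] toral_conj[OF t rs_root(2)] by (simp_all add: character_comb[OF A.ij] t30)
    then have comm_y: "h \<otimes>\<^bsub>C\<^esub> ?y \<mu> = ?y \<mu> \<otimes>\<^bsub>C\<^esub> h" for \<mu>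
      unfolding y_def using xC hC by (metis C.m_assoc)
    have yz: "?y \<mu> \<in> carrier C" "?z \<mu> \<in> carrier C" for \<mu>
      using unipotent_C[OF U(1)] unipotent_C[OF U(2)] by auto
    have "?y a \<otimes>\<^bsub>C\<^esub> ((h \<otimes>\<^bsub>C\<^esub> ?z b) \<otimes>\<^bsub>C\<^esub> ?y d) = h \<otimes>\<^bsub>C\<^esub> ?u"
      using comm_y[of a] yz hC by (simp flip: C.m_assoc)
    also have "\<dots> = ?y a \<otimes>\<^bsub>C\<^esub> ((?z b \<otimes>\<^bsub>C\<^esub> h) \<otimes>\<^bsub>C\<^esub> ?y d)"
      unfolding comm using comm_y[of d] yz hC by (simp add: C.m_assoc)
    finally have "h \<otimes>\<^bsub>C\<^esub> ?z b = ?z b \<otimes>\<^bsub>C\<^esub> h" using yz hC by simp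
    then have "t 2 = 1" "t 1 = 1" using B.z_toral[OF gram(1) e t hC \<open>b \<noteq> 0\<close>] by auto
    then show "h = \<one>\<^bsub>C\<^esub>" using t30 rank by (intro toral_eq_one[OF t]) auto
  qed
  have car: "?y a \<in> carrier C" "?z a \<in> carrier C" for a
    using unipotent_C[OF U(1)] unipotent_C[OF U(2)] by auto
  have "?y a \<otimes>\<^bsub>C\<^esub> ?z a \<in> fixed e" for a using y_fixed z_fixed by (intro subgroup.m_closed[OF subgroup_fixed])
  moreover have "regular C cartan_group (?y a \<otimes>\<^bsub>C\<^esub> ?z a)" if "a \<noteq> 0" for a
    using reg[of a 0 a] that car by (simp add: y_0[OF ex])
  moreover have "regular C cartan_group ((?y 1 \<otimes>\<^bsub>C\<^esub> ?z 1) \<otimes>\<^bsub>C\<^esub> inv\<^bsub>C\<^esub> (?y \<zeta> \<otimes>\<^bsub>C\<^esub> ?z \<zeta>))"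
  proof -
    have "(?y 1 \<otimes>\<^bsub>C\<^esub> ?z 1) \<otimes>\<^bsub>C\<^esub> inv\<^bsub>C\<^esub> (?y \<zeta> \<otimes>\<^bsub>C\<^esub> ?z \<zeta>) =
        ?y 1 \<otimes>\<^bsub>C\<^esub> ((?z 1 \<otimes>\<^bsub>C\<^esub> ?z (- \<zeta>)) \<otimes>\<^bsub>C\<^esub> ?y (- \<zeta>))"
      using car by (simp only: C.inv_mult_group y_inv[OF ex rs_sum] y_inv[OF zz] C.m_assoc C.m_closed)
    also have "?z 1 \<otimes>\<^bsub>C\<^esub> ?z (- \<zeta>) = ?z (1 - \<zeta>)" unfolding y_add[OF zz] by simp
    finally show ?thesis using reg[of 1 "- \<zeta>" "1 - \<zeta>"] zeta(2) by simp
  qed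
  ultimately show ?thesis using zeta(1) by (intro bexI[of _ "?y 1 \<otimes>\<^bsub>C\<^esub> ?z 1"] bexI[of _ "?y \<zeta> \<otimes>\<^bsub>C\<^esub> ?z \<zeta>"]) auto
qed

end

section \<open>The class of groups\<close>

lemma diagram_symmetry_gram:
  assumes sym: "diagram_symmetry X \<rho>" and len: "\<And>i. i < rank X \<Longrightarrow> sqlen X i = 2" and ij: "i < rank X" "j < rank X"
  shows "gram X (\<rho> i) (\<rho> j) = gram X i j"
proof -
  have bij: "bij_betw \<rho> {..<rank X} {..<rank X}" using sym by (simp add: diagram_symmetry_def)
  then have "\<rho> i < rank X" "\<rho> j < rank X" "\<rho> i = \<rho> j \<longleftrightarrow> i = j"
    using ij by (auto simp: bij_betw_def inj_on_eq_iff)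
  then show ?thesis using sym ij len unfolding diagram_symmetry_def gram_def by auto
qed

text \<open>Without its arrow the diagram is a path of four nodes, whose only nontrivial symmetry is
  the reversal.\<close>

lemma diagram_symmetry_F4:
  assumes sym: "diagram_symmetry F4 \<rho>" and moved: "\<exists>i<rank F4. \<rho> i \<noteq> i"
  shows "\<rho> 0 = 3" "\<rho> 1 = 2" "\<rho> 2 = 1" "\<rho> 3 = 0"
proof -
  have bij: "bij_betw \<rho> {..<4} {..<4}" and edges: "\<And>i j. i < 4 \<Longrightarrow> j < 4 \<Longrightarrow> i \<noteq> j \<Longrightarrow>
      (max i j = Suc (min i j)) = (max (\<rho> i) (\<rho> j) = Suc (min (\<rho> i) (\<rho> j)))"
    using sym by (auto simp: diagram_symmetry_def)
  have less: "\<rho> i < 4" if "i < 4" for i using bij that by (auto simp: bij_betw_def)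
  have inj: "\<rho> i \<noteq> \<rho> j" if "i < 4" "j < 4" "i \<noteq> j" for i j using bij that by (auto simp: bij_betw_def inj_on_def)
  have cases4: "m = 0 \<or> m = 1 \<or> m = 2 \<or> m = 3" if "m < 4" for m :: nat using that by auto
  note e = edges[of 0 1] edges[of 1 2] edges[of 2 3]
  note n = inj[of 0 2] inj[of 1 3] inj[of 0 3]
  have "\<rho> 0 \<noteq> 0 \<or> \<rho> 1 \<noteq> 1 \<or> \<rho> 2 \<noteq> 2 \<or> \<rho> 3 \<noteq> 3" using moved cases4 by fastforce
  then have "\<rho> 0 = 3 \<and> \<rho> 1 = 2 \<and> \<rho> 2 = 1 \<and> \<rho> 3 = 0"
    using e n cases4[OF less, of 0] cases4[OF less, of 1] cases4[OF less, of 2] cases4[OF less, of 3]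
    by (auto simp: max_def min_def split: if_splits)
  then show "\<rho> 0 = 3" "\<rho> 1 = 2" "\<rho> 2 = 1" "\<rho> 3 = 0" by auto
qed

lemma rank_2_swap:
  assumes bij: "bij_betw \<rho> {..<2} {..<2}" and moved: "\<exists>i<2. \<rho> i \<noteq> i"
  shows "\<rho> 0 = 1" "\<rho> 1 = (0 :: nat)"
proof -
  have "\<rho> 0 < 2" "\<rho> 1 < 2" "\<rho> 0 \<noteq> \<rho> 1"
    using bij inj_on_eq_iff[of \<rho> "{..<2}" 0 1] by (auto simp: bij_betw_def)
  moreover have "\<rho> 0 \<noteq> 0 \<or> \<rho> 1 \<noteq> 1" using moved by (auto simp: less_2_cases_iff)
  ultimately show "\<rho> 0 = 1" "\<rho> 1 = 0" by auto
qed

text \<open>The diagram is a tree and contains no triangle.\<close>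

lemma gram_D4_triangle:
  assumes "i < 4" "j < 4" "l < 4" "i \<noteq> j" "j \<noteq> l" "i \<noteq> l"
  shows "gram (Dn 4) i j = 0 \<or> gram (Dn 4) j l = 0 \<or> gram (Dn 4) i l = 0"
  using assms by (auto simp: gram_def min_def max_def)

text \<open>Here \<open>root_bar\<close> permutes coefficients along a symmetry of the Gram matrix
  and so preserves norms.\<close>

lemma root_exponent_simply_laced:
  assumes sym: "diagram_symmetry X \<rho>" and len: "\<And>i. i < rank X \<Longrightarrow> sqlen X i = 2" and r: "r \<in> roots X"
  shows "root_exponent X (root_bar X \<rho> r) = 1"
proof -
  obtain l where l: "l < rank X" "inner X r r = sqlen X l" using root_norm[OF r] .
  then have norm: "inner X r r = 2" using len by simp
  have bij: "bij_betw \<rho> {..<rank X} {..<rank X}" using sym by (simp add: diagram_symmetry_def)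
  have bar: "root_bar X \<rho> r (\<rho> i) = r i" if i: "i < rank X" for i
  proof -
    have "coroot X r m = r m" if "m < rank X" for m using coroot_eq[OF r that] norm len[OF that] by simp
    then have "root_bar X \<rho> r (\<rho> i) = (\<Sum>m<rank X. if m = i then r m else 0)"
      unfolding root_bar_def using bij i
      by (intro sum.cong) (auto simp: simple_root_def bij_betw_def inj_on_eq_iff)
    then show ?thesis using i by simp
  qed
  have "inner X (root_bar X \<rho> r) (root_bar X \<rho> r) =
      (\<Sum>i<rank X. \<Sum>j<rank X. root_bar X \<rho> r (\<rho> i) * root_bar X \<rho> r (\<rho> j) * gram X (\<rho> i) (\<rho> j))"
    unfolding inner_def by (subst (1 2) sum.reindex_bij_betw[OF bij, symmetric]) simp
  also have "\<dots> = 2" unfolding norm[symmetric] inner_def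
    using bar diagram_symmetry_gram[OF sym len] by (intro sum.cong) auto
  finally have "inner X (root_bar X \<rho> r) (root_bar X \<rho> r) = 2" .
  moreover have "sqlen X ` {..<rank X} = {2}" using len l(1) by force
  ultimately show ?thesis by (simp add: root_exponent_def)
qed

lemma chevalley_class_L:
  assumes "class_L t X N (\<sigma> :: 'k::{field,finite} lie_map \<Rightarrow> 'k lie_map)"
  shows "chevalley X N"
proof
  show "chevalley_constants X N" using assms by (simp add: class_L_def)
  show "finite (roots X)"
    using assms finite_roots_A finite_roots_B finite_roots_C finite_roots_D finite_roots_E finite_roots_F finite_roots_G
    unfolding class_L_def exceptional_type_def large_classical_type_def by auto
qed

lemma bond_simply_laced:
  assumes "0 < rank X" "\<And>i. i < rank X \<Longrightarrow> sqlen X i = 2" shows "bond X = 1"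
proof -
  have "sqlen X ` {..<rank X} = {2}" using assms by force
  then show ?thesis by (simp add: bond_def)
qed

lemma sqlen_two_lengths:
  "sqlen F4 ` {..<rank F4} = {4, 2}" "sqlen G2 ` {..<rank G2} = {2, 6}" "sqlen (Bn 2) ` {..<rank (Bn 2)} = {4, 2}"
proof -
  have "{..<4} = {0, 1, 2, 3 :: nat}" "{..<2} = {0, 1 :: nat}" by auto
  then show "sqlen F4 ` {..<rank F4} = {4, 2}" "sqlen G2 ` {..<rank G2} = {2, 6}"
    "sqlen (Bn 2) ` {..<rank (Bn 2)} = {4, 2}" by auto
qed

theorem theorem1p2:
  fixes t :: nat and X :: dynkin and N :: "root \<Rightarrow> root \<Rightarrow> int"
    and \<sigma> :: "'k::{field,finite} lie_map \<Rightarrow> 'k lie_map"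
  assumes "class_L t X N \<sigma>"
  shows "separable TYPE('b) 2 (cartan_scheme X N \<sigma>)"
proof -
  interpret chevalley_field X N "TYPE('k)" using chevalley_class_L[OF assms] by (simp add: chevalley_field_def)
  have aut: "lie_type_automorphism t X N \<sigma>" using assms by (simp add: class_L_def)
  have types: "exceptional_type t X \<or> (\<exists>q. large_classical_type t X q)" using assms by (auto simp: class_L_def)
  have hom: "\<sigma> \<in> hom C C"
    using aut by (auto simp: lie_type_automorphism_def twisting_automorphism_def iso_def hom_def split: if_splits)
  interpret lie_type X N "TYPE('k)" \<sigma> by unfold_locales (rule hom)
  have "regular_pair e" if e: "e = 1 \<or> e = - 1" for e
  proof (cases "t = 1")
    case True
    then show ?thesis using aut by (intro regular_pair_untwisted e) (simp add: lie_type_automorphism_def)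
  next
    case False
    then have "twisting_automorphism t X N \<sigma>" using aut by (simp add: lie_type_automorphism_def)
    then obtain \<rho> and f :: "'k \<Rightarrow> 'k" and \<gamma> :: "root \<Rightarrow> 'k" where sym: "diagram_symmetry X \<rho>"
      and moved: "\<exists>i<rank X. \<rho> i \<noteq> i" and \<rho>_t: "\<And>i. i < rank X \<Longrightarrow> (\<rho> ^^ t) i = i"
      and f: "field_automorphism f" and f_t: "\<And>\<zeta>. ((f ^^ t) \<zeta>) ^ bond X = \<zeta>"
      and f_bond: "if bond X = 1 then f \<noteq> id else of_nat (bond X) = (0 :: 'k)"
      and \<gamma>: "\<And>r. \<gamma> r = 1 \<or> \<gamma> r = - 1" "\<And>i. i < rank X \<Longrightarrow> \<gamma> (simple_root i) = 1"
        "\<And>i. i < rank X \<Longrightarrow> \<gamma> (- simple_root i) = 1"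
      and \<sigma>_x: "\<And>r \<zeta>. r \<in> roots X \<Longrightarrow>
        \<sigma> (x r \<zeta>) = x (root_bar X \<rho> r) (\<gamma> r * f \<zeta> ^ root_exponent X (root_bar X \<rho> r))"
      unfolding twisting_automorphism_def by blast
    have bij: "bij_betw \<rho> {..<rank X} {..<rank X}" using sym by (simp add: diagram_symmetry_def)
    consider l where "X \<in> {An l, Dn l, En l}" "t = 2 \<or> t = 3 \<and> X = Dn 4" | "t = 2" "X \<in> {Bn 2, G2}" | "t = 2" "X = F4"
      using types False unfolding exceptional_type_def large_classical_type_def by auto
    then show ?thesis
    proof cases
      case 1
      have len: "sqlen X i = 2" for i using 1(1) by auto
      have "0 < rank X" using moved by auto
      then have bond: "bond X = 1" using len by (intro bond_simply_laced)
      have \<sigma>_x': "\<sigma> (x r \<zeta>) = x (root_bar X \<rho> r) (\<gamma> r * f \<zeta>)" if r: "r \<in> roots X" for r \<zeta>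
        using \<sigma>_x[OF r] root_exponent_simply_laced[OF sym len r] by simp
      interpret simply_laced_twist X N "TYPE('k)" \<sigma> \<rho> f \<gamma>
        using f f_bond bond len bij diagram_symmetry_gram[OF sym len] \<sigma>_x' \<gamma> by unfold_locales auto
      show ?thesis
      proof (cases "t = 2")
        case True
        then show ?thesis
          using \<rho>_t f_t by (intro regular_pair_involution e) (simp_all add: bond eval_nat_numeral)
      next
        case False
        then have t: "t = 3" "X = Dn 4" using 1(2) by auto
        have \<rho>3: "\<rho> (\<rho> (\<rho> i)) = i" if "i < rank X" for i using \<rho>_t[OF that] by (simp add: t(1) eval_nat_numeral)
        show ?thesis
        proof (rule regular_pair_triality[OF \<rho>3 _ e])
          show "f (f (f \<zeta>)) = \<zeta>" for \<zeta> using f_t[of \<zeta>] by (simp add: t(1) bond eval_nat_numeral)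
          show "gram X i (\<rho> i) = 0" if i: "i < rank X" "\<rho> i \<noteq> i" for i
          proof -
            \<comment> \<open>The symmetry permutes a moved orbit of three nodes cyclically and
              preserves the Gram matrix, so the three nodes are pairwise joined or pairwise
              orthogonal; a tree excludes the former.\<close>
            note less = \<rho>_less[OF i(1)] \<rho>_less[OF \<rho>_less[OF i(1)]]
            have "\<rho> (\<rho> i) \<noteq> \<rho> i" "\<rho> (\<rho> i) \<noteq> i" using i(2) \<rho>3[OF i(1)] by metis+
            then have "gram X i (\<rho> i) = 0 \<or> gram X (\<rho> i) (\<rho> (\<rho> i)) = 0 \<or> gram X i (\<rho> (\<rho> i)) = 0"
              using gram_D4_triangle[of i "\<rho> i" "\<rho> (\<rho> i)"] i less by (auto simp: t(2))
            moreover have "gram X (\<rho> i) (\<rho> (\<rho> i)) = gram X i (\<rho> i)"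
              by (rule \<rho>_gram[OF i(1) less(1)])
            moreover have "gram X i (\<rho> (\<rho> i)) = gram X i (\<rho> i)"
              using \<rho>_gram[OF less(2) i(1)] \<rho>3[OF i(1)] gram_sym by metis
            ultimately show ?thesis by simp
          qed
        qed
      qed
    next
      case 2
      define p where "p = bond X"
      have bond_p: "p = (if X = G2 then 3 else 2)" using 2(2) sqlen_two_lengths(2,3) by (auto simp: p_def bond_def)
      have char: "of_nat p = (0 :: 'k)" using f_bond bond_p unfolding p_def[symmetric] by (simp split: if_splits)
      have f_p: "f (f \<zeta>) ^ p = \<zeta>" for \<zeta> using f_t[of \<zeta>] 2(1) by (simp add: p_def eval_nat_numeral)
      have min: "Min (sqlen X ` {..<rank X}) = 2" using 2(2) sqlen_two_lengths(2,3) by auto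
      have rank: "rank X = 2" using 2(2) by auto
      interpret special_twist X N "TYPE('k)" \<sigma> \<rho> f \<gamma> p
        using f char f_p min \<sigma>_x \<gamma> bond_p by unfold_locales (auto split: if_splits)
      have \<rho>: "\<rho> 0 = 1" "\<rho> 1 = 0" using rank_2_swap[of \<rho>] bij moved rank by simp_all
      show ?thesis
      proof (cases "X = G2")
        case True
        then have p3: "p = 3" using bond_p by simp
        interpret exchanged_nodes X N "TYPE('k)" \<sigma> \<rho> f \<gamma> p 0 1
          by unfold_locales (use \<rho> in \<open>simp_all add: True p3\<close>)
        show ?thesis by (rule regular_pair_rank_2[OF _ e rank]) (simp add: gram_def True p3)
      next
        case False
        then have X: "X = Bn 2" and p2: "p = 2" using 2(2) bond_p by simp_all
        \<comment> \<open>In \<open>Bn 2\<close> the short node is 1, in contrast to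
          \<open>G2\<close>.\<close>
        interpret exchanged_nodes X N "TYPE('k)" \<sigma> \<rho> f \<gamma> p 1 0
          by unfold_locales (use \<rho> in \<open>simp_all add: X p2\<close>)
        show ?thesis by (rule regular_pair_rank_2[OF _ e rank]) (simp add: gram_def X p2)
      qed
    next
      case 3
      have p: "bond X = 2" using 3(2) sqlen_two_lengths(1) by (auto simp: bond_def)
      interpret special_twist X N "TYPE('k)" \<sigma> \<rho> f \<gamma> 2
        using f f_t f_bond p 3 sqlen_two_lengths(1) \<sigma>_x \<gamma> by unfold_locales (auto simp: eval_nat_numeral split: if_splits)
      show ?thesis
        using diagram_symmetry_F4[of \<rho>] sym moved 3(2) by (intro regular_pair_F4 e) auto
    qed
  qed
  then show ?thesis by (intro separable_if_regular_pairs) auto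
qed

end
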